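(* Let $d\ge 3$ be an integer. 1. For any $\kappa$ with $0\le\kappa\le d-2$, there exists a maximally inflected plane curve of degree $d$ with $\kappa$ cusps, $3(d-2)-2\kappa$ flexes, and $\binom{d-2}{2}$ real nodes (hence $d-2-\kappa$ solitary points). 2. There exists a maximally inflected plane curve of degree $d$ with $3(d-2)$ flexes and $\binom{d-1}{2}$ solitary points (hence without real nodes or complex nodes).
   Context: A rational plane curve of degree $d>2$ is a morphism $\varphi=[\varphi_0,\varphi_1,\varphi_2]:\mathbb{P}^1\to\mathbb{P}^2$ given by three coprime, linearly independent binary forms of degree $d$ (over $\mathbb{C}$), up to projective transformations of $\mathbb{P}^2$. The ramification sequence of $\varphi$ at $s\in\mathbb{P}^1$ is $(0,\alpha_1,\alpha_2)$, $0<\alpha_1<\alpha_2$, such that in suitable coordinates of $\mathbb{P}^2$ the components of $\varphi$ vanish at $s$ to orders exactly $0,\alpha_1,\alpha_2$. The point $s$ is a ramification point if this is not $(0,1,2)$; it is a flex if it is $(0,1,3)$ and a cusp if it is $(0,2,3)$. The curve is maximally inflected if $\varphi$ is real (given by real forms) and all of its ramification points lie in $\mathbb{RP}^1$. A real node is an ordinary double point of the image curve lying in $\mathbb{RP}^2$ with two real tangents; a solitary point is an ordinary double point in $\mathbb{RP}^2$ with complex conjugate tangents; a complex node is an ordinary double point not in $\mathbb{RP}^2$. *)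

theory Defs
  imports "HOL-Analysis.Analysis" "HOL-Computational_Algebra.Polynomial"
begin

text \<open>Points of the complex projective spaces are the one-dimensional subspaces
  \<open>vec.span {v}\<close>, \<open>v \<noteq> 0\<close>, of \<open>\<complex>^2\<close> and \<open>\<complex>^3\<close>; lines of the projective plane are
  the two-dimensional subspaces of \<open>\<complex>^3\<close>.  Polynomials in \<open>X, Y\<close> are elements of
  \<open>\<complex>[Y][X]\<close>: \<open>coeff (coeff f i) j\<close> is the coefficient of \<open>X^i Y^j\<close>.\<close>

type_synonym bipoly = "complex poly poly"

definition binary_form :: "nat \<Rightarrow> bipoly \<Rightarrow> bool" where
  "binary_form d f \<longleftrightarrow> (\<forall>i j. coeff (coeff f i) j \<noteq> 0 \<longrightarrow> i + j = d)"

definition eval2 :: "bipoly \<Rightarrow> complex^2 \<Rightarrow> complex" where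
  "eval2 f v = poly (poly f [:v $ 1:]) (v $ 2)"

text \<open>The linear form \<open>v\<^sub>2 X - v\<^sub>1 Y\<close>, whose only zero is the point \<open>[v\<^sub>1, v\<^sub>2]\<close>.
  The order of vanishing of a form at that point is the exponent of this factor.\<close>

definition lin_form :: "complex^2 \<Rightarrow> bipoly" where
  "lin_form v = [: [:0, - (v $ 1):], [:v $ 2:] :]"

definition vanishes_to_order :: "bipoly \<Rightarrow> complex^2 \<Rightarrow> nat \<Rightarrow> bool" where
  "vanishes_to_order f v k \<longleftrightarrow> lin_form v ^ k dvd f \<and> \<not> lin_form v ^ Suc k dvd f"

definition lin_comb :: "complex^3 \<Rightarrow> bipoly^3 \<Rightarrow> bipoly" where
  "lin_comb a \<phi> = (\<Sum>i\<in>UNIV. smult [:a $ i:] (\<phi> $ i))"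

definition rational_plane_curve :: "nat \<Rightarrow> bipoly^3 \<Rightarrow> bool" where
  "rational_plane_curve d \<phi> \<longleftrightarrow>
     2 < d \<and>
     (\<forall>i. binary_form d (\<phi> $ i)) \<and>
     (\<forall>h. (\<forall>i. h dvd \<phi> $ i) \<longrightarrow> is_unit h) \<and>
     (\<forall>a. lin_comb a \<phi> = 0 \<longrightarrow> a = 0)"

text \<open>The image in the projective plane of the point with homogeneous coordinates \<open>v\<close>.\<close>

definition image_point :: "bipoly^3 \<Rightarrow> complex^2 \<Rightarrow> (complex^3) set" where
  "image_point \<phi> v = vec.span {\<chi> i. eval2 (\<phi> $ i) v}"

text \<open>\<open>ramification_sequence \<phi> v \<alpha>\<^sub>1 \<alpha>\<^sub>2\<close>: the sequence at \<open>v\<close> is \<open>(0, \<alpha>\<^sub>1, \<alpha>\<^sub>2)\<close>.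
  The rows of \<open>A\<close> give the new coordinates of the plane.\<close>

definition ramification_sequence :: "bipoly^3 \<Rightarrow> complex^2 \<Rightarrow> nat \<Rightarrow> nat \<Rightarrow> bool" where
  "ramification_sequence \<phi> v \<alpha>\<^sub>1 \<alpha>\<^sub>2 \<longleftrightarrow>
     0 < \<alpha>\<^sub>1 \<and> \<alpha>\<^sub>1 < \<alpha>\<^sub>2 \<and>
     (\<exists>A :: complex^3^3. invertible A \<and>
        vanishes_to_order (lin_comb (A $ 1) \<phi>) v 0 \<and>
        vanishes_to_order (lin_comb (A $ 2) \<phi>) v \<alpha>\<^sub>1 \<and>
        vanishes_to_order (lin_comb (A $ 3) \<phi>) v \<alpha>\<^sub>2)"

definition ramification_points :: "bipoly^3 \<Rightarrow> (complex^2) set set" where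
  "ramification_points \<phi> =
     {vec.span {v} | v. v \<noteq> 0 \<and> \<not> ramification_sequence \<phi> v 1 2}"

definition flexes :: "bipoly^3 \<Rightarrow> (complex^2) set set" where
  "flexes \<phi> = {vec.span {v} | v. v \<noteq> 0 \<and> ramification_sequence \<phi> v 1 3}"

definition cusps :: "bipoly^3 \<Rightarrow> (complex^2) set set" where
  "cusps \<phi> = {vec.span {v} | v. v \<noteq> 0 \<and> ramification_sequence \<phi> v 2 3}"

text \<open>A projective point or line is real if it is spanned by real vectors.\<close>

definition real_subspace :: "(complex^'n) set \<Rightarrow> bool" where
  "real_subspace L \<longleftrightarrow> (\<exists>B. (\<forall>b\<in>B. \<forall>i. b $ i \<in> \<real>) \<and> L = vec.span B)"

definition conj_subspace :: "(complex^'n) set \<Rightarrow> (complex^'n) set" where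
  "conj_subspace L = (\<lambda>v. \<chi> i. cnj (v $ i)) ` L"

definition maximally_inflected :: "nat \<Rightarrow> bipoly^3 \<Rightarrow> bool" where
  "maximally_inflected d \<phi> \<longleftrightarrow>
     rational_plane_curve d \<phi> \<and>
     (\<forall>i j k. coeff (coeff (\<phi> $ i) j) k \<in> \<real>) \<and>
     (\<forall>s\<in>ramification_points \<phi>. real_subspace s)"

text \<open>The range of the derivative at \<open>v\<close> of the map \<open>\<complex>^2 \<rightarrow> \<complex>^3\<close> given by \<open>\<phi>\<close>.  By
  Euler's relation it contains the image of \<open>v\<close>.  The branch of the curve
  parametrized near \<open>v\<close> is smooth iff this space has dimension 2, and it is then the
  tangent line of that branch.\<close>

definition tangent_space :: "bipoly^3 \<Rightarrow> complex^2 \<Rightarrow> (complex^3) set" where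
  "tangent_space \<phi> v =
     vec.span {\<chi> i. eval2 (pderiv (\<phi> $ i)) v, \<chi> i. eval2 (map_poly pderiv (\<phi> $ i)) v}"

text \<open>\<open>p\<close> is an ordinary double point of the image curve with tangents \<open>T\<^sub>1, T\<^sub>2\<close>: the
  curve has exactly two branches at \<open>p\<close>, both smooth, with distinct tangents.  Branches
  at \<open>p\<close> are the points of the projective line over \<open>p\<close>, which presupposes that \<open>\<phi>\<close>
  is birational onto its image.  This is automatic when all ramification points are
  flexes and cusps, that is, when the number of flexes plus twice the number of cusps
  is \<open>3(d-2)\<close>: if \<open>\<phi>\<close> factors through a map \<open>g\<close> of degree at least 2 from the
  projective line to itself, then at a point where \<open>g\<close> ramifies with index \<open>e \<ge> 2\<close> both
  \<open>\<alpha>\<^sub>1\<close> and \<open>\<alpha>\<^sub>2\<close> are divisible by \<open>e\<close>.\<close>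

definition ordinary_double_point ::
  "bipoly^3 \<Rightarrow> (complex^3) set \<Rightarrow> (complex^3) set \<Rightarrow> (complex^3) set \<Rightarrow> bool" where
  "ordinary_double_point \<phi> p T\<^sub>1 T\<^sub>2 \<longleftrightarrow>
     (\<exists>v w. v \<noteq> 0 \<and> w \<noteq> 0 \<and> vec.span {v} \<noteq> vec.span {w} \<and>
        image_point \<phi> v = p \<and> image_point \<phi> w = p \<and>
        (\<forall>u. u \<noteq> 0 \<and> image_point \<phi> u = p \<longrightarrow>
           vec.span {u} = vec.span {v} \<or> vec.span {u} = vec.span {w}) \<and>
        T\<^sub>1 = tangent_space \<phi> v \<and> T\<^sub>2 = tangent_space \<phi> w \<and>
        vec.dim T\<^sub>1 = 2 \<and> vec.dim T\<^sub>2 = 2 \<and> T\<^sub>1 \<noteq> T\<^sub>2)"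

definition real_nodes :: "bipoly^3 \<Rightarrow> (complex^3) set set" where
  "real_nodes \<phi> = {p. real_subspace p \<and>
     (\<exists>T\<^sub>1 T\<^sub>2. ordinary_double_point \<phi> p T\<^sub>1 T\<^sub>2 \<and> real_subspace T\<^sub>1 \<and> real_subspace T\<^sub>2)}"

definition solitary_points :: "bipoly^3 \<Rightarrow> (complex^3) set set" where
  "solitary_points \<phi> = {p. real_subspace p \<and>
     (\<exists>T\<^sub>1 T\<^sub>2. ordinary_double_point \<phi> p T\<^sub>1 T\<^sub>2 \<and> T\<^sub>2 = conj_subspace T\<^sub>1)}"

definition complex_nodes :: "bipoly^3 \<Rightarrow> (complex^3) set set" where
  "complex_nodes \<phi> = {p. \<not> real_subspace p \<and> (\<exists>T\<^sub>1 T\<^sub>2. ordinary_double_point \<phi> p T\<^sub>1 T\<^sub>2)}"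

text \<open>Finiteness is required because \<open>card\<close> of an infinite set is 0.\<close>

definition has_exactly :: "'a set \<Rightarrow> nat \<Rightarrow> bool" where
  "has_exactly S n \<longleftrightarrow> finite S \<and> card S = n"

end

theory Submission imports Defs begin

text \<open>All curves have the form \<open>[f\<^sub>1, f\<^sub>2, f\<^sub>3]\<close> with polynomials of degrees \<open>d - 2\<close>, \<open>d - 1\<close>, \<open>d\<close> in
  an affine parameter.  It suffices to exhibit enough real flexes and cusps and enough pairs of
  parameters with the same image: the Wronskian has degree \<open>3 (d - 2)\<close>, so there is no further
  ramification, and comparing the dimension of the space of forms of degree \<open>d - 2\<close> that vanish at
  the double points and cusps with the number of zeros of their pullbacks shows that \<open>(d - 1 choose 2)\<close>
  double points and cusps are all there are and that they are ordinary.

  For the first part perturb the conic \<open>(t, t\<^sup>2)\<close> together with its tangents at \<open>d - 2\<close> integers: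
  \<open>x = t + \<epsilon>\<^sup>2 (\<Sum>i. V\<^sub>i / (t - i))\<close>, \<open>y = t\<^sup>2 + \<epsilon>\<^sup>2 (\<Sum>i. U\<^sub>i / (t - i))\<close>.  Any two tangents meet in a real
  node, and each point of contact yields three flexes and a solitary point, or a flex and a cusp,
  according to the choice of \<open>(V\<^sub>i, U\<^sub>i)\<close>.

  For the second part take a curve close to \<open>[1, \<Sum>k. e\<^sub>k t^k, t^d]\<close> with positive and strongly log-concave
  \<open>e\<^sub>k\<close>, \<open>0 < k < d\<close>.  Complex conjugate parameters of modulus \<open>r\<close> and argument close to \<open>j \<pi> / d\<close> have almost
  the same third coordinate; the second coordinate is dominated by single terms, and its imaginary part has
  the sign of \<open>sin (m \<theta>)\<close>, where \<open>m\<close> grows with \<open>r\<close>.  Each of the \<open>j - 1\<close> sign changes of this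
  sequence gives a solitary point.\<close>

subsection \<open>Binary forms\<close>

text \<open>The counts are exact and concern complex parameters too, so surplus points must be
  excluded without computing the curve. The degrees \<open>d - 2\<close>, \<open>d - 1\<close>,
  \<open>d\<close> put an unramified point at infinity whose image no other parameter shares; hence
  everything can be counted in one affine parameter. The points to be exhibited are zeros of one or
  two real functions. They come only from sign changes that are visible in a limit, through the
  intermediate value theorem or its two-dimensional version, so no derivatives of the solutions have
  to be controlled. The factor \<epsilon>^2 is chosen so that at distance of order \<epsilon> from a
  pole i the terms t - i and \<epsilon>^2 / (t - i) have the same order; flexes, cusp and solitary
  point are found there, while at distance of order \<epsilon>^2 the curve runs along the tangent
  line, where the nodes are found. For the second part, [1, y, t^d] concentrates
  \<open>d - 2\<close> flexes at 0 and \<open>d - 2\<close> at infinity. The outer components are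
  therefore modified by a polynomial with alternating signs that splits both groups into real
  flexes, at scales too extreme to disturb the solitary points.\<close>

definition homog :: "nat \<Rightarrow> complex poly \<Rightarrow> bipoly" where
  "homog d p = (\<Sum>i\<le>d. monom (monom (coeff p i) (d - i)) i)"

lemma coeff_homog: "coeff (homog d p) i = (if i \<le> d then monom (coeff p i) (d - i) else 0)"
  by (simp add: homog_def coeff_sum)

lemma coeff_coeff_homog: "coeff (coeff (homog d p) i) j = (if i + j = d then coeff p i else 0)"
  by (auto simp: coeff_homog)

lemma homog_add: "homog d (p + q) = homog d p + homog d q"
  by (intro poly_eqI) (simp add: coeff_homog add_monom)

lemma homog_smult: "homog d (smult c p) = smult [:c:] (homog d p)"
  by (intro poly_eqI) (simp add: coeff_homog smult_monom)

lemma homog_0 [simp]: "homog d 0 = 0"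
  by (intro poly_eqI) (simp add: coeff_homog)

lemma homog_sum: "homog d (\<Sum>x\<in>A. f x) = (\<Sum>x\<in>A. homog d (f x))"
  by (induction A rule: infinite_finite_induct) (simp_all add: homog_add)

lemma homog_monom_mult:
  assumes "k \<le> m" "degree q \<le> n"
  shows "homog (m + n) (monom c k * q) = monom (monom c (m - k)) k * homog n q"
proof (intro poly_eqI)
  fix i j
  show "coeff (coeff (homog (m + n) (monom c k * q)) i) j
      = coeff (coeff (monom (monom c (m - k)) k * homog n q) i) j"
    using assms by (auto simp: coeff_coeff_homog coeff_monom_mult coeff_eq_0)
qed

lemma homog_mult:
  assumes "degree p \<le> m" "degree q \<le> n"
  shows "homog (m + n) (p * q) = homog m p * homog n q"
proof -
  have p: "p = (\<Sum>k\<le>m. monom (coeff p k) k)"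
    using assms(1) by (simp add: poly_as_sum_of_monoms')
  have "homog (m + n) (p * q) = (\<Sum>k\<le>m. homog (m + n) (monom (coeff p k) k * q))"
    by (subst p) (simp add: sum_distrib_right homog_sum)
  also have "\<dots> = (\<Sum>k\<le>m. monom (monom (coeff p k) (m - k)) k * homog n q)"
    using assms(2) by (intro sum.cong) (auto simp: homog_monom_mult)
  also have "\<dots> = homog m p * homog n q"
    by (simp add: homog_def sum_distrib_right)
  finally show ?thesis .
qed

lemma homog_power:
  assumes "degree p \<le> m"
  shows "homog (k * m) (p ^ k) = homog m p ^ k"
proof (induction k)
  case 0
  show ?case by (intro poly_eqI) (auto simp: coeff_homog one_pCons coeff_pCons split: nat.splits)
next
  case (Suc k)
  have "degree (p ^ k) \<le> k * m"
    using degree_power_le[of p k] assms by (metis le_trans mult_le_mono1 mult.commute)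
  with Suc assms show ?case by (simp add: homog_mult)
qed

section \<open>Dehomogenisation and orders of vanishing\<close>

definition dehom :: "bipoly \<Rightarrow> complex poly" where
  "dehom f = map_poly (\<lambda>c. poly c 1) f"

lemma coeff_dehom: "coeff (dehom f) i = poly (coeff f i) 1"
  by (simp add: dehom_def coeff_map_poly)

lemma dehom_mult: "dehom (f * g) = dehom f * dehom g"
  by (intro poly_eqI) (simp add: coeff_dehom coeff_mult poly_sum)

lemma dehom_dvd: "f dvd g \<Longrightarrow> dehom f dvd dehom g"
  by (auto elim!: dvdE simp: dehom_mult)

lemma dehom_homog: "degree p \<le> d \<Longrightarrow> dehom (homog d p) = p"
  by (intro poly_eqI) (auto simp: coeff_dehom coeff_homog poly_monom coeff_eq_0)

lemma eval2_homog: "eval2 (homog d p) v = (\<Sum>i\<le>d. coeff p i * v $ 1 ^ i * v $ 2 ^ (d - i))"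
  by (simp add: eval2_def homog_def poly_sum poly_monom poly_power algebra_simps poly_const_pow)

lemma eval2_homog_affine:
  assumes "degree p \<le> d" "v $ 2 \<noteq> 0"
  shows "eval2 (homog d p) v = v $ 2 ^ d * poly p (v $ 1 / v $ 2)"
proof -
  have "poly p (v $ 1 / v $ 2) = (\<Sum>i\<le>d. coeff p i * (v $ 1 / v $ 2) ^ i)"
    unfolding poly_altdef using assms(1) by (intro sum.mono_neutral_left) (auto simp: coeff_eq_0)
  thus ?thesis using assms(2)
    by (auto simp: eval2_homog sum_distrib_left power_diff power_divide field_simps intro!: sum.cong)
qed

lemma eval2_homog_infinity:
  assumes "v $ 2 = 0"
  shows "eval2 (homog d p) v = coeff p d * v $ 1 ^ d"
proof -
  have "eval2 (homog d p) v = (\<Sum>i\<le>d. if i = d then coeff p d * v $ 1 ^ d else 0)"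
    unfolding eval2_homog using assms by (intro sum.cong) (auto simp: power_0_left)
  thus ?thesis by simp
qed

lemma binary_form_homog: "binary_form d (homog d p)"
  by (simp add: binary_form_def coeff_coeff_homog)

lemma lin_form_homog: "lin_form v = homog 1 [:- (v $ 1), v $ 2:]"
  by (intro poly_eqI) (auto simp: lin_form_def coeff_coeff_homog coeff_pCons split: nat.splits)

lemma lin_form_power: "lin_form v ^ k = homog k ([:- (v $ 1), v $ 2:] ^ k)"
  using homog_power[of "[:- (v $ 1), v $ 2:]" 1 k] by (simp add: lin_form_homog)

text \<open>Setting Y = 1 turns the linear form into a nonzero multiple of a linear factor. For the
  way back the quotient has degree at most \<open>d - k\<close>, so it can be homogenised as
  well.\<close>

lemma lin_form_power_dvd_homog_iff:
  assumes "p \<noteq> 0" "degree p \<le> d" "v $ 2 \<noteq> 0"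
  shows "lin_form v ^ k dvd homog d p \<longleftrightarrow> k \<le> order (v $ 1 / v $ 2) p"
proof -
  let ?l = "[:- (v $ 1), v $ 2:]"
  have l: "?l = smult (v $ 2) [:- (v $ 1 / v $ 2), 1:]" using assms(3) by simp
  have "?l ^ k = smult (v $ 2 ^ k) ([:- (v $ 1 / v $ 2), 1:] ^ k)"
    by (subst l) (rule smult_power)
  hence l_dvd: "?l ^ k dvd p \<longleftrightarrow> k \<le> order (v $ 1 / v $ 2) p"
    using assms by (simp add: smult_dvd_iff order_divides)
  show ?thesis
  proof
    assume "lin_form v ^ k dvd homog d p"
    hence "?l ^ k dvd p"
      using dehom_dvd[of "lin_form v ^ k" "homog d p"] assms degree_power_le[of ?l k]
      by (simp add: lin_form_power dehom_homog)
    thus "k \<le> order (v $ 1 / v $ 2) p" using l_dvd by simp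
  next
    assume "k \<le> order (v $ 1 / v $ 2) p"
    then obtain q where q: "p = ?l ^ k * q" using l_dvd by blast
    have "degree p = k + degree q"
      using assms q by (subst q, subst degree_mult_eq) (auto simp: degree_power_eq)
    hence kd: "k \<le> d" "degree q \<le> d - k" using assms by auto
    have "homog (k + (d - k)) (?l ^ k * q) = homog k (?l ^ k) * homog (d - k) q"
      using kd degree_power_le[of ?l k] assms(3) by (intro homog_mult) auto
    thus "lin_form v ^ k dvd homog d p" using kd by (simp add: q lin_form_power)
  qed
qed

lemma vanishes_to_order_homog_affine:
  assumes "p \<noteq> 0" "degree p \<le> d" "v $ 2 \<noteq> 0"
  shows "vanishes_to_order (homog d p) v k \<longleftrightarrow> order (v $ 1 / v $ 2) p = k"
  unfolding vanishes_to_order_def lin_form_power_dvd_homog_iff[OF assms] by auto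

text \<open>At infinity the linear form is a multiple of Y, a constant as polynomial in X, so
  divisibility is tested coefficientwise. The common power of Y is the defect of the degree,
  attained at the leading coefficient.\<close>

lemma vanishes_to_order_homog_infinity:
  assumes "p \<noteq> 0" "degree p + k = d" "v $ 2 = 0" "v $ 1 \<noteq> 0"
  shows "vanishes_to_order (homog d p) v k"
proof -
  let ?c = "[:0, - (v $ 1):]"
  have c: "?c = monom (- (v $ 1)) 1" by (simp add: monom_altdef)
  have cpow: "?c ^ j = monom ((- (v $ 1)) ^ j) j" for j
    by (simp add: c monom_power)
  have pow: "lin_form v ^ j = [:?c ^ j:]" for j
    using assms(3) by (simp add: lin_form_def poly_const_pow)
  have dvd: "?c ^ j dvd monom a i \<longleftrightarrow> a = 0 \<or> j \<le> i" for j i and a :: complex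
  proof -
    have "?c ^ j = smult ((- (v $ 1)) ^ j) (monom 1 j)" by (simp add: cpow smult_monom)
    thus ?thesis using assms(4) by (auto simp: smult_dvd_iff monom_1_dvd_iff' coeff_monom)
  qed
  have "lin_form v ^ k dvd homog d p"
    unfolding pow const_poly_dvd_iff coeff_homog using assms(2)
    by (auto simp: dvd coeff_eq_0)
  moreover have "coeff (homog d p) (degree p) = monom (lead_coeff p) k"
    using assms(2) by (auto simp: coeff_homog)
  hence "\<not> ?c ^ Suc k dvd coeff (homog d p) (degree p)"
    using assms(1) by (simp only: dvd) simp
  hence "\<not> lin_form v ^ Suc k dvd homog d p"
    unfolding pow const_poly_dvd_iff by blast
  ultimately show ?thesis by (simp add: vanishes_to_order_def)
qed

text \<open>Replaces unique factorisation in the proof of coprimality: primes that do not divide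
  \<open>h\<close> are cancelled one at a time.\<close>

lemma dvd_prod_prime_elems:
  fixes h :: "'a :: idom"
  assumes "finite A" "\<And>a. a \<in> A \<Longrightarrow> prime_elem (\<pi> a) \<and> \<not> \<pi> a dvd h" "h dvd m * (\<Prod>a\<in>A. \<pi> a)"
  shows "h dvd m"
  using assms
proof (induction A rule: finite_induct)
  case (insert x A)
  from insert.prems(2) obtain k where k: "m * (\<Prod>a\<in>insert x A. \<pi> a) = h * k" by (auto elim: dvdE)
  have x: "prime_elem (\<pi> x)" "\<not> \<pi> x dvd h" using insert.prems(1) by auto
  have "\<pi> x dvd h * k" unfolding k[symmetric] using insert.hyps by simp
  then obtain k' where k': "k = \<pi> x * k'" using x by (auto simp: prime_elem_dvd_mult_iff elim: dvdE)
  have "\<pi> x \<noteq> 0" using x by (simp add: prime_elem_def)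
  hence "m * (\<Prod>a\<in>A. \<pi> a) = h * k'" using k k' insert.hyps by (simp add: mult_ac)
  thus ?case using insert by auto
qed simp

subsection \<open>Forms vanishing on the curve\<close>

text \<open>Gaussian elimination. It serves both for interpolation by plane forms and, with one
  additional unknown, for inhomogeneous square systems.\<close>

lemma underdetermined_system:
  fixes L :: "'c \<Rightarrow> 'm \<Rightarrow> 'a :: field"
  assumes "finite C" "finite M" "card C < card M"
  shows "\<exists>\<gamma>. (\<exists>i\<in>M. \<gamma> i \<noteq> 0) \<and> (\<forall>c\<in>C. (\<Sum>i\<in>M. L c i * \<gamma> i) = 0)"
  using assms
proof (induction C arbitrary: M L rule: finite_induct)
  case empty
  hence "M \<noteq> {}" by auto
  thus ?case by (auto intro!: exI[of _ "\<lambda>_. 1"])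
next
  case (insert x C)
  show ?case
  proof (cases "\<exists>p\<in>M. L x p \<noteq> 0")
    case False
    with insert.IH[of M L] insert.prems insert.hyps show ?thesis by auto
  next
    case True
    then obtain p where p: "p \<in> M" "L x p \<noteq> 0" by blast
    \<comment> \<open>The equation of \<open>c\<close> after the unknown \<open>p\<close> has been
      eliminated by means of \<open>x\<close>.\<close>
    define B where "B c i = L c i - L c p * L x i / L x p" for c i
    have "card C < card (M - {p})" using insert p by simp
    then obtain \<gamma> where \<gamma>: "\<exists>i\<in>M - {p}. \<gamma> i \<noteq> 0" "\<And>c. c \<in> C \<Longrightarrow> (\<Sum>i\<in>M - {p}. B c i * \<gamma> i) = 0"
      using insert.IH[of "M - {p}" B] insert.prems by auto
    define s where "s = (\<Sum>i\<in>M - {p}. L x i * \<gamma> i)"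
    define \<delta> where "\<delta> = \<gamma>(p := - s / L x p)"
    have sum: "(\<Sum>i\<in>M. L c i * \<delta> i) = (\<Sum>i\<in>M - {p}. L c i * \<gamma> i) - L c p * s / L x p" for c
    proof -
      have "(\<Sum>i\<in>M. L c i * \<delta> i) = L c p * \<delta> p + (\<Sum>i\<in>M - {p}. L c i * \<delta> i)"
        using p insert.prems by (simp add: sum.remove)
      also have "(\<Sum>i\<in>M - {p}. L c i * \<delta> i) = (\<Sum>i\<in>M - {p}. L c i * \<gamma> i)"
        by (intro sum.cong) (auto simp: \<delta>_def)
      finally show ?thesis by (simp add: \<delta>_def)
    qed
    have "(\<Sum>i\<in>M. L x i * \<delta> i) = 0" using p by (simp add: sum s_def)
    moreover have "(\<Sum>i\<in>M. L c i * \<delta> i) = 0" if "c \<in> C" for c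
    proof -
      have "0 = (\<Sum>i\<in>M - {p}. L c i * \<gamma> i - L c p / L x p * (L x i * \<gamma> i))"
        using \<gamma>(2)[OF that] by (simp add: B_def algebra_simps)
      also have "\<dots> = (\<Sum>i\<in>M - {p}. L c i * \<gamma> i) - L c p / L x p * s"
        by (simp add: sum_subtractf s_def sum_distrib_left)
      finally show ?thesis by (simp add: sum)
    qed
    moreover have "\<exists>i\<in>M. \<delta> i \<noteq> 0" using \<gamma>(1) by (auto simp: \<delta>_def)
    ultimately show ?thesis by (auto intro!: exI[of _ \<delta>])
  qed
qed

text \<open>Exponents of the second and third variable in a ternary monomial of degree
  \<open>m\<close>; the first variable takes the remaining \<open>m - i - j\<close>.\<close>

definition exps :: "nat \<Rightarrow> (nat \<times> nat) set" where
  "exps m = (SIGMA i:{..m}. {..m - i})"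

lemma finite_exps [simp]: "finite (exps m)"
  by (simp add: exps_def)

lemma card_exps: "card (exps m) = (m + 2) choose 2"
proof -
  have "card (exps m) = (\<Sum>i\<le>m. Suc (m - i))" by (simp add: exps_def)
  also have "\<dots> = (\<Sum>i\<le>m. Suc i)" by (rule sum.nat_diff_reindex[of Suc "Suc m", simplified lessThan_Suc_atMost, simplified])
  also have "\<dots> = (m + 2) choose 2"
    by (induction m) (simp_all add: choose_two numeral_2_eq_2)
  finally show ?thesis .
qed

section \<open>Pullbacks of plane forms to the parameter line\<close>

text \<open>By the degrees, infinity has ramification sequence \<open>(0, 1, 2)\<close> and the line
  \<open>f $ 1 = 0\<close> is its tangent. \<open>A\<close> contains the other \<open>d - 2\<close>
  parameters on this line, and the quotient in the last assumption is a coordinate on it.\<close>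

locale plane_param =
  fixes d :: nat and f :: "complex poly ^ 3" and A :: "complex set"
  assumes d3: "d \<ge> 3"
    and degree_f: "degree (f $ 1) = d - 2" "degree (f $ 2) = d - 1" "degree (f $ 3) = d"
    and A: "finite A" "card A = d - 2" "\<And>a. a \<in> A \<Longrightarrow> poly (f $ 1) a = 0"
      "\<And>a. a \<in> A \<Longrightarrow> poly (f $ 2) a \<noteq> 0" "inj_on (\<lambda>a. poly (f $ 3) a / poly (f $ 2) a) A"
begin

definition mon :: "nat \<Rightarrow> nat \<times> nat \<Rightarrow> complex poly" where
  "mon m e = f $ 1 ^ (m - fst e - snd e) * f $ 2 ^ fst e * f $ 3 ^ snd e"

definition pull :: "nat \<Rightarrow> (nat \<times> nat \<Rightarrow> complex) \<Rightarrow> complex poly" where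
  "pull m \<gamma> = (\<Sum>e\<in>exps m. smult (\<gamma> e) (mon m e))"

lemma f_nonzero: "f $ 1 \<noteq> 0" "f $ 2 \<noteq> 0" "f $ 3 \<noteq> 0"
  using degree_f d3 A(4) by auto

text \<open>The defect of the degree is the order of vanishing at infinity, where
  \<open>f $ 1\<close> and \<open>f $ 2\<close> vanish to orders 2 and 1.\<close>

lemma degree_mon:
  assumes "e \<in> exps m"
  shows "degree (mon m e) + (2 * (m - fst e - snd e) + fst e) = d * m"
proof -
  obtain i j where e: "e = (i, j)" by force
  define l where "l = m - i - j"
  have m: "m = l + i + j" using assms by (auto simp: e exps_def l_def)
  have "degree (mon m e) = (d - 2) * l + (d - 1) * i + d * j"
    using f_nonzero by (simp add: mon_def e degree_mult_eq degree_power_eq degree_f l_def)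
  moreover obtain d' where "d = d' + 2" using d3 by (metis add.commute le_Suc_ex numeral_3_eq_3 Suc_leD numeral_2_eq_2)
  ultimately show ?thesis by (simp add: m e algebra_simps)
qed

lemma degree_pull: "degree (pull m \<gamma>) \<le> d * m"
proof -
  have "degree (smult (\<gamma> e) (mon m e)) \<le> d * m" if "e \<in> exps m" for e
    using degree_mon[OF that] degree_smult_le[of "\<gamma> e" "mon m e"] by linarith
  thus ?thesis unfolding pull_def by (intro degree_sum_le) auto
qed

text \<open>The line \<open>f\<^sub>1 = 0\<close> meets the curve in \<open>d - 1\<close> points, those over \<open>A\<close> and the
  image of infinity, so a form of degree less than \<open>d - 1\<close> that vanishes on the
  curve is divisible by the equation of this line.\<close>

lemma pull_injective:
  assumes "m \<le> d - 2" "pull m \<gamma> = 0" "e \<in> exps m"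
  shows "\<gamma> e = 0"
  using assms
proof (induction m arbitrary: \<gamma> e)
  case 0
  thus ?case by (auto simp: pull_def exps_def mon_def)
next
  case (Suc m)
  let ?m = "Suc m"
  \<comment> \<open>Vanishing at the image of infinity: only the power of \<open>f $ 3\<close>
    reaches the degree \<open>d * ?m\<close>.\<close>
  have top: "\<gamma> (0, ?m) = 0"
  proof -
    have "0 = coeff (pull ?m \<gamma>) (d * ?m)" using Suc by simp
    also have "\<dots> = (\<Sum>e\<in>exps ?m. \<gamma> e * coeff (mon ?m e) (d * ?m))"
      by (simp add: pull_def coeff_sum)
    also have "\<dots> = (\<Sum>e\<in>exps ?m. if e = (0, ?m) then \<gamma> (0, ?m) * lead_coeff (mon ?m (0, ?m)) else 0)"
    proof (intro sum.cong refl)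
      fix e assume e: "e \<in> exps ?m"
      show "\<gamma> e * coeff (mon ?m e) (d * ?m) =
        (if e = (0, ?m) then \<gamma> (0, ?m) * lead_coeff (mon ?m (0, ?m)) else 0)"
      proof (cases "e = (0, ?m)")
        case True
        thus ?thesis using degree_mon[OF e] by simp
      next
        case False
        hence "0 < 2 * (?m - fst e - snd e) + fst e" using e by (cases e) (auto simp: exps_def)
        hence "degree (mon ?m e) < d * ?m" using degree_mon[OF e] by linarith
        thus ?thesis using False by (simp add: coeff_eq_0)
      qed
    qed
    also have "\<dots> = \<gamma> (0, ?m) * lead_coeff (mon ?m (0, ?m))"
      by (simp add: exps_def)
    finally show ?thesis using f_nonzero by (simp add: mon_def)
  qed
  \<comment> \<open>The restriction of the form to the line \<open>f $ 1 = 0\<close>, in the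
    coordinate \<open>f $ 3 / f $ 2\<close>.\<close>
  define q where "q = (\<Sum>j\<le>?m. monom (\<gamma> (?m - j, j)) j)"
  have split: "exps ?m = exps m \<union> (\<lambda>j. (?m - j, j)) ` {..?m}"
    by (auto simp: exps_def image_iff)
  have disj: "exps m \<inter> (\<lambda>j. (?m - j, j)) ` {..?m} = {}"
    by (auto simp: exps_def)
  have pull: "pull ?m \<gamma> = f $ 1 * pull m \<gamma> + (\<Sum>j\<le>?m. smult (\<gamma> (?m - j, j)) (mon ?m (?m - j, j)))"
  proof -
    have "mon ?m e = f $ 1 * mon m e" if "e \<in> exps m" for e
      using that by (cases e) (auto simp: mon_def exps_def Suc_diff_le mult_ac)
    moreover have "(\<Sum>e\<in>(\<lambda>j. (?m - j, j)) ` {..?m}. smult (\<gamma> e) (mon ?m e))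
        = (\<Sum>j\<le>?m. smult (\<gamma> (?m - j, j)) (mon ?m (?m - j, j)))"
      by (subst sum.reindex) (auto simp: inj_on_def)
    ultimately show ?thesis
      unfolding pull_def split by (subst sum.union_disjoint[OF _ _ disj]) (auto simp: sum_distrib_left)
  qed
  have "poly q (poly (f $ 3) a / poly (f $ 2) a) = 0" if a: "a \<in> A" for a
  proof -
    have "0 = poly (pull ?m \<gamma>) a" using Suc by simp
    also have "\<dots> = (\<Sum>j\<le>?m. \<gamma> (?m - j, j) * poly (f $ 2) a ^ (?m - j) * poly (f $ 3) a ^ j)"
      unfolding pull using A(3)[OF a] by (simp add: poly_sum mon_def mult_ac)
    also have "\<dots> = poly (f $ 2) a ^ ?m * poly q (poly (f $ 3) a / poly (f $ 2) a)"
      unfolding q_def using A(4)[OF a]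
      by (auto simp: poly_sum poly_monom sum_distrib_left power_diff power_divide field_simps intro!: sum.cong)
    finally show ?thesis using A(4)[OF a] by simp
  qed
  hence sub: "(\<lambda>a. poly (f $ 3) a / poly (f $ 2) a) ` A \<subseteq> {x. poly q x = 0}" by auto
  \<comment> \<open>There are \<open>d - 2\<close> zeros over \<open>A\<close>, while
    \<open>top\<close> lowers the degree to \<open>m < d - 2\<close>.\<close>
  have "q = 0"
  proof (rule ccontr)
    assume "q \<noteq> 0"
    have "d - 2 \<le> card {x. poly q x = 0}"
      using card_mono[OF poly_roots_finite[OF \<open>q \<noteq> 0\<close>] sub] card_image[OF A(5)] A(2) by simp
    also have "\<dots> \<le> degree q" using \<open>q \<noteq> 0\<close> by (rule card_poly_roots_bound)
    also have "\<dots> \<le> m"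
    proof -
      have "q = (\<Sum>j\<le>m. monom (\<gamma> (?m - j, j)) j)" using top by (simp add: q_def)
      thus ?thesis by (auto intro!: degree_sum_le order.trans[OF degree_monom_le])
    qed
    finally show False using Suc.prems(1) by simp
  qed
  have \<gamma>0: "\<gamma> (?m - j, j) = 0" if "j \<le> ?m" for j
  proof -
    have "coeff q j = \<gamma> (?m - j, j)" using that by (simp add: q_def coeff_sum)
    thus ?thesis using \<open>q = 0\<close> by simp
  qed
  hence "f $ 1 * pull m \<gamma> = 0" using Suc.prems(2) pull by simp
  hence "pull m \<gamma> = 0" using f_nonzero by simp
  hence "\<gamma> e = 0" if "e \<in> exps m" for e using Suc.IH[of \<gamma> e] Suc.prems(1) that by simp
  moreover have "e \<in> exps m \<or> (\<exists>j\<le>?m. e = (?m - j, j))"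
    using Suc.prems(3) unfolding split by blast
  ultimately show ?case using \<gamma>0 by blast
qed

text \<open>If \<open>card C\<close> linear conditions on the adjoint forms of degree \<open>d - 2\<close> force their
  pullbacks to be divisible by \<open>Z\<close>, then \<open>degree Z\<close> exceeds \<open>card C\<close> at most by the
  arithmetic genus: otherwise further points could be prescribed until a
  nonzero pullback has more than \<open>d * (d - 2)\<close> zeros.\<close>

lemma excess_bound:
  fixes L :: "'c \<Rightarrow> nat \<times> nat \<Rightarrow> complex"
  assumes "finite C" "card C < d choose 2" "Z \<noteq> 0"
    and Z: "\<And>\<gamma>. (\<forall>c\<in>C. (\<Sum>e\<in>exps (d - 2). L c e * \<gamma> e) = 0) \<Longrightarrow> Z dvd pull (d - 2) \<gamma>"
  shows "degree Z \<le> card C + ((d - 1) choose 2)"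
proof -
  let ?m = "d - 2"
  have m2: "d - 2 + 2 = d" using d3 by simp
  have "infinite (- {x. poly Z x = 0})"
    using poly_roots_finite[OF assms(3)] by (simp add: finite_compl infinite_UNIV_char_0)
  \<comment> \<open>Together with \<open>C\<close> these are one condition fewer than there are
    coefficients, so a nonzero form survives.\<close>
  then obtain E where E: "E \<subseteq> - {x. poly Z x = 0}" "finite E" "card E = (d choose 2) - 1 - card C"
    by (meson infinite_arbitrarily_large)
  define L' where "L' c = (case c of Inl c \<Rightarrow> L c | Inr x \<Rightarrow> (\<lambda>e. poly (mon ?m e) x))" for c
  have "card (exps ?m) = d choose 2" by (simp only: card_exps m2)
  hence "card (C <+> E) < card (exps ?m)"
    using assms(1,2) E by (simp add: card_Plus)
  then obtain \<gamma> where \<gamma>: "\<exists>e\<in>exps ?m. \<gamma> e \<noteq> 0"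
      "\<And>c. c \<in> C <+> E \<Longrightarrow> (\<Sum>e\<in>exps ?m. L' c e * \<gamma> e) = 0"
    using underdetermined_system[of "C <+> E" "exps ?m" L'] assms(1) E(2) by auto
  have nz: "pull ?m \<gamma> \<noteq> 0" using pull_injective[of ?m \<gamma>] \<gamma>(1) by auto
  have "Z dvd pull ?m \<gamma>"
  proof (intro Z ballI)
    fix c assume "c \<in> C"
    from \<gamma>(2)[OF InlI[OF this]] show "(\<Sum>e\<in>exps ?m. L c e * \<gamma> e) = 0" by (simp add: L'_def)
  qed
  then obtain Q where Q: "pull ?m \<gamma> = Z * Q" by (auto elim: dvdE)
  have "poly Q x = 0" if "x \<in> E" for x
  proof -
    have "poly (pull ?m \<gamma>) x = (\<Sum>e\<in>exps ?m. L' (Inr x) e * \<gamma> e)"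
      by (simp add: pull_def poly_sum L'_def mult_ac)
    also have "\<dots> = 0" by (rule \<gamma>(2)[OF InrI[OF that]])
    finally have "poly Z x * poly Q x = 0" by (simp add: Q)
    moreover have "poly Z x \<noteq> 0" using E(1) that by auto
    ultimately show ?thesis by simp
  qed
  hence "E \<subseteq> {x. poly Q x = 0}" by auto
  moreover have "Q \<noteq> 0" using nz Q by auto
  ultimately have "card E \<le> card {x. poly Q x = 0}"
    by (intro card_mono poly_roots_finite)
  also have "\<dots> \<le> degree Q" using \<open>Q \<noteq> 0\<close> by (rule card_poly_roots_bound)
  finally have "card E \<le> degree Q" .
  moreover have "degree (pull ?m \<gamma>) = degree Z + degree Q"
    using \<open>Q \<noteq> 0\<close> assms(3) by (simp add: Q degree_mult_eq)
  ultimately have *: "degree Z + ((d choose 2) - 1 - card C) \<le> d * (d - 2)"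
    using degree_pull[of ?m \<gamma>] E(3) by linarith
  \<comment> \<open>Sums of consecutive triangular numbers are squares. Hence d (d - 2) exceeds the
    largest admissible number of conditions, (d choose 2) - 1, by exactly the arithmetic
    genus.\<close>
  have "(Suc k choose 2) + (k choose 2) = k * k" for k
    by (induction k) (simp_all add: numeral_2_eq_2)
  from this[of "d - 1"] have "(d choose 2) + ((d - 1) choose 2) = (d - 1) * (d - 1)"
    using d3 by simp
  moreover have "d * (d - 2) + 1 = (d - 1) * (d - 1)"
  proof -
    obtain n where "d = n + 3" using d3 by (metis add.commute le_Suc_ex)
    thus ?thesis by (simp add: algebra_simps)
  qed
  ultimately show ?thesis using * assms(2) by linarith
qed

end

section \<open>Multiple zeros and derivative vectors of the curve\<close>

lemma order_eqI_pderiv: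
  fixes p :: "'a :: field_char_0 poly"
  assumes "\<And>k. k < n \<Longrightarrow> poly ((pderiv ^^ k) p) t = 0" "poly ((pderiv ^^ n) p) t \<noteq> 0"
  shows "order t p = n"
  using assms
proof (induction n arbitrary: p)
  case 0
  thus ?case by (simp add: order_0I)
next
  case (Suc n)
  have "order t (pderiv p) = n"
    using Suc.prems(1)[of "Suc k" for k] Suc.prems(2)
    by (intro Suc.IH) (auto simp: funpow_Suc_right simp del: funpow.simps)
  moreover have "p \<noteq> 0" using Suc.prems(2) by auto
  moreover have "poly p t = 0" using Suc.prems(1)[of 0] by simp
  ultimately show ?case by (simp add: order_pderiv)
qed

lemma prod_linear_dvd:
  fixes p :: "'a :: field poly"
  assumes "finite T" "\<And>t. t \<in> T \<Longrightarrow> poly p t = 0"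
  shows "(\<Prod>t\<in>T. [:- t, 1:]) dvd p"
  using assms
proof (induction T rule: finite_induct)
  case (insert x T)
  then obtain q where q: "p = (\<Prod>t\<in>T. [:- t, 1:]) * q" by (auto elim: dvdE)
  have "poly (\<Prod>t\<in>T. [:- t, 1:]) x \<noteq> 0" using insert.hyps by (auto simp: poly_prod)
  moreover have "poly p x = 0" using insert.prems by simp
  ultimately have "[:- x, 1:] dvd q" by (simp add: q poly_eq_0_iff_dvd[symmetric])
  thus ?case using insert.hyps by (simp add: q mult.commute mult_dvd_mono del: mult_pCons_left)
qed simp

lemma prod_linear_double_dvd:
  fixes p :: "'a :: field poly"
  assumes "finite T" "D \<subseteq> T" "\<And>t. t \<in> T \<Longrightarrow> poly p t = 0" "\<And>t. t \<in> D \<Longrightarrow> poly (pderiv p) t = 0"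
  shows "(\<Prod>t\<in>T. [:- t, 1:]) * (\<Prod>t\<in>D. [:- t, 1:]) dvd p"
proof -
  obtain q where q: "p = (\<Prod>t\<in>T. [:- t, 1:]) * q"
    using prod_linear_dvd[OF assms(1,3)] by (auto elim: dvdE)
  have "poly q t = 0" if "t \<in> D" for t
  proof -
    define r where "r = (\<Prod>t\<in>T - {t}. [:- t, 1:])"
    have r: "poly r t \<noteq> 0" using assms(1) by (auto simp: r_def poly_prod)
    have "p = [:- t, 1:] * (r * q)"
      using assms(1,2) that by (auto simp: q r_def prod.remove[of T t] simp del: mult_pCons_left)
    hence "poly (pderiv p) t = poly r t * poly q t"
      by (simp add: pderiv_mult pderiv_pCons del: mult_pCons_left)
    thus ?thesis using r assms(4)[OF that] by simp
  qed
  hence "(\<Prod>t\<in>D. [:- t, 1:]) dvd q"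
    using finite_subset[OF assms(2,1)] by (intro prod_linear_dvd)
  thus ?thesis by (simp add: q mult_dvd_mono)
qed

definition det3 :: "'a :: comm_ring_1 ^ 3 \<Rightarrow> 'a ^ 3 \<Rightarrow> 'a ^ 3 \<Rightarrow> 'a" where
  "det3 u v w = u $ 1 * (v $ 2 * w $ 3 - v $ 3 * w $ 2) - u $ 2 * (v $ 1 * w $ 3 - v $ 3 * w $ 1)
     + u $ 3 * (v $ 1 * w $ 2 - v $ 2 * w $ 1)"

lemma det_rows_eq_det3: "det (vector [u, v, w]) = det3 u v w"
  by (simp add: det_3 det3_def vector_3 algebra_simps)

context plane_param
begin

definition cv :: "nat \<Rightarrow> complex \<Rightarrow> complex ^ 3" where
  "cv k t = (\<chi> i. poly ((pderiv ^^ k) (f $ i)) t)"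

lemma cv_nth: "cv k t $ i = poly ((pderiv ^^ k) (f $ i)) t"
  by (simp add: cv_def)

lemma degree_f_le: "degree (f $ i) \<le> d"
  using degree_f d3 exhaust_3[of i] by auto

lemma roots_f1: "poly (f $ 1) t = 0 \<longleftrightarrow> t \<in> A"
proof -
  have "A \<subseteq> {t. poly (f $ 1) t = 0}" using A by auto
  moreover have "card {t. poly (f $ 1) t = 0} \<le> card A"
    using card_poly_roots_bound[OF f_nonzero(1)] degree_f A(2) by simp
  ultimately have "A = {t. poly (f $ 1) t = 0}"
    using poly_roots_finite[OF f_nonzero(1)] by (intro card_seteq) auto
  thus ?thesis by auto
qed

lemma cv_nonzero: "cv 0 t \<noteq> 0"
proof
  assume "cv 0 t = 0"
  hence "poly (f $ 1) t = 0" "poly (f $ 2) t = 0" by (metis cv_nth funpow_0 zero_index)+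
  thus False using roots_f1 A(4) by blast
qed

text \<open>Equality of image points, expressed by lifts so that vanishing of a form is transferred
  by homogeneity.\<close>

definition par :: "complex \<Rightarrow> complex \<Rightarrow> bool" where
  "par s t \<longleftrightarrow> (\<exists>k. cv 0 t = k *s cv 0 s)"

lemma par_refl: "par t t"
  by (auto simp: par_def intro: exI[of _ 1])

lemma par_sym: "par s t \<Longrightarrow> par t s"
proof -
  assume "par s t"
  then obtain k where k: "cv 0 t = k *s cv 0 s" by (auto simp: par_def)
  hence "k \<noteq> 0" using cv_nonzero[of t] by auto
  hence "cv 0 s = inverse k *s cv 0 t" by (simp add: k)
  thus ?thesis by (auto simp: par_def)
qed

lemma par_trans: "par s t \<Longrightarrow> par t u \<Longrightarrow> par s u"
  unfolding par_def by (metis vector_smult_assoc)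

lemma poly_mon: "poly (mon m e) t = cv 0 t $ 1 ^ (m - fst e - snd e) * cv 0 t $ 2 ^ fst e * cv 0 t $ 3 ^ snd e"
  by (simp add: mon_def cv_nth)

lemma poly_mon_par:
  assumes "e \<in> exps m" "cv 0 t = k *s cv 0 s"
  shows "poly (mon m e) t = k ^ m * poly (mon m e) s"
proof -
  obtain i j where e: "e = (i, j)" by force
  define l where "l = m - i - j"
  have m: "m = l + i + j" using assms(1) by (auto simp: e exps_def l_def)
  show ?thesis unfolding poly_mon assms(2) by (simp add: e m power_add power_mult_distrib mult_ac)
qed

text \<open>Euler's relation: for a form F of degree m, the differential of F at k P in the
  direction a P + b P' is k^(m-1) (m a F(P) + b dF(P)(P')).\<close>

lemma poly_pderiv_mon:
  assumes "e \<in> exps m" "0 < m" "cv 0 t = k *s cv 0 s" "cv 1 t = a *s cv 0 s + b *s cv 1 s"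
  shows "poly (pderiv (mon m e)) t
    = k ^ (m - 1) * (of_nat m * a * poly (mon m e) s + b * poly (pderiv (mon m e)) s)"
proof -
  obtain i j where e: "e = (i, j)" by force
  define l where "l = m - i - j"
  have m: "m = l + i + j" using assms(1) by (auto simp: e exps_def l_def)
  have mon: "mon m e = f $ 1 ^ l * f $ 2 ^ i * f $ 3 ^ j"
    by (simp add: mon_def e m)
  have v: "poly (f $ n) t = k * poly (f $ n) s"
    "poly (pderiv (f $ n)) t = a * poly (f $ n) s + b * poly (pderiv (f $ n)) s" for n
    using arg_cong[OF assms(3), of "\<lambda>x. x $ n"] arg_cong[OF assms(4), of "\<lambda>x. x $ n"]
    by (simp_all add: cv_nth)
  have pd: "poly (pderiv (mon m e)) u
    = of_nat l * poly (f $ 1) u ^ (l - 1) * poly (pderiv (f $ 1)) u * poly (f $ 2) u ^ i * poly (f $ 3) u ^ j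
    + poly (f $ 1) u ^ l * (of_nat i * poly (f $ 2) u ^ (i - 1) * poly (pderiv (f $ 2)) u) * poly (f $ 3) u ^ j
    + poly (f $ 1) u ^ l * poly (f $ 2) u ^ i * (of_nat j * poly (f $ 3) u ^ (j - 1) * poly (pderiv (f $ 3)) u)" for u
    unfolding mon by (simp add: pderiv_mult pderiv_power algebra_simps)
  \<comment> \<open>Multiplied by \<open>k\<close>, so that the truncated exponents
    \<open>l - 1\<close>, \<open>i - 1\<close>, \<open>j - 1\<close> fit the power
    \<open>k ^ m\<close>; the factor is cancelled afterwards.\<close>
  have "k * poly (pderiv (mon m e)) t
    = k ^ m * (of_nat m * a * poly (mon m e) s + b * poly (pderiv (mon m e)) s)"
    unfolding pd unfolding mon unfolding m v poly_mult poly_power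
    by (cases l; cases i; cases j) (simp_all add: power_mult_distrib power_add algebra_simps)
  moreover have "k \<noteq> 0" using cv_nonzero[of t] assms(3) by auto
  ultimately show ?thesis using assms(2) by (cases m) auto
qed

text \<open>The instance of \<open>excess_bound\<close> in which the elements of \<open>D\<close>
  are prescribed as double zeros.\<close>

lemma excess_conditions:
  fixes L :: "'c \<Rightarrow> nat \<times> nat \<Rightarrow> complex"
  assumes "finite T" "D \<subseteq> T" "finite C" "card C < d choose 2"
    and "\<And>\<gamma> t. (\<forall>c\<in>C. (\<Sum>e\<in>exps (d - 2). L c e * \<gamma> e) = 0) \<Longrightarrow> t \<in> T \<Longrightarrow> poly (pull (d - 2) \<gamma>) t = 0"
    and "\<And>\<gamma> t. (\<forall>c\<in>C. (\<Sum>e\<in>exps (d - 2). L c e * \<gamma> e) = 0) \<Longrightarrow> t \<in> D \<Longrightarrow> poly (pderiv (pull (d - 2) \<gamma>)) t = 0"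
  shows "card T + card D \<le> card C + ((d - 1) choose 2)"
proof -
  let ?Z = "(\<Prod>t\<in>T. [:- t, 1:]) * (\<Prod>t\<in>D. [:- t, 1:]) :: complex poly"
  have nz: "(\<Prod>t\<in>S. [:- t, 1:]) \<noteq> (0 :: complex poly)" for S
    by (cases "finite S") (auto simp: prod_zero_iff)
  have deg: "degree (\<Prod>t\<in>S. [:- t, 1 :: complex:]) = card S" for S
    by (subst degree_prod_sum_eq) auto
  have "degree ?Z \<le> card C + ((d - 1) choose 2)"
    using assms nz by (intro excess_bound[where L = L] prod_linear_double_dvd) auto
  moreover have "degree ?Z = card T + card D" using nz by (simp add: degree_mult_eq deg)
  ultimately show ?thesis by simp
qed

lemma poly_pull: "poly (pull m \<gamma>) t = (\<Sum>e\<in>exps m. poly (mon m e) t * \<gamma> e)"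
  by (simp add: pull_def poly_sum mult.commute)

lemma poly_pderiv_pull: "poly (pderiv (pull m \<gamma>)) t = (\<Sum>e\<in>exps m. poly (pderiv (mon m e)) t * \<gamma> e)"
  by (simp add: pull_def higher_pderiv_sum[of 1, simplified] pderiv_smult poly_sum mult.commute)

lemma poly_pull_par: "par s t \<Longrightarrow> poly (pull m \<gamma>) s = 0 \<Longrightarrow> poly (pull m \<gamma>) t = 0"
proof -
  assume "par s t" and 0: "poly (pull m \<gamma>) s = 0"
  then obtain k where k: "cv 0 t = k *s cv 0 s" by (auto simp: par_def)
  have "poly (pull m \<gamma>) t = k ^ m * poly (pull m \<gamma>) s"
    unfolding poly_pull by (auto simp: sum_distrib_left poly_mon_par[OF _ k] intro!: sum.cong)
  thus ?thesis using 0 by simp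
qed

text \<open>Double zeros pass between branches with the same image and the same tangent. With
  \<open>b = 0\<close> and \<open>s = t\<close> it expresses that every form through a cusp has a
  double zero at its parameter.\<close>

lemma poly_pderiv_pull_tangent:
  assumes "0 < m" "cv 0 t = k *s cv 0 s" "cv 1 t = a *s cv 0 s + b *s cv 1 s"
    "poly (pull m \<gamma>) s = 0" "b = 0 \<or> poly (pderiv (pull m \<gamma>)) s = 0"
  shows "poly (pderiv (pull m \<gamma>)) t = 0"
proof -
  have "poly (pderiv (pull m \<gamma>)) t
    = k ^ (m - 1) * (of_nat m * a * poly (pull m \<gamma>) s + b * poly (pderiv (pull m \<gamma>)) s)"
    unfolding poly_pull poly_pderiv_pull
    by (auto simp: sum_distrib_left sum.distrib[symmetric] poly_pderiv_mon[OF _ assms(1-3)] algebra_simps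
      intro!: sum.cong)
  thus ?thesis using assms by auto
qed

text \<open>Conditions are imposed at the representatives \<open>R\<close> only: the other
  parameters over the same image points are zeros for free, and so is the second zero at each
  cusp.\<close>

lemma excess_points:
  assumes "finite T" "K \<subseteq> T" "\<And>k. k \<in> K \<Longrightarrow> \<exists>l. cv 1 k = l *s cv 0 k"
    "finite R" "card R < d choose 2" "\<And>t. t \<in> T \<Longrightarrow> \<exists>r\<in>R. par r t"
  shows "card T + card K \<le> card R + ((d - 1) choose 2)"
proof -
  have T: "poly (pull (d - 2) \<gamma>) t = 0"
    if "\<forall>r\<in>R. (\<Sum>e\<in>exps (d - 2). poly (mon (d - 2) e) r * \<gamma> e) = 0" "t \<in> T" for \<gamma> t
    using that assms(6)[of t] poly_pull_par by (metis poly_pull)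
  show ?thesis
  proof (rule excess_conditions[where L = "\<lambda>r e. poly (mon (d - 2) e) r"])
    fix \<gamma> t assume *: "\<forall>r\<in>R. (\<Sum>e\<in>exps (d - 2). poly (mon (d - 2) e) r * \<gamma> e) = 0" "t \<in> K"
    then obtain l where "cv 1 t = l *s cv 0 t" using assms(3) by blast
    hence "cv 1 t = l *s cv 0 t + 0 *s cv 1 t" by simp
    thus "poly (pderiv (pull (d - 2) \<gamma>)) t = 0"
      using d3 T[of \<gamma> t] * assms(2) by (intro poly_pderiv_pull_tangent[of _ t 1 t l 0]) auto
  qed (use assms T in auto)
qed

text \<open>If the two branches over a point share their tangent, one additional condition, on the
  derivative at \<open>s\<close>, produces two additional zeros, at \<open>s\<close> and at
  \<open>t\<close>.\<close>

lemma excess_tacnode: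
  assumes "finite T" "K \<subseteq> T" "\<And>k. k \<in> K \<Longrightarrow> \<exists>l. cv 1 k = l *s cv 0 k"
    "finite R" "card R + 1 < d choose 2" "\<And>t. t \<in> T \<Longrightarrow> \<exists>r\<in>R. par r t"
    "s \<in> T - K" "t \<in> T - K" "s \<noteq> t" "par s t" "cv 1 t = a *s cv 0 s + b *s cv 1 s"
  shows "card T + card K + 2 \<le> card R + 1 + ((d - 1) choose 2)"
proof -
  let ?m = "d - 2"
  define C where "C = R <+> {()}"
  define L where "L c e = (case c of Inl r \<Rightarrow> poly (mon ?m e) r | Inr _ \<Rightarrow> poly (pderiv (mon ?m e)) s)"
    for c :: "complex + unit" and e
  have C: "(\<forall>r\<in>R. poly (pull ?m \<gamma>) r = 0) \<and> poly (pderiv (pull ?m \<gamma>)) s = 0"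
    if "\<forall>c\<in>C. (\<Sum>e\<in>exps ?m. L c e * \<gamma> e) = 0" for \<gamma>
  proof -
    have "\<forall>r\<in>R. (\<Sum>e\<in>exps ?m. L (Inl r) e * \<gamma> e) = 0" "(\<Sum>e\<in>exps ?m. L (Inr ()) e * \<gamma> e) = 0"
      using that by (auto simp: C_def)
    thus ?thesis by (simp add: L_def poly_pull poly_pderiv_pull)
  qed
  have T: "poly (pull ?m \<gamma>) t = 0" if "\<forall>c\<in>C. (\<Sum>e\<in>exps ?m. L c e * \<gamma> e) = 0" "t \<in> T" for \<gamma> t
    using C[OF that(1)] assms(6)[OF that(2)] poly_pull_par by blast
  have finK: "finite K" using assms(1,2) finite_subset by blast
  obtain k where k: "cv 0 t = k *s cv 0 s" using assms(10) by (auto simp: par_def)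
  have "card T + card (insert s (insert t K)) \<le> card C + ((d - 1) choose 2)"
  proof (rule excess_conditions[where L = L])
    fix \<gamma> x assume *: "\<forall>c\<in>C. (\<Sum>e\<in>exps ?m. L c e * \<gamma> e) = 0" "x \<in> insert s (insert t K)"
    consider "x = s" | "x = t" | "x \<in> K" using *(2) by blast
    thus "poly (pderiv (pull ?m \<gamma>)) x = 0"
    proof cases
      case 1 thus ?thesis using C[OF *(1)] by simp
    next
      case 2 thus ?thesis
        using d3 T[OF *(1)] assms C[OF *(1)] k by (intro poly_pderiv_pull_tangent[of _ x k s a b]) auto
    next
      case 3
      then obtain l where "cv 1 x = l *s cv 0 x" using assms(3) by blast
      hence "cv 1 x = l *s cv 0 x + 0 *s cv 1 x" by simp
      thus ?thesis
        using d3 T[of \<gamma> x] * assms 3 by (intro poly_pderiv_pull_tangent[of _ x 1 x l 0]) auto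
    qed
  qed (use assms T finK in \<open>auto simp: C_def card_Plus\<close>)
  thus ?thesis using assms finK by (simp add: C_def card_Plus)
qed

end

subsection \<open>Ramification and the Wronskian\<close>

lemma coeff_mult_degree_bound:
  fixes p q :: "'a :: comm_semiring_0 poly"
  assumes "degree p \<le> m" "degree q \<le> n"
  shows "coeff (p * q) (m + n) = coeff p m * coeff q n"
proof -
  have "coeff (p * q) (m + n) = (\<Sum>i\<le>m + n. coeff p i * coeff q (m + n - i))"
    by (simp add: coeff_mult)
  also have "\<dots> = (\<Sum>i\<le>m + n. if i = m then coeff p m * coeff q n else 0)"
  proof (intro sum.cong refl)
    fix i
    have "i < m \<Longrightarrow> coeff q (m + n - i) = 0" using assms by (intro coeff_eq_0) auto
    moreover have "m < i \<Longrightarrow> coeff p i = 0" using assms by (intro coeff_eq_0) auto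
    ultimately show "coeff p i * coeff q (m + n - i) = (if i = m then coeff p m * coeff q n else 0)"
      by (cases i m rule: linorder_cases) auto
  qed
  finally show ?thesis by simp
qed

definition wronskian :: "'a :: idom poly ^ 3 \<Rightarrow> 'a poly" where
  "wronskian g = det3 g (\<chi> i. pderiv (g $ i)) (\<chi> i. pderiv (pderiv (g $ i)))"

text \<open>Multiplying the derivatives by \<open>X\<close> and \<open>X\<^sup>2\<close> makes every entry of a row have the same
  degree, so that the top coefficient is a Vandermonde determinant.\<close>

lemma wronskian_leading:
  fixes g :: "'a :: field_char_0 poly ^ 3"
  assumes "degree (g $ 1) = n" "degree (g $ 2) = n + 1" "degree (g $ 3) = n + 2"
  shows "degree (wronskian g * monom 1 3) \<le> 3 * n + 3"
    and "coeff (wronskian g * monom 1 3) (3 * n + 3)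
      = 2 * lead_coeff (g $ 1) * lead_coeff (g $ 2) * lead_coeff (g $ 3)"
proof -
  define X :: "'a poly" where "X = monom 1 1"
  define E1 E2 where "E1 p = X * pderiv p" and "E2 p = X ^ 2 * pderiv (pderiv p)" for p :: "'a poly"
  have c: "coeff (E1 p) k = of_nat k * coeff p k" "coeff (E2 p) k = of_nat k * (of_nat k - 1) * coeff p k" for p k
  proof -
    show "coeff (E1 p) k = of_nat k * coeff p k"
      by (cases k) (auto simp: E1_def X_def coeff_monom_mult coeff_pderiv)
    show "coeff (E2 p) k = of_nat k * (of_nat k - 1) * coeff p k"
      by (cases k; cases "k - 1") (auto simp: E2_def X_def monom_power coeff_monom_mult coeff_pderiv)
  qed
  have dg: "degree (E1 p) \<le> degree p" "degree (E2 p) \<le> degree p" for p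
    by (auto intro!: degree_le simp: c coeff_eq_0)
  have eq: "wronskian g * monom 1 3 = g $ 1 * (E1 (g $ 2) * E2 (g $ 3)) - g $ 1 * (E1 (g $ 3) * E2 (g $ 2))
     - g $ 2 * (E1 (g $ 1) * E2 (g $ 3)) + g $ 2 * (E1 (g $ 3) * E2 (g $ 1))
     + g $ 3 * (E1 (g $ 1) * E2 (g $ 2)) - g $ 3 * (E1 (g $ 2) * E2 (g $ 1))"
  proof -
    have "monom 1 3 = X * X ^ 2" by (simp add: X_def monom_power mult_monom numeral_3_eq_3)
    thus ?thesis by (simp add: wronskian_def det3_def E1_def E2_def algebra_simps)
  qed
  have d3: "degree (p * (E1 q * E2 r)) \<le> 3 * n + 3"
    if "degree p + degree q + degree r = 3 * n + 3" for p q r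
  proof -
    have "degree (p * (E1 q * E2 r)) \<le> degree p + (degree (E1 q) + degree (E2 r))"
      by (meson add_left_mono degree_mult_le order.trans)
    thus ?thesis using dg(1)[of q] dg(2)[of r] that by linarith
  qed
  have c3: "coeff (p * (E1 q * E2 r)) (3 * n + 3) = lead_coeff p *
      (of_nat (degree q) * lead_coeff q * (of_nat (degree r) * (of_nat (degree r) - 1) * lead_coeff r))"
    if "degree p + degree q + degree r = 3 * n + 3" for p q r
  proof -
    have "coeff (p * (E1 q * E2 r)) (degree p + (degree q + degree r))
      = coeff p (degree p) * (coeff (E1 q) (degree q) * coeff (E2 r) (degree r))"
      by (subst coeff_mult_degree_bound, simp, rule order.trans[OF degree_mult_le add_mono[OF dg]])
        (simp add: coeff_mult_degree_bound dg)
    thus ?thesis using that by (simp add: c add.assoc)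
  qed
  show "degree (wronskian g * monom 1 3) \<le> 3 * n + 3"
    unfolding eq by (intro degree_add_le degree_diff_le d3) (auto simp: assms)
  show "coeff (wronskian g * monom 1 3) (3 * n + 3)
      = 2 * lead_coeff (g $ 1) * lead_coeff (g $ 2) * lead_coeff (g $ 3)"
    unfolding eq coeff_add coeff_diff
      c3[of "g $ 1" "g $ 2" "g $ 3", unfolded assms, simplified] c3[of "g $ 1" "g $ 3" "g $ 2", unfolded assms, simplified]
      c3[of "g $ 2" "g $ 1" "g $ 3", unfolded assms, simplified] c3[of "g $ 2" "g $ 3" "g $ 1", unfolded assms, simplified]
      c3[of "g $ 3" "g $ 1" "g $ 2", unfolded assms, simplified] c3[of "g $ 3" "g $ 2" "g $ 1", unfolded assms, simplified]
      assms by (simp add: algebra_simps)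
qed

lemma wronskian_degree:
  fixes g :: "'a :: field_char_0 poly ^ 3"
  assumes "degree (g $ 1) = n" "degree (g $ 2) = n + 1" "degree (g $ 3) = n + 2" "g $ 1 \<noteq> 0"
  shows "degree (wronskian g) = 3 * n" "wronskian g \<noteq> 0"
proof -
  have "g $ 2 \<noteq> 0" "g $ 3 \<noteq> 0" using assms by auto
  hence nz: "coeff (wronskian g * monom 1 3) (3 * n + 3) \<noteq> 0"
    using wronskian_leading(2)[OF assms(1-3)] assms(4) by simp
  hence "degree (wronskian g * monom 1 3) = 3 * n + 3"
    using wronskian_leading(1)[OF assms(1-3)] le_degree by (metis order.antisym)
  moreover show w: "wronskian g \<noteq> 0" using nz by auto
  ultimately show "degree (wronskian g) = 3 * n" by (simp add: degree_mult_eq degree_monom_eq)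
qed

section \<open>Ramification sequences computed from an affine parameter\<close>

lemma vec_span_singleton_scale:
  fixes v :: "'a :: field ^ 'n"
  assumes "k \<noteq> 0"
  shows "vec.span {k *s v} = vec.span {v}"
proof -
  have "v = inverse k *s (k *s v)" using assms by simp
  hence "v \<in> vec.span {k *s v}" by (metis vec.span_base vec.span_scale insertI1)
  moreover have "k *s v \<in> vec.span {v}" by (simp add: vec.span_base vec.span_scale)
  ultimately show ?thesis by (auto simp: vec.span_eq)
qed

definition curve_of :: "nat \<Rightarrow> complex poly ^ 3 \<Rightarrow> bipoly ^ 3" where
  "curve_of d f = (\<chi> i. homog d (f $ i))"

definition pt :: "complex \<Rightarrow> complex ^ 2" where
  "pt t = vector [t, 1]"

lemma pt_nth [simp]: "pt t $ 1 = t" "pt t $ 2 = 1"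
  by (simp_all add: pt_def)

lemma pt_nonzero [simp]: "pt t \<noteq> 0"
  by (metis pt_nth(2) zero_index zero_neq_one)

lemma span_pt: "v $ 2 \<noteq> 0 \<Longrightarrow> vec.span {v} = vec.span {pt (v $ 1 / v $ 2)}"
proof -
  assume "v $ 2 \<noteq> 0"
  moreover from this have "v = v $ 2 *s pt (v $ 1 / v $ 2)"
    by (auto simp: vec_eq_iff forall_2)
  ultimately show ?thesis by (metis vec_span_singleton_scale)
qed

lemma span_pt_inject: "vec.span {pt s} = vec.span {pt t} \<longleftrightarrow> s = t"
proof
  assume "vec.span {pt s} = vec.span {pt t}"
  hence "pt s \<in> vec.span {pt t}" using vec.span_base by blast
  then obtain k where "pt s = k *s pt t" by (auto simp: vec.span_singleton)
  thus "s = t" by (auto simp: vec_eq_iff forall_2)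
qed auto

lemma lin_comb_curve_of: "lin_comb a (curve_of d f) = homog d (\<Sum>i\<in>UNIV. smult (a $ i) (f $ i))"
  by (simp add: lin_comb_def curve_of_def homog_sum homog_smult)

text \<open>The numbers of a ramification sequence are the orders of vanishing of the linear
  combinations of the components.\<close>

lemma ramification_sequence_orders:
  assumes "ramification_sequence \<phi> v \<alpha> \<beta>"
  shows "{k. \<exists>a. a \<noteq> 0 \<and> vanishes_to_order (lin_comb a \<phi>) v k} = {0, \<alpha>, \<beta>}"
proof -
  let ?L = "lin_form v"
  obtain M :: "complex ^ 3 ^ 3" where M: "invertible M" "0 < \<alpha>" "\<alpha> < \<beta>"
    "vanishes_to_order (lin_comb (M $ 1) \<phi>) v 0" "vanishes_to_order (lin_comb (M $ 2) \<phi>) v \<alpha>"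
    "vanishes_to_order (lin_comb (M $ 3) \<phi>) v \<beta>"
    using assms by (auto simp: ramification_sequence_def)
  obtain N where N: "N ** M = mat 1" "M ** N = mat 1" using M(1) by (auto simp: invertible_def)
  have row: "M $ i \<noteq> 0" for i
  proof
    assume "M $ i = 0"
    hence "(M ** N) $ i $ i = 0" by (simp add: matrix_matrix_mult_def)
    thus False using N(2) by (simp add: mat_def)
  qed
  have lc_add: "lin_comb (a + b) \<phi> = lin_comb a \<phi> + lin_comb b \<phi>" for a b
  proof -
    have split: "[:a $ i + b $ i:] = [:a $ i:] + [:b $ i:]" for i by simp
    show ?thesis unfolding lin_comb_def
      by (simp only: vector_add_component split smult_add_left sum.distrib)
  qed
  have lc_smult: "lin_comb (c *s a) \<phi> = smult [:c:] (lin_comb a \<phi>)" for c a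
  proof -
    have "smult [:c:] (\<Sum>i\<in>S. smult [:a $ i:] (\<phi> $ i)) = (\<Sum>i\<in>S. smult [:c * a $ i:] (\<phi> $ i))" for S
      by (induction S rule: infinite_finite_induct) (simp_all add: smult_add_right mult.commute)
    thus ?thesis by (simp add: lin_comb_def)
  qed
  have uniq: "k = l" if "vanishes_to_order g v k" "vanishes_to_order g v l" for g k l
  proof -
    have "\<not> k < l" if "vanishes_to_order g v k" "vanishes_to_order g v l" for k l
    proof
      assume "k < l"
      hence "?L ^ Suc k dvd ?L ^ l" by (intro le_imp_power_dvd) simp
      thus False using that unfolding vanishes_to_order_def by (blast intro: dvd_trans)
    qed
    from this[OF that] this[OF that(2,1)] show ?thesis by simp
  qed
  have smult: "vanishes_to_order (smult [:c:] g + h) v k"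
    if "c \<noteq> 0" "vanishes_to_order g v k" "?L ^ Suc k dvd h" for c g h k
  proof -
    have "?L ^ Suc k dvd g" if "?L ^ Suc k dvd smult [:c:] g"
    proof -
      have "?L ^ Suc k dvd smult [:inverse c:] (smult [:c:] g)" using that by (rule dvd_smult)
      also have "smult [:inverse c:] (smult [:c:] g) = g"
        using \<open>c \<noteq> 0\<close> by (simp flip: one_pCons)
      finally show ?thesis .
    qed
    hence "\<not> ?L ^ Suc k dvd smult [:c:] g + h"
      using that(2) dvd_add_left_iff[OF that(3), of "smult [:c:] g"] unfolding vanishes_to_order_def by blast
    moreover have "?L ^ k dvd h" using that(3) by (rule power_le_dvd) simp
    hence "?L ^ k dvd smult [:c:] g + h"
      using that(2) unfolding vanishes_to_order_def by (intro dvd_add dvd_smult) auto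
    ultimately show ?thesis unfolding vanishes_to_order_def by blast
  qed
  have dvd: "?L ^ j dvd smult [:c:] g" if "vanishes_to_order g v k" "j \<le> k" for c g j k
  proof -
    have "?L ^ k dvd g" using that(1) unfolding vanishes_to_order_def by blast
    hence "?L ^ j dvd g" using that(2) by (rule power_le_dvd)
    thus ?thesis by (rule dvd_smult)
  qed
  have "k \<in> {0, \<alpha>, \<beta>}" if a: "a \<noteq> 0" "vanishes_to_order (lin_comb a \<phi>) v k" for a k
  proof -
    \<comment> \<open>Coordinates of \<open>a\<close> in the basis formed by the rows of
      \<open>M\<close>; the first nonzero one decides the order of vanishing.\<close>
    define c where "c = a v* N"
    have "a = c v* M" using N(1) by (simp add: c_def vector_matrix_mul_assoc vector_matrix_mul_rid)
    hence a_eq: "a = c $ 1 *s M $ 1 + (c $ 2 *s M $ 2 + c $ 3 *s M $ 3)"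
      by (simp add: vec_eq_iff vector_matrix_mult_def sum_3 mult.commute)
    have lc: "lin_comb a \<phi> = smult [:c $ 1:] (lin_comb (M $ 1) \<phi>) +
        (smult [:c $ 2:] (lin_comb (M $ 2) \<phi>) + smult [:c $ 3:] (lin_comb (M $ 3) \<phi>))"
      by (subst a_eq) (simp only: lc_add lc_smult)
    have "c $ 1 \<noteq> 0 \<or> c $ 2 \<noteq> 0 \<or> c $ 3 \<noteq> 0"
    proof (rule ccontr)
      assume "\<not> (c $ 1 \<noteq> 0 \<or> c $ 2 \<noteq> 0 \<or> c $ 3 \<noteq> 0)"
      hence "a = 0" by (subst a_eq) simp
      thus False using a(1) by simp
    qed
    then consider "c $ 1 \<noteq> 0" | "c $ 1 = 0" "c $ 2 \<noteq> 0" | "c $ 1 = 0" "c $ 2 = 0" "c $ 3 \<noteq> 0"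
      by blast
    thus ?thesis
    proof cases
      case 1
      have "vanishes_to_order (lin_comb a \<phi>) v 0"
        unfolding lc using M(2,3) by (intro smult[OF 1 M(4)] dvd_add dvd[OF M(5)] dvd[OF M(6)]) linarith+
      thus ?thesis using uniq a(2) by blast
    next
      case 2
      have "vanishes_to_order (lin_comb a \<phi>) v \<alpha>"
        unfolding lc using smult[OF 2(2) M(5) dvd[OF M(6), of "Suc \<alpha>" "c $ 3"]] M(3) 2(1) by simp
      thus ?thesis using uniq a(2) by blast
    next
      case 3
      have "vanishes_to_order (lin_comb a \<phi>) v \<beta>"
        unfolding lc using smult[OF 3(3) M(6), of 0] 3(1,2) by simp
      thus ?thesis using uniq a(2) by blast
    qed
  qed
  thus ?thesis using M row by blast
qed

lemma ramification_sequence_unique: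
  assumes "ramification_sequence \<phi> v \<alpha> \<beta>" "ramification_sequence \<phi> v \<alpha>' \<beta>'"
  shows "\<alpha> = \<alpha>' \<and> \<beta> = \<beta>'"
proof -
  have "{0, \<alpha>, \<beta>} = {0, \<alpha>', \<beta>'}"
    using assms[THEN ramification_sequence_orders] by simp
  moreover have "0 < \<alpha>" "\<alpha> < \<beta>" "0 < \<alpha>'" "\<alpha>' < \<beta>'"
    using assms by (auto simp: ramification_sequence_def)
  moreover have "\<beta> = Max {0, \<alpha>, \<beta>}" "\<alpha> = Min ({0, \<alpha>, \<beta>} - {0})" if "0 < \<alpha>" "\<alpha> < \<beta>" for \<alpha> \<beta> :: nat
    using that by auto
  ultimately show ?thesis by metis
qed

context plane_param
begin

abbreviation "\<phi> \<equiv> curve_of d f"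

lemma f_nz: "f $ i \<noteq> 0"
  using f_nonzero exhaust_3[of i] by auto

lemma wronskian_f: "degree (wronskian f) = 3 * (d - 2)" "wronskian f \<noteq> 0"
  using wronskian_degree[of f "d - 2"] degree_f f_nonzero d3 by auto

lemma poly_wronskian: "poly (wronskian f) t = det3 (cv 0 t) (cv 1 t) (cv 2 t)"
  by (simp add: wronskian_def det3_def cv_nth numeral_2_eq_2)

text \<open>Differentiating a determinant of derivative vectors leaves only the terms whose rows are
  distinct.\<close>

lemma poly_wronskian': "poly (pderiv (wronskian f)) t = det3 (cv 0 t) (cv 1 t) (cv 3 t)"
  by (simp add: wronskian_def det3_def cv_nth numeral_3_eq_3 pderiv_mult pderiv_add pderiv_diff algebra_simps)

lemma poly_wronskian'': "poly (pderiv (pderiv (wronskian f))) t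
    = det3 (cv 0 t) (cv 2 t) (cv 3 t) + det3 (cv 0 t) (cv 1 t) (cv 4 t)"
  by (simp add: wronskian_def det3_def cv_nth numeral_3_eq_3 numeral_2_eq_2 numeral_eq_Suc
      pderiv_mult pderiv_add pderiv_diff algebra_simps)

text \<open>The orders at infinity are the defects of the degrees, so the given components in
  reverse order are already suitable coordinates.\<close>

lemma ramification_infinity:
  assumes "v \<noteq> 0" "v $ 2 = 0"
  shows "ramification_sequence \<phi> v 1 2"
proof -
  define M :: "complex ^ 3 ^ 3" where "M = vector [axis 3 1, axis 2 1, axis 1 1]"
  have v1: "v $ 1 \<noteq> 0" using assms by (auto simp: vec_eq_iff forall_2)
  have "det M \<noteq> 0" by (simp add: M_def det_rows_eq_det3 det3_def axis_def)
  moreover have "lin_comb (axis i 1) \<phi> = homog d (f $ i)" for i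
  proof -
    have "(\<Sum>j\<in>UNIV. smult (axis i 1 $ j) (f $ j)) = (\<Sum>j\<in>UNIV. if j = i then f $ i else 0)"
      by (intro sum.cong) (auto simp: axis_def)
    thus ?thesis by (simp add: lin_comb_curve_of)
  qed
  moreover have "vanishes_to_order (homog d (f $ 3)) v 0" "vanishes_to_order (homog d (f $ 2)) v 1"
    "vanishes_to_order (homog d (f $ 1)) v 2"
    using degree_f d3 by (auto intro!: vanishes_to_order_homog_infinity f_nz assms(2) v1)
  ultimately show ?thesis
    unfolding ramification_sequence_def invertible_det_nz
    by (intro conjI exI[of _ M]) (auto simp: M_def)
qed

text \<open>The new coordinates are dual to the three independent derivative vectors: each of the
  three derivatives is nonzero in exactly one component. The dependences assumed for the orders in
  between make all lower derivatives vanish.\<close>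

lemma ramification_affine:
  assumes "v $ 2 \<noteq> 0" "t = v $ 1 / v $ 2" "0 < \<alpha>" "\<alpha> < \<beta>" "det3 (cv 0 t) (cv \<alpha> t) (cv \<beta> t) \<noteq> 0"
    and \<alpha>: "\<And>k. k < \<alpha> \<Longrightarrow> \<exists>a. cv k t = a *s cv 0 t"
    and \<beta>: "\<And>k. k < \<beta> \<Longrightarrow> \<exists>a b. cv k t = a *s cv 0 t + b *s cv \<alpha> t"
  shows "ramification_sequence \<phi> v \<alpha> \<beta>"
proof -
  define B :: "complex ^ 3 ^ 3" where "B = transpose (vector [cv 0 t, cv \<alpha> t, cv \<beta> t])"
  have "det B \<noteq> 0" using assms(5) by (simp add: B_def det_transpose det_rows_eq_det3)
  then obtain M where M: "M ** B = mat 1" "B ** M = mat 1"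
    by (metis invertible_det_nz invertible_def)
  define g where "g i = (\<Sum>j\<in>UNIV. smult (M $ i $ j) (f $ j))" for i
  have pg: "poly ((pderiv ^^ k) (g i)) t = (\<Sum>j\<in>UNIV. M $ i $ j * cv k t $ j)" for k i
    by (simp add: g_def higher_pderiv_sum higher_pderiv_smult poly_sum cv_nth)
  have MB: "(\<Sum>j\<in>UNIV. M $ i $ j * B $ j $ l) = (if i = l then 1 else 0)" for i l
    using arg_cong[OF M(1), of "\<lambda>X. X $ i $ l"] by (simp add: matrix_matrix_mult_def mat_def)
  have e: "poly ((pderiv ^^ 0) (g i)) t = (if i = 1 then 1 else 0)"
    "poly ((pderiv ^^ \<alpha>) (g i)) t = (if i = 2 then 1 else 0)"
    "poly ((pderiv ^^ \<beta>) (g i)) t = (if i = 3 then 1 else 0)" for i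
    using MB[of i 1] MB[of i 2] MB[of i 3] unfolding pg
    by (simp_all add: B_def transpose_def)
  have lin: "poly ((pderiv ^^ k) (g i)) t = a * poly ((pderiv ^^ 0) (g i)) t + b * poly ((pderiv ^^ \<alpha>) (g i)) t"
    if "cv k t = a *s cv 0 t + b *s cv \<alpha> t" for k a b i
    unfolding pg that by (simp add: sum_3 algebra_simps)
  have low: "poly ((pderiv ^^ k) (g i)) t = 0" if i: "i \<noteq> 1" and k: "k < \<alpha>" for k i
  proof -
    obtain a where "cv k t = a *s cv 0 t + 0 *s cv \<alpha> t" using \<alpha>[OF k] by auto
    from lin[OF this, of i] show ?thesis using i e(1)[of i] by simp
  qed
  have mid: "poly ((pderiv ^^ k) (g i)) t = 0" if i: "i \<noteq> 1" "i \<noteq> 2" and k: "k < \<beta>" for k i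
  proof -
    obtain a b where "cv k t = a *s cv 0 t + b *s cv \<alpha> t" using \<beta>[OF k] by auto
    from lin[OF this, of i] show ?thesis using i e(1,2)[of i] by simp
  qed
  have ord: "order t (g 1) = 0" "order t (g 2) = \<alpha>" "order t (g 3) = \<beta>"
    using e low mid by (auto intro!: order_eqI_pderiv)
  have nz: "g i \<noteq> 0" for i
    using e[of i] exhaust_3[of i] by auto
  have deg: "degree (g i) \<le> d" for i
    unfolding g_def by (intro degree_sum_le) (simp_all add: degree_f_le)
  have "invertible M" using M by (auto simp: invertible_def)
  moreover have "lin_comb (M $ i) \<phi> = homog d (g i)" for i
    by (simp add: lin_comb_curve_of g_def)
  ultimately show ?thesis
    unfolding ramification_sequence_def using assms(1-4) ord
    by (intro conjI exI[of _ M]) (auto simp: vanishes_to_order_homog_affine[OF nz deg])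
qed

text \<open>Independence follows from the three different degrees. A common divisor divides the
  first form, which is a constant times \<open>Y\<close> twice and the linear forms of
  \<open>A\<close>; these primes are excluded by the third and the second form respectively.\<close>

lemma rational_plane_curve: "rational_plane_curve d \<phi>"
proof -
  have indep: "a = 0" if "lin_comb a \<phi> = 0" for a
  proof -
    have "homog d (\<Sum>i\<in>UNIV. smult (a $ i) (f $ i)) = 0"
      using that by (simp add: lin_comb_curve_of)
    hence "dehom (homog d (\<Sum>i\<in>UNIV. smult (a $ i) (f $ i))) = dehom (homog d 0)" by simp
    moreover have "degree (\<Sum>i\<in>UNIV. smult (a $ i) (f $ i)) \<le> d"
      by (intro degree_sum_le) (simp_all add: degree_f_le)
    ultimately have s: "smult (a $ 1) (f $ 1) + smult (a $ 2) (f $ 2) + smult (a $ 3) (f $ 3) = 0"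
      by (simp add: dehom_homog sum_3 del: homog_0)
    have lc: "coeff (f $ 1) (d - 2) \<noteq> 0" "coeff (f $ 2) (d - 1) \<noteq> 0" "coeff (f $ 3) d \<noteq> 0"
      using degree_f f_nonzero by (metis leading_coeff_0_iff)+
    have z: "coeff (f $ 1) (d - 1) = 0" "coeff (f $ 1) d = 0" "coeff (f $ 2) d = 0"
      using degree_f d3 by (auto intro!: coeff_eq_0)
    have a3: "a $ 3 = 0" using arg_cong[OF s, of "\<lambda>p. coeff p d"] lc z by simp
    have a2: "a $ 2 = 0" using arg_cong[OF s, of "\<lambda>p. coeff p (d - 1)"] lc z a3 by simp
    have a1: "a $ 1 = 0" using arg_cong[OF s, of "\<lambda>p. coeff p (d - 2)"] lc z a2 a3 by simp
    show "a = 0" using a1 a2 a3 by (simp add: vec_eq_iff forall_3)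
  qed
  have "is_unit h" if h: "\<And>i. h dvd \<phi> $ i" for h
  proof -
    define Y :: bipoly where "Y = [:[:0, 1:]:]"
    define l where "l a = homog 1 [:- a, 1:]" for a
    have homog_dvd: "h dvd homog d (f $ i)" for i using h[of i] by (simp add: curve_of_def)
    have l: "l a = [:- [:0, a:], 1:]" for a
      by (intro poly_eqI) (auto simp: l_def coeff_coeff_homog coeff_pCons split: nat.splits)
    have l_dvd: "l a dvd g \<longleftrightarrow> poly g [:0, a:] = 0" for a g
      by (simp add: l poly_eq_0_iff_dvd)
    have l_prime: "prime_elem (l a)" for a
    proof -
      have "\<not> l a dvd 1" by (simp add: l_dvd)
      moreover have "l a \<noteq> 0" by (simp add: l)
      ultimately show ?thesis by (auto simp: prime_elem_def l_dvd)
    qed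
    \<comment> \<open>Like the linear forms above, \<open>Y\<close> generates the kernel of a
      substitution with values in a domain, here Y = 0, and is therefore prime.\<close>
    have Y_dvd: "Y dvd g \<longleftrightarrow> map_poly (\<lambda>c. poly c 0) g = 0" for g
      by (auto simp: Y_def const_poly_dvd_iff poly_eq_0_iff_dvd[of _ 0, simplified, symmetric]
        poly_eq_iff coeff_map_poly)
    have map_mult: "map_poly (\<lambda>c. poly c (0::complex)) (g * k)
        = map_poly (\<lambda>c. poly c 0) g * map_poly (\<lambda>c. poly c 0) k" for g k
      by (intro poly_eqI) (simp add: coeff_map_poly coeff_mult poly_sum)
    have Y_prime: "prime_elem Y"
    proof -
      have "\<not> Y dvd 1" by (simp add: Y_dvd)
      moreover have "Y \<noteq> 0" by (simp add: Y_def)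
      ultimately show ?thesis by (auto simp: prime_elem_def Y_dvd map_mult)
    qed
    have f1: "f $ 1 = smult (lead_coeff (f $ 1)) (\<Prod>a\<in>A. [:- a, 1:])"
    proof -
      obtain q where q: "f $ 1 = (\<Prod>a\<in>A. [:- a, 1:]) * q"
        using prod_linear_dvd[OF A(1,3)] by (auto elim: dvdE)
      have "degree (\<Prod>a\<in>A. [:- a, 1:]) = d - 2"
        by (subst degree_prod_sum_eq) (auto simp: A(2))
      moreover have "q \<noteq> 0" "(\<Prod>a\<in>A. [:- a, 1:]) \<noteq> 0" using q f_nonzero(1) by auto
      ultimately have "degree q = 0" using degree_f(1) q by (metis degree_mult_eq add_cancel_right_right)
      then obtain c where c: "q = [:c:]" by (metis degree_eq_zeroE)
      have "lead_coeff (\<Prod>a\<in>A. [:- a, 1:]) = 1" by (simp add: lead_coeff_prod)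
      thus ?thesis unfolding q c by (simp add: lead_coeff_mult)
    qed
    have homog_prod: "homog (card S) (\<Prod>a\<in>S. [:- a, 1:]) = (\<Prod>a\<in>S. l a)" if "finite S" for S
      using that
    proof (induction S rule: finite_induct)
      case empty
      show ?case by (intro poly_eqI) (auto simp: coeff_homog one_pCons coeff_pCons split: nat.splits)
    next
      case (insert x S)
      have "degree (\<Prod>a\<in>S. [:- a, 1 :: complex:]) \<le> card S" by (subst degree_prod_sum_eq) auto
      hence "homog (1 + card S) ([:- x, 1:] * (\<Prod>a\<in>S. [:- a, 1:]))
        = homog 1 [:- x, 1:] * homog (card S) (\<Prod>a\<in>S. [:- a, 1:])"
        by (intro homog_mult) auto
      thus ?case using insert by (simp add: l_def del: mult_pCons_left)
    qed
    have d2: "2 + (d - 2) = d" using d3 by simp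
    have "homog d (f $ 1) = homog (2 + (d - 2)) ([:lead_coeff (f $ 1):] * (\<Prod>a\<in>A. [:- a, 1:]))"
      unfolding d2 by (subst f1) simp
    also have "\<dots> = homog 2 [:lead_coeff (f $ 1):] * (\<Prod>a\<in>A. l a)"
      using homog_prod[OF A(1)] A(2) by (subst homog_mult) (auto simp: degree_prod_sum_eq)
    \<comment> \<open>The degree of \<open>f $ 1\<close> is 2 below \<open>d\<close>; the index set
      \<open>{1, 2}\<close> only serves to write the resulting square of \<open>Y\<close> as a
      product.\<close>
    also have "homog 2 [:lead_coeff (f $ 1):] = [:[:lead_coeff (f $ 1):]:] * (\<Prod>_\<in>{1, 2 :: nat}. Y)"
    proof -
      have "homog 2 [:c:] = [:[:0, 0, c:]:]" for c
        by (intro poly_eqI) (auto simp: coeff_coeff_homog coeff_pCons split: nat.splits)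
      thus ?thesis by (simp add: Y_def)
    qed
    finally have eq: "homog d (f $ 1) = [:[:lead_coeff (f $ 1):]:] * (\<Prod>_\<in>{1, 2 :: nat}. Y) * (\<Prod>a\<in>A. l a)" .
    have "\<not> l a dvd h" if "a \<in> A" for a
    proof
      assume "l a dvd h"
      hence "dehom (l a) dvd dehom (homog d (f $ 2))"
        using homog_dvd dvd_trans dehom_dvd by blast
      hence "[:- a, 1:] dvd f $ 2" by (simp add: l_def dehom_homog degree_f_le)
      thus False using A(4)[OF that] by (simp add: poly_eq_0_iff_dvd)
    qed
    moreover have "h dvd [:[:lead_coeff (f $ 1):]:] * (\<Prod>_\<in>{1, 2 :: nat}. Y) * (\<Prod>a\<in>A. l a)"
      using homog_dvd[of 1] unfolding eq .
    ultimately have "h dvd [:[:lead_coeff (f $ 1):]:] * (\<Prod>_\<in>{1, 2 :: nat}. Y)"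
      using dvd_prod_prime_elems[OF A(1), of l h] l_prime by blast
    moreover have "\<not> Y dvd h"
    proof
      assume "Y dvd h"
      hence "Y dvd homog d (f $ 3)" using homog_dvd dvd_trans by blast
      hence "[:0, 1:] dvd coeff (homog d (f $ 3)) d" by (simp add: Y_def const_poly_dvd_iff)
      hence "lead_coeff (f $ 3) = 0" using degree_f(3) by (simp add: coeff_homog monom_0 poly_eq_0_iff_dvd[of _ 0, simplified, symmetric])
      thus False using f_nonzero by simp
    qed
    ultimately have "h dvd [:[:lead_coeff (f $ 1):]:]"
      using dvd_prod_prime_elems[of "{1, 2 :: nat}" "\<lambda>_. Y" h] Y_prime by blast
    moreover have "[:[:lead_coeff (f $ 1):]:] dvd 1"
      using f_nonzero by (simp add: is_unit_const_poly_iff dvd_field_iff)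
    ultimately show "is_unit h" by (rule dvd_trans)
  qed
  thus ?thesis
    using d3 indep by (auto simp: rational_plane_curve_def curve_of_def binary_form_homog)
qed

end

section \<open>Linear algebra in three-space, conjugation and real subspaces\<close>

text \<open>Cramer's rule, in the form of the linear relation between four vectors.\<close>

lemma det3_combination:
  "det3 u v x *s w = det3 w v x *s u + det3 u w x *s v + det3 u v w *s x"
  by (simp add: vec_eq_iff forall_3 det3_def algebra_simps)

lemma det3_indep:
  fixes u v w :: "'a :: idom ^ 3"
  assumes "det3 u v w \<noteq> 0" "a *s u + b *s v = 0"
  shows "a = 0" "b = 0"
proof -
  have "det3 (a *s u + b *s v) v w = a * det3 u v w" "det3 u (a *s u + b *s v) w = b * det3 u v w"
    by (simp_all add: det3_def algebra_simps)
  thus "a = 0" "b = 0" using assms by (simp_all add: det3_def)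
qed

lemma det3_span:
  fixes u v w x :: "'a :: field ^ 3"
  assumes "det3 u v w = 0" "det3 u v x \<noteq> 0"
  shows "\<exists>a b. w = a *s u + b *s v"
proof -
  let ?D = "det3 u v x"
  have "?D *s w = det3 w v x *s u + det3 u w x *s v"
    using det3_combination[of u v x w] assms(1) by simp
  hence "inverse ?D *s (?D *s w) = inverse ?D *s (det3 w v x *s u + det3 u w x *s v)" by simp
  hence "w = (inverse ?D * det3 w v x) *s u + (inverse ?D * det3 u w x) *s v"
    using assms(2) by (simp add: vector_smult_assoc vector_add_ldistrib)
  thus ?thesis by blast
qed

lemma vec_span_pair: "x \<in> vec.span {u, v} \<longleftrightarrow> (\<exists>a b. x = a *s u + b *s (v :: 'a :: field ^ 'n))"
proof -
  have "x \<in> vec.span {u, v} \<longleftrightarrow> (\<exists>a b. x - a *s u = b *s v)"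
    by (auto simp: vec.span_breakdown_eq[of _ u] vec.span_singleton)
  thus ?thesis by (simp add: algebra_simps)
qed

definition cnj_vec :: "complex ^ 'n \<Rightarrow> complex ^ 'n" where
  "cnj_vec v = (\<chi> i. cnj (v $ i))"

lemma cnj_vec_cnj_vec [simp]: "cnj_vec (cnj_vec v) = v"
  by (simp add: cnj_vec_def vec_eq_iff)

lemma conj_subspace_span:
  fixes B :: "(complex ^ 'n) set"
  shows "conj_subspace (vec.span B) = vec.span (cnj_vec ` B)"
proof -
  have sub: "cnj_vec ` vec.span B \<subseteq> vec.span (cnj_vec ` B)" for B :: "(complex ^ 'n) set"
  proof
    fix x assume "x \<in> cnj_vec ` vec.span B"
    then obtain y where y: "y \<in> vec.span B" "x = cnj_vec y" by blast
    from y(1) have "cnj_vec y \<in> vec.span (cnj_vec ` B)"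
    proof (induction rule: vec.span_induct_alt)
      case base
      have "cnj_vec 0 = (0 :: complex ^ 'n)" by (simp add: cnj_vec_def vec_eq_iff)
      thus ?case by (simp add: vec.span_zero)
    next
      case (step c x y)
      have "cnj_vec (c *s x + y) = cnj c *s cnj_vec x + cnj_vec y"
        by (simp add: cnj_vec_def vec_eq_iff)
      thus ?case using step by (auto intro: vec.span_add vec.span_scale vec.span_base)
    qed
    thus "x \<in> vec.span (cnj_vec ` B)" using y by simp
  qed
  have "vec.span (cnj_vec ` B) \<subseteq> cnj_vec ` vec.span B"
  proof
    fix x assume "x \<in> vec.span (cnj_vec ` B)"
    hence "cnj_vec x \<in> vec.span (cnj_vec ` cnj_vec ` B)" using sub by blast
    hence "cnj_vec x \<in> vec.span B" by (simp add: image_image)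
    thus "x \<in> cnj_vec ` vec.span B" by (metis cnj_vec_cnj_vec imageI)
  qed
  with sub have "cnj_vec ` vec.span B = vec.span (cnj_vec ` B)" by blast
  moreover have "conj_subspace (vec.span B) = cnj_vec ` vec.span B"
    unfolding conj_subspace_def by (intro image_cong) (simp_all add: cnj_vec_def)
  ultimately show ?thesis by simp
qed

lemma conj_subspace_real: "real_subspace L \<Longrightarrow> conj_subspace L = L"
proof -
  assume "real_subspace L"
  then obtain B where B: "\<forall>b\<in>B. \<forall>i. b $ i \<in> \<real>" "L = vec.span B" by (auto simp: real_subspace_def)
  have "cnj_vec ` B = (\<lambda>b. b) ` B"
    using B(1) by (intro image_cong) (auto simp: cnj_vec_def vec_eq_iff Reals_cnj_iff)
  thus ?thesis by (simp add: B(2) conj_subspace_span)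
qed

section \<open>Curves that attain both counting bounds\<close>

text \<open>\<open>Fl_K\<close> is the equality case of the degree of the Wronskian,
  \<open>P_card\<close> that of \<open>excess_bound\<close>. Exact types of ramification,
  completeness of \<open>P\<close> and distinctness of tangents are all drawn from these two
  equalities; \<open>P_type\<close> then makes every double point real.\<close>

locale counted_curve = plane_param +
  fixes Fl K :: "complex set" and P :: "(complex \<times> complex) set"
  assumes real_f: "coeff (f $ i) k \<in> \<real>"
    and Fl: "finite Fl" "Fl \<subseteq> \<real>" "\<And>a. a \<in> Fl \<Longrightarrow> poly (wronskian f) a = 0"
    and K: "finite K" "K \<subseteq> \<real>" "\<And>k. k \<in> K \<Longrightarrow> \<exists>l. \<forall>i. poly (pderiv (f $ i)) k = l * poly (f $ i) k"
    and Fl_K: "Fl \<inter> K = {}" "card Fl + 2 * card K = 3 * (d - 2)"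
    and P: "finite P" "\<And>s t. (s, t) \<in> P \<Longrightarrow> s \<noteq> t"
      "\<And>s t. (s, t) \<in> P \<Longrightarrow> \<exists>k. \<forall>i. poly (f $ i) t = k * poly (f $ i) s"
    and P_distinct: "inj_on fst P" "inj_on snd P" "fst ` P \<inter> snd ` P = {}" "(fst ` P \<union> snd ` P) \<inter> K = {}"
    and P_card: "card P + card K = (d - 1) choose 2"
    and P_type: "\<And>s t. (s, t) \<in> P \<Longrightarrow> s \<in> \<real> \<and> t \<in> \<real> \<or> t = cnj s"
begin

lemma cusp_cv: "k \<in> K \<Longrightarrow> \<exists>l. cv 1 k = l *s cv 0 k"
  using K(3) by (auto simp: vec_eq_iff cv_nth)

lemma P_par: "(s, t) \<in> P \<Longrightarrow> par s t"
  using P(3) by (auto simp: par_def vec_eq_iff cv_nth)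

lemma cv_dependent:
  assumes "k \<in> K"
  shows "det3 (cv 0 k) (cv 1 k) w = 0"
proof -
  obtain l where "cv 1 k = l *s cv 0 k" using cusp_cv[OF assms] by blast
  thus ?thesis by (simp add: det3_def algebra_simps)
qed

text \<open>The known roots, cusps counted twice, already exhaust the degree, so they form the full
  multiset of roots.\<close>

lemma wronskian_orders:
  "order t (wronskian f) = (if t \<in> Fl then 1 else if t \<in> K then 2 else 0)"
proof -
  let ?W = "wronskian f"
  define M where "M = mset_set Fl + (mset_set K + mset_set K)"
  have pd: "pderiv ?W \<noteq> 0" using wronskian_f d3 by (simp add: pderiv_eq_0_iff)
  have "M \<subseteq># proots ?W"
  proof (rule mset_subset_eqI)
    fix x
    have "x \<in> Fl \<Longrightarrow> 1 \<le> order x ?W"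
      using Fl(3) wronskian_f by (simp add: Suc_le_eq order_gt_0_iff)
    moreover have "2 \<le> order x ?W" if "x \<in> K"
    proof -
      have "poly ?W x = 0" "poly (pderiv ?W) x = 0"
        using that by (simp_all add: poly_wronskian poly_wronskian' cv_dependent del: One_nat_def)
      thus ?thesis using wronskian_f pd order_pderiv[of ?W x] order_root[of "pderiv ?W" x] by simp
    qed
    ultimately show "count M x \<le> count (proots ?W) x"
      using Fl(1) K(1) Fl_K(1) wronskian_f by (auto simp: M_def count_mset_set' split: if_splits)
  qed
  moreover have "size (proots ?W) \<le> size M"
    using size_proots_le[of ?W] wronskian_f Fl_K(2) by (simp add: M_def)
  ultimately have "M = proots ?W"
    using mset_subset_size[of M "proots ?W"] by (auto simp: subset_mset.less_le)
  hence "order t ?W = count M t" using wronskian_f by simp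
  thus ?thesis using Fl(1) K(1) Fl_K(1) by (auto simp: M_def count_mset_set')
qed

lemma det_generic: "t \<notin> Fl \<Longrightarrow> t \<notin> K \<Longrightarrow> det3 (cv 0 t) (cv 1 t) (cv 2 t) \<noteq> 0"
  using wronskian_orders[of t] wronskian_f by (auto simp: poly_wronskian[symmetric] order_eq_0_iff simp del: One_nat_def)

lemma pderiv_wronskian_nonzero: "pderiv (wronskian f) \<noteq> 0"
  using wronskian_f d3 by (simp add: pderiv_eq_0_iff)

lemma det_flex: "t \<in> Fl \<Longrightarrow> det3 (cv 0 t) (cv 1 t) (cv 3 t) \<noteq> 0"
  using wronskian_orders[of t] wronskian_f pderiv_wronskian_nonzero order_pderiv[of "wronskian f" t] Fl(3)[of t]
  by (auto simp: poly_wronskian'[symmetric] order_eq_0_iff simp del: One_nat_def)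

text \<open>Since \<open>cv 0\<close> and \<open>cv 1\<close> are dependent at a cusp, only this
  determinant survives in the second derivative of the Wronskian, which is nonzero because the root
  is exactly double.\<close>

lemma det_cusp: "t \<in> K \<Longrightarrow> det3 (cv 0 t) (cv 2 t) (cv 3 t) \<noteq> 0"
proof -
  let ?W = "wronskian f"
  assume t: "t \<in> K"
  have r: "poly ?W t = 0" "poly (pderiv ?W) t = 0"
    using t by (simp_all add: poly_wronskian poly_wronskian' cv_dependent del: One_nat_def)
  have "order t ?W = 2" using wronskian_orders[of t] t Fl_K(1) by auto
  hence "order t (pderiv (pderiv ?W)) = 0"
    using r order_pderiv[of ?W t] order_pderiv[of "pderiv ?W" t] wronskian_f pderiv_wronskian_nonzero by simp
  moreover have "pderiv (pderiv ?W) \<noteq> 0"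
  proof
    assume "pderiv (pderiv ?W) = 0"
    then obtain c where "pderiv ?W = [:c:]" by (metis pderiv_eq_0_iff degree_eq_zeroE)
    thus False using r(2) pderiv_wronskian_nonzero by simp
  qed
  ultimately have "poly (pderiv (pderiv ?W)) t \<noteq> 0" by (simp add: order_eq_0_iff)
  thus ?thesis using t by (simp add: poly_wronskian'' cv_dependent del: One_nat_def)
qed

lemma cv_low: "\<exists>a. cv 0 t = a *s cv 0 t" "\<exists>a b. cv 0 t = a *s cv 0 t + b *s w"
    "\<exists>a b. w = a *s cv 0 t + b *s w"
proof -
  have "cv 0 t = 1 *s cv 0 t" "cv 0 t = 1 *s cv 0 t + 0 *s w" "w = 0 *s cv 0 t + 1 *s w" by simp_all
  thus "\<exists>a. cv 0 t = a *s cv 0 t" "\<exists>a b. cv 0 t = a *s cv 0 t + b *s w"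
    "\<exists>a b. w = a *s cv 0 t + b *s w" by blast+
qed

lemma ramification_generic:
  assumes "v $ 2 \<noteq> 0" "v $ 1 / v $ 2 \<notin> Fl \<union> K"
  shows "ramification_sequence \<phi> v 1 2"
proof (rule ramification_affine[OF assms(1) refl])
  let ?t = "v $ 1 / v $ 2"
  show "det3 (cv 0 ?t) (cv 1 ?t) (cv 2 ?t) \<noteq> 0" using assms(2) by (intro det_generic) auto
  show "\<exists>a. cv k ?t = a *s cv 0 ?t" if "k < 1" for k using that cv_low(1) by simp
  show "\<exists>a b. cv k ?t = a *s cv 0 ?t + b *s cv 1 ?t" if "k < 2" for k
  proof -
    from that have "k = 0 \<or> k = 1" by linarith
    thus ?thesis using cv_low(2,3) by blast
  qed
qed simp_all

lemma ramification_flex: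
  assumes "v $ 2 \<noteq> 0" "v $ 1 / v $ 2 \<in> Fl"
  shows "ramification_sequence \<phi> v 1 3"
proof (rule ramification_affine[OF assms(1) refl])
  let ?t = "v $ 1 / v $ 2"
  show "det3 (cv 0 ?t) (cv 1 ?t) (cv 3 ?t) \<noteq> 0" using assms(2) by (rule det_flex)
  show "\<exists>a. cv k ?t = a *s cv 0 ?t" if "k < 1" for k using that cv_low(1) by simp
  show "\<exists>a b. cv k ?t = a *s cv 0 ?t + b *s cv 1 ?t" if "k < 3" for k
  proof -
    have "\<exists>a b. cv 2 ?t = a *s cv 0 ?t + b *s cv 1 ?t"
      using Fl(3)[OF assms(2)] det_flex[OF assms(2)] by (intro det3_span) (simp_all only: poly_wronskian)
    moreover from that have "k = 0 \<or> k = 1 \<or> k = 2" by linarith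
    ultimately show ?thesis using cv_low(2,3) by blast
  qed
qed simp_all

lemma ramification_cusp:
  assumes "v $ 2 \<noteq> 0" "v $ 1 / v $ 2 \<in> K"
  shows "ramification_sequence \<phi> v 2 3"
proof (rule ramification_affine[OF assms(1) refl])
  let ?t = "v $ 1 / v $ 2"
  show "det3 (cv 0 ?t) (cv 2 ?t) (cv 3 ?t) \<noteq> 0" using assms(2) by (rule det_cusp)
  show low: "\<exists>a. cv k ?t = a *s cv 0 ?t" if "k < 2" for k
  proof -
    from that have "k = 0 \<or> k = 1" by linarith
    thus ?thesis using cusp_cv[OF assms(2)] cv_low(1) by blast
  qed
  show "\<exists>a b. cv k ?t = a *s cv 0 ?t + b *s cv 2 ?t" if "k < 3" for k
  proof (cases "k = 2")
    case True
    thus ?thesis using cv_low(3) by blast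
  next
    case False
    hence "k < 2" using that by simp
    then obtain a where "cv k ?t = a *s cv 0 ?t" using low by blast
    hence "cv k ?t = a *s cv 0 ?t + 0 *s cv 2 ?t" by simp
    thus ?thesis by blast
  qed
qed simp_all

lemma ramification_cases:
  assumes "v \<noteq> 0"
  obtains "ramification_sequence \<phi> v 1 2" | "v $ 2 \<noteq> 0" "v $ 1 / v $ 2 \<in> Fl"
    | "v $ 2 \<noteq> 0" "v $ 1 / v $ 2 \<in> K"
  using assms ramification_infinity[of v] ramification_generic[of v] by blast

lemma flexes_eq: "flexes \<phi> = (\<lambda>t. vec.span {pt t}) ` Fl"
proof
  show "flexes \<phi> \<subseteq> (\<lambda>t. vec.span {pt t}) ` Fl"
  proof
    fix p assume "p \<in> flexes \<phi>"
    then obtain v where v: "v \<noteq> 0" "p = vec.span {v}" and ram: "ramification_sequence \<phi> v 1 3"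
      unfolding flexes_def by blast
    from v(1) show "p \<in> (\<lambda>t. vec.span {pt t}) ` Fl"
    proof (cases rule: ramification_cases)
      case 1
      from ramification_sequence_unique[OF this ram] show ?thesis by simp
    next
      case 2
      thus ?thesis using span_pt[of v] v(2) by blast
    next
      case 3
      from ramification_sequence_unique[OF ramification_cusp[OF this] ram] show ?thesis by simp
    qed
  qed
  show "(\<lambda>t. vec.span {pt t}) ` Fl \<subseteq> flexes \<phi>"
  proof
    fix p assume "p \<in> (\<lambda>t. vec.span {pt t}) ` Fl"
    then obtain t where "t \<in> Fl" "p = vec.span {pt t}" by blast
    moreover from this have "ramification_sequence \<phi> (pt t) 1 3" by (intro ramification_flex) simp_all
    ultimately show "p \<in> flexes \<phi>" unfolding flexes_def using pt_nonzero by blast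
  qed
qed

lemma cusps_eq: "cusps \<phi> = (\<lambda>t. vec.span {pt t}) ` K"
proof
  show "cusps \<phi> \<subseteq> (\<lambda>t. vec.span {pt t}) ` K"
  proof
    fix p assume "p \<in> cusps \<phi>"
    then obtain v where v: "v \<noteq> 0" "p = vec.span {v}" and ram: "ramification_sequence \<phi> v 2 3"
      unfolding cusps_def by blast
    from v(1) show "p \<in> (\<lambda>t. vec.span {pt t}) ` K"
    proof (cases rule: ramification_cases)
      case 1
      from ramification_sequence_unique[OF this ram] show ?thesis by simp
    next
      case 3
      thus ?thesis using span_pt[of v] v(2) by blast
    next
      case 2
      from ramification_sequence_unique[OF ramification_flex[OF this] ram] show ?thesis by simp
    qed
  qed
  show "(\<lambda>t. vec.span {pt t}) ` K \<subseteq> cusps \<phi>"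
  proof
    fix p assume "p \<in> (\<lambda>t. vec.span {pt t}) ` K"
    then obtain t where "t \<in> K" "p = vec.span {pt t}" by blast
    moreover from this have "ramification_sequence \<phi> (pt t) 2 3" by (intro ramification_cusp) simp_all
    ultimately show "p \<in> cusps \<phi>" unfolding cusps_def using pt_nonzero by blast
  qed
qed

lemma has_exactly_flexes: "has_exactly (flexes \<phi>) (card Fl)"
proof -
  have "inj_on (\<lambda>t. vec.span {pt t}) Fl" by (rule inj_onI) (simp only: span_pt_inject)
  thus ?thesis using Fl(1) by (simp add: has_exactly_def flexes_eq card_image)
qed

lemma has_exactly_cusps: "has_exactly (cusps \<phi>) (card K)"
proof -
  have "inj_on (\<lambda>t. vec.span {pt t}) K" by (rule inj_onI) (simp only: span_pt_inject)
  thus ?thesis using K(1) by (simp add: has_exactly_def cusps_eq card_image)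
qed

lemma maximally_inflected: "maximally_inflected d \<phi>"
proof -
  have "real_subspace p" if "p \<in> ramification_points \<phi>" for p
  proof -
    obtain v where v: "v \<noteq> 0" "p = vec.span {v}" "\<not> ramification_sequence \<phi> v 1 2"
      using \<open>p \<in> ramification_points \<phi>\<close> by (auto simp: ramification_points_def)
    from v(1) have "v $ 2 \<noteq> 0 \<and> v $ 1 / v $ 2 \<in> \<real>"
      by (cases rule: ramification_cases) (use v(3) Fl(2) K(2) in auto)
    hence v2: "v $ 2 \<noteq> 0" and t: "v $ 1 / v $ 2 \<in> \<real>" by auto
    have "p = vec.span {pt (v $ 1 / v $ 2)}" using v(2) span_pt[OF v2] by simp
    moreover have "\<forall>i. pt (v $ 1 / v $ 2) $ i \<in> \<real>" using t by (simp add: forall_2)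
    ultimately show ?thesis unfolding real_subspace_def by blast
  qed
  moreover have "coeff (coeff (\<phi> $ i) j) k \<in> \<real>" for i j k
    using real_f by (simp add: curve_of_def coeff_coeff_homog)
  ultimately show ?thesis using rational_plane_curve unfolding maximally_inflected_def by blast
qed

end

section \<open>Image points and tangent lines in the affine parameter\<close>

lemma pderiv_homog:
  assumes "0 < d"
  shows "pderiv (homog d p) = homog (d - 1) (pderiv p)"
proof (intro poly_eqI)
  fix i j
  show "coeff (coeff (pderiv (homog d p)) i) j = coeff (coeff (homog (d - 1) (pderiv p)) i) j"
    using assms by (auto simp: coeff_pderiv coeff_coeff_homog of_nat_poly
      simp del: of_nat_Suc)
qed

text \<open>By Euler's relation the derivative in Y becomes d p - t p' at Y = 1.\<close>

lemma map_pderiv_homog: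
  assumes "0 < d"
  shows "map_poly pderiv (homog d p) = homog (d - 1) (smult (of_nat d) p - pCons 0 (pderiv p))"
proof (intro poly_eqI)
  fix i j
  have "coeff (pCons 0 (pderiv p)) i = of_nat i * coeff p i"
    by (cases i) (simp_all add: coeff_pderiv)
  moreover have "of_nat (Suc j) * coeff p i = (of_nat (i + Suc j) - of_nat i) * coeff p i"
    by simp
  ultimately show "coeff (coeff (map_poly pderiv (homog d p)) i) j
      = coeff (coeff (homog (d - 1) (smult (of_nat d) p - pCons 0 (pderiv p))) i) j"
    using assms by (auto simp: coeff_map_poly coeff_pderiv coeff_coeff_homog algebra_simps)
qed

lemma vec_span_pair_change:
  fixes x y :: "'a :: field ^ 'n"
  assumes "c \<noteq> 0" "a \<noteq> 0"
  shows "vec.span {c *s y, c *s (a *s x - b *s y)} = vec.span {x, y}"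
proof -
  have "{c *s y, c *s (a *s x - b *s y)} \<subseteq> vec.span {x, y}"
    by (auto intro!: vec.span_scale vec.span_diff intro: vec.span_base)
  moreover have "y = inverse c *s (c *s y) + 0 *s (c *s (a *s x - b *s y))"
    "x = (inverse c * b / a) *s (c *s y) + (inverse c / a) *s (c *s (a *s x - b *s y))"
    using assms by (simp_all add: vec_eq_iff field_simps)
  hence "{x, y} \<subseteq> vec.span {c *s y, c *s (a *s x - b *s y)}"
    unfolding insert_subset vec_span_pair by blast
  ultimately show ?thesis by (simp only: vec.span_eq)
qed

context plane_param
begin

definition T :: "complex \<Rightarrow> (complex ^ 3) set" where
  "T t = vec.span {cv 0 t, cv 1 t}"

lemma image_affine:
  assumes "v $ 2 \<noteq> 0"
  shows "image_point \<phi> v = vec.span {cv 0 (v $ 1 / v $ 2)}"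
proof -
  have "(\<chi> i. eval2 (\<phi> $ i) v) = v $ 2 ^ d *s cv 0 (v $ 1 / v $ 2)"
    by (simp add: vec_eq_iff curve_of_def eval2_homog_affine[OF degree_f_le assms] cv_nth)
  thus ?thesis using assms by (simp add: image_point_def vec_span_singleton_scale)
qed

lemma par_iff_span: "par s t \<longleftrightarrow> vec.span {cv 0 s} = vec.span {cv 0 t}"
proof
  assume "par s t"
  then obtain k where k: "cv 0 t = k *s cv 0 s" by (auto simp: par_def)
  hence "k \<noteq> 0" using cv_nonzero[of t] by auto
  thus "vec.span {cv 0 s} = vec.span {cv 0 t}" using vec_span_singleton_scale[of k "cv 0 s"] k by simp
next
  assume "vec.span {cv 0 s} = vec.span {cv 0 t}"
  hence "cv 0 t \<in> vec.span {cv 0 s}" using vec.span_base[of "cv 0 t" "{cv 0 t}"] by simp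
  thus "par s t" by (auto simp: par_def vec.span_singleton)
qed

text \<open>The first two components vanish at infinity but never together at an affine parameter.
  So infinity takes no part in double points.\<close>

lemma image_infinity:
  assumes "v \<noteq> 0" "v $ 2 = 0"
  shows "image_point \<phi> v \<noteq> vec.span {cv 0 t}"
proof
  let ?w = "\<chi> i. eval2 (\<phi> $ i) v"
  assume "image_point \<phi> v = vec.span {cv 0 t}"
  hence "cv 0 t \<in> vec.span {?w}" using vec.span_base[of "cv 0 t" "{cv 0 t}"] by (simp add: image_point_def)
  then obtain k where k: "cv 0 t = k *s ?w" by (auto simp: vec.span_singleton)
  have "?w $ 1 = 0" "?w $ 2 = 0"
    using degree_f d3 assms(2) by (auto simp: curve_of_def eval2_homog_infinity intro!: coeff_eq_0)
  hence "cv 0 t $ 1 = 0" "cv 0 t $ 2 = 0" unfolding k by simp_all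
  hence "poly (f $ 1) t = 0" "poly (f $ 2) t = 0" by (simp_all add: cv_nth)
  thus False using roots_f1 A(4) by blast
qed

lemma tangent_affine:
  assumes "v $ 2 \<noteq> 0"
  shows "tangent_space \<phi> v = T (v $ 1 / v $ 2)"
proof -
  let ?t = "v $ 1 / v $ 2"
  have d0: "0 < d" using d3 by simp
  have deg1: "degree (pderiv (f $ i)) \<le> d - 1" for i
    using degree_f_le[of i] by (simp add: degree_pderiv)
  have deg2: "degree (smult (of_nat d) (f $ i) - pCons 0 (pderiv (f $ i))) \<le> d - 1" for i
  proof (rule degree_le, intro allI impI)
    fix k assume k: "k > d - 1"
    have "coeff (pCons 0 (pderiv (f $ i))) k = of_nat k * coeff (f $ i) k"
      by (cases k) (simp_all add: coeff_pderiv)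
    moreover have "k = d \<or> coeff (f $ i) k = 0"
      using k degree_f_le[of i] by (cases "k = d") (auto intro!: coeff_eq_0)
    ultimately show "coeff (smult (of_nat d) (f $ i) - pCons 0 (pderiv (f $ i))) k = 0" by auto
  qed
  have 1: "(\<chi> i. eval2 (pderiv (\<phi> $ i)) v) = v $ 2 ^ (d - 1) *s cv 1 ?t"
    by (simp add: vec_eq_iff curve_of_def pderiv_homog[OF d0]
      eval2_homog_affine[OF deg1 assms] cv_nth del: One_nat_def) simp
  have 2: "(\<chi> i. eval2 (map_poly pderiv (\<phi> $ i)) v) = v $ 2 ^ (d - 1) *s (of_nat d *s cv 0 ?t - ?t *s cv 1 ?t)"
    by (simp add: vec_eq_iff curve_of_def map_pderiv_homog[OF d0]
      eval2_homog_affine[OF deg2 assms] cv_nth del: One_nat_def) (simp add: algebra_simps)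
  show ?thesis
    unfolding tangent_space_def T_def 1 2 using assms d0 by (intro vec_span_pair_change) simp_all
qed

end

context counted_curve
begin

lemma cv_indep:
  assumes "t \<notin> K" "a *s cv 0 t + b *s cv 1 t = 0"
  shows "a = 0" "b = 0"
proof -
  have "\<exists>w. det3 (cv 0 t) (cv 1 t) w \<noteq> 0"
    using det_flex[of t] det_generic[of t] assms(1) by blast
  thus "a = 0" "b = 0" using det3_indep[OF _ assms(2)] by blast+
qed

lemma dim_T:
  assumes "t \<notin> K"
  shows "vec.dim (T t) = 2"
proof -
  have "cv 0 t \<notin> vec.span {cv 1 t}"
  proof
    assume "cv 0 t \<in> vec.span {cv 1 t}"
    then obtain k where "cv 0 t = k *s cv 1 t" by (auto simp: vec.span_singleton)
    hence "1 *s cv 0 t + (- k) *s cv 1 t = 0" by simp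
    from cv_indep(1)[OF assms this] show False by simp
  qed
  moreover have "cv 1 t \<noteq> 0"
  proof
    assume "cv 1 t = 0"
    hence "0 *s cv 0 t + 1 *s cv 1 t = 0" by simp
    from cv_indep(2)[OF assms this] show False by simp
  qed
  ultimately have "vec.independent {cv 0 t, cv 1 t}" "cv 0 t \<noteq> cv 1 t"
    by (auto simp: vec.independent_insert vec.span_base)
  thus ?thesis by (simp add: T_def vec.dim_span vec.dim_eq_card_independent)
qed

definition S where "S = fst ` P \<union> snd ` P"

text \<open>One parameter over each known singular point. Counting cusps twice,
  \<open>S \<union> K\<close> has twice as many elements as \<open>R\<close>, which is exactly what
  \<open>excess\<close> allows.\<close>

definition R where "R = fst ` P \<union> K"

lemma S_K: "finite (S \<union> K)" "card (S \<union> K) + card K = 2 * ((d - 1) choose 2)"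
proof -
  show "finite (S \<union> K)" using P(1) K(1) by (simp add: S_def)
  have "card (S \<union> K) = card P + card P + card K"
    using P(1) K(1) P_distinct unfolding S_def
    by (subst card_Un_disjoint, simp, simp, simp, subst card_Un_disjoint) (auto simp: card_image)
  thus "card (S \<union> K) + card K = 2 * ((d - 1) choose 2)" using P_card by simp
qed

lemma R_props: "finite R" "card R = (d - 1) choose 2" "R \<subseteq> S \<union> K"
proof -
  show "finite R" "R \<subseteq> S \<union> K" using P(1) K(1) by (auto simp: R_def S_def)
  have "card R = card P + card K"
    using P(1) K(1) P_distinct unfolding R_def
    by (subst card_Un_disjoint) (auto simp: card_image)
  thus "card R = (d - 1) choose 2" using P_card by simp
qed

text \<open>The difference is \<open>d - 1\<close>. It leaves room for one condition beyond those at
  \<open>R\<close>, as the bounds require fewer conditions than coefficients.\<close>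

lemma choose_gap: "((d - 1) choose 2) + 2 \<le> d choose 2"
proof -
  obtain n where "d = Suc (Suc (Suc n))" using d3 by (metis Suc_le_D numeral_3_eq_3 Suc_le_mono)
  thus ?thesis by (simp add: numeral_2_eq_2)
qed

lemma rep_exists:
  assumes "t \<in> S \<union> K"
  obtains r where "r \<in> R" "par r t" "r = t \<or> (r, t) \<in> P"
proof (cases "t \<in> snd ` P")
  case True
  then obtain r where r: "(r, t) \<in> P" by auto
  hence "r \<in> R" by (force simp: R_def)
  thus ?thesis using that[of r] P_par[OF r] r by blast
next
  case False
  hence "t \<in> R" using assms by (auto simp: R_def S_def)
  thus ?thesis using that par_refl by blast
qed

lemma rep_par: "t \<in> S \<union> K \<Longrightarrow> \<exists>r\<in>R. par r t"
  by (rule rep_exists) blast+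

lemma P_members:
  assumes "(s, t) \<in> P"
  shows "s \<in> fst ` P" "t \<in> snd ` P" "s \<notin> K" "t \<notin> K"
proof -
  show "s \<in> fst ` P" "t \<in> snd ` P" using assms by force+
  thus "s \<notin> K" "t \<notin> K" using P_distinct(4) by blast+
qed

lemma excess:
  assumes "finite T'" "K \<subseteq> T'" "finite R'" "card R' \<le> ((d - 1) choose 2) + 1" "\<And>t. t \<in> T' \<Longrightarrow> \<exists>r\<in>R'. par r t"
  shows "card T' + card K \<le> card R' + ((d - 1) choose 2)"
  using excess_points[OF assms(1,2) cusp_cv assms(3) _ assms(5)] assms(4) choose_gap by linarith

text \<open>The bound is already sharp. If \<open>s\<close> is known, \<open>t\<close> is one more
  zero for no condition; otherwise \<open>s\<close> and \<open>t\<close> are two more zeros for one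
  condition.\<close>

lemma pair_in_P_half:
  assumes "s \<noteq> t" "par s t" "t \<notin> S \<union> K"
  shows False
proof (cases "s \<in> S \<union> K")
  case True
  have "card (insert t (S \<union> K)) + card K \<le> card R + ((d - 1) choose 2)"
  proof (rule excess)
    fix u assume "u \<in> insert t (S \<union> K)"
    moreover have "\<exists>r\<in>R. par r t" using rep_par[OF True] assms(2) par_trans by blast
    ultimately show "\<exists>r\<in>R. par r u" using rep_par by blast
  qed (use S_K R_props in auto)
  thus False using S_K R_props assms(3) by simp
next
  case False
  have "card (insert s (insert t (S \<union> K))) + card K \<le> card (insert s R) + ((d - 1) choose 2)"
  proof (rule excess)
    fix u assume "u \<in> insert s (insert t (S \<union> K))"
    thus "\<exists>r\<in>insert s R. par r u" using assms(2) par_refl rep_par by blast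
  qed (use S_K R_props in \<open>auto simp: card_insert_if\<close>)
  moreover have "s \<notin> R" using False R_props by auto
  ultimately show False using S_K R_props assms False by simp
qed

text \<open>If two different representatives had the same image, the condition at one of them could
  be dropped without losing a zero, against the sharp bound. This rules out triple points and
  branches through cusps.\<close>

lemma pair_in_P:
  assumes "s \<noteq> t" "par s t"
  shows "(s, t) \<in> P \<or> (t, s) \<in> P"
proof -
  have "s \<in> S \<union> K" "t \<in> S \<union> K"
    using pair_in_P_half[OF assms] pair_in_P_half[of t s] assms par_sym by auto
  then obtain r r' where r: "r \<in> R" "par r s" "r = s \<or> (r, s) \<in> P"
    and r': "r' \<in> R" "par r' t" "r' = t \<or> (r', t) \<in> P"
    using rep_exists[of s] rep_exists[of t] by metis
  have "r = r'"
  proof (rule ccontr)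
    assume "r \<noteq> r'"
    have rr': "par r r'" using r r' assms(2) par_trans par_sym by blast
    have "card (S \<union> K) + card K \<le> card (R - {r'}) + ((d - 1) choose 2)"
    proof (rule excess)
      fix u assume "u \<in> S \<union> K"
      then obtain q where q: "q \<in> R" "par q u" using rep_par by blast
      show "\<exists>r\<in>R - {r'}. par r u"
      proof (cases "q = r'")
        case True
        thus ?thesis using q rr' r(1) \<open>r \<noteq> r'\<close> par_trans by blast
      qed (use q in blast)
    qed (use S_K R_props card_Diff1_le[of R r'] in auto)
    moreover have "Suc (card (R - {r'})) = card R" using R_props(1) r'(1) by (rule card_Suc_Diff1)
    ultimately show False using S_K(2) R_props(2) by linarith
  qed
  hence "r = s \<or> (r, s) \<in> P" "r = t \<or> (r, t) \<in> P" using r r' by auto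
  thus ?thesis using assms(1) inj_onD[OF P_distinct(1), of "(r, s)" "(r, t)"] by auto
qed

lemma T_distinct:
  assumes "(s, t) \<in> P"
  shows "T s \<noteq> T t"
proof
  assume "T s = T t"
  hence "cv 1 t \<in> vec.span {cv 0 s, cv 1 s}" using vec.span_base[of "cv 1 t" "{cv 0 t, cv 1 t}"] by (simp add: T_def)
  then obtain a b where ab: "cv 1 t = a *s cv 0 s + b *s cv 1 s" using vec_span_pair by blast
  have st: "s \<in> S \<union> K - K" "t \<in> S \<union> K - K"
    using P_members[OF assms] by (simp_all add: S_def)
  have "card (S \<union> K) + card K + 2 \<le> card R + 1 + ((d - 1) choose 2)"
  proof (rule excess_tacnode[OF _ _ cusp_cv _ _ _ st P(2)[OF assms] P_par[OF assms] ab])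
    show "card R + 1 < d choose 2" using R_props(2) choose_gap by linarith
    show "\<exists>r\<in>R. par r t" if "t \<in> S \<union> K" for t using that by (rule rep_par)
  qed (use S_K R_props in auto)
  thus False using S_K R_props by simp
qed

lemma P_fst_snd:
  assumes "(s, t) \<in> P"
  shows "(s, u) \<in> P \<Longrightarrow> u = t" "(u, s) \<notin> P"
proof -
  show "u = t" if "(s, u) \<in> P"
    using inj_onD[OF P_distinct(1), of "(s, u)" "(s, t)"] that assms by simp
  show "(u, s) \<notin> P" using P_distinct(3) P_members(1)[OF assms] P_members(2)[of u s] by blast
qed

lemma P_odp:
  assumes "(s, t) \<in> P"
  shows "ordinary_double_point \<phi> (vec.span {cv 0 s}) (T s) (T t)"
proof -
  note K = P_members(3,4)[OF assms]
  have u: "vec.span {u} = vec.span {pt s} \<or> vec.span {u} = vec.span {pt t}"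
    if u: "u \<noteq> 0" "image_point \<phi> u = vec.span {cv 0 s}" for u
  proof -
    have u2: "u $ 2 \<noteq> 0" using image_infinity[OF u(1)] u(2) by blast
    hence "par s (u $ 1 / u $ 2)" using u(2) image_affine[OF u2] by (simp add: par_iff_span)
    hence "u $ 1 / u $ 2 = s \<or> u $ 1 / u $ 2 = t"
      using pair_in_P[of s "u $ 1 / u $ 2"] P_fst_snd[OF assms] by auto
    thus ?thesis using span_pt[OF u2] by auto
  qed
  have "image_point \<phi> (pt s) = vec.span {cv 0 s}" "image_point \<phi> (pt t) = vec.span {cv 0 s}"
    "tangent_space \<phi> (pt s) = T s" "tangent_space \<phi> (pt t) = T t"
    using P_par[OF assms] by (simp_all add: image_affine tangent_affine par_iff_span)
  moreover have "vec.span {pt s} \<noteq> vec.span {pt t}" using P(2)[OF assms] by (simp only: span_pt_inject simp_thms)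
  ultimately show ?thesis
    unfolding ordinary_double_point_def using u dim_T[OF K(1)] dim_T[OF K(2)] T_distinct[OF assms]
    by (intro exI[of _ "pt s"] exI[of _ "pt t"] conjI allI impI) simp_all
qed

lemma odp_cases:
  assumes "ordinary_double_point \<phi> p T1 T2"
  obtains s t where "(s, t) \<in> P" "p = vec.span {cv 0 s}" "T1 = T s" "T2 = T t" "T1 \<noteq> T2"
    | s t where "(s, t) \<in> P" "p = vec.span {cv 0 s}" "T1 = T t" "T2 = T s" "T1 \<noteq> T2"
proof -
  obtain v w where vw: "v \<noteq> 0" "w \<noteq> 0" "vec.span {v} \<noteq> vec.span {w}" "image_point \<phi> v = p" "image_point \<phi> w = p"
    "T1 = tangent_space \<phi> v" "T2 = tangent_space \<phi> w" and neq: "T1 \<noteq> T2"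
    using assms unfolding ordinary_double_point_def by blast
  \<comment> \<open>Infinity is a single point of the parameter line, so at most one of
    \<open>v\<close>, \<open>w\<close> lies there, and then \<open>image_infinity\<close> forbids a
    common image.\<close>
  have inf: "vec.span {u} = vec.span {axis 1 1}" if "u \<noteq> 0" "u $ 2 = 0" for u :: "complex ^ 2"
  proof -
    have "u = u $ 1 *s axis 1 1" "u $ 1 \<noteq> 0"
      using that by (auto simp: vec_eq_iff forall_2 axis_def)
    thus ?thesis by (metis vec_span_singleton_scale)
  qed
  have "v $ 2 \<noteq> 0"
  proof
    assume v2: "v $ 2 = 0"
    hence "w $ 2 \<noteq> 0" using inf[OF vw(1)] inf[OF vw(2)] vw(3) by auto
    from image_affine[OF this] image_infinity[OF vw(1) v2] vw(4,5) show False by metis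
  qed
  moreover have "w $ 2 \<noteq> 0"
    using image_infinity[OF vw(2)] image_affine[OF \<open>v $ 2 \<noteq> 0\<close>] vw(4,5) by metis
  moreover define s t where "s = v $ 1 / v $ 2" and "t = w $ 1 / w $ 2"
  ultimately have st: "p = vec.span {cv 0 s}" "p = vec.span {cv 0 t}" "T1 = T s" "T2 = T t"
    "vec.span {v} = vec.span {pt s}" "vec.span {w} = vec.span {pt t}"
    using vw(4-7) image_affine[of v] image_affine[of w] tangent_affine[of v] tangent_affine[of w]
      span_pt[of v] span_pt[of w] by simp_all
  have "s \<noteq> t" using vw(3) st by auto
  moreover have "par s t" using st(1,2) by (simp add: par_iff_span)
  ultimately have "(s, t) \<in> P \<or> (t, s) \<in> P" by (rule pair_in_P)
  thus ?thesis
  proof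
    assume "(s, t) \<in> P"
    thus ?thesis by (rule that(1)[OF _ st(1,3,4) neq])
  next
    assume "(t, s) \<in> P"
    thus ?thesis by (rule that(2)[OF _ st(2,3,4) neq])
  qed
qed

lemma cnj_vec_cv: "cnj_vec (cv k t) = cv k (cnj t)"
proof -
  have "map_poly cnj ((pderiv ^^ k) (f $ i)) = (pderiv ^^ k) (f $ i)" for i
  proof -
    have "coeff ((pderiv ^^ k) (f $ i)) n \<in> \<real>" for n
      by (induction k arbitrary: n) (simp_all add: real_f coeff_pderiv Reals_mult del: of_nat_Suc)
    thus ?thesis by (intro poly_eqI) (auto simp: coeff_map_poly Reals_cnj_iff)
  qed
  thus ?thesis by (simp add: cnj_vec_def cv_def vec_eq_iff poly_cnj)
qed

lemma conj_T: "conj_subspace (T t) = T (cnj t)"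
  by (simp add: T_def conj_subspace_span cnj_vec_cv)

lemma real_cv: "t \<in> \<real> \<Longrightarrow> cv k t $ i \<in> \<real>"
  using arg_cong[OF cnj_vec_cv[of k t], of "\<lambda>v. v $ i"] by (simp add: cnj_vec_def Reals_cnj_iff)

lemma real_T: "t \<in> \<real> \<Longrightarrow> real_subspace (T t)"
  unfolding real_subspace_def T_def using real_cv by (intro exI[of _ "{cv 0 t, cv 1 t}"]) auto

lemma real_image:
  assumes "(s, t) \<in> P"
  shows "real_subspace (vec.span {cv 0 s})"
  using P_type[OF assms]
proof
  assume "s \<in> \<real> \<and> t \<in> \<real>"
  thus ?thesis unfolding real_subspace_def using real_cv by (intro exI[of _ "{cv 0 s}"]) auto
next
  assume "t = cnj s"
  with P_par[OF assms] obtain k where k: "cnj_vec (cv 0 s) = k *s cv 0 s"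
    by (auto simp: par_def cnj_vec_cv)
  obtain i where i: "cv 0 s $ i \<noteq> 0" using cv_nonzero[of s] by (auto simp: vec_eq_iff)
  \<comment> \<open>Conjugation multiplies all coordinates by the same factor, so normalising one of
    them to 1 makes the others real.\<close>
  define w where "w = inverse (cv 0 s $ i) *s cv 0 s"
  have cn: "cnj (cv 0 s $ j) = k * cv 0 s $ j" for j
    using arg_cong[OF k, of "\<lambda>v. v $ j"] by (simp add: cnj_vec_def)
  have "k \<noteq> 0" using cn[of i] i by auto
  hence "w $ j \<in> \<real>" for j using i by (simp add: w_def Reals_cnj_iff cn)
  moreover have "vec.span {w} = vec.span {cv 0 s}"
    unfolding w_def using i by (intro vec_span_singleton_scale) simp
  ultimately show ?thesis unfolding real_subspace_def by (intro exI[of _ "{w}"]) auto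
qed

text \<open>Conjugate parameters have conjugate tangents. As the two tangents of a node differ, they
  cannot be real.\<close>

lemma real_nodes_eq:
  "real_nodes \<phi> = (\<lambda>(s, t). vec.span {cv 0 s}) ` {(s, t) \<in> P. s \<in> \<real> \<and> t \<in> \<real>}" (is "_ = ?f ` ?P")
proof
  show "real_nodes \<phi> \<subseteq> ?f ` ?P"
  proof
    fix p assume "p \<in> real_nodes \<phi>"
    then obtain T1 T2 where o: "ordinary_double_point \<phi> p T1 T2" and r: "real_subspace T1" "real_subspace T2"
      by (auto simp: real_nodes_def)
    have *: "p \<in> ?f ` ?P" if "(s, t) \<in> P" "p = vec.span {cv 0 s}" "T1 \<noteq> T2"
      "T1 = T s \<and> T2 = T t \<or> T1 = T t \<and> T2 = T s" for s t
    proof -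
      have "t \<noteq> cnj s"
      proof
        assume "t = cnj s"
        hence "conj_subspace T1 = T2" using that(4) by (auto simp: conj_T)
        thus False using conj_subspace_real[OF r(1)] that(3) by simp
      qed
      hence "(s, t) \<in> ?P" using that(1) P_type by auto
      thus ?thesis using that(2) by force
    qed
    from o show "p \<in> ?f ` ?P"
    proof (cases rule: odp_cases)
      case (1 s t)
      thus ?thesis by (intro *[of s t]) simp_all
    next
      case (2 s t)
      thus ?thesis by (intro *[of s t]) simp_all
    qed
  qed
  show "?f ` ?P \<subseteq> real_nodes \<phi>"
  proof clarify
    fix s t assume st: "(s, t) \<in> P" "s \<in> \<real>" "t \<in> \<real>"
    thus "vec.span {cv 0 s} \<in> real_nodes \<phi>"
      using P_odp[OF st(1)] real_image[OF st(1)] real_T unfolding real_nodes_def by blast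
  qed
qed

text \<open>Real parameters have real tangents, which conjugation fixes; two different ones are
  therefore not conjugate.\<close>

lemma solitary_points_eq:
  "solitary_points \<phi> = (\<lambda>(s, t). vec.span {cv 0 s}) ` {(s, t) \<in> P. \<not> (s \<in> \<real> \<and> t \<in> \<real>)}" (is "_ = ?f ` ?P")
proof
  show "solitary_points \<phi> \<subseteq> ?f ` ?P"
  proof
    fix p assume "p \<in> solitary_points \<phi>"
    then obtain T1 T2 where o: "ordinary_double_point \<phi> p T1 T2" and r: "T2 = conj_subspace T1"
      by (auto simp: solitary_points_def)
    have *: "p \<in> ?f ` ?P" if "(s, t) \<in> P" "p = vec.span {cv 0 s}" "T1 \<noteq> T2" "T1 = T s \<or> T1 = T t" for s t
    proof -
      have "\<not> (s \<in> \<real> \<and> t \<in> \<real>)"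
        using conj_subspace_real[of T1] real_T that(3,4) r by auto
      thus ?thesis using that(1,2) by force
    qed
    from o show "p \<in> ?f ` ?P"
    proof (cases rule: odp_cases)
      case (1 s t)
      thus ?thesis by (intro *[of s t]) simp_all
    next
      case (2 s t)
      thus ?thesis by (intro *[of s t]) simp_all
    qed
  qed
  show "?f ` ?P \<subseteq> solitary_points \<phi>"
  proof clarify
    fix s t assume st: "(s, t) \<in> P" "\<not> (s \<in> \<real> \<and> t \<in> \<real>)"
    hence "T t = conj_subspace (T s)" using P_type conj_T by auto
    thus "vec.span {cv 0 s} \<in> solitary_points \<phi>"
      using P_odp[OF st(1)] real_image[OF st(1)] unfolding solitary_points_def by blast
  qed
qed

lemma complex_nodes_empty: "complex_nodes \<phi> = {}"
proof -
  have "real_subspace p" if "ordinary_double_point \<phi> p T1 T2" for p T1 T2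
    using that by (rule odp_cases) (simp_all add: real_image)
  thus ?thesis by (auto simp: complex_nodes_def)
qed

lemma inj_on_nodes: "inj_on (\<lambda>(s, t). vec.span {cv 0 s}) P"
proof (rule inj_onI, clarsimp)
  fix s t s' t' assume st: "(s, t) \<in> P" "(s', t') \<in> P" "vec.span {cv 0 s} = vec.span {cv 0 s'}"
  hence "par s s'" by (simp add: par_iff_span)
  hence "s = s'" using pair_in_P[of s s'] P_fst_snd(2)[OF st(1)] P_fst_snd(2)[OF st(2)] by blast
  thus "s = s' \<and> t = t'" using P_fst_snd(1)[OF st(1), of t'] st(2) by simp
qed

lemma has_exactly_nodes:
  "has_exactly (real_nodes \<phi>) (card {(s, t) \<in> P. s \<in> \<real> \<and> t \<in> \<real>})"
  "has_exactly (solitary_points \<phi>) (card {(s, t) \<in> P. \<not> (s \<in> \<real> \<and> t \<in> \<real>)})"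
proof -
  have *: "has_exactly ((\<lambda>(s, t). vec.span {cv 0 s}) ` A) (card A)" if "A \<subseteq> P" for A
    using finite_subset[OF that P(1)] card_image[OF inj_on_subset[OF inj_on_nodes that]]
    by (simp add: has_exactly_def)
  show "has_exactly (real_nodes \<phi>) (card {(s, t) \<in> P. s \<in> \<real> \<and> t \<in> \<real>})"
    unfolding real_nodes_eq by (rule *) auto
  show "has_exactly (solitary_points \<phi>) (card {(s, t) \<in> P. \<not> (s \<in> \<real> \<and> t \<in> \<real>)})"
    unfolding solitary_points_eq by (rule *) auto
qed

end

subsection \<open>Curves given by real data\<close>

abbreviation cpoly :: "real poly \<Rightarrow> complex poly" where
  "cpoly \<equiv> map_poly of_real"

lemma coeff_cpoly: "coeff (cpoly p) n = of_real (coeff p n)"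
  by (simp add: coeff_map_poly)

lemma cpoly_simps:
  "cpoly (p + q) = cpoly p + cpoly q" "cpoly (p - q) = cpoly p - cpoly q" "cpoly (p * q) = cpoly p * cpoly q"
  "pderiv (cpoly p) = cpoly (pderiv p)"
  by (intro poly_eqI; simp add: coeff_cpoly coeff_mult coeff_pderiv)+

lemma poly_cpoly: "poly (cpoly p) z = (\<Sum>i\<le>degree p. of_real (coeff p i) * z ^ i)"
  by (simp add: poly_altdef coeff_cpoly degree_map_poly)

lemma poly_cpoly_of_real: "poly (cpoly p) (of_real x) = of_real (poly p x)"
  by (simp add: poly_cpoly) (simp add: poly_altdef)

lemma poly_cpoly_cnj: "poly (cpoly p) (cnj z) = cnj (poly (cpoly p) z)"
  by (simp add: poly_cpoly)

lemma wronskian_cpoly: "wronskian (\<chi> i. cpoly (p $ i)) = cpoly (wronskian p)"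
  by (simp add: wronskian_def det3_def cpoly_simps)

text \<open>Real data that determine a maximally inflected curve: the flexes \<open>Fl\<close>, the cusps
  \<open>K\<close>, pairs of real parameters of real nodes, and one parameter in the upper half-plane
  for each solitary point.\<close>

lemma curve_from_real_data:
  fixes p :: "real poly ^ 3" and A Fl K :: "real set" and NR :: "(real \<times> real) set" and NS :: "complex set"
  assumes d: "d \<ge> 3" "degree (p $ 1) = d - 2" "degree (p $ 2) = d - 1" "degree (p $ 3) = d"
    and A: "finite A" "card A = d - 2" "\<And>a. a \<in> A \<Longrightarrow> poly (p $ 1) a = 0"
      "\<And>a. a \<in> A \<Longrightarrow> poly (p $ 2) a \<noteq> 0" "inj_on (\<lambda>a. poly (p $ 3) a / poly (p $ 2) a) A"
    and Fl: "finite Fl" "\<And>a. a \<in> Fl \<Longrightarrow> poly (wronskian p) a = 0"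
    and K: "finite K" "\<And>k. k \<in> K \<Longrightarrow> \<exists>l. \<forall>i. poly (pderiv (p $ i)) k = l * poly (p $ i) k"
      "Fl \<inter> K = {}" "card Fl + 2 * card K = 3 * (d - 2)"
    and NR: "finite NR" "\<And>s t. (s, t) \<in> NR \<Longrightarrow> s \<noteq> t"
      "\<And>s t. (s, t) \<in> NR \<Longrightarrow> \<exists>k. \<forall>i. poly (p $ i) t = k * poly (p $ i) s"
      "inj_on fst NR" "inj_on snd NR" "fst ` NR \<inter> snd ` NR = {}" "(fst ` NR \<union> snd ` NR) \<inter> K = {}"
    and NS: "finite NS" "\<And>t. t \<in> NS \<Longrightarrow> Im t > 0"
      "\<And>t. t \<in> NS \<Longrightarrow> poly (cpoly (p $ 1)) t \<noteq> 0"
      "\<And>t. t \<in> NS \<Longrightarrow> Im (poly (cpoly (p $ 2)) t * cnj (poly (cpoly (p $ 1)) t)) = 0"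
      "\<And>t. t \<in> NS \<Longrightarrow> Im (poly (cpoly (p $ 3)) t * cnj (poly (cpoly (p $ 1)) t)) = 0"
    and count: "card NR + card NS + card K = (d - 1) choose 2"
  shows "\<exists>\<phi>. maximally_inflected d \<phi> \<and> has_exactly (cusps \<phi>) (card K) \<and> has_exactly (flexes \<phi>) (card Fl) \<and>
    has_exactly (real_nodes \<phi>) (card NR) \<and> has_exactly (solitary_points \<phi>) (card NS) \<and> complex_nodes \<phi> = {}"
proof -
  define f :: "complex poly ^ 3" where "f = (\<chi> i. cpoly (p $ i))"
  define PR where "PR = (\<lambda>(s, t). (complex_of_real s, complex_of_real t)) ` NR"
  define PS where "PS = (\<lambda>t. (t, cnj t)) ` NS"
  have f: "f $ i = cpoly (p $ i)" for i by (simp add: f_def)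
  have inj: "inj_on complex_of_real X" for X by (simp add: inj_on_def)
  have c0: "x = 0" if "complex_of_real x = 0" for x using that by simp
  have fst_PR: "fst ` PR = of_real ` fst ` NR" and snd_PR: "snd ` PR = of_real ` snd ` NR"
    by (force simp: PR_def image_iff)+
  have fst_PS: "fst ` PS = NS" and snd_PS: "snd ` PS = cnj ` NS"
    by (force simp: PS_def image_iff)+
  \<comment> \<open>The sign of the imaginary part separates the parameters of real nodes from the
    two parameters of a solitary point.\<close>
  have im_PR: "Im z = 0" if "z \<in> fst ` PR \<union> snd ` PR" for z using that by (auto simp: fst_PR snd_PR)
  have im_PS: "Im z > 0" if "z \<in> NS" for z using that NS by auto
  have im_PS': "Im z < 0" if "z \<in> cnj ` NS" for z using that NS by auto
  interpret counted_curve d f "of_real ` A" "of_real ` Fl" "of_real ` K" "PR \<union> PS"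
  proof
    show "d \<ge> 3" "degree (f $ 1) = d - 2" "degree (f $ 2) = d - 1" "degree (f $ 3) = d"
      using d by (simp_all add: f degree_map_poly)
    show "finite (complex_of_real ` A)" "card (complex_of_real ` A) = d - 2"
      using A by (simp_all add: card_image inj)
    show "poly (f $ 1) a = 0" "poly (f $ 2) a \<noteq> 0" if "a \<in> of_real ` A" for a
      using that A by (auto simp: f poly_cpoly_of_real)
    show "inj_on (\<lambda>a. poly (f $ 3) a / poly (f $ 2) a) (of_real ` A)"
    proof (rule inj_onI, clarify)
      fix a b assume ab: "a \<in> A" "b \<in> A"
        "poly (f $ 3) (of_real a) / poly (f $ 2) (of_real a) = poly (f $ 3) (of_real b) / poly (f $ 2) (of_real b)"
      hence "complex_of_real (poly (p $ 3) a / poly (p $ 2) a) = of_real (poly (p $ 3) b / poly (p $ 2) b)"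
        by (simp add: f poly_cpoly_of_real)
      hence "poly (p $ 3) a / poly (p $ 2) a = poly (p $ 3) b / poly (p $ 2) b" by (simp only: of_real_eq_iff)
      hence "a = b" using inj_onD[OF A(5)] ab by blast
      thus "complex_of_real a = of_real b" by simp
    qed
    show "coeff (f $ i) k \<in> \<real>" for i k by (simp add: f coeff_cpoly)
    show "finite (complex_of_real ` Fl)" "complex_of_real ` Fl \<subseteq> \<real>" "finite (complex_of_real ` K)" "complex_of_real ` K \<subseteq> \<real>"
      using Fl K by auto
    show "poly (wronskian f) a = 0" if "a \<in> of_real ` Fl" for a
      using that Fl by (auto simp: f_def wronskian_cpoly poly_cpoly_of_real)
    show "\<exists>l. \<forall>i. poly (pderiv (f $ i)) k = l * poly (f $ i) k" if k: "k \<in> of_real ` K" for k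
    proof -
      obtain k' l where "k = of_real k'" "\<forall>i. poly (pderiv (p $ i)) k' = l * poly (p $ i) k'"
        using k K(2) by blast
      thus ?thesis by (intro exI[of _ "of_real l"]) (simp add: f cpoly_simps poly_cpoly_of_real)
    qed
    show "complex_of_real ` Fl \<inter> of_real ` K = {}" using K(3) by auto
    show "card (complex_of_real ` Fl) + 2 * card (complex_of_real ` K) = 3 * (d - 2)"
      using K(4) by (simp add: card_image inj)
    show "finite (PR \<union> PS)" using NR(1) NS(1) by (simp add: PR_def PS_def)
    show "s \<noteq> t" if st: "(s, t) \<in> PR \<union> PS" for s t
      using st
    proof
      assume "(s, t) \<in> PS"
      hence "t = cnj s" "Im s > 0" using NS(2)[of s] by (simp_all add: PS_def image_iff)
      thus "s \<noteq> t" by (simp add: complex_eq_iff)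
    next
      assume "(s, t) \<in> PR"
      thus "s \<noteq> t" using NR(2) by (auto simp: PR_def)
    qed
    show "\<exists>k. \<forall>i. poly (f $ i) t = k * poly (f $ i) s" if st: "(s, t) \<in> PR \<union> PS" for s t
      using st
    proof
      assume "(s, t) \<in> PR"
      then obtain s' t' where st': "s = of_real s'" "t = of_real t'" "(s', t') \<in> NR" by (auto simp: PR_def)
      then obtain k where "\<forall>i. poly (p $ i) t' = k * poly (p $ i) s'" using NR(3) by blast
      thus ?thesis using st' by (intro exI[of _ "of_real k"]) (simp add: f poly_cpoly_of_real)
    next
      assume "(s, t) \<in> PS"
      hence t: "t = cnj s" and s: "s \<in> NS" by (auto simp: PS_def)
      define z where "z = poly (cpoly (p $ 1)) s"
      have z: "z \<noteq> 0" using NS(3)[OF s] by (simp add: z_def)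
      \<comment> \<open>The quotients by the first component are real at \<open>s\<close>, so
        conjugation multiplies all components by the same factor and \<open>s\<close>,
        \<open>cnj s\<close> have the same image.\<close>
      have "cnj (poly (f $ i) s) = cnj z / z * poly (f $ i) s" for i
      proof -
        have "Im (poly (f $ i) s * cnj z) = 0"
          using exhaust_3[of i] NS(4,5)[OF s] by (auto simp: f z_def)
        hence "cnj (poly (f $ i) s * cnj z) = poly (f $ i) s * cnj z" by (simp add: complex_eq_iff)
        thus ?thesis using z by (simp add: field_simps)
      qed
      thus ?thesis unfolding t by (intro exI[of _ "cnj z / z"]) (simp add: f poly_cpoly_cnj)
    qed
    have inj_PR: "inj_on fst PR" "inj_on snd PR"
    proof -
      show "inj_on fst PR" "inj_on snd PR"
        using inj_onD[OF NR(4)] inj_onD[OF NR(5)] by (fastforce simp: inj_on_def PR_def)+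
    qed
    have inj_PS: "inj_on fst PS" "inj_on snd PS"
      by (auto simp: inj_on_def PS_def)
    have img: "fst ` (PR \<union> PS) = fst ` PR \<union> NS" "snd ` (PR \<union> PS) = snd ` PR \<union> cnj ` NS"
      by (simp_all add: image_Un fst_PS snd_PS)
    have disj: "fst ` PR \<inter> NS = {}" "snd ` PR \<inter> cnj ` NS = {}" "fst ` PR \<inter> cnj ` NS = {}" "NS \<inter> snd ` PR = {}"
    proof -
      have "z \<notin> NS" "z \<notin> cnj ` NS" if "z \<in> fst ` PR \<union> snd ` PR" for z
        using im_PR[OF that] im_PS[of z] im_PS'[of z] by auto
      thus "fst ` PR \<inter> NS = {}" "snd ` PR \<inter> cnj ` NS = {}" "fst ` PR \<inter> cnj ` NS = {}" "NS \<inter> snd ` PR = {}"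
        by blast+
    qed
    have "inj_on h (X \<union> Y)" if "inj_on h X" "inj_on h Y" "h ` X \<inter> h ` Y = {}"
      for h :: "complex \<times> complex \<Rightarrow> complex" and X Y
    proof -
      have "h ` (X - Y) \<subseteq> h ` X" "h ` (Y - X) \<subseteq> h ` Y" by auto
      hence "h ` (X - Y) \<inter> h ` (Y - X) = {}" using that(3) by blast
      thus ?thesis using that(1,2) by (simp only: inj_on_Un simp_thms)
    qed
    from this[OF inj_PR(1) inj_PS(1)] this[OF inj_PR(2) inj_PS(2)]
    show "inj_on fst (PR \<union> PS)" "inj_on snd (PR \<union> PS)"
      using disj(1,2) unfolding fst_PS snd_PS by simp_all
    have inj_UNIV: "inj complex_of_real" by (rule inj)
    have "fst ` PR \<inter> snd ` PR = {}"
      using NR(6) unfolding fst_PR snd_PR by (simp flip: image_Int[OF inj_UNIV])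
    moreover have "NS \<inter> cnj ` NS = {}"
    proof (rule equals0I)
      fix z assume "z \<in> NS \<inter> cnj ` NS"
      thus False using im_PS[of z] im_PS'[of z] by simp
    qed
    ultimately show "fst ` (PR \<union> PS) \<inter> snd ` (PR \<union> PS) = {}" 
      using disj(3,4) unfolding img by (simp add: Int_Un_distrib Int_Un_distrib2)
    have "(fst ` PR \<union> snd ` PR) \<inter> complex_of_real ` K = {}"
      using NR(7) unfolding fst_PR snd_PR by (simp flip: image_Int[OF inj_UNIV] image_Un)
    moreover have "NS \<inter> complex_of_real ` K = {}" "cnj ` NS \<inter> complex_of_real ` K = {}"
    proof -
      have "z \<notin> complex_of_real ` K" if "z \<in> NS \<or> z \<in> cnj ` NS" for z
      proof -
        have "Im z \<noteq> 0" using that im_PS[of z] im_PS'[of z] by linarith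
        thus ?thesis by (auto simp del: of_real_eq_iff)
      qed
      thus "NS \<inter> complex_of_real ` K = {}" "cnj ` NS \<inter> complex_of_real ` K = {}" by blast+
    qed
    ultimately show "(fst ` (PR \<union> PS) \<union> snd ` (PR \<union> PS)) \<inter> complex_of_real ` K = {}"
      unfolding img by (simp add: Int_Un_distrib2)
    have "card PR = card NR" "card PS = card NS"
      unfolding PR_def PS_def by (intro card_image; auto simp: inj_on_def)+
    moreover have "PR \<inter> PS = {}" using disj(1) fst_PS by blast
    ultimately show "card (PR \<union> PS) + card (complex_of_real ` K) = (d - 1) choose 2"
      using count NR(1) NS(1) by (subst card_Un_disjoint) (auto simp: card_image inj PR_def PS_def)
    show "s \<in> \<real> \<and> t \<in> \<real> \<or> t = cnj s" if "(s, t) \<in> PR \<union> PS" for s t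
      using that by (auto simp: PR_def PS_def)
  qed
  have "{(s, t) \<in> PR \<union> PS. s \<in> \<real> \<and> t \<in> \<real>} = PR" "{(s, t) \<in> PR \<union> PS. \<not> (s \<in> \<real> \<and> t \<in> \<real>)} = PS"
  proof -
    have "s \<notin> \<real>" if "(s, t) \<in> PS" for s t
      using that NS(2)[of s] by (auto simp: PS_def complex_is_Real_iff)
    moreover have "s \<in> \<real> \<and> t \<in> \<real>" if "(s, t) \<in> PR" for s t
      using that by (auto simp: PR_def)
    ultimately show "{(s, t) \<in> PR \<union> PS. s \<in> \<real> \<and> t \<in> \<real>} = PR" "{(s, t) \<in> PR \<union> PS. \<not> (s \<in> \<real> \<and> t \<in> \<real>)} = PS"
      by blast+
  qed
  moreover have "card PR = card NR" "card PS = card NS"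
    unfolding PR_def PS_def by (intro card_image; auto simp: inj_on_def)+
  moreover have "card (complex_of_real ` K) = card K" "card (complex_of_real ` Fl) = card Fl"
    by (simp_all add: card_image inj)
  ultimately show ?thesis
    using maximally_inflected has_exactly_cusps has_exactly_flexes has_exactly_nodes complex_nodes_empty
    by (intro exI[of _ "curve_of d f"]) (simp only: simp_thms)
qed

section \<open>Common zeros of two functions from sign changes\<close>

text \<open>The theorem of Poincare and Miranda, deduced from Brouwer's: move by
  \<open>- (g1, g2)\<close> and truncate to the box. At a fixed point on a side the truncation and
  the boundary sign give opposite inequalities, so the function vanishes there too.\<close>

lemma miranda:
  fixes g1 g2 :: "real \<Rightarrow> real \<Rightarrow> real"
  assumes "a < b" "c < d"
    "continuous_on (cbox (a, c) (b, d)) (\<lambda>(x, y). g1 x y)"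
    "continuous_on (cbox (a, c) (b, d)) (\<lambda>(x, y). g2 x y)"
    "\<And>y. y \<in> {c..d} \<Longrightarrow> g1 a y \<le> 0 \<and> 0 \<le> g1 b y"
    "\<And>x. x \<in> {a..b} \<Longrightarrow> g2 x c \<le> 0 \<and> 0 \<le> g2 x d"
  shows "\<exists>x\<in>{a..b}. \<exists>y\<in>{c..d}. g1 x y = 0 \<and> g2 x y = 0"
proof -
  define F where "F = (\<lambda>(x, y). (max a (min b (x - g1 x y)), max c (min d (y - g2 x y))))"
  have "continuous_on (cbox (a, c) (b, d)) F"
    using assms(3,4) unfolding F_def case_prod_unfold by (intro continuous_intros) auto
  moreover have "F \<in> cbox (a, c) (b, d) \<rightarrow> cbox (a, c) (b, d)"
    using assms(1,2) by (auto simp: F_def cbox_Pair_eq)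
  moreover have "cbox (a, c) (b, d) \<noteq> {}" using assms(1,2) by (auto simp: cbox_Pair_eq)
  ultimately obtain z where "z \<in> cbox (a, c) (b, d)" "F z = z"
    using brouwer[of "cbox (a, c) (b, d)" F] by (auto simp: convex_box)
  then obtain x y where xy: "x \<in> {a..b}" "y \<in> {c..d}" "max a (min b (x - g1 x y)) = x" "max c (min d (y - g2 x y)) = y"
    by (cases z) (auto simp: F_def cbox_Pair_eq)
  have "g1 x y = 0"
    using xy assms(1) assms(5)[OF xy(2)] by (cases "x = a"; cases "x = b") (auto simp: max_def min_def split: if_splits)
  moreover have "g2 x y = 0"
    using xy assms(2) assms(6)[OF xy(1)] by (cases "y = c"; cases "y = d") (auto simp: max_def min_def split: if_splits)
  ultimately show ?thesis using xy by blast
qed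

text \<open>A limit taken jointly in both variables gives positivity on a whole neighbourhood for
  all late \<open>e\<close>; finitely many neighbourhoods cover the compact set.\<close>

lemma eventually_compact_pos:
  fixes g :: "'e \<Rightarrow> 'b :: topological_space \<Rightarrow> real"
  assumes "compact C" "\<And>x. x \<in> C \<Longrightarrow> \<exists>l>0. ((\<lambda>(e, y). g e y) \<longlongrightarrow> l) (F \<times>\<^sub>F nhds x)"
  shows "\<forall>\<^sub>F e in F. \<forall>y\<in>C. g e y > 0"
proof -
  have "\<exists>U. open U \<and> x \<in> U \<and> (\<forall>\<^sub>F e in F. \<forall>y\<in>U. g e y > 0)" if x: "x \<in> C" for x
  proof -
    obtain l where "l > 0" "((\<lambda>(e, y). g e y) \<longlongrightarrow> l) (F \<times>\<^sub>F nhds x)" using assms(2)[OF x] by blast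
    hence "\<forall>\<^sub>F z in F \<times>\<^sub>F nhds x. (case z of (e, y) \<Rightarrow> g e y) > 0"
      by (intro order_tendstoD(1))
    then obtain Q R where QR: "eventually Q F" "eventually R (nhds x)" "\<And>e y. Q e \<Longrightarrow> R y \<Longrightarrow> g e y > 0"
      unfolding eventually_prod_filter by auto
    then obtain U where U: "open U" "x \<in> U" "\<forall>y\<in>U. R y" by (auto simp: eventually_nhds)
    have "\<forall>\<^sub>F e in F. \<forall>y\<in>U. g e y > 0" using QR(1) by eventually_elim (use QR(3) U(3) in blast)
    thus ?thesis using U by blast
  qed
  hence "\<forall>x\<in>C. \<exists>U. open U \<and> x \<in> U \<and> (\<forall>\<^sub>F e in F. \<forall>y\<in>U. g e y > 0)" by (rule ballI)
  then obtain U where U: "\<forall>x\<in>C. open (U x) \<and> x \<in> U x \<and> (\<forall>\<^sub>F e in F. \<forall>y\<in>U x. g e y > 0)"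
    by (rule bchoice[THEN exE])
  note UD = bspec[OF U]
  have open_U: "open (U x)" if "x \<in> C" for x by (rule UD[OF that, THEN conjunct1])
  have in_U: "x \<in> U x" if "x \<in> C" for x by (rule UD[OF that, THEN conjunct2, THEN conjunct1])
  have ev_U: "\<forall>\<^sub>F e in F. \<forall>y\<in>U x. g e y > 0" if "x \<in> C" for x
    by (rule UD[OF that, THEN conjunct2, THEN conjunct2])
  have cover: "C \<subseteq> (\<Union>x\<in>C. U x)" by (rule subsetI) (rule UN_I, assumption, rule in_U)
  obtain D where D: "D \<subseteq> C" "finite D" "C \<subseteq> (\<Union>x\<in>D. U x)"
    by (rule compactE_image[OF assms(1) _ cover]) (rule open_U, assumption, rule that)
  have "\<forall>\<^sub>F e in F. \<forall>x\<in>D. \<forall>y\<in>U x. g e y > 0"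
  proof (rule eventually_ball_finite[OF D(2)], rule ballI)
    fix x assume "x \<in> D"
    hence "x \<in> C" using D(1) by (rule rev_subsetD)
    thus "\<forall>\<^sub>F e in F. \<forall>y\<in>U x. g e y > 0" by (rule ev_U)
  qed
  thus ?thesis
  proof eventually_elim
    case (elim e)
    show ?case
    proof
      fix y assume "y \<in> C"
      hence "y \<in> (\<Union>x\<in>D. U x)" using D(3) by (rule rev_subsetD)
      then obtain x where "x \<in> D" "y \<in> U x" by (rule UN_E)
      from bspec[OF bspec[OF elim this(1)] this(2)] show "g e y > 0" .
    qed
  qed
qed

text \<open>Besides continuity only limits on the four sides enter. \<open>\<sigma>\<close> and
  \<open>\<tau>\<close> carry the orientations of the two sign changes, and the strictness of the
  signs keeps the zero off the boundary.\<close>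

lemma eventually_zero_in_box:
  fixes g1 g2 :: "'e \<Rightarrow> real \<Rightarrow> real \<Rightarrow> real"
  assumes ab: "a < b" "c < d"
    and cont: "\<forall>\<^sub>F e in F. continuous_on (cbox (a, c) (b, d)) (\<lambda>(x, y). g1 e x y)"
      "\<forall>\<^sub>F e in F. continuous_on (cbox (a, c) (b, d)) (\<lambda>(x, y). g2 e x y)"
    and lim1: "\<And>y. y \<in> {c..d} \<Longrightarrow> ((\<lambda>(e, y). g1 e a y) \<longlongrightarrow> la y) (F \<times>\<^sub>F nhds y) \<and>
        ((\<lambda>(e, y). g1 e b y) \<longlongrightarrow> ra y) (F \<times>\<^sub>F nhds y) \<and> \<sigma> * la y < 0 \<and> 0 < \<sigma> * ra y"
    and lim2: "\<And>x. x \<in> {a..b} \<Longrightarrow> ((\<lambda>(e, x). g2 e x c) \<longlongrightarrow> lb x) (F \<times>\<^sub>F nhds x) \<and>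
        ((\<lambda>(e, x). g2 e x d) \<longlongrightarrow> rb x) (F \<times>\<^sub>F nhds x) \<and> \<tau> * lb x < 0 \<and> 0 < \<tau> * rb x"
  shows "\<forall>\<^sub>F e in F. \<exists>x\<in>{a<..<b}. \<exists>y\<in>{c<..<d}. g1 e x y = 0 \<and> g2 e x y = 0"
proof -
  have st: "\<sigma> \<noteq> 0" "\<tau> \<noteq> 0" using lim1[of c] lim2[of a] ab by auto
  have pos: "\<forall>\<^sub>F e in F. \<forall>y\<in>C. k * g e y > 0"
    if "compact C" "\<And>y. y \<in> C \<Longrightarrow> ((\<lambda>(e, y). g e y) \<longlongrightarrow> l y) (F \<times>\<^sub>F nhds y) \<and> 0 < k * l y"
    for C :: "real set" and k and g :: "'e \<Rightarrow> real \<Rightarrow> real" and l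
  proof (rule eventually_compact_pos[OF that(1)])
    fix x assume x: "x \<in> C"
    have "((\<lambda>z. k * (case z of (e, y) \<Rightarrow> g e y)) \<longlongrightarrow> k * l x) (F \<times>\<^sub>F nhds x)"
      using that(2)[OF x] by (intro tendsto_intros) blast
    thus "\<exists>l>0. ((\<lambda>(e, y). k * g e y) \<longlongrightarrow> l) (F \<times>\<^sub>F nhds x)"
      using that(2)[OF x] by (intro exI[of _ "k * l x"]) (simp add: case_prod_unfold)
  qed
  have "\<forall>\<^sub>F e in F. \<forall>y\<in>{c..d}. - \<sigma> * g1 e a y > 0" "\<forall>\<^sub>F e in F. \<forall>y\<in>{c..d}. \<sigma> * g1 e b y > 0"
    "\<forall>\<^sub>F e in F. \<forall>x\<in>{a..b}. - \<tau> * g2 e x c > 0" "\<forall>\<^sub>F e in F. \<forall>x\<in>{a..b}. \<tau> * g2 e x d > 0"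
    using lim1 lim2
    by - (rule pos[where l = la] pos[where l = ra] pos[where l = lb] pos[where l = rb]; simp)+
  with cont show ?thesis
  proof eventually_elim
    case (elim e)
    have "continuous_on (cbox (a, c) (b, d)) (\<lambda>(x, y). \<sigma> * g1 e x y)"
      "continuous_on (cbox (a, c) (b, d)) (\<lambda>(x, y). \<tau> * g2 e x y)"
      using continuous_on_mult_left[OF elim(1), of \<sigma>] continuous_on_mult_left[OF elim(2), of \<tau>]
      by (simp_all add: case_prod_unfold)
    hence "\<exists>x\<in>{a..b}. \<exists>y\<in>{c..d}. \<sigma> * g1 e x y = 0 \<and> \<tau> * g2 e x y = 0"
      using elim(3-6) by (intro miranda ab) (auto simp: less_imp_le)
    then obtain x y where xy: "x \<in> {a..b}" "y \<in> {c..d}" "g1 e x y = 0" "g2 e x y = 0" using st by auto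
    moreover have "x \<noteq> a" "x \<noteq> b" "y \<noteq> c" "y \<noteq> d"
      using bspec[OF elim(3) xy(2)] bspec[OF elim(4) xy(2)] bspec[OF elim(5) xy(1)] bspec[OF elim(6) xy(1)] xy(3,4)
      by auto
    ultimately show ?case by (intro bexI[of _ x] bexI[of _ y]) auto
  qed
qed

subsection \<open>A conic and tangent lines\<close>

text \<open>The matrix is the identity plus one of norm at most 1/2 for the maximum norm, so a
  solution is at most twice as large as the right-hand side. The same bound yields uniqueness and
  hence existence.\<close>

lemma small_linear_system:
  fixes m :: "nat \<Rightarrow> nat \<Rightarrow> real" and b :: "nat \<Rightarrow> real"
  assumes m: "\<And>i. i < n \<Longrightarrow> (\<Sum>j<n. \<bar>m i j\<bar>) \<le> 1 / 2" and b: "\<And>i. i < n \<Longrightarrow> \<bar>b i\<bar> \<le> B"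
  shows "\<exists>v. (\<forall>i<n. v i + (\<Sum>j<n. m i j * v j) = b i) \<and> (\<forall>i<n. \<bar>v i\<bar> \<le> 2 * B)"
proof -
  have bound: "\<bar>w i\<bar> \<le> 2 * B'"
    if w: "\<And>i. i < n \<Longrightarrow> \<bar>w i + (\<Sum>j<n. m i j * w j)\<bar> \<le> B'" and i: "i < n" for w B' i
  proof -
    define N where "N = Max ((\<lambda>i. \<bar>w i\<bar>) ` {..<n})"
    have le: "\<bar>w j\<bar> \<le> N" if "j < n" for j using that by (simp add: N_def)
    have "N \<in> (\<lambda>i. \<bar>w i\<bar>) ` {..<n}" unfolding N_def using i by (intro Max_in) auto
    then obtain k where k: "k < n" "N = \<bar>w k\<bar>" by auto
    have "\<bar>\<Sum>j<n. m k j * w j\<bar> \<le> (\<Sum>j<n. \<bar>m k j\<bar> * N)"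
      using le by (intro order.trans[OF sum_abs sum_mono]) (auto simp: abs_mult intro!: mult_left_mono)
    also have "\<dots> \<le> 1 / 2 * N"
      unfolding sum_distrib_right[symmetric] using m[OF k(1)] k(2) by (intro mult_right_mono) simp_all
    finally show ?thesis using w[OF k(1)] k(2) le[OF i] by linarith
  qed
  \<comment> \<open>The extra unknown of index \<open>n\<close> multiplies the right-hand side; by
    the bound it cannot vanish in a nontrivial solution.\<close>
  define L where "L i j = (if j = n then - b i else (if i = j then 1 else 0) + m i j)" for i j
  obtain \<gamma> where \<gamma>: "\<exists>j\<in>{..n}. \<gamma> j \<noteq> 0" "\<And>i. i < n \<Longrightarrow> (\<Sum>j\<le>n. L i j * \<gamma> j) = 0"
    using underdetermined_system[of "{..<n}" "{..n}" L] by auto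
  have eq: "\<gamma> i + (\<Sum>j<n. m i j * \<gamma> j) = b i * \<gamma> n" if "i < n" for i
  proof -
    have "(\<Sum>j\<le>n. L i j * \<gamma> j) = (\<Sum>j<n. L i j * \<gamma> j) + L i n * \<gamma> n"
      by (simp add: lessThan_Suc_atMost[symmetric])
    also have "(\<Sum>j<n. L i j * \<gamma> j) = (\<Sum>j<n. (if i = j then \<gamma> j else 0) + m i j * \<gamma> j)"
      by (intro sum.cong) (auto simp: L_def algebra_simps)
    also have "\<dots> = \<gamma> i + (\<Sum>j<n. m i j * \<gamma> j)" using that by (simp add: sum.distrib)
    finally show ?thesis using \<gamma>(2)[OF that] by (simp add: L_def)
  qed
  have z: "\<gamma> n \<noteq> 0"
  proof
    assume z: "\<gamma> n = 0"
    have "\<bar>\<gamma> i\<bar> \<le> 2 * 0" if "i < n" for i by (rule bound[OF _ that]) (simp add: eq z)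
    thus False using \<gamma>(1) z by (auto simp: le_less)
  qed
  define v where "v i = \<gamma> i / \<gamma> n" for i
  have v: "v i + (\<Sum>j<n. m i j * v j) = b i" if "i < n" for i
    using eq[OF that] z by (simp add: v_def sum_divide_distrib[symmetric] field_simps)
  moreover have "\<bar>v i\<bar> \<le> 2 * B" if "i < n" for i by (rule bound[OF _ that]) (simp add: v b)
  ultimately show ?thesis by blast
qed

text \<open>The solution differs from \<open>b\<close> by a term of order \<open>e\<^sup>2\<close>,
  so the difference vanishes even after division by \<open>e\<close>. This precision is required
  because the first-order part of the residues determines the cusps.\<close>

lemma perturbed_linear_system:
  fixes b :: "real \<Rightarrow> nat \<Rightarrow> real"
  assumes b: "\<And>e i. 0 < e \<Longrightarrow> e < 1 \<Longrightarrow> i < n \<Longrightarrow> \<bar>b e i\<bar> \<le> B"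
    and m: "\<And>e i. 0 < e \<Longrightarrow> e < \<delta> \<Longrightarrow> i < n \<Longrightarrow> (\<Sum>j<n. \<bar>m e i j\<bar>) \<le> c * e\<^sup>2" and "0 < \<delta>" "0 < c" "0 \<le> B"
  shows "\<exists>v. (\<forall>\<^sub>F e in at_right 0. \<forall>i<n. v e i + (\<Sum>j<n. m e i j * v e j) = b e i) \<and>
    (\<forall>i<n. ((\<lambda>e. (v e i - b e i) / e) \<longlongrightarrow> 0) (at_right (0::real)))"
proof -
  define Q where "Q e w \<longleftrightarrow> (\<forall>i<n. w i + (\<Sum>j<n. m e i j * w j) = b e i) \<and> (\<forall>i<n. \<bar>w i\<bar> \<le> 2 * B)"
    for e and w :: "nat \<Rightarrow> real"
  define v where "v e = (SOME w. Q e w)" for e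
  define r where "r = min (min 1 \<delta>) (1 / (2 * c))"
  have r: "0 < r" using assms(3,4) by (simp add: r_def)
  have Q: "Q e (v e)" if e: "0 < e" "e < r" for e
  proof -
    have ce: "c * e \<le> 1 / 2" using e assms(4) by (simp add: r_def field_simps)
    have "c * e\<^sup>2 \<le> 1 / 2"
    proof -
      have "c * e\<^sup>2 = c * e * e" by (simp add: power2_eq_square)
      also have "\<dots> \<le> 1 / 2 * 1" using ce e assms(4) by (intro mult_mono) (auto simp: r_def)
      finally show ?thesis by simp
    qed
    hence "(\<Sum>j<n. \<bar>m e i j\<bar>) \<le> 1 / 2" if "i < n" for i
      using m[of e i] e that by (simp add: r_def)
    hence "\<exists>w. Q e w"
      unfolding Q_def using b[of e] e assms(5) by (intro small_linear_system) (simp_all add: r_def)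
    thus ?thesis unfolding v_def by (rule someI_ex)
  qed
  have ev: "\<forall>\<^sub>F e in at_right 0. Q e (v e) \<and> 0 < e \<and> e < r"
    using Q r by (intro eventually_at_rightI[of 0 r]) auto
  have "((\<lambda>e. (v e i - b e i) / e) \<longlongrightarrow> 0) (at_right 0)" if i: "i < n" for i
  proof (rule Lim_null_comparison)
    show "\<forall>\<^sub>F e in at_right 0. norm ((v e i - b e i) / e) \<le> 2 * B * c * e"
      using ev
    proof eventually_elim
      case (elim e)
      have "v e i - b e i = - (\<Sum>j<n. m e i j * v e j)"
        using elim i by (auto simp: Q_def algebra_simps)
      hence "\<bar>v e i - b e i\<bar> = \<bar>\<Sum>j<n. m e i j * v e j\<bar>" by simp
      also have "\<dots> \<le> (\<Sum>j<n. \<bar>m e i j\<bar> * (2 * B))"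
        using elim by (intro order.trans[OF sum_abs sum_mono]) (auto simp: abs_mult Q_def intro!: mult_left_mono)
      also have "\<dots> \<le> c * e\<^sup>2 * (2 * B)"
        unfolding sum_distrib_right[symmetric] using m[of e i] elim i assms(5)
        by (intro mult_right_mono) (auto simp: r_def)
      finally show ?case using elim by (simp add: field_simps power2_eq_square)
    qed
    show "((\<lambda>e. 2 * B * c * e) \<longlongrightarrow> 0) (at_right 0)"
      by (auto intro!: tendsto_eq_intros)
  qed
  moreover have "\<forall>\<^sub>F e in at_right 0. \<forall>i<n. v e i + (\<Sum>j<n. m e i j * v e j) = b e i"
    using ev by eventually_elim (simp add: Q_def)
  ultimately show ?thesis by blast
qed

text \<open>A common factor of the components enters the Wronskian with its cube, and the Wronskian
  of (1, x, y) is x' y'' - x'' y'.\<close>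

lemma wronskian_quotient:
  fixes p :: "real poly ^ 3"
  assumes "open S" "t \<in> S"
    and x: "\<And>s. s \<in> S \<Longrightarrow> poly (p $ 2) s = poly (p $ 1) s * x s"
      "\<And>s. s \<in> S \<Longrightarrow> (x has_real_derivative x' s) (at s)" "(x' has_real_derivative x'') (at t)"
    and y: "\<And>s. s \<in> S \<Longrightarrow> poly (p $ 3) s = poly (p $ 1) s * y s"
      "\<And>s. s \<in> S \<Longrightarrow> (y has_real_derivative y' s) (at s)" "(y' has_real_derivative y'') (at t)"
  shows "poly (wronskian p) t = poly (p $ 1) t ^ 3 * (x' t * y'' - x'' * y' t)"
proof -
  have d1: "poly (pderiv q) s = poly (pderiv (p $ 1)) s * z s + poly (p $ 1) s * z' s"
    if "s \<in> S" "\<And>s. s \<in> S \<Longrightarrow> poly q s = poly (p $ 1) s * z s"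
      "(z has_real_derivative z' s) (at s)" for q z z' s
  proof -
    have "((\<lambda>s. poly (p $ 1) s * z s) has_real_derivative
        (poly (pderiv (p $ 1)) s * z s + z' s * poly (p $ 1) s)) (at s)"
      using that(3) by (intro DERIV_mult poly_DERIV)
    hence "(poly q has_real_derivative (poly (pderiv (p $ 1)) s * z s + z' s * poly (p $ 1) s)) (at s)"
      by (rule has_field_derivative_transform_within_open[OF _ assms(1) that(1)]) (simp add: that(2))
    from DERIV_unique[OF poly_DERIV this] show ?thesis by simp
  qed
  have d2: "poly (pderiv (pderiv q)) t = poly (pderiv (pderiv (p $ 1))) t * z t
      + 2 * poly (pderiv (p $ 1)) t * z' t + poly (p $ 1) t * z''"
    if "\<And>s. s \<in> S \<Longrightarrow> poly q s = poly (p $ 1) s * z s"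
      "\<And>s. s \<in> S \<Longrightarrow> (z has_real_derivative z' s) (at s)" "(z' has_real_derivative z'') (at t)" for q z z' z''
  proof -
    have "((\<lambda>s. poly (pderiv (p $ 1)) s * z s + poly (p $ 1) s * z' s) has_real_derivative
        (poly (pderiv (pderiv (p $ 1))) t * z t + z' t * poly (pderiv (p $ 1)) t
          + (poly (pderiv (p $ 1)) t * z' t + z'' * poly (p $ 1) t))) (at t)"
      using that(2)[OF assms(2)] that(3) by (intro DERIV_add DERIV_mult poly_DERIV)
    hence "(poly (pderiv q) has_real_derivative
        (poly (pderiv (pderiv (p $ 1))) t * z t + z' t * poly (pderiv (p $ 1)) t
          + (poly (pderiv (p $ 1)) t * z' t + z'' * poly (p $ 1) t))) (at t)"
      by (rule has_field_derivative_transform_within_open[OF _ assms(1,2)]) (metis d1 that(1,2))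
    from DERIV_unique[OF poly_DERIV this] show ?thesis by (simp add: algebra_simps)
  qed
  show ?thesis
    unfolding wronskian_def det3_def
    by (simp add: x(1)[OF assms(2)] y(1)[OF assms(2)] d1[OF assms(2), of "p $ 2" x x', OF x(1) x(2)[OF assms(2)]]
      d1[OF assms(2), of "p $ 3" y y', OF y(1) y(2)[OF assms(2)]]
      d2[of "p $ 2" x x' x'', OF x] d2[of "p $ 3" y y' y'', OF y] power3_eq_cube algebra_simps)
qed

definition base_poly :: "nat \<Rightarrow> 'a :: real_field poly" where
  "base_poly n = (\<Prod>j<n. [:- of_nat j, 1:])"

text \<open>The numerator of t^c + e^2 (sum of v_j / (t - j)) over the common denominator
  \<open>base_poly n\<close>.\<close>

definition pole_poly :: "nat \<Rightarrow> real \<Rightarrow> nat \<Rightarrow> (nat \<Rightarrow> real) \<Rightarrow> 'a :: real_field poly" where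
  "pole_poly n e c v = monom 1 c * base_poly n
     + (\<Sum>j<n. smult (of_real (e\<^sup>2 * v j)) (\<Prod>k\<in>{..<n} - {j}. [:- of_nat k, 1:]))"

lemma cpoly_prod: "cpoly (\<Prod>j\<in>S. g j) = (\<Prod>j\<in>S. cpoly (g j))"
  by (induction S rule: infinite_finite_induct) (simp_all add: cpoly_simps)

lemma cpoly_sum: "cpoly (\<Sum>j\<in>S. g j) = (\<Sum>j\<in>S. cpoly (g j))"
  by (induction S rule: infinite_finite_induct) (simp_all add: cpoly_simps)

lemma cpoly_base_poly: "cpoly (base_poly n) = base_poly n"
  by (simp add: base_poly_def cpoly_prod map_poly_pCons)

lemma cpoly_pole_poly: "cpoly (pole_poly n e c v) = pole_poly n e c v"
  by (simp add: pole_poly_def cpoly_simps cpoly_prod cpoly_sum map_poly_smult map_poly_pCons map_poly_monom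
    cpoly_base_poly)

lemma poly_base_poly: "poly (base_poly n) t = (\<Prod>j<n. t - of_nat j)"
  by (simp add: base_poly_def poly_prod)

lemma poly_pole_poly:
  fixes t :: "'a :: real_field"
  assumes "\<And>j. j < n \<Longrightarrow> t \<noteq> of_nat j"
  shows "poly (pole_poly n e c v) t
    = poly (base_poly n) t * (t ^ c + of_real (e\<^sup>2) * (\<Sum>j<n. of_real (v j) / (t - of_nat j)))"
proof -
  have "(\<Prod>k\<in>{..<n} - {j}. t - of_nat k) = poly (base_poly n) t / (t - of_nat j)" if "j < n" for j
    using assms[OF that] that by (simp add: poly_base_poly prod.remove[of "{..<n}" j])
  hence "(\<Sum>j<n. of_real (e\<^sup>2 * v j) * (\<Prod>k\<in>{..<n} - {j}. t - of_nat k))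
      = (\<Sum>j<n. poly (base_poly n) t * (of_real (e\<^sup>2) * (of_real (v j) / (t - of_nat j))))"
    by (intro sum.cong) auto
  thus ?thesis
    by (simp add: pole_poly_def poly_sum poly_prod poly_monom distrib_left sum_distrib_left mult.commute)
qed

text \<open>Only the residue of the pole itself survives, so quotients of components at a pole are
  quotients of residues.\<close>

lemma poly_pole_poly_pole:
  assumes "i < n"
  shows "poly (pole_poly n e c v) (of_nat i :: 'a :: real_field)
    = of_real (e\<^sup>2 * v i) * (\<Prod>k\<in>{..<n} - {i}. of_nat i - of_nat k)"
proof -
  have "(\<Sum>j<n. of_real (e\<^sup>2 * v j) * (\<Prod>k\<in>{..<n} - {j}. (of_nat i :: 'a) - of_nat k))
      = (\<Sum>j<n. if j = i then of_real (e\<^sup>2 * v i) * (\<Prod>k\<in>{..<n} - {i}. of_nat i - of_nat k) else 0)"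
    using assms by (intro sum.cong) (auto intro!: bexI[of _ i])
  moreover have "poly (base_poly n) (of_nat i :: 'a) = 0"
    using assms by (auto simp: poly_base_poly intro!: bexI[of _ i])
  ultimately show ?thesis
    using assms by (simp add: pole_poly_def poly_sum poly_prod)
qed

lemma degree_base_poly: "degree (base_poly n :: 'a :: real_field poly) = n" "lead_coeff (base_poly n :: 'a poly) = 1"
proof -
  show "degree (base_poly n :: 'a poly) = n" by (simp add: base_poly_def degree_prod_sum_eq)
  show "lead_coeff (base_poly n :: 'a poly) = 1" unfolding base_poly_def lead_coeff_prod by simp
qed

lemma degree_pole_poly: "degree (pole_poly n e c v :: 'a :: real_field poly) = n + c"
proof -
  have nz: "base_poly n \<noteq> (0 :: 'a poly)" using degree_base_poly(2)[of n, where 'a = 'a] by auto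
  have main: "degree (monom 1 c * base_poly n :: 'a poly) = n + c"
    using nz by (simp add: degree_mult_eq degree_monom_eq degree_base_poly)
  show ?thesis
  proof (cases "n = 0")
    case False
    have "degree (\<Sum>j<n. smult (of_real (e\<^sup>2 * v j)) (\<Prod>k\<in>{..<n} - {j}. [:- of_nat k, 1 :: 'a:])) \<le> n - 1"
      by (intro degree_sum_le order.trans[OF degree_smult_le]) (auto simp: degree_prod_sum_eq)
    thus ?thesis unfolding pole_poly_def using main False by (subst degree_add_eq_left) auto
  qed (use main in \<open>simp add: pole_poly_def\<close>)
qed

text \<open>For \<open>i < \<kappa>\<close> the equations say that both affine coordinates have
  derivative 0 at \<open>i + e\<close>, where the summand of pole \<open>i\<close> is the bare
  residue because (t - i)^2 = e^2. For the other \<open>i\<close> the residues (1, 2 i) are the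
  direction of the tangent of the conic. The last limit measures the first-order deviation from that
  direction.\<close>

lemma tangent_coefficients:
  fixes n \<kappa> :: nat
  shows "\<exists>V U. (\<forall>\<^sub>F e in at_right 0. \<forall>i<n. i < \<kappa> \<longrightarrow>
      1 - V e i - e\<^sup>2 * (\<Sum>j\<in>{..<n} - {i}. V e j / (real i + e - real j)\<^sup>2) = 0 \<and>
      2 * (real i + e) - U e i - e\<^sup>2 * (\<Sum>j\<in>{..<n} - {i}. U e j / (real i + e - real j)\<^sup>2) = 0) \<and>
    (\<forall>\<^sub>F e in at_right 0. \<forall>i<n. \<kappa> \<le> i \<longrightarrow> V e i = 1 \<and> U e i = 2 * real i) \<and>
    (\<forall>i<n. ((\<lambda>e. V e i) \<longlongrightarrow> 1) (at_right 0) \<and> ((\<lambda>e. U e i) \<longlongrightarrow> 2 * real i) (at_right 0) \<and>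
      ((\<lambda>e. (U e i - 2 * real i * V e i) / e) \<longlongrightarrow> (if i < \<kappa> then 2 else 0)) (at_right (0::real)))"
proof -
  define m where "m e i j = (if i < \<kappa> \<and> j \<noteq> i then e\<^sup>2 / (real i + e - real j)\<^sup>2 else 0)" for e :: real and i j
  define bU where "bU e i = 2 * real i + (if i < \<kappa> then 2 * e else 0)" for e :: real and i
  \<comment> \<open>Different poles are at distance at least 1/2 from \<open>i + e\<close>, whence
    the 4; the summand 1 keeps the constant positive for \<open>n = 0\<close>.\<close>
  have m: "(\<Sum>j<n. \<bar>m e i j\<bar>) \<le> (4 * real n + 1) * e\<^sup>2" if e: "0 < e" "e < 1 / 2" for e i
  proof -
    have "\<bar>m e i j\<bar> \<le> 4 * e\<^sup>2" for j
    proof (cases "i < \<kappa> \<and> j \<noteq> i")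
      case True
      have "1 \<le> \<bar>real i - real j\<bar>" using True by linarith
      hence "1 / 2 \<le> \<bar>real i + e - real j\<bar>" using e by linarith
      hence "(1 / 2)\<^sup>2 \<le> (real i + e - real j)\<^sup>2" by (simp add: abs_le_square_iff[symmetric])
      hence q: "1 / 4 \<le> (real i + e - real j)\<^sup>2" by (simp add: power2_eq_square)
      hence "e\<^sup>2 * 1 \<le> e\<^sup>2 * (4 * (real i + e - real j)\<^sup>2)" by (intro mult_left_mono) auto
      hence "e\<^sup>2 / (real i + e - real j)\<^sup>2 \<le> 4 * e\<^sup>2" using q by (subst pos_divide_le_eq) (linarith, simp)
      thus ?thesis using True by (simp add: m_def)
    qed (auto simp: m_def)
    hence "(\<Sum>j<n. \<bar>m e i j\<bar>) \<le> (\<Sum>j<n. 4 * e\<^sup>2)" by (intro sum_mono)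
    also have "\<dots> \<le> (4 * real n + 1) * e\<^sup>2" by (simp add: algebra_simps)
    finally show ?thesis .
  qed
  have m_sum: "(\<Sum>j<n. m e i j * v j) = (if i < \<kappa> then e\<^sup>2 * (\<Sum>j\<in>{..<n} - {i}. v j / (real i + e - real j)\<^sup>2) else 0)"
    if "i < n" for e i and v :: "nat \<Rightarrow> real"
    using that by (simp add: m_def sum.remove[of "{..<n}" i] sum_distrib_left)
  obtain V where V: "\<forall>\<^sub>F e in at_right 0. \<forall>i<n. V e i + (\<Sum>j<n. m e i j * V e j) = 1"
    "\<And>i. i < n \<Longrightarrow> ((\<lambda>e. (V e i - 1) / e) \<longlongrightarrow> 0) (at_right (0::real))"
    using perturbed_linear_system[of n "\<lambda>_ _. 1" 1 "1 / 2" m "4 * real n + 1"] m by auto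
  obtain U where U: "\<forall>\<^sub>F e in at_right 0. \<forall>i<n. U e i + (\<Sum>j<n. m e i j * U e j) = bU e i"
    "\<And>i. i < n \<Longrightarrow> ((\<lambda>e. (U e i - bU e i) / e) \<longlongrightarrow> 0) (at_right (0::real))"
  proof -
    have "\<bar>bU e i\<bar> \<le> 2 * real n + 2" if "0 < e" "e < 1" "i < n" for e i
    proof -
      have "real i < real n" using that by simp
      thus ?thesis using that by (auto simp: bU_def)
    qed
    thus ?thesis
      using that perturbed_linear_system[of n bU "2 * real n + 2" "1 / 2" m "4 * real n + 1"] m by auto
  qed
  have e0: "((\<lambda>e. e) \<longlongrightarrow> (0::real)) (at_right 0)" by (rule tendsto_ident_at)
  have pos: "\<forall>\<^sub>F e in at_right (0::real). e \<noteq> 0" by (auto simp: eventually_at_filter)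
  have lim: "((\<lambda>e. V e i) \<longlongrightarrow> 1) (at_right 0)" "((\<lambda>e. U e i) \<longlongrightarrow> 2 * real i) (at_right 0)"
    "((\<lambda>e. (U e i - 2 * real i * V e i) / e) \<longlongrightarrow> (if i < \<kappa> then 2 else 0)) (at_right (0::real))"
    if i: "i < n" for i
  proof -
    have "((\<lambda>e. 1 + e * ((V e i - 1) / e)) \<longlongrightarrow> 1 + 0 * 0) (at_right 0)"
      by (intro tendsto_intros e0 V(2) i)
    hence "((\<lambda>e. 1 + e * ((V e i - 1) / e)) \<longlongrightarrow> 1) (at_right 0)" by simp
    thus "((\<lambda>e. V e i) \<longlongrightarrow> 1) (at_right 0)"
      by (rule Lim_transform_eventually) (rule eventually_mono[OF pos], simp)
    have "((\<lambda>e. 2 * real i + (if i < \<kappa> then 2 * e else 0) + e * ((U e i - bU e i) / e))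
        \<longlongrightarrow> 2 * real i + (if i < \<kappa> then 2 * 0 else 0) + 0 * 0) (at_right 0)"
      by (cases "i < \<kappa>"; simp only: if_True if_False; intro tendsto_intros e0 U(2) i)
    hence "((\<lambda>e. 2 * real i + (if i < \<kappa> then 2 * e else 0) + e * ((U e i - bU e i) / e))
        \<longlongrightarrow> 2 * real i) (at_right 0)" by (cases "i < \<kappa>") simp_all
    thus "((\<lambda>e. U e i) \<longlongrightarrow> 2 * real i) (at_right 0)"
      by (rule Lim_transform_eventually) (rule eventually_mono[OF pos], simp add: bU_def)
    have "((\<lambda>e. (U e i - bU e i) / e - 2 * real i * ((V e i - 1) / e) + (if i < \<kappa> then 2 else 0))
        \<longlongrightarrow> 0 - 2 * real i * 0 + (if i < \<kappa> then 2 else 0)) (at_right 0)"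
      by (intro tendsto_intros U(2) V(2) i)
    hence "((\<lambda>e. (U e i - bU e i) / e - 2 * real i * ((V e i - 1) / e) + (if i < \<kappa> then 2 else 0))
        \<longlongrightarrow> (if i < \<kappa> then 2 else 0)) (at_right 0)" by simp
    thus "((\<lambda>e. (U e i - 2 * real i * V e i) / e) \<longlongrightarrow> (if i < \<kappa> then 2 else 0)) (at_right (0::real))"
      by (rule Lim_transform_eventually) (rule eventually_mono[OF pos], simp add: bU_def field_simps)
  qed
  show ?thesis
  proof (rule exI[of _ V], rule exI[of _ U], intro conjI)
    show "\<forall>\<^sub>F e in at_right 0. \<forall>i<n. i < \<kappa> \<longrightarrow>
      1 - V e i - e\<^sup>2 * (\<Sum>j\<in>{..<n} - {i}. V e j / (real i + e - real j)\<^sup>2) = 0 \<and>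
      2 * (real i + e) - U e i - e\<^sup>2 * (\<Sum>j\<in>{..<n} - {i}. U e j / (real i + e - real j)\<^sup>2) = 0"
      using V(1) U(1)
    proof eventually_elim
      case (elim e)
      show ?case
      proof (intro allI impI)
        fix i assume i: "i < n" "i < \<kappa>"
        have "V e i + (\<Sum>j<n. m e i j * V e j) = 1" "U e i + (\<Sum>j<n. m e i j * U e j) = bU e i"
          using elim i(1) by blast+
        thus "1 - V e i - e\<^sup>2 * (\<Sum>j\<in>{..<n} - {i}. V e j / (real i + e - real j)\<^sup>2) = 0 \<and>
          2 * (real i + e) - U e i - e\<^sup>2 * (\<Sum>j\<in>{..<n} - {i}. U e j / (real i + e - real j)\<^sup>2) = 0"
          unfolding m_sum[OF i(1)] bU_def using i(2) by (simp add: algebra_simps)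
      qed
    qed
    show "\<forall>\<^sub>F e in at_right 0. \<forall>i<n. \<kappa> \<le> i \<longrightarrow> V e i = 1 \<and> U e i = 2 * real i"
      using V(1) U(1) by eventually_elim (auto simp: m_sum bU_def)
  qed (use lim in blast)
qed

section \<open>The perturbed conic near its points of contact\<close>

locale tangent_config =
  fixes n \<kappa> :: nat and V U :: "real \<Rightarrow> nat \<Rightarrow> real"
  assumes n: "1 \<le> n" "\<kappa> \<le> n"
    and cusp_eq: "\<forall>\<^sub>F e in at_right 0. \<forall>i<n. i < \<kappa> \<longrightarrow>
      1 - V e i - e\<^sup>2 * (\<Sum>j\<in>{..<n} - {i}. V e j / (real i + e - real j)\<^sup>2) = 0 \<and>
      2 * (real i + e) - U e i - e\<^sup>2 * (\<Sum>j\<in>{..<n} - {i}. U e j / (real i + e - real j)\<^sup>2) = 0"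
    and noncusp_eq: "\<forall>\<^sub>F e in at_right 0. \<forall>i<n. \<kappa> \<le> i \<longrightarrow> V e i = 1 \<and> U e i = 2 * real i"
    and V_lim: "i < n \<Longrightarrow> ((\<lambda>e. V e i) \<longlongrightarrow> 1) (at_right 0)"
    and U_lim: "i < n \<Longrightarrow> ((\<lambda>e. U e i) \<longlongrightarrow> 2 * real i) (at_right 0)"
    and UV_lim: "i < n \<Longrightarrow> ((\<lambda>e. (U e i - 2 * real i * V e i) / e) \<longlongrightarrow> (if i < \<kappa> then 2 else 0)) (at_right (0::real))"
begin

definition p :: "real \<Rightarrow> real poly ^ 3" where
  "p e = vector [base_poly n, pole_poly n e 1 (V e), pole_poly n e 2 (U e)]"

lemma p_nth: "p e $ 1 = base_poly n" "p e $ 2 = pole_poly n e 1 (V e)" "p e $ 3 = pole_poly n e 2 (U e)"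
  by (simp_all add: p_def)

text \<open>The contribution of the other poles at \<open>i + e z\<close>, bounded as
  \<open>e\<close> tends to 0. It is used with real \<open>z\<close> for flexes, complex
  \<open>z\<close> for solitary points and \<open>z = e / u\<close> for nodes.\<close>

definition tail :: "real \<Rightarrow> (nat \<Rightarrow> real) \<Rightarrow> nat \<Rightarrow> nat \<Rightarrow> 'a :: real_normed_field \<Rightarrow> 'a" where
  "tail e v i c z = (\<Sum>j\<in>{..<n} - {i}. of_real (v j) / (of_nat i + of_real e * z - of_nat j) ^ c)"

lemma tendsto_tail:
  fixes z :: "'b \<Rightarrow> 'a :: real_normed_field"
  assumes "filterlim e (at_right 0) H" "(z \<longlongrightarrow> z0) H" "\<And>j. j < n \<Longrightarrow> ((\<lambda>e. v e j) \<longlongrightarrow> l j) (at_right 0)"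
  shows "((\<lambda>h. tail (e h) (v (e h)) i c (z h)) \<longlongrightarrow> (\<Sum>j\<in>{..<n} - {i}. of_real (l j) / (of_nat i - of_nat j) ^ c)) H"
proof -
  have e: "(e \<longlongrightarrow> 0) H" using assms(1) by (simp add: filterlim_at)
  have "((\<lambda>h. tail (e h) (v (e h)) i c (z h)) \<longlongrightarrow>
      (\<Sum>j\<in>{..<n} - {i}. of_real (l j) / (of_nat i + of_real 0 * z0 - of_nat j) ^ c)) H"
    unfolding tail_def
    by (intro tendsto_intros e assms(2) filterlim_compose[OF assms(3) assms(1)]) auto
  thus ?thesis by simp
qed

lemma sum_split:
  fixes g :: "nat \<Rightarrow> 'a :: real_normed_field"
  assumes "i < n"
  shows "(\<Sum>j<n. g j) = g i + (\<Sum>j\<in>{..<n} - {i}. g j)"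
  using assms by (simp add: sum.remove)

lemma poly_p:
  assumes "\<And>j. j < n \<Longrightarrow> t \<noteq> real j"
  shows "poly (p e $ 2) t = poly (p e $ 1) t * (t + e\<^sup>2 * (\<Sum>j<n. V e j / (t - real j)))"
    "poly (p e $ 3) t = poly (p e $ 1) t * (t\<^sup>2 + e\<^sup>2 * (\<Sum>j<n. U e j / (t - real j)))"
  using poly_pole_poly[of n t e 1 "V e"] poly_pole_poly[of n t e 2 "U e"] assms by (simp_all add: p_nth)

lemma poly_cp:
  assumes "\<And>j. j < n \<Longrightarrow> t \<noteq> of_nat j"
  shows "poly (cpoly (p e $ 2)) t = poly (cpoly (p e $ 1)) t * (t + of_real (e\<^sup>2) * (\<Sum>j<n. of_real (V e j) / (t - of_nat j)))"
    "poly (cpoly (p e $ 3)) t = poly (cpoly (p e $ 1)) t * (t\<^sup>2 + of_real (e\<^sup>2) * (\<Sum>j<n. of_real (U e j) / (t - of_nat j)))"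
  using poly_pole_poly[of n t e 1 "V e"] poly_pole_poly[of n t e 2 "U e"] assms
  by (simp_all add: p_nth cpoly_pole_poly cpoly_base_poly)

definition X' where "X' e t = 1 - e\<^sup>2 * (\<Sum>j<n. V e j / (t - real j)\<^sup>2)"
definition Y' where "Y' e t = 2 * t - e\<^sup>2 * (\<Sum>j<n. U e j / (t - real j)\<^sup>2)"
definition X'' where "X'' e t = 2 * e\<^sup>2 * (\<Sum>j<n. V e j / (t - real j) ^ 3)"
definition Y'' where "Y'' e t = 2 + 2 * e\<^sup>2 * (\<Sum>j<n. U e j / (t - real j) ^ 3)"

lemma inverse_sum_derivs:
  assumes "\<And>j. j < n \<Longrightarrow> t \<noteq> real j"
  shows "((\<lambda>t. \<Sum>j<n. v j / (t - real j)) has_real_derivative - (\<Sum>j<n. v j / (t - real j)\<^sup>2)) (at t)"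
    "((\<lambda>t. \<Sum>j<n. v j / (t - real j)\<^sup>2) has_real_derivative - 2 * (\<Sum>j<n. v j / (t - real j) ^ 3)) (at t)"
proof -
  have "((\<lambda>t. v j / (t - real j)) has_real_derivative - (v j / (t - real j)\<^sup>2)) (at t)" if "j < n" for j
    using assms[OF that] by (auto intro!: derivative_eq_intros simp: power2_eq_square divide_simps)
  hence "((\<lambda>t. \<Sum>j<n. v j / (t - real j)) has_real_derivative (\<Sum>j<n. - (v j / (t - real j)\<^sup>2))) (at t)"
    by (intro DERIV_sum) simp
  thus "((\<lambda>t. \<Sum>j<n. v j / (t - real j)) has_real_derivative - (\<Sum>j<n. v j / (t - real j)\<^sup>2)) (at t)"
    by (simp add: sum_negf)
  have "((\<lambda>t. v j / (t - real j)\<^sup>2) has_real_derivative - 2 * (v j / (t - real j) ^ 3)) (at t)" if "j < n" for j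
    using assms[OF that]
    by (auto intro!: derivative_eq_intros simp: power2_eq_square power3_eq_cube divide_simps)
  hence "((\<lambda>t. \<Sum>j<n. v j / (t - real j)\<^sup>2) has_real_derivative (\<Sum>j<n. - 2 * (v j / (t - real j) ^ 3))) (at t)"
    by (intro DERIV_sum) simp
  thus "((\<lambda>t. \<Sum>j<n. v j / (t - real j)\<^sup>2) has_real_derivative - 2 * (\<Sum>j<n. v j / (t - real j) ^ 3)) (at t)"
    by (simp only: sum_distrib_left)
qed

lemma poly_wronskian_p:
  assumes "\<And>j. j < n \<Longrightarrow> t \<noteq> real j"
  shows "poly (wronskian (p e)) t = poly (p e $ 1) t ^ 3 * (X' e t * Y'' e t - X'' e t * Y' e t)"
proof (rule wronskian_quotient[of "- (real ` {..<n})"])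
  show "open (- (real ` {..<n}))" by (intro open_Compl finite_imp_closed) simp
  show "t \<in> - (real ` {..<n})" using assms by auto
  fix s assume "s \<in> - (real ` {..<n})"
  hence s: "s \<noteq> real j" if "j < n" for j using that by auto
  show "poly (p e $ 2) s = poly (p e $ 1) s * (s + e\<^sup>2 * (\<Sum>j<n. V e j / (s - real j)))"
    "poly (p e $ 3) s = poly (p e $ 1) s * (s\<^sup>2 + e\<^sup>2 * (\<Sum>j<n. U e j / (s - real j)))"
    using poly_p s by blast+
  show "((\<lambda>s. s + e\<^sup>2 * (\<Sum>j<n. V e j / (s - real j))) has_real_derivative X' e s) (at s)"
    "((\<lambda>s. s\<^sup>2 + e\<^sup>2 * (\<Sum>j<n. U e j / (s - real j))) has_real_derivative Y' e s) (at s)"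
  proof -
    have "((\<lambda>s. s + e\<^sup>2 * (\<Sum>j<n. V e j / (s - real j))) has_real_derivative
        1 + e\<^sup>2 * - (\<Sum>j<n. V e j / (s - real j)\<^sup>2)) (at s)"
      by (intro DERIV_add DERIV_ident DERIV_cmult inverse_sum_derivs(1) s)
    thus "((\<lambda>s. s + e\<^sup>2 * (\<Sum>j<n. V e j / (s - real j))) has_real_derivative X' e s) (at s)"
      by (simp add: X'_def)
    have "((\<lambda>s. s\<^sup>2) has_real_derivative 2 * s) (at s)" by (auto intro!: derivative_eq_intros)
    hence "((\<lambda>s. s\<^sup>2 + e\<^sup>2 * (\<Sum>j<n. U e j / (s - real j))) has_real_derivative
        2 * s + e\<^sup>2 * - (\<Sum>j<n. U e j / (s - real j)\<^sup>2)) (at s)"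
      by (intro DERIV_add DERIV_cmult inverse_sum_derivs(1) s)
    thus "((\<lambda>s. s\<^sup>2 + e\<^sup>2 * (\<Sum>j<n. U e j / (s - real j))) has_real_derivative Y' e s) (at s)"
      by (simp add: Y'_def)
  qed
next
  show "(X' e has_real_derivative X'' e t) (at t)" "(Y' e has_real_derivative Y'' e t) (at t)"
  proof -
    have "((\<lambda>s. 1 - e\<^sup>2 * (\<Sum>j<n. V e j / (s - real j)\<^sup>2)) has_real_derivative
        0 - e\<^sup>2 * (- 2 * (\<Sum>j<n. V e j / (t - real j) ^ 3))) (at t)"
      by (intro DERIV_diff DERIV_const DERIV_cmult inverse_sum_derivs(2) assms)
    thus "(X' e has_real_derivative X'' e t) (at t)"
      by (simp add: X'_def[abs_def] X''_def mult_ac)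
    have "((\<lambda>s. 2 * s) has_real_derivative 2) (at t)" by (auto intro!: derivative_eq_intros)
    hence "((\<lambda>s. 2 * s - e\<^sup>2 * (\<Sum>j<n. U e j / (s - real j)\<^sup>2)) has_real_derivative
        2 - e\<^sup>2 * (- 2 * (\<Sum>j<n. U e j / (t - real j) ^ 3))) (at t)"
      by (intro DERIV_diff DERIV_cmult inverse_sum_derivs(2) assms)
    thus "(Y' e has_real_derivative Y'' e t) (at t)"
      by (simp add: Y'_def[abs_def] Y''_def mult_ac)
  qed
qed

text \<open>With \<open>t = i + e s\<close> the zeros of the Wronskian near \<open>i\<close> tend to those of a cubic in \<open>s\<close>.\<close>

definition cubic :: "nat \<Rightarrow> real \<Rightarrow> real" where
  "cubic i s = s ^ 3 - 3 * s + (if i < \<kappa> then 2 else 0)"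

lemma eventually_not_pole:
  assumes "filterlim e (at_right 0) H" "(z \<longlongrightarrow> z0) H" "\<forall>\<^sub>F h in H. z h \<noteq> 0"
  shows "\<forall>\<^sub>F h in H. \<forall>j<n. of_nat i + of_real (e h) * z h \<noteq> (of_nat j :: 'a :: real_normed_field)"
proof -
  have e: "(e \<longlongrightarrow> 0) H" "\<forall>\<^sub>F h in H. e h \<noteq> 0" using assms(1) by (auto simp: filterlim_at elim: eventually_mono)
  have "\<forall>\<^sub>F h in H. of_nat i + of_real (e h) * z h \<noteq> (of_nat j :: 'a)" for j
  proof (cases "j = i")
    case True
    show ?thesis using e(2) assms(3) by eventually_elim (simp add: True)
  next
    case False
    have "((\<lambda>h. of_nat i + of_real (e h) * z h) \<longlongrightarrow> of_nat i + of_real 0 * z0) H"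
      by (intro tendsto_intros e(1) assms(2))
    hence "((\<lambda>h. of_nat i + of_real (e h) * z h) \<longlongrightarrow> (of_nat i :: 'a)) H" by simp
    thus ?thesis by (rule tendsto_imp_eventually_ne) (use False in simp)
  qed
  hence "\<forall>\<^sub>F h in H. \<forall>j\<in>{..<n}. of_nat i + of_real (e h) * z h \<noteq> (of_nat j :: 'a)"
    by (intro eventually_ball_finite) auto
  thus ?thesis by eventually_elim auto
qed

lemma at_right_facts:
  "filterlim (\<lambda>e. e) (at_right 0) (at_right (0::real))" "((\<lambda>e. e) \<longlongrightarrow> (0::real)) (at_right 0)"
  "\<forall>\<^sub>F e in at_right (0::real). 0 < e"
  by (auto simp: filterlim_ident tendsto_ident_at eventually_at_right_less)

lemma wronskian_limit:
  assumes i: "i < n" and s: "s \<noteq> 0"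
  shows "((\<lambda>e. poly (wronskian (p e)) (real i + e * s) / e ^ 3) \<longlongrightarrow>
     (\<Prod>j\<in>{..<n} - {i}. real i - real j) ^ 3 * (2 * cubic i s)) (at_right 0)"
proof -
  note e0 = at_right_facts(2)
  define a b c f where "a e = tail e (V e) i 2 s" and "b e = 2 * tail e (V e) i 3 s"
    and "c e = tail e (U e) i 2 s" and "f e = 2 * tail e (U e) i 3 s" for e
  have lim_tail: "\<exists>l. ((\<lambda>e. tail e (v e) i k s) \<longlongrightarrow> l) (at_right 0)"
    if "\<And>j. j < n \<Longrightarrow> ((\<lambda>e. v e j) \<longlongrightarrow> l j) (at_right 0)" for v k l
    by (rule exI, rule tendsto_tail[OF at_right_facts(1) tendsto_const that])
  obtain la lb lc lf where l: "(a \<longlongrightarrow> la) (at_right 0)" "(b \<longlongrightarrow> lb) (at_right 0)"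
    "(c \<longlongrightarrow> lc) (at_right 0)" "(f \<longlongrightarrow> lf) (at_right 0)"
  proof -
    obtain la where la: "((\<lambda>e. tail e (V e) i 2 s) \<longlongrightarrow> la) (at_right 0)" using lim_tail[OF V_lim] by (rule exE)
    obtain lb where lb: "((\<lambda>e. tail e (V e) i 3 s) \<longlongrightarrow> lb) (at_right 0)" using lim_tail[OF V_lim] by (rule exE)
    obtain lc where lc: "((\<lambda>e. tail e (U e) i 2 s) \<longlongrightarrow> lc) (at_right 0)" using lim_tail[OF U_lim] by (rule exE)
    obtain lf where lf: "((\<lambda>e. tail e (U e) i 3 s) \<longlongrightarrow> lf) (at_right 0)" using lim_tail[OF U_lim] by (rule exE)
    show ?thesis
      by (rule that[of la "2 * lb" lc "2 * lf"])
        (simp_all add: a_def[abs_def] b_def[abs_def] c_def[abs_def] f_def[abs_def] la lb lc lf tendsto_mult_left)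
  qed
  \<comment> \<open>This is X' Y'' - X'' Y' at \<open>i + e s\<close>. The terms of order 1/e are
    collected in the middle: their products of \<open>U\<close> and \<open>V\<close> cancel, and
    what is left has the limit given by \<open>UV_lim\<close>.\<close>
  define D where "D e = (1 - V e i / s\<^sup>2 - e\<^sup>2 * a e) * (2 + e\<^sup>2 * f e)
      + 2 / s ^ 3 * ((U e i - 2 * real i * V e i) / e - 2 * s * V e i + e * (c e * V e i - a e * U e i))
      - e\<^sup>2 * b e * (2 * (real i + e * s) - U e i / s\<^sup>2 - e\<^sup>2 * c e)" for e
  have "(D \<longlongrightarrow> (1 - 1 / s\<^sup>2 - 0\<^sup>2 * la) * (2 + 0\<^sup>2 * lf)
      + 2 / s ^ 3 * ((if i < \<kappa> then 2 else 0) - 2 * s * 1 + 0 * (lc * 1 - la * (2 * real i)))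
      - 0\<^sup>2 * lb * (2 * (real i + 0 * s) - 2 * real i / s\<^sup>2 - 0\<^sup>2 * lc)) (at_right 0)"
    unfolding D_def[abs_def] by (intro tendsto_intros e0 l V_lim[OF i] U_lim[OF i] UV_lim[OF i]) (use s in auto)
  hence D: "(D \<longlongrightarrow> 2 * (1 - 1 / s\<^sup>2) + 2 / s ^ 3 * ((if i < \<kappa> then 2 else 0) - 2 * s)) (at_right 0)"
    by simp
  have "((\<lambda>e. s ^ 3 * (\<Prod>j\<in>{..<n} - {i}. real i + e * s - real j) ^ 3 * D e) \<longlongrightarrow>
     s ^ 3 * (\<Prod>j\<in>{..<n} - {i}. real i + 0 * s - real j) ^ 3 *
       (2 * (1 - 1 / s\<^sup>2) + 2 / s ^ 3 * ((if i < \<kappa> then 2 else 0) - 2 * s))) (at_right 0)"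
    by (intro tendsto_intros e0 D)
  also have "s ^ 3 * (\<Prod>j\<in>{..<n} - {i}. real i + 0 * s - real j) ^ 3 *
       (2 * (1 - 1 / s\<^sup>2) + 2 / s ^ 3 * ((if i < \<kappa> then 2 else 0) - 2 * s))
     = (\<Prod>j\<in>{..<n} - {i}. real i - real j) ^ 3 * (2 * cubic i s)"
    using s by (simp add: cubic_def field_simps power2_eq_square power3_eq_cube)
  finally have lim: "((\<lambda>e. s ^ 3 * (\<Prod>j\<in>{..<n} - {i}. real i + e * s - real j) ^ 3 * D e) \<longlongrightarrow>
     (\<Prod>j\<in>{..<n} - {i}. real i - real j) ^ 3 * (2 * cubic i s)) (at_right 0)" .
  have "\<forall>\<^sub>F e in at_right 0. \<forall>j<n. real i + e * s \<noteq> real j"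
    using eventually_not_pole[OF at_right_facts(1) tendsto_const, of s i] s by simp
  with at_right_facts(3)
  have "\<forall>\<^sub>F e in at_right 0. s ^ 3 * (\<Prod>j\<in>{..<n} - {i}. real i + e * s - real j) ^ 3 * D e
      = poly (wronskian (p e)) (real i + e * s) / e ^ 3"
  proof eventually_elim
    case (elim e)
    define t where "t = real i + e * s"
    have t: "t - real i = e * s" "\<And>j. j < n \<Longrightarrow> t \<noteq> real j" using elim by (simp_all add: t_def)
    have x: "X' e t = 1 - V e i / s\<^sup>2 - e\<^sup>2 * a e" "X'' e t = 2 * V e i / (e * s ^ 3) + e\<^sup>2 * b e"
      "Y' e t = 2 * t - U e i / s\<^sup>2 - e\<^sup>2 * c e" "Y'' e t = 2 + 2 * U e i / (e * s ^ 3) + e\<^sup>2 * f e"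
      unfolding X'_def Y'_def X''_def Y''_def sum_split[OF i] t(1) a_def b_def c_def f_def tail_def
      using elim(1) s by (simp_all add: t_def algebra_simps power_mult_distrib power2_eq_square power3_eq_cube)
    have "X' e t * Y'' e t - X'' e t * Y' e t = D e"
    proof -
      have "(1 - v * q - e\<^sup>2 * a') * (2 + g * u * h + e\<^sup>2 * f') - (g * v * h + e\<^sup>2 * b') * (2 * w - u * q - e\<^sup>2 * c')
        = (1 - v * q - e\<^sup>2 * a') * (2 + e\<^sup>2 * f') + g * ((u - 2 * real i * v) * h - 2 * s * v + e * (c' * v - a' * u))
          - e\<^sup>2 * b' * (2 * w - u * q - e\<^sup>2 * c')"
        if "e * h = 1" "w = real i + e * s" for v u q g h a' b' c' f' w
        using that by algebra
      from this[of "1 / e" t "V e i" "1 / s\<^sup>2" "a e" "2 / s ^ 3" "U e i" "f e" "b e" "c e"]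
      show ?thesis unfolding x D_def using elim(1) by (simp add: t_def mult.commute)
    qed
    moreover have "poly (p e $ 1) t = e * s * (\<Prod>j\<in>{..<n} - {i}. t - real j)"
      using i t(1) by (simp add: p_nth poly_base_poly prod.remove[of "{..<n}" i])
    ultimately have "poly (wronskian (p e)) t = (e * s * (\<Prod>j\<in>{..<n} - {i}. t - real j)) ^ 3 * D e"
      using poly_wronskian_p[OF t(2), of e] by simp
    thus ?case using elim(1) by (simp add: t_def[symmetric] power_mult_distrib)
  qed
  thus ?thesis using lim by (rule Lim_transform_eventually[rotated])
qed

lemma flex_exists:
  assumes i: "i < n" and "l < u" "l \<noteq> 0" "u \<noteq> 0" "cubic i l * cubic i u < 0"
  shows "\<forall>\<^sub>F e in at_right 0. \<exists>x. real i + e * l < x \<and> x < real i + e * u \<and> poly (wronskian (p e)) x = 0"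
proof -
  let ?c = "(\<Prod>j\<in>{..<n} - {i}. real i - real j) ^ 3"
  have c: "?c \<noteq> 0" by auto
  have "((\<lambda>e. poly (wronskian (p e)) (real i + e * l) / e ^ 3 * (poly (wronskian (p e)) (real i + e * u) / e ^ 3)) \<longlongrightarrow>
     ?c * (2 * cubic i l) * (?c * (2 * cubic i u))) (at_right 0)"
    by (intro tendsto_mult wronskian_limit i assms)
  moreover have "?c * (2 * cubic i l) * (?c * (2 * cubic i u)) < 0"
  proof -
    have "?c * (2 * cubic i l) * (?c * (2 * cubic i u)) = 4 * (?c\<^sup>2 * (cubic i l * cubic i u))"
      by (simp add: power2_eq_square algebra_simps)
    moreover have "?c\<^sup>2 * (cubic i l * cubic i u) < 0"
      by (rule mult_pos_neg[OF _ assms(5)]) (use c in \<open>simp only: zero_less_power2 not_False_eq_True\<close>)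
    ultimately show ?thesis by linarith
  qed
  ultimately have "\<forall>\<^sub>F e in at_right 0. poly (wronskian (p e)) (real i + e * l) / e ^ 3 * (poly (wronskian (p e)) (real i + e * u) / e ^ 3) < 0"
    by (rule order_tendstoD(2))
  with at_right_facts(3) show ?thesis
  proof eventually_elim
    case (elim e)
    hence "poly (wronskian (p e)) (real i + e * l) * poly (wronskian (p e)) (real i + e * u) < 0"
      by (simp add: divide_less_0_iff mult_less_0_iff zero_less_mult_iff)
    from poly_IVT[OF _ this] show ?case using elim(1) assms(2) by simp
  qed
qed

end

lemma card_pairs: "card (SIGMA j:{..<n}. {..<j}) = n choose 2"
proof -
  have "card (SIGMA j:{..<n}. {..<j}) = (\<Sum>j<n. j)" by simp
  also have "\<dots> = n choose 2" by (induction n) (simp_all add: numeral_2_eq_2)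
  finally show ?thesis .
qed

context tangent_config
begin

text \<open>Isolating intervals for the simple roots of the cubic. For \<open>i < \<kappa>\<close>
  it is (s - 1)^2 (s + 2), with the cusp at the double root 1; otherwise its roots are 0 and the
  square roots of 3. The endpoints avoid 0, where the pole lies.\<close>

definition intervals :: "nat \<Rightarrow> (real \<times> real) set" where
  "intervals i = (if i < \<kappa> then {(-3, -1)} else {(-2, -1), (-1, 1), (1, 2)})"

lemma flexes_exist:
  "\<forall>\<^sub>F e in at_right 0. \<forall>(i, l, u)\<in>(SIGMA i:{..<n}. intervals i).
     \<exists>x. real i + e * l < x \<and> x < real i + e * u \<and> poly (wronskian (p e)) x = 0"
proof (rule eventually_ball_finite)
  show "finite (SIGMA i:{..<n}. intervals i)" by (simp add: intervals_def)
  show "\<forall>z\<in>(SIGMA i:{..<n}. intervals i). \<forall>\<^sub>F e in at_right 0. case z of (i, l, u) \<Rightarrow>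
     \<exists>x. real i + e * l < x \<and> x < real i + e * u \<and> poly (wronskian (p e)) x = 0"
  proof clarify
    fix i l u assume "i < n" "(l, u) \<in> intervals i"
    thus "\<forall>\<^sub>F e in at_right 0. \<exists>x. real i + e * l < x \<and> x < real i + e * u \<and> poly (wronskian (p e)) x = 0"
      by (intro flex_exists) (auto simp: intervals_def cubic_def split: if_splits)
  qed
qed

text \<open>When both affine coordinates have derivative 0, the derivative of the lift is the lift
  times the logarithmic derivative of the common denominator.\<close>

lemma cusps_exist:
  "\<forall>\<^sub>F e in at_right 0. \<forall>k<\<kappa>. \<exists>l. \<forall>i. poly (pderiv (p e $ i)) (real k + e) = l * poly (p e $ i) (real k + e)"
proof -
  have "\<forall>\<^sub>F e in at_right (0::real). e < 1" by (rule eventually_at_rightI[of 0 1]) auto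
  with at_right_facts(3) cusp_eq show ?thesis
  proof eventually_elim
    case (elim e)
    show ?case
    proof (intro allI impI)
      fix k assume k: "k < \<kappa>"
      hence kn: "k < n" using n by simp
      define t where "t = real k + e"
      have t: "t \<noteq> real j" for j
      proof
        assume "t = real j"
        hence "real k < real j" "real j < real (Suc k)" using elim by (auto simp: t_def)
        thus False unfolding of_nat_less_iff by simp
      qed
      have X: "X' e t = 0" "Y' e t = 0"
      proof -
        have "X' e t = 1 - V e k - e\<^sup>2 * (\<Sum>j\<in>{..<n} - {k}. V e j / (real k + e - real j)\<^sup>2)"
          "Y' e t = 2 * (real k + e) - U e k - e\<^sup>2 * (\<Sum>j\<in>{..<n} - {k}. U e j / (real k + e - real j)\<^sup>2)"
          unfolding X'_def Y'_def sum_split[OF kn] using elim(1) by (simp_all add: t_def algebra_simps)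
        thus "X' e t = 0" "Y' e t = 0" using elim(2) k kn by simp_all
      qed
      have der: "poly (pderiv q) t = poly (pderiv (p e $ 1)) t * z t"
        if "\<And>s. s \<in> - (real ` {..<n}) \<Longrightarrow> poly q s = poly (p e $ 1) s * z s" "(z has_real_derivative 0) (at t)" for q z
      proof -
        have "((\<lambda>s. poly (p e $ 1) s * z s) has_real_derivative
            (poly (pderiv (p e $ 1)) t * z t + 0 * poly (p e $ 1) t)) (at t)"
          using that(2) by (intro DERIV_mult poly_DERIV)
        hence "(poly q has_real_derivative (poly (pderiv (p e $ 1)) t * z t + 0 * poly (p e $ 1) t)) (at t)"
        proof (rule has_field_derivative_transform_within_open)
          show "open (- (real ` {..<n}))" by (intro open_Compl finite_imp_closed) simp
          show "t \<in> - (real ` {..<n})" using t by auto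
        qed (simp add: that(1))
        from DERIV_unique[OF poly_DERIV this] show ?thesis by simp
      qed
      have not_pole: "s \<noteq> real j" if "s \<in> - (real ` {..<n})" "j < n" for s j using that by auto
      have sq: "((\<lambda>s. s\<^sup>2) has_real_derivative 2 * t) (at t)" by (auto intro!: derivative_eq_intros)
      have dx: "((\<lambda>s. s + e\<^sup>2 * (\<Sum>j<n. V e j / (s - real j))) has_real_derivative 0) (at t)"
        using DERIV_add[OF DERIV_ident DERIV_cmult[OF inverse_sum_derivs(1)[OF t, of "V e"], of "e\<^sup>2"]] X(1)
        by (simp add: X'_def)
      have dy: "((\<lambda>s. s\<^sup>2 + e\<^sup>2 * (\<Sum>j<n. U e j / (s - real j))) has_real_derivative 0) (at t)"
        using DERIV_add[OF sq DERIV_cmult[OF inverse_sum_derivs(1)[OF t, of "U e"], of "e\<^sup>2"]] X(2)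
        by (simp add: Y'_def)
      have p1: "poly (p e $ 1) t \<noteq> 0" using t by (simp add: p_nth poly_base_poly)
      define l where "l = poly (pderiv (p e $ 1)) t / poly (p e $ 1) t"
      have "poly (pderiv (p e $ 1)) t = l * poly (p e $ 1) t" using p1 by (simp add: l_def)
      moreover have "poly (pderiv (p e $ 2)) t = l * poly (p e $ 2) t"
        using der[OF poly_p(1) dx] not_pole poly_p(1)[OF t, of e] p1 by (simp add: l_def)
      moreover have "poly (pderiv (p e $ 3)) t = l * poly (p e $ 3) t"
        using der[OF poly_p(2) dy] not_pole poly_p(2)[OF t, of e] p1 by (simp add: l_def)
      ultimately show "\<exists>l. \<forall>i. poly (pderiv (p e $ i)) (real k + e) = l * poly (p e $ i) (real k + e)"
        unfolding t_def[symmetric] forall_3 by blast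
    qed
  qed
qed

lemma Lim_at_right_fst:
  "filterlim fst (at_right 0) (at_right (0::real) \<times>\<^sub>F G)"
  by (rule filterlim_fst)

text \<open>Put \<open>z = i + e s\<close>. The first coordinate is i + e (s + 1/s) up to smaller
  terms, real for |s| = 1. The second minus \<open>2 i\<close> times the first is a real constant
  plus e^2 times s^2 and tails with real limits, so to leading order it is real for Re s = 0. Both
  hold near the imaginary unit.\<close>

lemma solitary_exist:
  assumes i: "i < n" "\<kappa> \<le> i"
  shows "\<forall>\<^sub>F e in at_right 0. \<exists>x\<in>{-1/10<..<1/10}. \<exists>y\<in>{1/2<..<2}. \<exists>z.
    z = of_nat i + of_real e * Complex x y \<and>
    Im (z + of_real (e\<^sup>2) * (\<Sum>j<n. of_real (V e j) / (z - of_nat j))) = 0 \<and>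
    Im (z\<^sup>2 + of_real (e\<^sup>2) * (\<Sum>j<n. of_real (U e j) / (z - of_nat j))) = 0"
proof -
  define g1 where "g1 e x y = Im ((Complex x y)\<^sup>2 + tail e (U e) i 1 (Complex x y)
      - of_nat (2 * i) * tail e (V e) i 1 (Complex x y))" for e x y
  define g2 where "g2 e x y = Im (Complex x y + of_real (V e i) / Complex x y
      + of_real e * tail e (V e) i 1 (Complex x y))" for e x y
  have cplx: "(\<lambda>(x, y). Complex x y) = (\<lambda>(x, y). of_real x + \<i> * of_real y)"
    by (auto simp: complex_eq_iff)
  have cont_C: "continuous_on S (\<lambda>(x, y). Complex x y)" for S
    unfolding cplx case_prod_unfold by (intro continuous_intros)
  have lim1: "((\<lambda>h. g1 (fst h) (xx h) (yy h)) \<longlongrightarrow> 2 * x * y) (at_right 0 \<times>\<^sub>F G)"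
    if "(xx \<longlongrightarrow> x) (at_right 0 \<times>\<^sub>F G)" "(yy \<longlongrightarrow> y) (at_right 0 \<times>\<^sub>F G)" for xx yy x y and G :: "real filter"
  proof -
    have C: "((\<lambda>h. Complex (xx h) (yy h)) \<longlongrightarrow> Complex x y) (at_right 0 \<times>\<^sub>F G)"
      using that by (rule tendsto_Complex)
    note tl = tendsto_tail[OF Lim_at_right_fst C]
    have "((\<lambda>h. g1 (fst h) (xx h) (yy h)) \<longlongrightarrow> Im ((Complex x y)\<^sup>2
        + (\<Sum>j\<in>{..<n} - {i}. of_real (2 * real j) / (of_nat i - of_nat j) ^ 1)
        - of_nat (2 * i) * (\<Sum>j\<in>{..<n} - {i}. of_real 1 / (of_nat i - of_nat j) ^ 1))) (at_right 0 \<times>\<^sub>F G)"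
      unfolding g1_def by (intro tendsto_intros C tl V_lim U_lim)
    moreover have "Im (of_real a / (of_nat i - of_nat j) ^ 1) = 0" for a j
      by (metis Im_complex_of_real of_real_diff of_real_divide of_real_of_nat_eq power_one_right)
    ultimately show ?thesis by (simp add: power2_eq_square mult.assoc)
  qed
  have lim2: "((\<lambda>h. g2 (fst h) (xx h) (yy h)) \<longlongrightarrow> y * (1 - 1 / (x\<^sup>2 + y\<^sup>2))) (at_right 0 \<times>\<^sub>F G)"
    if "(xx \<longlongrightarrow> x) (at_right 0 \<times>\<^sub>F G)" "(yy \<longlongrightarrow> y) (at_right 0 \<times>\<^sub>F G)" "y \<noteq> 0" for xx yy x y and G :: "real filter"
  proof -
    have C: "((\<lambda>h. Complex (xx h) (yy h)) \<longlongrightarrow> Complex x y) (at_right 0 \<times>\<^sub>F G)"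
      using that(1,2) by (rule tendsto_Complex)
    note tl = tendsto_tail[OF Lim_at_right_fst C]
    have e: "(fst \<longlongrightarrow> (0::real)) (at_right 0 \<times>\<^sub>F G)"
      using Lim_at_right_fst[of G] by (simp add: filterlim_at)
    have "((\<lambda>h. g2 (fst h) (xx h) (yy h)) \<longlongrightarrow> Im (Complex x y + of_real 1 / Complex x y
        + of_real 0 * (\<Sum>j\<in>{..<n} - {i}. of_real 1 / (of_nat i - of_nat j) ^ 1))) (at_right 0 \<times>\<^sub>F G)"
      unfolding g2_def
      by (intro tendsto_intros C tl e V_lim filterlim_compose[OF V_lim[OF i(1)] Lim_at_right_fst])
        (use that(3) in \<open>simp add: complex_eq_iff\<close>)
    moreover have "Im (Complex x y + of_real 1 / Complex x y) = y * (1 - 1 / (x\<^sup>2 + y\<^sup>2))"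
      by (simp add: Im_divide algebra_simps)
    ultimately show ?thesis by simp
  qed
  have fs: "((\<lambda>h. snd h) \<longlongrightarrow> y) (at_right (0::real) \<times>\<^sub>F nhds y)" for y :: real
    by (rule filterlim_snd)
  \<comment> \<open>The box surrounds the imaginary unit; its lower side lies inside the unit
    circle, its upper side outside.\<close>
  have "\<forall>\<^sub>F e in at_right 0. \<exists>x\<in>{-1/10<..<1/10}. \<exists>y\<in>{1/2<..<2}. g1 e x y = 0 \<and> g2 e x y = 0"
  proof (rule eventually_zero_in_box[where \<sigma> = 1 and \<tau> = 1
        and la = "\<lambda>y. 2 * (-1/10) * y" and ra = "\<lambda>y. 2 * (1/10) * y"
        and lb = "\<lambda>x. 1/2 * (1 - 1 / (x\<^sup>2 + (1/2)\<^sup>2))" and rb = "\<lambda>x. 2 * (1 - 1 / (x\<^sup>2 + 2\<^sup>2))"])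
    let ?B = "cbox (-1/10, 1/2) (1/10, 2) :: (real \<times> real) set"
    have nz: "of_nat i + complex_of_real e * Complex (fst q) (snd q) - of_nat j \<noteq> 0"
      if "e > 0" "q \<in> ?B" for e q j
      using that by (cases q) (auto simp: complex_eq_iff cbox_Pair_eq)
    have nz': "Complex (fst q) (snd q) \<noteq> 0" if "q \<in> ?B" for q
      using that by (cases q) (auto simp: complex_eq_iff cbox_Pair_eq)
    have C: "continuous_on ?B (\<lambda>q. Complex (fst q) (snd q))"
      using cont_C by (simp add: case_prod_unfold)
    have ct: "continuous_on ?B (\<lambda>q. tail e v i 1 (Complex (fst q) (snd q)))" if "e > 0" for e v
      unfolding tail_def using nz[OF that] by (intro continuous_intros C) simp_all
    show "\<forall>\<^sub>F e in at_right 0. continuous_on ?B (\<lambda>(x, y). g1 e x y)"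
      "\<forall>\<^sub>F e in at_right 0. continuous_on ?B (\<lambda>(x, y). g2 e x y)"
      using at_right_facts(3) unfolding g1_def g2_def case_prod_unfold
      by (eventually_elim, use nz' in \<open>intro continuous_intros C ct; simp\<close>)+
  next
    fix y :: real assume y: "y \<in> {1/2..2}"
    show "((\<lambda>(e, y). g1 e (- 1 / 10) y) \<longlongrightarrow> 2 * (-1/10) * y) (at_right 0 \<times>\<^sub>F nhds y) \<and>
        ((\<lambda>(e, y). g1 e (1 / 10) y) \<longlongrightarrow> 2 * (1/10) * y) (at_right 0 \<times>\<^sub>F nhds y) \<and>
        1 * (2 * (-1/10) * y) < 0 \<and> 0 < 1 * (2 * (1/10) * y)"
      using lim1[OF tendsto_const[of "-1/10"] fs] lim1[OF tendsto_const[of "1/10"] fs] y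
      by (simp add: case_prod_unfold)
  next
    fix x :: real assume x: "x \<in> {-1/10..1/10}"
    have "x\<^sup>2 \<le> (1/10)\<^sup>2" using x by (intro abs_le_square_iff[THEN iffD1]) auto
    hence "x\<^sup>2 < 1/2" by (simp add: power2_eq_square)
    hence "1 < 1 / (x\<^sup>2 + (1/2)\<^sup>2)" "1 / (x\<^sup>2 + 2\<^sup>2) < 1"
    proof -
      have "(1/2)\<^sup>2 = (1/4 :: real)" "2\<^sup>2 = (4 :: real)" by (simp_all add: power2_eq_square)
      hence "0 < x\<^sup>2 + (1/2)\<^sup>2" "x\<^sup>2 + (1/2)\<^sup>2 < 1" "1 < x\<^sup>2 + 2\<^sup>2"
        using zero_le_power2[of x] \<open>x\<^sup>2 < 1/2\<close> by linarith+
      thus "1 < 1 / (x\<^sup>2 + (1/2)\<^sup>2)" "1 / (x\<^sup>2 + 2\<^sup>2) < 1" by (simp_all only: less_divide_eq_1_pos divide_less_eq_1_pos)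
    qed
    thus "((\<lambda>(e, x). g2 e x (1/2)) \<longlongrightarrow> 1/2 * (1 - 1 / (x\<^sup>2 + (1/2)\<^sup>2))) (at_right 0 \<times>\<^sub>F nhds x) \<and>
        ((\<lambda>(e, x). g2 e x 2) \<longlongrightarrow> 2 * (1 - 1 / (x\<^sup>2 + 2\<^sup>2))) (at_right 0 \<times>\<^sub>F nhds x) \<and>
        1 * (1/2 * (1 - 1 / (x\<^sup>2 + (1/2)\<^sup>2))) < 0 \<and> 0 < 1 * (2 * (1 - 1 / (x\<^sup>2 + 2\<^sup>2)))"
      using lim2[OF fs tendsto_const[of "1/2"]] lim2[OF fs tendsto_const[of 2]]
      by (simp add: case_prod_unfold)
  qed simp_all
  with noncusp_eq at_right_facts(3) show ?thesis
  proof eventually_elim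
    case (elim e)
    then obtain x y where xy: "x \<in> {-1/10<..<1/10}" "y \<in> {1/2<..<2}" "g1 e x y = 0" "g2 e x y = 0" by blast
    define s where "s = Complex x y"
    define z where "z = of_nat i + of_real e * s"
    define A B where "A = tail e (V e) i 1 s" and "B = tail e (U e) i 1 s"
    have s0: "s \<noteq> 0" using xy by (auto simp: s_def complex_eq_iff)
    have VU: "V e i = 1" "U e i = 2 * real i" using elim(1) i by blast+
    have zi: "z - of_nat i = of_real e * s" by (simp add: z_def)
    have sums: "(\<Sum>j<n. of_real (V e j) / (z - of_nat j)) = 1 / (of_real e * s) + A"
      "(\<Sum>j<n. of_real (U e j) / (z - of_nat j)) = of_nat (2 * i) / (of_real e * s) + B"
      unfolding sum_split[OF i(1)] zi A_def B_def tail_def by (simp_all add: z_def VU)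
    have e: "complex_of_real e \<noteq> 0" using elim by simp
    have g2: "Im (s + 1 / s + of_real e * A) = 0" using xy(4) by (simp add: g2_def s_def A_def VU)
    have g1: "Im (s\<^sup>2 + B - of_nat (2 * i) * A) = 0" using xy(3) by (simp add: g1_def s_def A_def B_def)
    have zx: "z + of_real (e\<^sup>2) * (\<Sum>j<n. of_real (V e j) / (z - of_nat j))
      = of_nat i + of_real e * (s + 1 / s + of_real e * A)"
      unfolding sums using e s0 by (simp add: z_def field_simps power2_eq_square)
    have zy: "z\<^sup>2 + of_real (e\<^sup>2) * (\<Sum>j<n. of_real (U e j) / (z - of_nat j))
      = of_nat (i * i) + of_real (2 * real i * e) * (s + 1 / s + of_real e * A) + of_real (e\<^sup>2) * (s\<^sup>2 + B - of_nat (2 * i) * A)"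
      unfolding sums using e s0 by (simp add: z_def field_simps power2_eq_square)
    have "Im (z + of_real (e\<^sup>2) * (\<Sum>j<n. of_real (V e j) / (z - of_nat j))) = 0"
      "Im (z\<^sup>2 + of_real (e\<^sup>2) * (\<Sum>j<n. of_real (U e j) / (z - of_nat j))) = 0"
    proof -
      have "Im (of_nat k + of_real a * w) = a * Im w" "Im (of_nat k + of_real a * w + of_real b * w') = a * Im w + b * Im w'"
        for k a b w w' by simp_all
      thus "Im (z + of_real (e\<^sup>2) * (\<Sum>j<n. of_real (V e j) / (z - of_nat j))) = 0"
        "Im (z\<^sup>2 + of_real (e\<^sup>2) * (\<Sum>j<n. of_real (U e j) / (z - of_nat j))) = 0"
        unfolding zx zy using g1 g2 by (simp_all only: mult_zero_right add_0)
    qed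
    thus ?case using xy(1,2) unfolding z_def s_def by blast
  qed
qed

text \<open>Affine coordinates at \<open>t = i + e\<^sup>2 / u\<close>. At this scale the pole
  contributes the residue times \<open>u\<close>, so in the limit the point runs along the tangent
  of the conic at \<open>i\<close> with \<open>u\<close> as parameter.\<close>

definition XN where
  "XN e i u = real i + e\<^sup>2 / u + V e i * u + e\<^sup>2 * (\<Sum>j\<in>{..<n} - {i}. V e j / (real i + e\<^sup>2 / u - real j))"
definition YN where
  "YN e i u = (real i + e\<^sup>2 / u)\<^sup>2 + U e i * u + e\<^sup>2 * (\<Sum>j\<in>{..<n} - {i}. U e j / (real i + e\<^sup>2 / u - real j))"

lemma node_limits:
  assumes i: "i < n" and e: "filterlim e (at_right 0) H" and u: "(u \<longlongrightarrow> u0) H" "u0 \<noteq> 0"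
  shows "((\<lambda>h. XN (e h) i (u h)) \<longlongrightarrow> real i + u0) H"
    "((\<lambda>h. YN (e h) i (u h)) \<longlongrightarrow> (real i)\<^sup>2 + 2 * real i * u0) H"
proof -
  have e0: "(e \<longlongrightarrow> 0) H" using e by (simp add: filterlim_at)
  have z: "((\<lambda>h. e h / u h) \<longlongrightarrow> 0 / u0) H" by (intro tendsto_intros e0 u)
  have tail: "(\<Sum>j\<in>{..<n} - {i}. v j / (real i + a\<^sup>2 / b - real j)) = tail a v i 1 (a / b)" for v a b
    by (simp add: tail_def power2_eq_square)
  have c: "filterlim e (at_right 0) H \<Longrightarrow> (f \<longlongrightarrow> l) (at_right 0) \<Longrightarrow> ((\<lambda>h. f (e h)) \<longlongrightarrow> l) H" for f :: "real \<Rightarrow> real" and l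
    by (rule filterlim_compose)
  have "((\<lambda>h. XN (e h) i (u h)) \<longlongrightarrow> real i + 0\<^sup>2 / u0 + 1 * u0
      + 0\<^sup>2 * (\<Sum>j\<in>{..<n} - {i}. of_real 1 / (of_nat i - of_nat j) ^ 1)) H"
    unfolding XN_def tail by (intro tendsto_intros e0 u c[OF e V_lim[OF i]] tendsto_tail[OF e z] V_lim)
  thus "((\<lambda>h. XN (e h) i (u h)) \<longlongrightarrow> real i + u0) H" by simp
  have "((\<lambda>h. YN (e h) i (u h)) \<longlongrightarrow> (real i + 0\<^sup>2 / u0)\<^sup>2 + (2 * real i) * u0
      + 0\<^sup>2 * (\<Sum>j\<in>{..<n} - {i}. of_real (2 * real j) / (of_nat i - of_nat j) ^ 1)) H"
    unfolding YN_def tail by (intro tendsto_intros e0 u c[OF e U_lim[OF i]] tendsto_tail[OF e z] U_lim)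
  thus "((\<lambda>h. YN (e h) i (u h)) \<longlongrightarrow> (real i)\<^sup>2 + 2 * real i * u0) H" by simp
qed

text \<open>The number 3/8 is half the least distance of two poles minus the half-width 1/8 of the
  boxes used for nodes.\<close>

lemma node_not_pole:
  assumes "0 < e" "e < 1 / 2" "3 / 8 \<le> \<bar>u\<bar>"
  shows "\<bar>e\<^sup>2 / u\<bar> < 2 / 3 * e * 2" "real i + e\<^sup>2 / u \<noteq> real j"
proof -
  have "e\<^sup>2 < e * (1 / 2)" using assms by (simp add: power2_eq_square)
  hence "e\<^sup>2 / \<bar>u\<bar> < e * (1 / 2) / (3 / 8)"
    using assms by (intro frac_less) auto
  thus l: "\<bar>e\<^sup>2 / u\<bar> < 2 / 3 * e * 2" by (simp add: abs_divide)
  show "real i + e\<^sup>2 / u \<noteq> real j"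
  proof
    assume "real i + e\<^sup>2 / u = real j"
    hence eq: "e\<^sup>2 / u = real_of_int (int j - int i)" by simp
    moreover have "\<bar>e\<^sup>2 / u\<bar> < 1"
    proof -
      have "2 / 3 * e * 2 < 1" using assms(2) by simp
      with l show ?thesis by linarith
    qed
    ultimately have "\<bar>int j - int i\<bar> < 1" by linarith
    hence "e\<^sup>2 / u = 0" using eq by simp
    thus False using assms by auto
  qed
qed

lemma poly_node:
  assumes "i < n" "0 < e" "e < 1 / 2" "3 / 8 \<le> \<bar>u\<bar>"
  shows "poly (p e $ 1) (real i + e\<^sup>2 / u) \<noteq> 0"
    "poly (p e $ 2) (real i + e\<^sup>2 / u) = poly (p e $ 1) (real i + e\<^sup>2 / u) * XN e i u"
    "poly (p e $ 3) (real i + e\<^sup>2 / u) = poly (p e $ 1) (real i + e\<^sup>2 / u) * YN e i u"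
proof -
  let ?t = "real i + e\<^sup>2 / u"
  note t = node_not_pole(2)[OF assms(2-4), of i]
  show "poly (p e $ 1) ?t \<noteq> 0" using t by (simp add: p_nth poly_base_poly)
  have "u \<noteq> 0" using assms by auto
  hence "e\<^sup>2 * (v / (?t - real i)) = v * u" for v using assms by simp
  thus "poly (p e $ 2) ?t = poly (p e $ 1) ?t * XN e i u" "poly (p e $ 3) ?t = poly (p e $ 1) ?t * YN e i u"
    using poly_p[of ?t e] t unfolding sum_split[OF assms(1)] distrib_left XN_def YN_def by (simp_all add: add_ac)
qed

text \<open>The tangents of the conic at \<open>i\<close> and \<open>j\<close> meet over the first
  coordinate (i + j) / 2, that is, for u = (j - i) / 2 and w = (i - j) / 2.\<close>

lemma nodes_exist:
  assumes ij: "i < j" "j < n"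
  shows "\<forall>\<^sub>F e in at_right 0. \<exists>u\<in>{(real j - real i) / 2 - 1/8<..<(real j - real i) / 2 + 1/8}.
    \<exists>w\<in>{(real i - real j) / 2 - 1/8<..<(real i - real j) / 2 + 1/8}. XN e i u = XN e j w \<and> YN e i u = YN e j w"
proof -
  have d: "1 \<le> real j - real i" using ij by linarith
  let ?a = "(real j - real i) / 2 - 1/8" and ?b = "(real j - real i) / 2 + 1/8"
  let ?c = "(real i - real j) / 2 - 1/8" and ?d = "(real i - real j) / 2 + 1/8"
  \<comment> \<open>Subtracting \<open>2 k\<close> times the first coordinate kills the direction of
    the tangent at \<open>k\<close>. In the limit \<open>k = j\<close> leaves a function of
    \<open>u\<close> alone and \<open>k = i\<close> one of \<open>w\<close> alone.\<close>
  define g where "g k e u w = (YN e i u - 2 * real k * XN e i u) - (YN e j w - 2 * real k * XN e j w)" for k :: nat and e u w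
  have i: "i < n" using ij by simp
  have lim: "((\<lambda>h. g k (fst h) (u h) (w h)) \<longlongrightarrow>
      ((real i)\<^sup>2 + 2 * real i * u0 - 2 * real k * (real i + u0))
      - ((real j)\<^sup>2 + 2 * real j * w0 - 2 * real k * (real j + w0))) (at_right 0 \<times>\<^sub>F G)"
    if "(u \<longlongrightarrow> u0) (at_right 0 \<times>\<^sub>F G)" "u0 \<noteq> 0" "(w \<longlongrightarrow> w0) (at_right 0 \<times>\<^sub>F G)" "w0 \<noteq> 0"
    for k u w u0 w0 and G :: "real filter"
    unfolding g_def
    by (intro tendsto_intros node_limits[OF i Lim_at_right_fst that(1,2)] node_limits[OF ij(2) Lim_at_right_fst that(3,4)])
  have fs: "((\<lambda>h. snd h) \<longlongrightarrow> y) (at_right (0::real) \<times>\<^sub>F nhds y)" for y :: real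
    by (rule filterlim_snd)
  have "x / 2 - 1/8 \<noteq> 0 \<and> x / 2 + 1/8 \<noteq> 0" if "1 \<le> x \<or> x \<le> -1" for x :: real
    using that by auto
  from this[of "real j - real i"] this[of "real i - real j"]
  have ab: "?a \<noteq> 0" "?b \<noteq> 0" "?c \<noteq> 0" "?d \<noteq> 0" using d by simp_all
  have "\<forall>\<^sub>F e in at_right 0. \<exists>u\<in>{?a<..<?b}. \<exists>w\<in>{?c<..<?d}. g j e u w = 0 \<and> g i e u w = 0"
  proof (rule eventually_zero_in_box[where \<sigma> = "-1" and \<tau> = "-1"
        and la = "\<lambda>w. (real j - real i) / 4" and ra = "\<lambda>w. - (real j - real i) / 4"
        and lb = "\<lambda>u. (real j - real i) / 4" and rb = "\<lambda>u. - (real j - real i) / 4"])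
    let ?B = "cbox (?a, ?c) (?b, ?d) :: (real \<times> real) set"
    have small: "\<forall>\<^sub>F e in at_right (0::real). 0 < e \<and> e < 1/2" by (rule eventually_at_rightI[of 0 "1/2"]) auto
    have B: "3/8 \<le> \<bar>fst q\<bar>" "3/8 \<le> \<bar>snd q\<bar>" if "q \<in> ?B" for q
    proof -
      have q: "?a \<le> fst q" "snd q \<le> ?d" using that by (cases q; simp add: cbox_Pair_eq)+
      have "3/8 \<le> \<bar>u\<bar>" if "x / 2 - 1/8 \<le> u" "1 \<le> x" for u x :: real
      proof -
        have "3/8 \<le> u" using that by simp
        thus ?thesis by simp
      qed
      from this[OF q(1) d] show "3/8 \<le> \<bar>fst q\<bar>" .
      have "3/8 \<le> \<bar>u\<bar>" if "u \<le> x / 2 + 1/8" "x \<le> -1" for u x :: real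
      proof -
        have "3/8 \<le> - u" using that by simp
        thus ?thesis by simp
      qed
      from this[OF q(2)] d show "3/8 \<le> \<bar>snd q\<bar>" by simp
    qed
    have cont: "continuous_on ?B (\<lambda>q. g k e (fst q) (snd q))" if e: "0 < e \<and> e < 1/2" for k e
    proof -
      have nz: "real l + e\<^sup>2 / fst q - real m \<noteq> 0" "real l + e\<^sup>2 / snd q - real m \<noteq> 0" if "q \<in> ?B" for l m q
        using node_not_pole(2)[of e "fst q" l m] node_not_pole(2)[of e "snd q" l m] B[OF that] e by auto
      have nz': "fst q \<noteq> 0" "snd q \<noteq> 0" if "q \<in> ?B" for q using B[OF that] by auto
      show ?thesis unfolding g_def XN_def YN_def
        by (intro continuous_intros) (use nz nz' in blast)+
    qed
    show "\<forall>\<^sub>F e in at_right 0. continuous_on ?B (\<lambda>(x, y). g j e x y)"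
      unfolding case_prod_unfold by (rule eventually_mono[OF small]) (rule cont)
    show "\<forall>\<^sub>F e in at_right 0. continuous_on ?B (\<lambda>(x, y). g i e x y)"
      unfolding case_prod_unfold by (rule eventually_mono[OF small]) (rule cont)
  next
    fix w :: real assume w: "w \<in> {?c..?d}"
    have "y < 0" if "y \<le> x / 2 + 1/8" "x \<le> -1" for x y :: real using that by simp
    from this[of w "real i - real j"] have w0: "w \<noteq> 0" using w d by simp
    have val: "((real i)\<^sup>2 + 2 * real i * u - 2 * real j * (real i + u)) - ((real j)\<^sup>2 + 2 * real j * w - 2 * real j * (real j + w))
        = (real j - real i) * (real j - real i - 2 * u)" for u
      by (simp add: power2_eq_square algebra_simps)
    show "((\<lambda>(e, w). g j e ?a w) \<longlongrightarrow> (real j - real i) / 4) (at_right 0 \<times>\<^sub>F nhds w) \<and>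
        ((\<lambda>(e, w). g j e ?b w) \<longlongrightarrow> - (real j - real i) / 4) (at_right 0 \<times>\<^sub>F nhds w) \<and>
        - 1 * ((real j - real i) / 4) < 0 \<and> 0 < - 1 * (- (real j - real i) / 4)"
    proof -
      have "(real j - real i) * (real j - real i - 2 * ?a) = (real j - real i) / 4"
        "(real j - real i) * (real j - real i - 2 * ?b) = - (real j - real i) / 4" by (simp_all add: field_simps)
      note v = this
      show ?thesis
        using lim[OF tendsto_const ab(1) fs w0, of j, unfolded val v(1)]
          lim[OF tendsto_const ab(2) fs w0, of j, unfolded val v(2)] d
        by (simp add: case_prod_unfold)
    qed
  next
    fix u :: real assume u: "u \<in> {?a..?b}"
    have "0 < y" if "x / 2 - 1/8 \<le> y" "1 \<le> x" for x y :: real using that by simp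
    from this[of "real j - real i" u] have u0: "u \<noteq> 0" using u d by simp
    have val: "((real i)\<^sup>2 + 2 * real i * u - 2 * real i * (real i + u)) - ((real j)\<^sup>2 + 2 * real j * w - 2 * real i * (real j + w))
        = (real j - real i) * (real i - real j - 2 * w)" for w
      by (simp add: power2_eq_square algebra_simps)
    show "((\<lambda>(e, u). g i e u ?c) \<longlongrightarrow> (real j - real i) / 4) (at_right 0 \<times>\<^sub>F nhds u) \<and>
        ((\<lambda>(e, u). g i e u ?d) \<longlongrightarrow> - (real j - real i) / 4) (at_right 0 \<times>\<^sub>F nhds u) \<and>
        - 1 * ((real j - real i) / 4) < 0 \<and> 0 < - 1 * (- (real j - real i) / 4)"
    proof -
      have "(real j - real i) * (real i - real j - 2 * ?c) = (real j - real i) / 4"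
        "(real j - real i) * (real i - real j - 2 * ?d) = - (real j - real i) / 4" by (simp_all add: field_simps)
      note v = this
      show ?thesis
        using lim[OF fs u0 tendsto_const ab(3), of i, unfolded val v(1)]
          lim[OF fs u0 tendsto_const ab(4), of i, unfolded val v(2)] d
        by (simp add: case_prod_unfold)
    qed
  qed simp_all
  thus ?thesis
  proof eventually_elim
    case (elim e)
    then obtain u w where uw: "u \<in> {?a<..<?b}" "w \<in> {?c<..<?d}" "g j e u w = 0" "g i e u w = 0" by blast
    have "g i e u w - g j e u w = 2 * (real j - real i) * (XN e i u - XN e j w)"
      by (simp add: g_def algebra_simps)
    hence "XN e i u = XN e j w" using uw(3,4) d by simp
    moreover from this have "YN e i u = YN e j w" using uw(3) by (simp add: g_def)
    ultimately show ?case using uw(1,2) by blast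
  qed
qed

text \<open>The residue quotients tend to the slopes \<open>2 i\<close> of the tangents. They supply
  the distinct points on the line \<open>f $ 1 = 0\<close>.\<close>

lemma poles_distinct:
  "\<forall>\<^sub>F e in at_right 0. (\<forall>i<n. V e i > 0) \<and> inj_on (\<lambda>i. U e i / V e i) {..<n}"
proof -
  have V: "\<forall>\<^sub>F e in at_right 0. \<forall>i\<in>{..<n}. V e i > 0"
    by (intro eventually_ball_finite ballI) (auto intro!: order_tendstoD(1)[OF V_lim])
  have "\<forall>\<^sub>F e in at_right 0. \<forall>i\<in>{..<n}. \<bar>U e i / V e i - 2 * real i\<bar> < 1 / 2"
  proof (intro eventually_ball_finite ballI)
    fix i assume "i \<in> {..<n}"
    hence "((\<lambda>e. \<bar>U e i / V e i - 2 * real i\<bar>) \<longlongrightarrow> \<bar>2 * real i / 1 - 2 * real i\<bar>) (at_right 0)"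
      by (intro tendsto_intros U_lim V_lim) auto
    thus "\<forall>\<^sub>F e in at_right 0. \<bar>U e i / V e i - 2 * real i\<bar> < 1 / 2"
      by (rule order_tendstoD(2)) simp
  qed simp
  with V show ?thesis
  proof eventually_elim
    case (elim e)
    have "inj_on (\<lambda>i. U e i / V e i) {..<n}"
    proof (rule inj_onI)
      fix i j assume ij: "i \<in> {..<n}" "j \<in> {..<n}" "U e i / V e i = U e j / V e j"
      from bspec[OF elim(2) ij(1)] bspec[OF elim(2) ij(2)] have "\<bar>real i - real j\<bar> < 1"
        unfolding ij(3) by linarith
      thus "i = j" by linarith
    qed
    thus ?case using elim(1) by auto
  qed
qed

section \<open>Separation of the parameters of flexes, cusps and double points\<close>

lemma intervals_disjoint:
  assumes "(l, u) \<in> intervals i" "(l', u') \<in> intervals i" "l < s" "s < u" "l' < s" "s < u'"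
  shows "(l, u) = (l', u')"
  using assms by (auto simp: intervals_def split: if_splits)

text \<open>Recovers from the node parameter on one branch the pole of the other branch.\<close>

lemma half_close:
  fixes u y y' z :: real
  assumes "\<bar>u - (y - z) / 2\<bar> < 1/8" "\<bar>u - (y' - z) / 2\<bar> < 1/8"
  shows "\<bar>y - y'\<bar> < 1"
proof -
  have "\<bar>r - s\<bar> < 1/4" if "\<bar>u - r\<bar> < 1/8" "\<bar>u - s\<bar> < 1/8" for r s
    using that by linarith
  from this[OF assms] have "\<bar>(y - z) / 2 - (y' - z) / 2\<bar> < 1/4" .
  moreover have "(y - z) / 2 - (y' - z) / 2 = (y - y') / 2" by (simp add: field_simps)
  ultimately show ?thesis by simp
qed

lemma same_pole: "\<bar>real i - real j\<bar> < 1 \<Longrightarrow> i = j"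
  by linarith

theorem curve_exists:
  "\<exists>\<phi>. maximally_inflected (n + 2) \<phi> \<and> has_exactly (cusps \<phi>) \<kappa> \<and> has_exactly (flexes \<phi>) (3 * n - 2 * \<kappa>) \<and>
    has_exactly (real_nodes \<phi>) (n choose 2) \<and> has_exactly (solitary_points \<phi>) (n - \<kappa>)"
proof -
  define IF where "IF = (SIGMA i:{..<n}. intervals i)"
  define IN where "IN = (SIGMA j:{..<n}. {..<j})"
  have "\<forall>\<^sub>F e in at_right 0. \<forall>(j, i)\<in>IN. \<exists>u\<in>{(real j - real i) / 2 - 1/8<..<(real j - real i) / 2 + 1/8}.
    \<exists>w\<in>{(real i - real j) / 2 - 1/8<..<(real i - real j) / 2 + 1/8}. XN e i u = XN e j w \<and> YN e i u = YN e j w"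
    using nodes_exist by (intro eventually_ball_finite) (auto simp: IN_def)
  moreover have "\<forall>\<^sub>F e in at_right 0. \<forall>i\<in>{\<kappa>..<n}. \<exists>x\<in>{-1/10<..<1/10}. \<exists>y\<in>{1/2<..<2}. \<exists>z.
    z = of_nat i + of_real e * Complex x y \<and>
    Im (z + of_real (e\<^sup>2) * (\<Sum>j<n. of_real (V e j) / (z - of_nat j))) = 0 \<and>
    Im (z\<^sup>2 + of_real (e\<^sup>2) * (\<Sum>j<n. of_real (U e j) / (z - of_nat j))) = 0"
    by (intro eventually_ball_finite ballI solitary_exist) auto
  \<comment> \<open>With 1/16 the flexes stay within 3/16 and the node parameters within 1/8 of
    their poles, so a parameter determines its pole.\<close>
  moreover have "\<forall>\<^sub>F e in at_right (0::real). 0 < e \<and> e < 1/16" by (rule eventually_at_rightI[of 0 "1/16"]) auto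
  ultimately have "\<forall>\<^sub>F e in at_right 0. (\<forall>(i, l, u)\<in>IF.
     \<exists>x. real i + e * l < x \<and> x < real i + e * u \<and> poly (wronskian (p e)) x = 0) \<and>
    (\<forall>k<\<kappa>. \<exists>l. \<forall>i. poly (pderiv (p e $ i)) (real k + e) = l * poly (p e $ i) (real k + e)) \<and>
    ((\<forall>i<n. V e i > 0) \<and> inj_on (\<lambda>i. U e i / V e i) {..<n}) \<and>
    (\<forall>(j, i)\<in>IN. \<exists>u\<in>{(real j - real i) / 2 - 1/8<..<(real j - real i) / 2 + 1/8}.
    \<exists>w\<in>{(real i - real j) / 2 - 1/8<..<(real i - real j) / 2 + 1/8}. XN e i u = XN e j w \<and> YN e i u = YN e j w) \<and>
    (\<forall>i\<in>{\<kappa>..<n}. \<exists>x\<in>{-1/10<..<1/10}. \<exists>y\<in>{1/2<..<2}. \<exists>z.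
    z = of_nat i + of_real e * Complex x y \<and>
    Im (z + of_real (e\<^sup>2) * (\<Sum>j<n. of_real (V e j) / (z - of_nat j))) = 0 \<and>
    Im (z\<^sup>2 + of_real (e\<^sup>2) * (\<Sum>j<n. of_real (U e j) / (z - of_nat j))) = 0) \<and> 0 < e \<and> e < 1/16"
    using flexes_exist cusps_exist poles_distinct unfolding IF_def by eventually_elim (elim conjE, intro conjI; assumption)
  from eventually_happens[OF this] obtain e where
    flex: "\<forall>(i, l, u)\<in>IF. \<exists>x. real i + e * l < x \<and> x < real i + e * u \<and> poly (wronskian (p e)) x = 0" and
    cusp: "\<forall>k<\<kappa>. \<exists>l. \<forall>i. poly (pderiv (p e $ i)) (real k + e) = l * poly (p e $ i) (real k + e)" and
    V: "\<forall>i<n. V e i > 0" and inj: "inj_on (\<lambda>i. U e i / V e i) {..<n}" and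
    node: "\<forall>(j, i)\<in>IN. \<exists>u\<in>{(real j - real i) / 2 - 1/8<..<(real j - real i) / 2 + 1/8}.
    \<exists>w\<in>{(real i - real j) / 2 - 1/8<..<(real i - real j) / 2 + 1/8}. XN e i u = XN e j w \<and> YN e i u = YN e j w" and
    sol: "\<forall>i\<in>{\<kappa>..<n}. \<exists>x\<in>{-1/10<..<1/10}. \<exists>y\<in>{1/2<..<2}. \<exists>z.
    z = of_nat i + of_real e * Complex x y \<and>
    Im (z + of_real (e\<^sup>2) * (\<Sum>j<n. of_real (V e j) / (z - of_nat j))) = 0 \<and>
    Im (z\<^sup>2 + of_real (e\<^sup>2) * (\<Sum>j<n. of_real (U e j) / (z - of_nat j))) = 0" and
    e: "0 < e" "e < 1/16"
    by (auto simp: trivial_limit_at_right_real)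
  have "\<forall>q\<in>IF. \<exists>x. real (fst q) + e * fst (snd q) < x \<and> x < real (fst q) + e * snd (snd q) \<and> poly (wronskian (p e)) x = 0"
    using flex by (auto simp: case_prod_unfold)
  then obtain F where F: "\<And>q. q \<in> IF \<Longrightarrow> real (fst q) + e * fst (snd q) < F q \<and> F q < real (fst q) + e * snd (snd q)
      \<and> poly (wronskian (p e)) (F q) = 0"
    by (rule bchoice[THEN exE]) blast
  have "\<forall>q\<in>IN. \<exists>z. \<bar>fst z - (real (fst q) - real (snd q)) / 2\<bar> < 1/8 \<and> \<bar>snd z - (real (snd q) - real (fst q)) / 2\<bar> < 1/8 \<and>
      XN e (snd q) (fst z) = XN e (fst q) (snd z) \<and> YN e (snd q) (fst z) = YN e (fst q) (snd z)"
  proof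
    fix q assume "q \<in> IN"
    hence "case q of (j, i) \<Rightarrow> \<exists>u\<in>{(real j - real i) / 2 - 1/8<..<(real j - real i) / 2 + 1/8}.
      \<exists>w\<in>{(real i - real j) / 2 - 1/8<..<(real i - real j) / 2 + 1/8}. XN e i u = XN e j w \<and> YN e i u = YN e j w"
      using node by blast
    then obtain u w where "u \<in> {(real (fst q) - real (snd q)) / 2 - 1/8<..<(real (fst q) - real (snd q)) / 2 + 1/8}"
      "w \<in> {(real (snd q) - real (fst q)) / 2 - 1/8<..<(real (snd q) - real (fst q)) / 2 + 1/8}"
      "XN e (snd q) u = XN e (fst q) w" "YN e (snd q) u = YN e (fst q) w"
      unfolding case_prod_unfold by blast
    thus "\<exists>z. \<bar>fst z - (real (fst q) - real (snd q)) / 2\<bar> < 1/8 \<and> \<bar>snd z - (real (snd q) - real (fst q)) / 2\<bar> < 1/8 \<and>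
      XN e (snd q) (fst z) = XN e (fst q) (snd z) \<and> YN e (snd q) (fst z) = YN e (fst q) (snd z)"
    proof -
      have "\<bar>u - c\<bar> < 1/8" if "u \<in> {c - 1/8<..<c + 1/8}" for u c :: real
        using that by (auto simp: abs_if)
      with \<open>u \<in> _\<close> \<open>w \<in> _\<close> \<open>XN _ _ _ = _\<close> \<open>YN _ _ _ = _\<close> show ?thesis
        by (intro exI[of _ "(u, w)"]) (simp only: fst_conv snd_conv simp_thms)
    qed
  qed
  then obtain N where N: "\<And>q. q \<in> IN \<Longrightarrow> \<bar>fst (N q) - (real (fst q) - real (snd q)) / 2\<bar> < 1/8 \<and>
      \<bar>snd (N q) - (real (snd q) - real (fst q)) / 2\<bar> < 1/8 \<and>
      XN e (snd q) (fst (N q)) = XN e (fst q) (snd (N q)) \<and> YN e (snd q) (fst (N q)) = YN e (fst q) (snd (N q))"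
    by (rule bchoice[THEN exE]) blast
  have "\<forall>i\<in>{\<kappa>..<n}. \<exists>z. \<bar>Re z - real i\<bar> < e / 10 \<and> 0 < Im z \<and>
    Im (z + of_real (e\<^sup>2) * (\<Sum>j<n. of_real (V e j) / (z - of_nat j))) = 0 \<and>
    Im (z\<^sup>2 + of_real (e\<^sup>2) * (\<Sum>j<n. of_real (U e j) / (z - of_nat j))) = 0"
  proof
    fix i assume "i \<in> {\<kappa>..<n}"
    from bspec[OF sol this] obtain x y z where z: "x \<in> {-1/10<..<1/10}" "y \<in> {1/2<..<2}"
      "z = of_nat i + of_real e * Complex x y" and
      im: "Im (z + of_real (e\<^sup>2) * (\<Sum>j<n. of_real (V e j) / (z - of_nat j))) = 0"
      "Im (z\<^sup>2 + of_real (e\<^sup>2) * (\<Sum>j<n. of_real (U e j) / (z - of_nat j))) = 0" by blast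
    have "\<bar>x\<bar> < 1/10" using z(1) by auto
    hence "\<bar>Re z - real i\<bar> < e / 10" using e(1) by (simp add: z(3) abs_mult)
    moreover have "0 < Im z" using e(1) z(2) by (simp add: z(3))
    ultimately show "\<exists>z. \<bar>Re z - real i\<bar> < e / 10 \<and> 0 < Im z \<and>
      Im (z + of_real (e\<^sup>2) * (\<Sum>j<n. of_real (V e j) / (z - of_nat j))) = 0 \<and>
      Im (z\<^sup>2 + of_real (e\<^sup>2) * (\<Sum>j<n. of_real (U e j) / (z - of_nat j))) = 0" using im by blast
  qed
  then obtain Z where Z: "\<And>i. i \<in> {\<kappa>..<n} \<Longrightarrow> \<bar>Re (Z i) - real i\<bar> < e / 10 \<and> 0 < Im (Z i) \<and>
    Im (Z i + of_real (e\<^sup>2) * (\<Sum>j<n. of_real (V e j) / (Z i - of_nat j))) = 0 \<and>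
    Im ((Z i)\<^sup>2 + of_real (e\<^sup>2) * (\<Sum>j<n. of_real (U e j) / (Z i - of_nat j))) = 0"
    by (rule bchoice[THEN exE]) blast
  \<comment> \<open>An element of \<open>IN\<close> is a pair (j, i) with i < j. The node lies to
    the right of the pole \<open>i\<close> on its branch and to the left of the pole
    \<open>j\<close> on the other one, which keeps \<open>S1\<close> and \<open>S2\<close>
    apart.\<close>
  define S1 where "S1 q = real (snd q) + e\<^sup>2 / fst (N q)" for q
  define S2 where "S2 q = real (fst q) + e\<^sup>2 / snd (N q)" for q
  have IN: "snd q < fst q" "fst q < n" "snd q < n" if "q \<in> IN" for q using that by (auto simp: IN_def)
  have N_pos: "3/8 \<le> fst (N q)" "snd (N q) \<le> - (3/8)" if q: "q \<in> IN" for q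
  proof -
    have "1 \<le> real (fst q) - real (snd q)" using IN(1)[OF q] by linarith
    moreover have "3/8 \<le> u" if "\<bar>u - x / 2\<bar> < 1/8" "1 \<le> x" for u x :: real
    proof -
      have "- (u - x / 2) < 1/8" using that(1) by (simp only: abs_less_iff)
      thus ?thesis using that(2) by simp
    qed
    moreover have "u \<le> - (3/8)" if "\<bar>u - x / 2\<bar> < 1/8" "x \<le> -1" for u x :: real
    proof -
      have "u - x / 2 < 1/8" using that(1) by (simp only: abs_less_iff)
      thus ?thesis using that(2) by simp
    qed
    moreover from calculation(1) have "real (snd q) - real (fst q) \<le> -1" by simp
    ultimately show "3/8 \<le> fst (N q)" "snd (N q) \<le> - (3/8)"
      using N[OF q] by blast+
  qed
  have e2: "e < 1/2" using e by simp
  have close: "\<bar>S1 q - real (snd q)\<bar> < 1/8" "\<bar>S2 q - real (fst q)\<bar> < 1/8" if q: "q \<in> IN" for q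
  proof -
    have le: "2 / 3 * e * 2 < 1/8" using e(2) by simp
    have lt: "\<bar>e\<^sup>2 / fst (N q)\<bar> < 2 / 3 * e * 2" "\<bar>e\<^sup>2 / snd (N q)\<bar> < 2 / 3 * e * 2"
      using N_pos[OF q] by (intro node_not_pole(1)[OF e(1) e2]; simp)+
    show "\<bar>S1 q - real (snd q)\<bar> < 1/8"
      unfolding S1_def add_diff_cancel_left' by (rule less_trans[OF lt(1) le])
    show "\<bar>S2 q - real (fst q)\<bar> < 1/8"
      unfolding S2_def add_diff_cancel_left' by (rule less_trans[OF lt(2) le])
  qed
  have F_close: "fst q < n \<and> (fst (snd q), snd (snd q)) \<in> intervals (fst q) \<and> \<bar>F q - real (fst q)\<bar> < 1/4 \<and>
      fst (snd q) < (F q - real (fst q)) / e \<and> (F q - real (fst q)) / e < snd (snd q)" if q: "q \<in> IF" for q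
  proof -
    have int: "fst q < n" "(fst (snd q), snd (snd q)) \<in> intervals (fst q)" using q by (auto simp: IF_def)
    hence "-3 \<le> fst (snd q)" "snd (snd q) \<le> 3" by (auto simp: intervals_def split: if_splits)
    hence "e * -3 \<le> e * fst (snd q)" "e * snd (snd q) \<le> e * 3" using e(1) by (intro mult_left_mono; simp)+
    moreover have "real (fst q) + e * fst (snd q) < F q" "F q < real (fst q) + e * snd (snd q)" using F[OF q] by blast+
    ultimately have "F q - real (fst q) < 1/4 \<and> - (F q - real (fst q)) < 1/4"
      using e(2) by (intro conjI; linarith)
    hence "\<bar>F q - real (fst q)\<bar> < 1/4" by (simp only: abs_less_iff)
    thus ?thesis using int F[OF q] e(1) by (simp add: pos_less_divide_eq pos_divide_less_eq mult.commute)
  qed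
  have inj_F: "inj_on F IF"
  proof (rule inj_onI)
    fix q r assume qr: "q \<in> IF" "r \<in> IF" "F q = F r"
    have "fst q = fst r"
      using F_close[OF qr(1)] F_close[OF qr(2)] qr(3) by (intro same_pole) linarith
    moreover from this have "(fst (snd q), snd (snd q)) = (fst (snd r), snd (snd r))"
      using F_close[OF qr(1)] F_close[OF qr(2)] qr(3)
      by (intro intervals_disjoint[of _ _ "fst q" _ _ "(F q - real (fst q)) / e"]) auto
    ultimately show "q = r" by (simp add: prod_eq_iff)
  qed
  have inj_S1: "inj_on S1 IN"
  proof (rule inj_onI)
    fix q r assume qr: "q \<in> IN" "r \<in> IN" "S1 q = S1 r"
    have eq: "snd q = snd r" using close[OF qr(1)] close[OF qr(2)] qr(3) by (intro same_pole) linarith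
    hence "fst (N q) = fst (N r)" using qr(3) e N_pos[OF qr(1)] N_pos[OF qr(2)] by (simp add: S1_def field_simps)
    hence "fst q = fst r"
      using N[OF qr(1)] N[OF qr(2)] eq by (intro same_pole half_close[of "fst (N q)" _ "real (snd q)"]) simp_all
    thus "q = r" using eq by (simp add: prod_eq_iff)
  qed
  have inj_S2: "inj_on S2 IN"
  proof (rule inj_onI)
    fix q r assume qr: "q \<in> IN" "r \<in> IN" "S2 q = S2 r"
    have eq: "fst q = fst r" using close[OF qr(1)] close[OF qr(2)] qr(3) by (intro same_pole) linarith
    hence "snd (N q) = snd (N r)" using qr(3) e N_pos[OF qr(1)] N_pos[OF qr(2)] by (simp add: S2_def field_simps)
    hence "snd q = snd r"
      using N[OF qr(1)] N[OF qr(2)] eq by (intro same_pole half_close[of "snd (N q)" _ "real (fst q)"]) simp_all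
    thus "q = r" using eq by (simp add: prod_eq_iff)
  qed
  have S12: "S1 q \<noteq> S2 r" if qr: "q \<in> IN" "r \<in> IN" for q r
  proof
    assume eq: "S1 q = S2 r"
    have "snd q = fst r" using close[OF qr(1)] close[OF qr(2)] eq by (intro same_pole) linarith
    hence "e\<^sup>2 / fst (N q) = e\<^sup>2 / snd (N r)" using eq by (simp add: S1_def S2_def)
    moreover have "0 < e\<^sup>2 / fst (N q)" using e N_pos[OF qr(1)] by simp
    moreover have "e\<^sup>2 / snd (N r) < 0" using e N_pos[OF qr(2)] by (intro divide_pos_neg) auto
    ultimately show False by linarith
  qed
  \<comment> \<open>Equality with a cusp would mean \<open>u = e\<close>, but \<open>u\<close> has
    absolute value at least 3/8.\<close>
  have SK: "S1 q \<noteq> real k + e" "S2 q \<noteq> real k + e" if q: "q \<in> IN" for q k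
  proof -
    have *: "e = u" if "real i + e\<^sup>2 / u = real k + e" "\<bar>e\<^sup>2 / u\<bar> < 1/8" "u \<noteq> 0" for i u
    proof -
      have "\<bar>real i - real k\<bar> < 1" using that(1,2) e by linarith
      hence "i = k" by (rule same_pole)
      hence "e\<^sup>2 / u = e" using that(1) by simp
      moreover have "e * e = (e\<^sup>2 / u) * u" using that(3) by (simp add: power2_eq_square)
      ultimately have "e * e = e * u" by (simp only:)
      thus "e = u" using e(1) by simp
    qed
    show "S1 q \<noteq> real k + e" using *[of "snd q" "fst (N q)"] close(1)[OF q] N_pos[OF q] e by (auto simp: S1_def)
    show "S2 q \<noteq> real k + e" using *[of "fst q" "snd (N q)"] close(2)[OF q] N_pos[OF q] e by (auto simp: S2_def)
  qed
  \<comment> \<open>The cusp is at s = 1, the only flex sought near such a pole between s = -3 and s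
    = -1.\<close>
  have FK: "F q \<noteq> real k + e" if q: "q \<in> IF" and k: "k < \<kappa>" for q k
  proof
    assume eq: "F q = real k + e"
    hence "fst q = k" using F_close[OF q] e by (intro same_pole) linarith
    thus False using F_close[OF q] k eq e by (auto simp: intervals_def)
  qed
  have inj_Z: "inj_on Z {\<kappa>..<n}"
  proof (rule inj_onI)
    fix i j assume ij: "i \<in> {\<kappa>..<n}" "j \<in> {\<kappa>..<n}" "Z i = Z j"
    have "\<bar>Re (Z i) - real i\<bar> < e / 10" "\<bar>Re (Z i) - real j\<bar> < e / 10"
      using Z[OF ij(1)] Z[OF ij(2)] unfolding ij(3) by blast+
    hence "\<bar>real i - real j\<bar> < 1" using e by linarith
    thus "i = j" by (rule same_pole)
  qed
  have card_IF: "card IF = 3 * n - 2 * \<kappa>"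
  proof -
    have "card IF = (\<Sum>i<n. if i < \<kappa> then 1 else 3)"
      unfolding IF_def by (subst card_SigmaI) (auto simp: intervals_def intro!: sum.cong)
    also have "{..<n} = {..<\<kappa>} \<union> {\<kappa>..<n}" using n by auto
    also have "(\<Sum>i\<in>{..<\<kappa>} \<union> {\<kappa>..<n}. if i < \<kappa> then 1 else 3 :: nat)
        = (\<Sum>i\<in>{..<\<kappa>}. if i < \<kappa> then 1 else 3) + (\<Sum>i\<in>{\<kappa>..<n}. if i < \<kappa> then 1 else 3)"
      by (rule sum.union_disjoint) auto
    also have "\<dots> = \<kappa> + 3 * (n - \<kappa>)" by simp
    finally show ?thesis using n by simp
  qed
  have fin_IF: "finite IF" by (auto simp: IF_def intervals_def)
  have fin_IN: "finite IN" by (auto simp: IN_def)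
  have card_NR: "card ((\<lambda>q. (S1 q, S2 q)) ` IN) = n choose 2"
    using inj_S1 card_pairs[of n] by (subst card_image) (auto simp: inj_on_def IN_def)
  have "\<exists>\<phi>. maximally_inflected (n + 2) \<phi> \<and> has_exactly (cusps \<phi>) (card ((\<lambda>k. real k + e) ` {..<\<kappa>})) \<and>
    has_exactly (flexes \<phi>) (card (F ` IF)) \<and> has_exactly (real_nodes \<phi>) (card ((\<lambda>q. (S1 q, S2 q)) ` IN)) \<and>
    has_exactly (solitary_points \<phi>) (card (Z ` {\<kappa>..<n})) \<and> complex_nodes \<phi> = {}"
  proof (rule curve_from_real_data[where p = "p e" and A = "real ` {..<n}"])
    show "n + 2 \<ge> 3" using n by simp
    show "degree (p e $ 1) = n + 2 - 2" "degree (p e $ 2) = n + 2 - 1" "degree (p e $ 3) = n + 2"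
      by (simp_all add: p_nth degree_base_poly degree_pole_poly)
    show "finite (real ` {..<n})" "card (real ` {..<n}) = n + 2 - 2" by (simp_all add: card_image)
    have c: "(\<Prod>k\<in>{..<n} - {i}. real i - real k) \<noteq> 0" for i by auto
    show "poly (p e $ 1) a = 0" if "a \<in> real ` {..<n}" for a
      using that by (auto simp: p_nth poly_base_poly)
    show "poly (p e $ 2) a \<noteq> 0" if "a \<in> real ` {..<n}" for a
    proof -
      obtain i where i: "i < n" "a = real i" using \<open>a \<in> real ` {..<n}\<close> by auto
      have "V e i \<noteq> 0" using V i(1) by auto
      thus ?thesis using poly_pole_poly_pole[OF i(1), of e 1 "V e", where 'a = real] c e i(2) by (simp add: p_nth)
    qed
    show "inj_on (\<lambda>a. poly (p e $ 3) a / poly (p e $ 2) a) (real ` {..<n})"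
    proof -
      have "poly (p e $ 3) (real i) / poly (p e $ 2) (real i) = U e i / V e i" if "i < n" for i
        using poly_pole_poly_pole[OF that, of e 1 "V e", where 'a = real]
          poly_pole_poly_pole[OF that, of e 2 "U e", where 'a = real] c[of i] e by (simp add: p_nth)
      thus ?thesis using inj_onD[OF inj] by (auto simp: inj_on_def)
    qed
    show "finite (F ` IF)" "\<And>a. a \<in> F ` IF \<Longrightarrow> poly (wronskian (p e)) a = 0" using fin_IF F by auto
    show "finite ((\<lambda>k. real k + e) ` {..<\<kappa>})" by simp
    show "\<exists>l. \<forall>i. poly (pderiv (p e $ i)) k = l * poly (p e $ i) k" if "k \<in> (\<lambda>k. real k + e) ` {..<\<kappa>}" for k
      using that cusp by auto
    show "F ` IF \<inter> (\<lambda>k. real k + e) ` {..<\<kappa>} = {}" using FK by auto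
    show "card (F ` IF) + 2 * card ((\<lambda>k. real k + e) ` {..<\<kappa>}) = 3 * (n + 2 - 2)"
      using n by (simp add: card_image[OF inj_F] card_IF card_image inj_on_def)
    show "finite ((\<lambda>q. (S1 q, S2 q)) ` IN)" using fin_IN by simp
    show "s \<noteq> t" if "(s, t) \<in> (\<lambda>q. (S1 q, S2 q)) ` IN" for s t
      using that S12 by auto
    show "\<exists>k. \<forall>i. poly (p e $ i) t = k * poly (p e $ i) s" if st: "(s, t) \<in> (\<lambda>q. (S1 q, S2 q)) ` IN" for s t
    proof -
      obtain q where q: "q \<in> IN" "s = S1 q" "t = S2 q" using st by auto
      have u: "3/8 \<le> \<bar>fst (N q)\<bar>" "3/8 \<le> \<bar>snd (N q)\<bar>" using N_pos[OF q(1)] by auto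
      note s = poly_node[OF IN(3)[OF q(1)] e(1) e2 u(1)] and t = poly_node[OF IN(2)[OF q(1)] e(1) e2 u(2)]
      show ?thesis
        unfolding forall_3 q(2,3) S1_def S2_def s(2,3) t(2,3)
        using s(1) N[OF q(1)]
        by (intro exI[of _ "poly (p e $ 1) (real (fst q) + e\<^sup>2 / snd (N q)) / poly (p e $ 1) (real (snd q) + e\<^sup>2 / fst (N q))"]) simp
    qed
    show "inj_on fst ((\<lambda>q. (S1 q, S2 q)) ` IN)"
    proof (rule inj_onI)
      fix x y assume "x \<in> (\<lambda>q. (S1 q, S2 q)) ` IN" "y \<in> (\<lambda>q. (S1 q, S2 q)) ` IN" and eq: "fst x = fst y"
      then obtain q r where qr: "q \<in> IN" "r \<in> IN" "x = (S1 q, S2 q)" "y = (S1 r, S2 r)" by blast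
      hence "q = r" using inj_onD[OF inj_S1 _ qr(1,2)] eq by simp
      thus "x = y" using qr by simp
    qed
    show "inj_on snd ((\<lambda>q. (S1 q, S2 q)) ` IN)"
    proof (rule inj_onI)
      fix x y assume "x \<in> (\<lambda>q. (S1 q, S2 q)) ` IN" "y \<in> (\<lambda>q. (S1 q, S2 q)) ` IN" and eq: "snd x = snd y"
      then obtain q r where qr: "q \<in> IN" "r \<in> IN" "x = (S1 q, S2 q)" "y = (S1 r, S2 r)" by blast
      hence "q = r" using inj_onD[OF inj_S2 _ qr(1,2)] eq by simp
      thus "x = y" using qr by simp
    qed
    show "fst ` (\<lambda>q. (S1 q, S2 q)) ` IN \<inter> snd ` (\<lambda>q. (S1 q, S2 q)) ` IN = {}"
      using S12 by (auto simp: image_image)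
    show "(fst ` (\<lambda>q. (S1 q, S2 q)) ` IN \<union> snd ` (\<lambda>q. (S1 q, S2 q)) ` IN) \<inter> (\<lambda>k. real k + e) ` {..<\<kappa>} = {}"
      using SK[THEN not_sym] by (auto simp: image_image)
    show "finite (Z ` {\<kappa>..<n})" by simp
    show "Im t > 0" if "t \<in> Z ` {\<kappa>..<n}" for t using that Z by auto
    have np: "Z i \<noteq> of_nat j" if "i \<in> {\<kappa>..<n}" for i j
      using Z[OF that] by (auto simp: complex_eq_iff)
    show "poly (cpoly (p e $ 1)) t \<noteq> 0" if "t \<in> Z ` {\<kappa>..<n}" for t
      using that np by (auto simp: p_nth cpoly_base_poly poly_base_poly)
    have im: "Im (a * x * cnj a) = 0" if "Im x = 0" for a x
      using that by (simp add: algebra_simps)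
    show "Im (poly (cpoly (p e $ 2)) t * cnj (poly (cpoly (p e $ 1)) t)) = 0" if t: "t \<in> Z ` {\<kappa>..<n}" for t
    proof -
      obtain i where i: "i \<in> {\<kappa>..<n}" "t = Z i" using t by auto
      show ?thesis unfolding i(2) poly_cp(1)[OF np[OF i(1)]] using Z[OF i(1)] by (intro im) blast
    qed
    show "Im (poly (cpoly (p e $ 3)) t * cnj (poly (cpoly (p e $ 1)) t)) = 0" if t: "t \<in> Z ` {\<kappa>..<n}" for t
    proof -
      obtain i where i: "i \<in> {\<kappa>..<n}" "t = Z i" using t by auto
      show ?thesis unfolding i(2) poly_cp(2)[OF np[OF i(1)]] using Z[OF i(1)] by (intro im) blast
    qed
    have "card (Z ` {\<kappa>..<n}) = n - \<kappa>" "card ((\<lambda>k. real k + e) ` {..<\<kappa>}) = \<kappa>"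
      using card_image[OF inj_Z] by (simp_all add: card_image inj_on_def)
    \<comment> \<open>The arithmetic genus splits into one point for each contact, solitary point or
      cusp, and one node for each pair of tangents.\<close>
    moreover have "(n + 2 - 1) choose 2 = n + (n choose 2)" by (simp add: numeral_2_eq_2)
    ultimately show "card ((\<lambda>q. (S1 q, S2 q)) ` IN) + card (Z ` {\<kappa>..<n}) + card ((\<lambda>k. real k + e) ` {..<\<kappa>})
        = (n + 2 - 1) choose 2"
      using card_NR n by simp
  qed
  moreover have "card (Z ` {\<kappa>..<n}) = n - \<kappa>" "card ((\<lambda>k. real k + e) ` {..<\<kappa>}) = \<kappa>" "card (F ` IF) = 3 * n - 2 * \<kappa>"
    using card_image[OF inj_Z] card_image[OF inj_F] card_IF by (simp_all add: card_image inj_on_def)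
  ultimately show ?thesis using card_NR by (simp only:) blast
qed

end

lemma tangent_curve_exists:
  assumes "1 \<le> n" "\<kappa> \<le> n"
  shows "\<exists>\<phi>. maximally_inflected (n + 2) \<phi> \<and> has_exactly (cusps \<phi>) \<kappa> \<and> has_exactly (flexes \<phi>) (3 * n - 2 * \<kappa>) \<and>
    has_exactly (real_nodes \<phi>) (n choose 2) \<and> has_exactly (solitary_points \<phi>) (n - \<kappa>)"
proof -
  obtain V U where VU: "(\<forall>\<^sub>F e in at_right 0. \<forall>i<n. i < \<kappa> \<longrightarrow>
      1 - V e i - e\<^sup>2 * (\<Sum>j\<in>{..<n} - {i}. V e j / (real i + e - real j)\<^sup>2) = 0 \<and>
      2 * (real i + e) - U e i - e\<^sup>2 * (\<Sum>j\<in>{..<n} - {i}. U e j / (real i + e - real j)\<^sup>2) = 0) \<and>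
    (\<forall>\<^sub>F e in at_right 0. \<forall>i<n. \<kappa> \<le> i \<longrightarrow> V e i = 1 \<and> U e i = 2 * real i) \<and>
    (\<forall>i<n. ((\<lambda>e. V e i) \<longlongrightarrow> 1) (at_right 0) \<and> ((\<lambda>e. U e i) \<longlongrightarrow> 2 * real i) (at_right 0) \<and>
      ((\<lambda>e. (U e i - 2 * real i * V e i) / e) \<longlongrightarrow> (if i < \<kappa> then 2 else 0)) (at_right (0::real)))"
    using tangent_coefficients[of n \<kappa>] by (elim exE)
  interpret tangent_config n \<kappa> V U
    by unfold_locales (use assms VU in blast)+
  show ?thesis by (rule curve_exists)
qed

subsection \<open>Curves with solitary points only\<close>

text \<open>The square (k - m)^2, formed through integers because natural subtraction
  truncates.\<close>

definition expo :: "nat \<Rightarrow> nat \<Rightarrow> nat" where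
  "expo k m = (nat \<bar>int k - int m\<bar>)\<^sup>2"

lemma expo_int: "int (expo k m) = (int k - int m)\<^sup>2"
  by (simp add: expo_def)

lemma expo_pos: "k \<noteq> m \<Longrightarrow> 0 < expo k m"
  by (simp add: expo_def)

text \<open>Completing the square, 2 m k - k^2 = m^2 - (k - m)^2: with coefficients Q^(-k^2) and
  radius Q^(2m), the term of index \<open>k\<close> is smaller than that of index \<open>m\<close>
  by Q^((k - m)^2).\<close>

lemma expo_add: "k\<^sup>2 + m\<^sup>2 = expo k m + 2 * m * k"
proof -
  have "int (k\<^sup>2 + m\<^sup>2) = int (expo k m + 2 * m * k)"
    by (simp add: expo_int power2_eq_square algebra_simps)
  thus ?thesis by (simp only: of_nat_eq_iff)
qed

lemma tendsto_inverse_power_at_top: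
  assumes "0 < k"
  shows "((\<lambda>Q. 1 / Q ^ k) \<longlongrightarrow> 0) (at_top :: real filter)"
proof -
  have "filterlim (\<lambda>Q::real. Q ^ k) at_top at_top" using assms by (intro filterlim_pow_at_top filterlim_ident)
  thus ?thesis by (intro tendsto_divide_0[OF tendsto_const] filterlim_at_top_imp_at_infinity)
qed

text \<open>A sum with coefficients \<open>Q^(-k^2)\<close> is dominated at radius \<open>Q^(2m)\<close> by its \<open>m\<close>-th term.\<close>

lemma tendsto_dominated:
  fixes c :: "'b \<Rightarrow> nat \<Rightarrow> 'a :: real_normed_field"
  assumes "finite S" "m \<in> S" "filterlim Q at_top H" "\<And>k. k \<in> S \<Longrightarrow> ((\<lambda>h. c h k) \<longlongrightarrow> c0 k) H"
  shows "((\<lambda>h. \<Sum>k\<in>S. of_real (1 / Q h ^ expo k m) * c h k) \<longlongrightarrow> c0 m) H"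
proof -
  have "((\<lambda>h. \<Sum>k\<in>S. of_real (1 / Q h ^ expo k m) * c h k) \<longlongrightarrow>
      (\<Sum>k\<in>S. of_real (if k = m then 1 else 0) * c0 k)) H"
  proof (intro tendsto_sum tendsto_mult tendsto_of_real assms(4))
    fix k assume "k \<in> S"
    show "((\<lambda>h. 1 / Q h ^ expo k m) \<longlongrightarrow> (if k = m then 1 else 0)) H"
    proof (cases "k = m")
      case True
      thus ?thesis by (simp add: expo_def)
    next
      case False
      thus ?thesis
        using filterlim_compose[OF tendsto_inverse_power_at_top[OF expo_pos[OF False]] assms(3)] by simp
    qed
  qed
  also have "(\<Sum>k\<in>S. of_real (if k = m then 1 else 0) * c0 k) = (\<Sum>k\<in>S. if k = m then c0 m else 0)"
    by (intro sum.cong) auto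
  finally show ?thesis using assms(1,2) by simp
qed

text \<open>At radius B^(2m) the term of index \<open>m\<close> dominates, so the signs alternate
  with \<open>m\<close>. The positive weights k (k - 1) do not affect this, hence the same radii
  isolate the roots of the polynomial, which become the set \<open>A\<close>, and those of its
  second derivative, which become flexes.\<close>

lemma alternating_template:
  assumes "2 < d"
  shows "\<exists>a s :: nat \<Rightarrow> real. a 0 = 0 \<and> a 1 = 0 \<and> a 2 \<noteq> 0 \<and> a d = 1 \<and> strict_mono s \<and> (\<forall>m. 0 < s m) \<and>
    (\<forall>m\<in>{2..<d}. (\<Sum>k\<le>d. a k * s m ^ k) * (\<Sum>k\<le>d. a k * s (Suc m) ^ k) < 0 \<and>
      (\<Sum>k\<le>d. real k * (real k - 1) * a k * s m ^ k) * (\<Sum>k\<le>d. real k * (real k - 1) * a k * s (Suc m) ^ k) < 0)"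
proof -
  \<comment> \<open>The sign and the factor B^(d^2) normalise the leading coefficient to 1. The
    missing terms of index 0 and 1 give the first component, which uses the reversed sequence, its
    degree \<open>d - 2\<close>.\<close>
  define a where "a B k = (if k < 2 then 0 else (-1) ^ (k + d) * B ^ d\<^sup>2 / B ^ k\<^sup>2)" for B :: real and k
  have sum_eq: "(\<Sum>k\<le>d. w k * a B k * (B ^ (2 * m)) ^ k)
      = (-1) ^ d * B ^ d\<^sup>2 * B ^ m\<^sup>2 * (\<Sum>k\<in>{2..d}. of_real (1 / B ^ expo k m) * ((-1) ^ k * w k))"
    if "B > 0" for B m and w :: "nat \<Rightarrow> real"
  proof -
    have "(\<Sum>k\<le>d. w k * a B k * (B ^ (2 * m)) ^ k) = (\<Sum>k\<in>{2..d}. w k * a B k * (B ^ (2 * m)) ^ k)"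
      by (intro sum.mono_neutral_right) (auto simp: a_def)
    also have "\<dots> = (\<Sum>k\<in>{2..d}. (-1) ^ d * B ^ d\<^sup>2 * B ^ m\<^sup>2 * (of_real (1 / B ^ expo k m) * ((-1) ^ k * w k)))"
    proof (intro sum.cong refl)
      fix k assume "k \<in> {2..d}"
      have "B ^ m\<^sup>2 * B ^ k\<^sup>2 = B ^ expo k m * (B ^ (2 * m)) ^ k"
        using expo_add[of k m] by (simp add: power_add[symmetric] power_mult[symmetric] add.commute)
      hence "(B ^ (2 * m)) ^ k / B ^ k\<^sup>2 = B ^ m\<^sup>2 / B ^ expo k m" using that by (simp add: field_simps)
      moreover have "w k * a B k * (B ^ (2 * m)) ^ k = w k * ((-1) ^ (k + d) * B ^ d\<^sup>2) * ((B ^ (2 * m)) ^ k / B ^ k\<^sup>2)"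
        using \<open>k \<in> {2..d}\<close> by (simp add: a_def)
      ultimately show "w k * a B k * (B ^ (2 * m)) ^ k
          = (-1) ^ d * B ^ d\<^sup>2 * B ^ m\<^sup>2 * (of_real (1 / B ^ expo k m) * ((-1) ^ k * w k))"
        by (simp add: power_add)
    qed
    finally show ?thesis by (simp only: sum_distrib_left)
  qed
  have sgn: "\<forall>\<^sub>F B in at_top. \<forall>m\<in>{2..<d}.
      (\<Sum>k\<le>d. w k * a B k * (B ^ (2 * m)) ^ k) * (\<Sum>k\<le>d. w k * a B k * (B ^ (2 * Suc m)) ^ k) < 0"
    if w: "\<And>k. 2 \<le> k \<Longrightarrow> 0 < w k" for w :: "nat \<Rightarrow> real"
  proof (intro eventually_ball_finite ballI)
    fix m assume m: "m \<in> {2..<d}"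
    have "((\<lambda>B. (\<Sum>k\<in>{2..d}. of_real (1 / B ^ expo k m) * ((-1) ^ k * w k)) *
        (\<Sum>k\<in>{2..d}. of_real (1 / B ^ expo k (Suc m)) * ((-1) ^ k * w k))) \<longlongrightarrow>
        ((-1) ^ m * w m) * ((-1) ^ Suc m * w (Suc m))) at_top"
      using m by (intro tendsto_mult tendsto_dominated filterlim_ident tendsto_const) auto
    moreover have "((-1) ^ m * w m) * ((-1) ^ Suc m * w (Suc m)) < 0"
    proof -
      have "((-1) ^ m * w m) * ((-1) ^ Suc m * w (Suc m)) = - (((-1) ^ m * (-1) ^ m) * (w m * w (Suc m)))"
        by simp
      also have "(-1) ^ m * (-1) ^ m = (1 :: real)" by (simp flip: power_mult_distrib)
      finally have "((-1) ^ m * w m) * ((-1) ^ Suc m * w (Suc m)) = - (w m * w (Suc m))" by simp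
      thus ?thesis using mult_pos_pos[OF w[of m] w[of "Suc m"]] m by (simp del: power_Suc)
    qed
    ultimately have "\<forall>\<^sub>F B in at_top. (\<Sum>k\<in>{2..d}. of_real (1 / B ^ expo k m) * ((-1) ^ k * w k)) *
        (\<Sum>k\<in>{2..d}. of_real (1 / B ^ expo k (Suc m)) * ((-1) ^ k * w k)) < 0"
      by (rule order_tendstoD(2))
    with eventually_gt_at_top[of "0::real"]
    show "\<forall>\<^sub>F B in at_top. (\<Sum>k\<le>d. w k * a B k * (B ^ (2 * m)) ^ k) * (\<Sum>k\<le>d. w k * a B k * (B ^ (2 * Suc m)) ^ k) < 0"
    proof eventually_elim
      case (elim B)
      let ?c = "((-1) ^ d * B ^ d\<^sup>2) * ((-1) ^ d * B ^ d\<^sup>2) * (B ^ m\<^sup>2 * B ^ (Suc m)\<^sup>2)"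
      have "0 < x * x" if "x \<noteq> 0" for x :: real
        using that by (simp only: zero_less_mult_iff) linarith
      from this[of "(-1) ^ d * B ^ d\<^sup>2"] have cc: "0 < ((-1) ^ d * B ^ d\<^sup>2) * ((-1) ^ d * B ^ d\<^sup>2)"
        using elim(1) by (simp del: not_real_square_gt_zero)
      have "0 < ?c" by (rule mult_pos_pos[OF cc]) (use elim(1) in simp)
      from mult_pos_neg[OF this elim(2)] show ?case
        unfolding sum_eq[OF elim(1)] by (simp only: mult_ac)
    qed
  qed simp
  have "\<forall>\<^sub>F B in at_top. 1 < B \<and>
     (\<forall>m\<in>{2..<d}. (\<Sum>k\<le>d. 1 * a B k * (B ^ (2 * m)) ^ k) * (\<Sum>k\<le>d. 1 * a B k * (B ^ (2 * Suc m)) ^ k) < 0) \<and>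
     (\<forall>m\<in>{2..<d}. (\<Sum>k\<le>d. real k * (real k - 1) * a B k * (B ^ (2 * m)) ^ k) *
        (\<Sum>k\<le>d. real k * (real k - 1) * a B k * (B ^ (2 * Suc m)) ^ k) < 0)"
    using eventually_gt_at_top[of "1::real"] sgn[of "\<lambda>_. 1"] sgn[of "\<lambda>k. real k * (real k - 1)"]
    by (intro eventually_conj) auto
  then obtain B where B: "1 < B"
     "\<forall>m\<in>{2..<d}. (\<Sum>k\<le>d. 1 * a B k * (B ^ (2 * m)) ^ k) * (\<Sum>k\<le>d. 1 * a B k * (B ^ (2 * Suc m)) ^ k) < 0"
     "\<forall>m\<in>{2..<d}. (\<Sum>k\<le>d. real k * (real k - 1) * a B k * (B ^ (2 * m)) ^ k) *
        (\<Sum>k\<le>d. real k * (real k - 1) * a B k * (B ^ (2 * Suc m)) ^ k) < 0"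
    using eventually_happens'[OF trivial_limit_at_top_linorder] by blast
  show ?thesis
  proof (rule exI[of _ "a B"], rule exI[of _ "\<lambda>m. B ^ (2 * m)"], intro conjI)
    show "strict_mono (\<lambda>m. B ^ (2 * m))" using B(1) by (auto intro!: strict_monoI power_strict_increasing)
    have "(-1) ^ (d + d) = (1 :: real)" by (metis even_add power_minus_even power_one)
    thus "a B d = 1" using assms B(1) by (simp add: a_def)
  qed (use assms B in \<open>auto simp: a_def\<close>)
qed

section \<open>Sign changes of sines of multiple angles\<close>

lemma sin_sign:
  assumes "real n * pi < x" "x < (real n + 1) * pi"
  shows "0 < (-1) ^ n * sin x"
proof -
  have "0 < sin (x - real n * pi)" using assms by (intro sin_gt_zero) (auto simp: algebra_simps)
  also have "sin (x - real n * pi) = (-1) ^ n * sin x" by (simp add: sin_diff)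
  finally show ?thesis .
qed

text \<open>The sign change number \<open>i\<close> in the sequence \<open>sin (k \<theta>)\<close>, \<open>1 \<le> k \<le> d - 1\<close>, for \<open>\<theta>\<close> near
  \<open>j \<pi> / d\<close>; it takes place between the indices \<open>lo\<close> and \<open>hi\<close>, which differ by 2 when
  the sine at the index between them vanishes for \<open>\<theta> = j \<pi> / d\<close>.\<close>

definition lo :: "nat \<Rightarrow> nat \<Rightarrow> nat \<Rightarrow> nat" where "lo d j i = (i * d - 1) div j"
definition hi :: "nat \<Rightarrow> nat \<Rightarrow> nat \<Rightarrow> nat" where "hi d j i = (i * d) div j + 1"

lemma lo_hi:
  assumes "1 \<le> i" "i < j" "j < d"
  shows "1 \<le> lo d j i" "lo d j i < hi d j i" "hi d j i \<le> d - 1"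
    "lo d j i * j < i * d" "i * d \<le> (lo d j i + 1) * j" "i * d < hi d j i * j" "hi d j i * j \<le> i * d + j"
proof -
  let ?l = "(i * d - 1) div j" and ?h = "(i * d) div j"
  have pos: "0 < i * d" "j \<le> i * d - 1"
  proof -
    have "1 * d \<le> i * d" using assms by (intro mult_right_mono) auto
    thus "0 < i * d" "j \<le> i * d - 1" using assms by linarith+
  qed
  have l: "?l * j \<le> i * d - 1" "i * d - 1 < (?l + 1) * j"
    using div_times_less_eq_dividend[of "i * d - 1" j] dividend_less_div_times[of j "i * d - 1"] assms by (simp_all add: algebra_simps)
  have h: "?h * j \<le> i * d" "i * d < (?h + 1) * j"
    using div_times_less_eq_dividend[of "i * d" j] dividend_less_div_times[of j "i * d"] assms by (simp_all add: algebra_simps)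
  show "lo d j i * j < i * d" unfolding lo_def using l(1) pos(1) by linarith
  show "i * d \<le> (lo d j i + 1) * j" unfolding lo_def using l(2) pos(1) by linarith
  show "i * d < hi d j i * j" "hi d j i * j \<le> i * d + j" using h by (auto simp: hi_def)
  show "1 \<le> lo d j i" using pos(2) assms div_le_mono[of j "i * d - 1" j] by (simp add: lo_def)
  have "?l \<le> ?h" by (intro div_le_mono) simp
  thus "lo d j i < hi d j i" by (simp add: lo_def hi_def)
  have "?h * j < (d - 1) * j"
  proof -
    have "i * d \<le> (j - 1) * d" using assms by (intro mult_right_mono) auto
    also have "(j - 1) * d < (d - 1) * j" using assms by (cases j; cases d) (auto simp: algebra_simps)
    finally show ?thesis using h(1) by linarith
  qed
  thus "hi d j i \<le> d - 1" by (simp add: hi_def)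
qed

text \<open>Consecutive sign changes are d / j > 1 apart in the index, so the index ranges for
  different \<open>i\<close> do not overlap. This later separates the radii.\<close>

lemma lo_hi_order:
  assumes "i < i'" "1 \<le> i" "i' < j" "j < d"
  shows "hi d j i \<le> lo d j i'"
proof -
  have "hi d j i * j \<le> i * d + j" using lo_hi(7)[of i j d] assms by simp
  also have "\<dots> < i * d + d" using assms by simp
  also have "\<dots> = (i + 1) * d" by simp
  also have "\<dots> \<le> i' * d" using assms by (intro mult_right_mono) auto
  also have "\<dots> \<le> (lo d j i' + 1) * j" using lo_hi(5)[of i' j d] assms by simp
  finally have "hi d j i < lo d j i' + 1" by (simp only: mult_less_cancel2)
  thus ?thesis by simp
qed

text \<open>At \<theta> = j \<pi> / d all angles are integer multiples of \<pi> / d, so those of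
  index \<open>lo\<close> and \<open>hi\<close> keep the distance \<pi> / d from i \<pi>. A
  deviation of at most \<pi> / d^2 is multiplied by an index below \<open>d\<close> and cannot
  bridge it.\<close>

lemma sin_signs:
  assumes ij: "1 \<le> i" "i < j" "j < d" and \<theta>: "\<bar>\<theta> - real j * pi / real d\<bar> \<le> pi / (real d)\<^sup>2"
  shows "0 < (-1) ^ i * sin (real (hi d j i) * \<theta>)" "(-1) ^ i * sin (real (lo d j i) * \<theta>) < 0"
proof -
  have d: "0 < real d" using ij by simp
  have eq: "real k * \<theta> * (real d)\<^sup>2 = real k * real j * real d * pi + real k * ((\<theta> - real j * pi / real d) * (real d)\<^sup>2)" for k
    using d by (simp add: field_simps power2_eq_square)
  have "\<bar>\<theta> - real j * pi / real d\<bar> * (real d)\<^sup>2 \<le> pi / (real d)\<^sup>2 * (real d)\<^sup>2"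
    using \<theta> by (rule mult_right_mono) simp
  hence "\<bar>(\<theta> - real j * pi / real d) * (real d)\<^sup>2\<bar> \<le> pi" using d by (simp only: abs_mult) simp
  hence bound: "\<bar>real k * \<theta> * (real d)\<^sup>2 - real k * real j * real d * pi\<bar> \<le> real k * pi" for k
    unfolding eq by (simp add: abs_mult mult_left_mono)
  \<comment> \<open>Multiplied by d^2 / \<pi>, comparisons of angles become inequalities between
    natural numbers.\<close>
  have step: "c * pi < real k * \<theta>" if "c * (real d)\<^sup>2 + real k < real k * real j * real d" for c k
  proof -
    have "(c * (real d)\<^sup>2 + real k) * pi < real k * real j * real d * pi" using that by simp
    hence "c * pi * (real d)\<^sup>2 < real k * \<theta> * (real d)\<^sup>2"
      using bound[of k] by (simp add: algebra_simps abs_le_iff)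
    thus ?thesis using d by simp
  qed
  have step': "real k * \<theta> < c * pi" if "real k * real j * real d + real k < c * (real d)\<^sup>2" for c k
  proof -
    have "(real k * real j * real d + real k) * pi < c * (real d)\<^sup>2 * pi" using that by simp
    hence "real k * \<theta> * (real d)\<^sup>2 < c * pi * (real d)\<^sup>2"
      using bound[of k] by (simp add: algebra_simps abs_le_iff)
    thus ?thesis using d by simp
  qed
  note lh = lo_hi[OF ij]
  have nat_less: "real x < real y" if "x < y" for x y using that by simp
  have "hi d j i < d" "lo d j i < d" using lh ij by linarith+
  define h l where "h = hi d j i" and "l = lo d j i"
  have h: "h < d" "i * d < h * j" "h * j \<le> i * d + j" and l: "l < d" "l * j < i * d" "i * d \<le> (l + 1) * j"
    using lh ij unfolding h_def l_def by linarith+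
  have "i * d\<^sup>2 + h < h * j * d"
  proof -
    have "(i * d + 1) * d \<le> h * j * d" using h(2) by (intro mult_right_mono) auto
    thus ?thesis using h(1) by (simp add: power2_eq_square algebra_simps)
  qed
  hence h1: "real i * pi < real h * \<theta>" using nat_less by (intro step) (fastforce simp flip: of_nat_mult of_nat_add of_nat_power)
  have "h * j * d + h < (i + 1) * d\<^sup>2"
  proof -
    have "h * j * d \<le> (i * d + j) * d" using h(3) by (intro mult_right_mono) auto
    moreover have "Suc j * d \<le> d * d" using ij by (intro mult_right_mono) auto
    hence "j * d + d \<le> d * d" by simp
    ultimately show ?thesis using h(1) by (simp add: power2_eq_square algebra_simps)
  qed
  hence h2: "real h * \<theta> < (real i + 1) * pi"
    using nat_less by (intro step') (fastforce simp flip: of_nat_mult of_nat_add of_nat_power of_nat_1 of_nat_Suc)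
  show "0 < (-1) ^ i * sin (real (hi d j i) * \<theta>)" using sin_sign[OF h1 h2] by (simp add: h_def)
  obtain i0 where i0: "i = Suc i0" using ij(1) by (cases i) auto
  have "i0 * d\<^sup>2 + l < l * j * d"
  proof -
    have "i0 * d + d \<le> l * j + j" using l(3) i0 by simp
    hence "i0 * d + 1 \<le> l * j" using ij(3) by linarith
    hence "(i0 * d + 1) * d \<le> l * j * d" by (intro mult_right_mono) auto
    thus ?thesis using l(1) by (simp add: power2_eq_square algebra_simps)
  qed
  hence l1: "real i0 * pi < real l * \<theta>" using nat_less by (intro step) (fastforce simp flip: of_nat_mult of_nat_add of_nat_power)
  have "l * j * d + l < i * d\<^sup>2"
  proof -
    have "(l * j + 1) * d \<le> i * d * d" using l(2) by (intro mult_right_mono) auto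
    thus ?thesis using l(1) by (simp add: power2_eq_square algebra_simps)
  qed
  hence l2: "real l * \<theta> < (real i0 + 1) * pi"
    unfolding i0 using nat_less by (intro step') (fastforce simp flip: of_nat_mult of_nat_add of_nat_power of_nat_1 of_nat_Suc)
  show "(-1) ^ i * sin (real (lo d j i) * \<theta>) < 0" using sin_sign[OF l1 l2] by (simp add: l_def i0)
qed

section \<open>Polynomials given by coefficients and their Wronskian\<close>

lemma roots_in_chain:
  fixes t :: "nat \<Rightarrow> real"
  assumes "a \<le> b" "\<And>m. m \<in> {a..<b} \<Longrightarrow> t m < t (Suc m)" "\<And>m. m \<in> {a..<b} \<Longrightarrow> \<exists>x. t m < x \<and> x < t (Suc m) \<and> P x"
  shows "\<exists>F. finite F \<and> card F = b - a \<and> F \<subseteq> {t a<..<t b} \<and> (\<forall>x\<in>F. P x) \<and> t a \<le> t b"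
  using assms
proof (induction b rule: dec_induct)
  case base
  thus ?case by (intro exI[of _ "{}"]) auto
next
  case (step b)
  then obtain F where F: "finite F" "card F = b - a" "F \<subseteq> {t a<..<t b}" "\<forall>x\<in>F. P x" "t a \<le> t b" by auto
  obtain x where x: "t b < x" "x < t (Suc b)" "P x" using step.prems(2)[of b] step.hyps by auto
  have "x \<notin> F" using F(3) x(1) by auto
  hence "card (insert x F) = Suc b - a" using F(1,2) step.hyps by simp
  moreover have "insert x F \<subseteq> {t a<..<t (Suc b)}" using F(3,5) x by auto
  ultimately show ?case using F x by (intro exI[of _ "insert x F"]) auto
qed

definition mk :: "nat \<Rightarrow> (nat \<Rightarrow> real) \<Rightarrow> real poly" where
  "mk d c = (\<Sum>k\<le>d. monom (c k) k)"

lemma coeff_mk: "coeff (mk d c) k = (if k \<le> d then c k else 0)"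
  by (simp add: mk_def coeff_sum)

lemma poly_mk: "poly (mk d c) t = (\<Sum>k\<le>d. 1 * (c k * t ^ k))"
  by (simp add: mk_def poly_sum poly_monom)

lemma poly_cpoly_mk: "poly (cpoly (mk d c)) t = (\<Sum>k\<le>d. of_real (c k) * t ^ k)"
  by (simp add: mk_def cpoly_sum map_poly_monom poly_sum poly_monom)

lemma poly_pderiv_mk: "t * poly (pderiv (mk d c)) t = (\<Sum>k\<le>d. real k * (c k * t ^ k))"
  "t\<^sup>2 * poly (pderiv (pderiv (mk d c))) t = (\<Sum>k\<le>d. real k * (real k - 1) * (c k * t ^ k))"
proof -
  have 1: "t * (real k * t ^ (k - 1)) = real k * t ^ k" for k by (cases k) auto
  have 2: "t\<^sup>2 * (real k * (real (k - 1) * t ^ (k - 1 - 1))) = real k * (real k - 1) * t ^ k" for k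
    by (cases k; cases "k - 1") (auto simp: power2_eq_square)
  have pd: "pderiv (mk d c) = (\<Sum>k\<le>d. smult (of_nat k) (monom (c k) (k - 1)))"
    by (simp add: mk_def higher_pderiv_sum[of 1, simplified] pderiv_monom smult_monom)
  have pd2: "pderiv (pderiv (mk d c)) = (\<Sum>k\<le>d. smult (of_nat k) (smult (of_nat (k - 1)) (monom (c k) (k - 1 - 1))))"
    unfolding pd by (simp add: higher_pderiv_sum[of 1, simplified] pderiv_smult pderiv_monom smult_monom mult_ac)
  show "t * poly (pderiv (mk d c)) t = (\<Sum>k\<le>d. real k * (c k * t ^ k))"
    unfolding pd poly_sum sum_distrib_left
  proof (intro sum.cong refl)
    fix k
    show "t * poly (smult (of_nat k) (monom (c k) (k - 1))) t = real k * (c k * t ^ k)"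
      using arg_cong[OF 1[of k], of "\<lambda>x. c k * x"] by (simp add: poly_monom mult_ac)
  qed
  show "t\<^sup>2 * poly (pderiv (pderiv (mk d c))) t = (\<Sum>k\<le>d. real k * (real k - 1) * (c k * t ^ k))"
    unfolding pd2 poly_sum sum_distrib_left
  proof (intro sum.cong refl)
    fix k
    show "t\<^sup>2 * poly (smult (of_nat k) (smult (of_nat (k - 1)) (monom (c k) (k - 1 - 1)))) t
        = real k * (real k - 1) * (c k * t ^ k)"
      using arg_cong[OF 2[of k], of "\<lambda>x. c k * x"] by (simp add: poly_monom mult_ac)
  qed
qed

text \<open>The falling factorial by which t^i times the i-th derivative acts on t^k, for i <
  3.\<close>

definition wt :: "nat \<Rightarrow> nat \<Rightarrow> real" where
  "wt i k = (if i = 0 then 1 else if i = 1 then real k else real k * (real k - 1))"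

definition jet :: "nat \<Rightarrow> (nat \<Rightarrow> real) \<Rightarrow> real \<Rightarrow> real ^ 3" where
  "jet d c t = vector [\<Sum>k\<le>d. wt 0 k * (c k * t ^ k), \<Sum>k\<le>d. wt 1 k * (c k * t ^ k), \<Sum>k\<le>d. wt 2 k * (c k * t ^ k)]"

text \<open>Multiplying the i-th derivative by t^i restores the powers of t, so every entry
  belonging to a component can be normalised by the same factor.\<close>

lemma wronskian_mk:
  "t ^ 3 * poly (wronskian (vector [mk d c1, mk d c2, mk d c3])) t = det3 (jet d c1 t) (jet d c2 t) (jet d c3 t)"
proof -
  have j: "jet d c t $ 1 = poly (mk d c) t" "jet d c t $ 2 = t * poly (pderiv (mk d c)) t"
    "jet d c t $ 3 = t\<^sup>2 * poly (pderiv (pderiv (mk d c))) t" for c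
    unfolding poly_mk poly_pderiv_mk by (simp_all add: jet_def wt_def)
  show ?thesis
    unfolding wronskian_def det3_def j by (simp add: algebra_simps power2_eq_square power3_eq_cube)
qed

section \<open>Dominant terms of the second family\<close>

locale solitary_config =
  fixes d :: nat and a s :: "nat \<Rightarrow> real"
  assumes d: "2 < d" and a: "a 0 = 0" "a 1 = 0" "a 2 \<noteq> 0" "a d = 1"
    and s: "strict_mono s" "\<And>m. 0 < s m"
    and alt: "m \<in> {2..<d} \<Longrightarrow> (\<Sum>k\<le>d. a k * s m ^ k) * (\<Sum>k\<le>d. a k * s (Suc m) ^ k) < 0"
    and alt2: "m \<in> {2..<d} \<Longrightarrow> (\<Sum>k\<le>d. real k * (real k - 1) * a k * s m ^ k) *
        (\<Sum>k\<le>d. real k * (real k - 1) * a k * s (Suc m) ^ k) < 0"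
begin

text \<open>For large \<open>Q\<close> the curve is close to \<open>[1, \<Sum>k. Q^(k(d-k)) t^k, t^d]\<close>.  The terms with \<open>De\<close> split
  the ramification of that curve at 0 and at infinity into flexes and do not matter at the
  radii \<open>R Q m\<close>, where the middle component is dominated by its \<open>m\<close>-th term.\<close>

definition De :: "real \<Rightarrow> real" where "De Q = 1 / Q ^ (2 * d)"
definition R :: "real \<Rightarrow> nat \<Rightarrow> real" where "R Q m = Q ^ (2 * m) / Q ^ d"
definition ee :: "real \<Rightarrow> nat \<Rightarrow> real" where "ee Q k = Q ^ (k * (d - k))"
definition cx where "cx Q k = a k * De Q ^ (d - k)"
definition cz where "cz Q k = a (d - k) * De Q ^ k"
definition cy where "cy Q k = (if k \<in> {1..d - 1} then ee Q k else 0)"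
definition p :: "real \<Rightarrow> real poly ^ 3" where "p Q = vector [mk d (cz Q), mk d (cy Q), mk d (cx Q)]"

lemma p_nth: "p Q $ 1 = mk d (cz Q)" "p Q $ 2 = mk d (cy Q)" "p Q $ 3 = mk d (cx Q)"
  by (simp_all add: p_def)

lemma sum_x:
  fixes t :: "'a :: real_field"
  assumes "t \<noteq> 0"
  shows "(\<Sum>k\<le>d. w k * (of_real (cx Q k) * t ^ k)) / t ^ d = (\<Sum>k\<le>d. w k * (of_real (a k) * (of_real (De Q) / t) ^ (d - k)))"
  unfolding sum_divide_distrib
proof (intro sum.cong refl)
  fix k assume "k \<in> {..d}"
  hence "t ^ d = t ^ (d - k) * t ^ k" by (simp flip: power_add)
  thus "w k * (of_real (cx Q k) * t ^ k) / t ^ d = w k * (of_real (a k) * (of_real (De Q) / t) ^ (d - k))"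
    using assms by (simp add: cx_def power_divide)
qed

text \<open>Far outside the scale \<open>De Q\<close> only the leading coefficient
  \<open>a d = 1\<close> counts. The weight \<open>w\<close> covers the value and the derivatives in
  \<open>jet\<close> at once.\<close>

lemma tendsto_x:
  fixes t :: "'b \<Rightarrow> 'a :: real_normed_field"
  assumes "((\<lambda>h. of_real (De (Q h)) / t h) \<longlongrightarrow> 0) H" "\<forall>\<^sub>F h in H. t h \<noteq> 0"
  shows "((\<lambda>h. (\<Sum>k\<le>d. w k * (of_real (cx (Q h) k) * t h ^ k)) / t h ^ d) \<longlongrightarrow> w d) H"
proof -
  have "((\<lambda>h. \<Sum>k\<le>d. w k * (of_real (a k) * (of_real (De (Q h)) / t h) ^ (d - k))) \<longlongrightarrow>
     (\<Sum>k\<le>d. w k * (of_real (a k) * 0 ^ (d - k)))) H"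
    by (intro tendsto_intros assms(1))
  also have "(\<Sum>k\<le>d. w k * (of_real (a k) * 0 ^ (d - k))) = (\<Sum>k\<le>d. if k = d then w d else 0)"
    using a by (intro sum.cong) (auto simp: power_0_left)
  finally have "((\<lambda>h. \<Sum>k\<le>d. w k * (of_real (a k) * (of_real (De (Q h)) / t h) ^ (d - k))) \<longlongrightarrow> w d) H" by simp
  thus ?thesis
    by (rule Lim_transform_eventually) (rule eventually_mono[OF assms(2)], rule sum_x[symmetric])
qed

text \<open>The coefficients are those of the third component in reverse, so the relevant quantity
  is \<open>De Q * t\<close>: for limit 0 the component tends to its constant term 1, at the scale
  \<open>1 / De Q\<close> to the reversed template.\<close>

lemma tendsto_z:
  fixes t :: "'b \<Rightarrow> 'a :: real_normed_field"
  assumes "((\<lambda>h. of_real (De (Q h)) * t h) \<longlongrightarrow> l) H"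
  shows "((\<lambda>h. \<Sum>k\<le>d. w k * (of_real (cz (Q h) k) * t h ^ k)) \<longlongrightarrow> (\<Sum>k\<le>d. w k * (of_real (a (d - k)) * l ^ k))) H"
proof -
  have "((\<lambda>h. \<Sum>k\<le>d. w k * (of_real (a (d - k)) * (of_real (De (Q h)) * t h) ^ k)) \<longlongrightarrow>
     (\<Sum>k\<le>d. w k * (of_real (a (d - k)) * l ^ k))) H"
    by (intro tendsto_intros assms)
  thus ?thesis by (simp add: cz_def power_mult_distrib mult_ac)
qed

lemma z_sum_0: "(\<Sum>k\<le>d. w k * (of_real (a (d - k)) * (0 :: 'a :: real_field) ^ k)) = w 0"
proof -
  have "(\<Sum>k\<le>d. w k * (of_real (a (d - k)) * (0 :: 'a) ^ k)) = (\<Sum>k\<le>d. if k = 0 then w 0 else 0)"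
    using a by (intro sum.cong) (auto simp: power_0_left)
  thus ?thesis by simp
qed

lemma sum_y: "(\<Sum>k\<le>d. w k * (of_real (cy Q k) * t ^ k)) = (\<Sum>k\<in>{1..d - 1}. w k * (of_real (ee Q k) * t ^ k))"
proof -
  have "(\<Sum>k\<le>d. w k * (of_real (cy Q k) * t ^ k)) = (\<Sum>k\<in>{1..d - 1}. w k * (of_real (cy Q k) * t ^ k))"
    by (intro sum.mono_neutral_right) (auto simp: cy_def)
  thus ?thesis by (simp add: cy_def)
qed

text \<open>In exponents of \<open>Q\<close>: k (d - k) + (2 m - d) k = m^2 - (k - m)^2.\<close>

lemma ee_R:
  assumes "0 < Q" "k \<le> d"
  shows "ee Q k * R Q m ^ k = Q ^ m\<^sup>2 / Q ^ expo k m"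
proof -
  obtain k' where k': "d = k + k'" using assms(2) le_Suc_ex by blast
  have "k * k' + 2 * m * k + expo k m = m\<^sup>2 + d * k"
    using expo_add[of k m] by (simp add: k' power2_eq_square algebra_simps)
  hence "Q ^ (k * k') * Q ^ (2 * m * k) * Q ^ expo k m = Q ^ m\<^sup>2 * Q ^ (d * k)"
    by (simp flip: power_add)
  moreover have "d - k = k'" using k' by simp
  hence "ee Q k = Q ^ (k * k')" by (simp only: ee_def)
  moreover have "R Q m ^ k = Q ^ (2 * m * k) / Q ^ (d * k)" by (simp add: R_def power_divide power_mult)
  ultimately have h: "Q ^ (k * k') * Q ^ (2 * m * k) * Q ^ expo k m = Q ^ m\<^sup>2 * Q ^ (d * k)"
    and e: "ee Q k = Q ^ (k * k')" and r: "R Q m ^ k = Q ^ (2 * m * k) / Q ^ (d * k)"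
    by blast+
  have "ee Q k * R Q m ^ k = (Q ^ (k * k') * Q ^ (2 * m * k)) / Q ^ (d * k)" unfolding e r by simp
  also have "\<dots> = Q ^ m\<^sup>2 / Q ^ expo k m"
    by (subst frac_eq_eq) (use assms(1) h in simp_all)
  finally show ?thesis .
qed

lemma tendsto_y:
  fixes \<zeta> :: "'b \<Rightarrow> 'a :: real_normed_field"
  assumes Q: "filterlim Q at_top H" and "(\<zeta> \<longlongrightarrow> z) H" and m: "m \<in> {1..d - 1}"
  shows "((\<lambda>h. (\<Sum>k\<le>d. w k * (of_real (cy (Q h) k) * (of_real (R (Q h) m) * \<zeta> h) ^ k)) / of_real (Q h ^ m\<^sup>2)) \<longlongrightarrow> w m * z ^ m) H"
proof -
  have "((\<lambda>h. \<Sum>k\<in>{1..d - 1}. of_real (1 / Q h ^ expo k m) * (w k * \<zeta> h ^ k)) \<longlongrightarrow> w m * z ^ m) H"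
    by (intro tendsto_dominated m Q tendsto_intros assms(2)) simp
  moreover have "\<forall>\<^sub>F h in H. Q h > 0" using Q by (simp add: filterlim_at_top_dense)
  hence "\<forall>\<^sub>F h in H. (\<Sum>k\<in>{1..d - 1}. of_real (1 / Q h ^ expo k m) * (w k * \<zeta> h ^ k))
      = (\<Sum>k\<le>d. w k * (of_real (cy (Q h) k) * (of_real (R (Q h) m) * \<zeta> h) ^ k)) / of_real (Q h ^ m\<^sup>2)"
  proof eventually_elim
    case (elim h)
    show ?case unfolding sum_y sum_divide_distrib
    proof (intro sum.cong refl)
      fix k assume "k \<in> {1..d - 1}"
      hence "k \<le> d" by auto
      hence "ee (Q h) k * R (Q h) m ^ k / Q h ^ m\<^sup>2 = 1 / Q h ^ expo k m"
        using ee_R[OF elim, of k m] elim by simp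
      note E = this
      show "of_real (1 / Q h ^ expo k m) * (w k * \<zeta> h ^ k)
          = w k * (of_real (ee (Q h) k) * (of_real (R (Q h) m) * \<zeta> h) ^ k) / of_real (Q h ^ m\<^sup>2)"
        unfolding E[symmetric] by (simp add: power_mult_distrib mult_ac)
    qed
  qed
  ultimately show ?thesis by (rule Lim_transform_eventually)
qed

text \<open>The exponent of \<open>Q\<close> by which the term of index \<open>k\<close> falls below
  that of index 1 at t of order Q^(-2d). By the symmetry of \<open>ee\<close> the same number
  compares the indices \<open>d - k\<close> and \<open>d - 1\<close> at t of order Q^(2d).\<close>

definition gap :: "nat \<Rightarrow> nat" where "gap k = (d - 1) + 2 * d * (k - 1) - k * (d - k)"

lemma gap:
  assumes "k \<in> {1..d - 1}"
  shows "gap k + k * (d - k) = (d - 1) + 2 * d * (k - 1)" "k \<noteq> 1 \<Longrightarrow> 0 < gap k" "gap 1 = 0"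
proof -
  have "k * (d - k) < (d - 1) + 2 * d * (k - 1)" if "k \<noteq> 1"
  proof -
    have "k * (d - k) \<le> k * d" by simp
    also have "\<dots> \<le> 2 * d * (k - 1)" using assms that by (cases k; cases "k - 1") auto
    finally show ?thesis using d by linarith
  qed
  thus "k \<noteq> 1 \<Longrightarrow> 0 < gap k" "gap k + k * (d - k) = (d - 1) + 2 * d * (k - 1)" "gap 1 = 0"
    by (cases "k = 1"; auto simp: gap_def)+
qed

lemma tendsto_gap:
  assumes "k \<in> {1..d - 1}"
  shows "((\<lambda>Q. 1 / Q ^ gap k) \<longlongrightarrow> (if k = 1 then 1 else 0)) (at_top :: real filter)"
  using tendsto_inverse_power_at_top[of "gap k"] gap(2)[OF assms] gap(3)[OF assms] by auto

lemma tendsto_y_near: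
  assumes "0 < \<sigma>"
  shows "((\<lambda>Q. (\<Sum>k\<le>d. w k * (cy Q k * (De Q * \<sigma>) ^ k)) / (ee Q 1 * De Q)) \<longlongrightarrow> w 1 * \<sigma>) at_top"
    and "((\<lambda>Q. (\<Sum>k\<le>d. w k * (cy Q k * (1 / (De Q * \<sigma>)) ^ k)) / (ee Q (d - 1) * (1 / (De Q * \<sigma>)) ^ (d - 1))) \<longlongrightarrow> w (d - 1)) at_top"
proof -
  have g: "ee Q k * De Q ^ (k - 1) / ee Q 1 = 1 / Q ^ gap k" "ee Q (d - k) * De Q ^ (k - 1) / ee Q (d - 1) = 1 / Q ^ gap k"
    if "Q > 0" "k \<in> {1..d - 1}" for Q k
  proof -
    have "Q ^ gap k * Q ^ (k * (d - k)) = Q ^ (d - 1) * Q ^ (2 * d * (k - 1))"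
      using gap(1)[OF that(2)] by (simp flip: power_add)
    hence "Q ^ (k * (d - k)) * (1 / Q ^ (2 * d * (k - 1))) / Q ^ (d - 1) = 1 / Q ^ gap k"
      using that(1) by (simp add: field_simps)
    moreover have "De Q ^ (k - 1) = 1 / Q ^ (2 * d * (k - 1))" by (simp add: De_def power_divide power_mult)
    moreover have "ee Q 1 = Q ^ (d - 1)" "ee Q (d - 1) = Q ^ (d - 1)" "ee Q k = Q ^ (k * (d - k))" "ee Q (d - k) = Q ^ (k * (d - k))"
      using that(2) d diff_diff_cancel[of k d] by (auto simp: ee_def mult.commute)
    ultimately show "ee Q k * De Q ^ (k - 1) / ee Q 1 = 1 / Q ^ gap k" "ee Q (d - k) * De Q ^ (k - 1) / ee Q (d - 1) = 1 / Q ^ gap k"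
      by simp_all
  qed
  have pos: "De Q > 0" "ee Q k > 0" if "Q > 0" for Q k using that by (simp_all add: De_def ee_def)
  have lim: "((\<lambda>Q. \<Sum>k\<in>{1..d - 1}. v k * (1 / Q ^ gap k)) \<longlongrightarrow> v 1) at_top" for v :: "nat \<Rightarrow> real"
  proof -
    have "((\<lambda>Q. \<Sum>k\<in>{1..d - 1}. v k * (1 / Q ^ gap k)) \<longlongrightarrow> (\<Sum>k\<in>{1..d - 1}. v k * (if k = 1 then 1 else 0))) at_top"
      by (intro tendsto_sum tendsto_mult tendsto_const tendsto_gap)
    also have "(\<Sum>k\<in>{1..d - 1}. v k * (if k = 1 then 1 else 0)) = (\<Sum>k\<in>{1..d - 1}. if k = 1 then v 1 else 0)"
      by (intro sum.cong) auto
    finally have "((\<lambda>Q. \<Sum>k\<in>{1..d - 1}. v k * (1 / Q ^ gap k)) \<longlongrightarrow> (\<Sum>k\<in>{1..d - 1}. if k = 1 then v 1 else 0)) at_top" .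
    moreover have "1 \<in> {1..d - 1}" using d by auto
    ultimately show ?thesis by (simp only: sum.delta finite_atLeastAtMost if_True)
  qed
  have sy: "(\<Sum>k\<le>d. w k * (cy Q k * t ^ k)) = (\<Sum>k\<in>{1..d - 1}. w k * (ee Q k * t ^ k))" for Q t
    using sum_y[of w Q t] by simp
  show "((\<lambda>Q. (\<Sum>k\<le>d. w k * (cy Q k * (De Q * \<sigma>) ^ k)) / (ee Q 1 * De Q)) \<longlongrightarrow> w 1 * \<sigma>) at_top"
  proof (rule Lim_transform_eventually)
    show "((\<lambda>Q. \<Sum>k\<in>{1..d - 1}. (w k * \<sigma> ^ k) * (1 / Q ^ gap k)) \<longlongrightarrow> w 1 * \<sigma>) at_top" using lim[of "\<lambda>k. w k * \<sigma> ^ k"] by simp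
    show "\<forall>\<^sub>F Q in at_top. (\<Sum>k\<in>{1..d - 1}. (w k * \<sigma> ^ k) * (1 / Q ^ gap k))
        = (\<Sum>k\<le>d. w k * (cy Q k * (De Q * \<sigma>) ^ k)) / (ee Q 1 * De Q)"
      using eventually_gt_at_top[of "0::real"]
    proof eventually_elim
      case (elim Q)
      show ?case unfolding sy sum_divide_distrib
      proof (intro sum.cong refl)
        fix k assume k: "k \<in> {1..d - 1}"
        have "De Q ^ k = De Q ^ (k - 1) * De Q" using k by (cases k) auto
        thus "(w k * \<sigma> ^ k) * (1 / Q ^ gap k) = w k * (ee Q k * (De Q * \<sigma>) ^ k) / (ee Q 1 * De Q)"
          unfolding g(1)[OF elim k, symmetric] using pos(1)[OF elim] pos(2)[OF elim, of 1] by (simp add: power_mult_distrib)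
      qed
    qed
  qed
  show "((\<lambda>Q. (\<Sum>k\<le>d. w k * (cy Q k * (1 / (De Q * \<sigma>)) ^ k)) / (ee Q (d - 1) * (1 / (De Q * \<sigma>)) ^ (d - 1))) \<longlongrightarrow> w (d - 1)) at_top"
  proof (rule Lim_transform_eventually)
    show "((\<lambda>Q. \<Sum>k\<in>{1..d - 1}. (w (d - k) * \<sigma> ^ (k - 1)) * (1 / Q ^ gap k)) \<longlongrightarrow> w (d - 1)) at_top"
      using lim[of "\<lambda>k. w (d - k) * \<sigma> ^ (k - 1)"] by simp
    show "\<forall>\<^sub>F Q in at_top. (\<Sum>k\<in>{1..d - 1}. (w (d - k) * \<sigma> ^ (k - 1)) * (1 / Q ^ gap k))
        = (\<Sum>k\<le>d. w k * (cy Q k * (1 / (De Q * \<sigma>)) ^ k)) / (ee Q (d - 1) * (1 / (De Q * \<sigma>)) ^ (d - 1))"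
      using eventually_gt_at_top[of "0::real"]
    proof eventually_elim
      case (elim Q)
      have "(\<Sum>k\<in>{1..d - 1}. w k * (ee Q k * (1 / (De Q * \<sigma>)) ^ k)) = (\<Sum>k\<in>{1..d - 1}. w (d - k) * (ee Q (d - k) * (1 / (De Q * \<sigma>)) ^ (d - k)))"
        by (rule sum.reindex_bij_witness[of _ "\<lambda>k. d - k" "\<lambda>k. d - k"]) (use d in auto)
      hence "(\<Sum>k\<le>d. w k * (cy Q k * (1 / (De Q * \<sigma>)) ^ k)) / (ee Q (d - 1) * (1 / (De Q * \<sigma>)) ^ (d - 1))
        = (\<Sum>k\<in>{1..d - 1}. w (d - k) * (ee Q (d - k) * (1 / (De Q * \<sigma>)) ^ (d - k)) / (ee Q (d - 1) * (1 / (De Q * \<sigma>)) ^ (d - 1)))"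
        unfolding sy by (simp only: sum_divide_distrib)
      also have "\<dots> = (\<Sum>k\<in>{1..d - 1}. (w (d - k) * \<sigma> ^ (k - 1)) * (1 / Q ^ gap k))"
      proof (intro sum.cong refl)
        fix k assume k: "k \<in> {1..d - 1}"
        let ?u = "De Q * \<sigma>"
        have u: "?u \<noteq> 0" using pos[OF elim] assms by simp
        have "d - 1 = (d - k) + (k - 1)" using k by auto
        hence "?u ^ (d - 1) = ?u ^ (d - k) * ?u ^ (k - 1)" by (simp flip: power_add)
        hence "(1 / ?u) ^ (d - k) / (1 / ?u) ^ (d - 1) = ?u ^ (k - 1)" using u by (simp add: power_divide)
        have "w (d - k) * (ee Q (d - k) * (1 / ?u) ^ (d - k)) / (ee Q (d - 1) * (1 / ?u) ^ (d - 1))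
            = w (d - k) * (ee Q (d - k) / ee Q (d - 1)) * ((1 / ?u) ^ (d - k) / (1 / ?u) ^ (d - 1))"
          by (simp only: times_divide_times_eq times_divide_eq_left times_divide_eq_right divide_divide_eq_left mult.assoc)
        also have "(1 / ?u) ^ (d - k) / (1 / ?u) ^ (d - 1) = ?u ^ (k - 1)" by fact
        finally have "w (d - k) * (ee Q (d - k) * (1 / ?u) ^ (d - k)) / (ee Q (d - 1) * (1 / ?u) ^ (d - 1))
            = w (d - k) * (ee Q (d - k) / ee Q (d - 1)) * ?u ^ (k - 1)" .
        thus "w (d - k) * (ee Q (d - k) * (1 / ?u) ^ (d - k)) / (ee Q (d - 1) * (1 / ?u) ^ (d - 1))
            = (w (d - k) * \<sigma> ^ (k - 1)) * (1 / Q ^ gap k)"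
          unfolding g(2)[OF elim k, symmetric] by (simp add: power_mult_distrib)
      qed
      finally show ?case by simp
    qed
  qed
qed

lemma De_pos: "0 < Q \<Longrightarrow> 0 < De Q"
  by (simp add: De_def)

lemma R_pos: "0 < Q \<Longrightarrow> 0 < R Q m"
  by (simp add: R_def)

lemma R_less: "1 < Q \<Longrightarrow> m < m' \<Longrightarrow> R Q m < R Q m'"
  unfolding R_def by (intro divide_strict_right_mono power_strict_increasing) auto

lemma R_le: "1 < Q \<Longrightarrow> m \<le> m' \<Longrightarrow> R Q m \<le> R Q m'"
  using R_less[of Q m m'] by (cases "m = m'") auto

lemma De_R_limits:
  shows "((\<lambda>Q. De Q / R Q m) \<longlongrightarrow> 0) at_top" "m \<le> d \<Longrightarrow> ((\<lambda>Q. De Q * R Q m) \<longlongrightarrow> 0) at_top"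
    "((\<lambda>Q. De Q) \<longlongrightarrow> 0) at_top"
proof -
  show "((\<lambda>Q. De Q) \<longlongrightarrow> 0) at_top" unfolding De_def by (rule tendsto_inverse_power_at_top) (use d in simp)
  show "((\<lambda>Q. De Q / R Q m) \<longlongrightarrow> 0) at_top"
  proof (rule Lim_transform_eventually)
    show "((\<lambda>Q::real. 1 / Q ^ (d + 2 * m)) \<longlongrightarrow> 0) at_top" by (rule tendsto_inverse_power_at_top) (use d in simp)
    show "\<forall>\<^sub>F Q in at_top. 1 / Q ^ (d + 2 * m) = De Q / R Q m"
      using eventually_gt_at_top[of "0::real"]
      by eventually_elim (simp add: De_def R_def power_add mult_2 field_simps, simp flip: power_add add: mult_2_right)
  qed
  show "((\<lambda>Q. De Q * R Q m) \<longlongrightarrow> 0) at_top" if "m \<le> d"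
  proof (rule Lim_transform_eventually)
    show "((\<lambda>Q::real. 1 / Q ^ (d + 2 * (d - m))) \<longlongrightarrow> 0) at_top" by (rule tendsto_inverse_power_at_top) (use d in simp)
    show "\<forall>\<^sub>F Q in at_top. 1 / Q ^ (d + 2 * (d - m)) = De Q * R Q m"
      using eventually_gt_at_top[of "0::real"]
    proof eventually_elim
      case (elim Q)
      have "2 * d = 2 * (d - m) + 2 * m" using that by simp
      hence "Q ^ (2 * d) = Q ^ (2 * (d - m)) * Q ^ (2 * m)" by (metis power_add)
      thus ?case using elim by (simp add: De_def R_def power_add)
    qed
  qed
qed

section \<open>Limits of the Wronskian and the resulting flexes\<close>

lemma det_limit:
  assumes Z: "\<And>i. i < 3 \<Longrightarrow> ((\<lambda>Q. \<Sum>k\<le>d. wt i k * (cz Q k * t Q ^ k)) \<longlongrightarrow> Z i) at_top"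
    and Y: "\<And>i. i < 3 \<Longrightarrow> ((\<lambda>Q. (\<Sum>k\<le>d. wt i k * (cy Q k * t Q ^ k)) / ny Q) \<longlongrightarrow> Y i) at_top"
    and X: "\<And>i. i < 3 \<Longrightarrow> ((\<lambda>Q. (\<Sum>k\<le>d. wt i k * (cx Q k * t Q ^ k)) / nx Q) \<longlongrightarrow> X i) at_top"
  shows "((\<lambda>Q. t Q ^ 3 * poly (wronskian (p Q)) (t Q) / (ny Q * nx Q)) \<longlongrightarrow>
    Z 0 * (Y 1 * X 2 - Y 2 * X 1) - Z 1 * (Y 0 * X 2 - Y 2 * X 0) + Z 2 * (Y 0 * X 1 - Y 1 * X 0)) at_top"
proof -
  define SZ SY SX where "SZ i Q = (\<Sum>k\<le>d. wt i k * (cz Q k * t Q ^ k))" and "SY i Q = (\<Sum>k\<le>d. wt i k * (cy Q k * t Q ^ k))"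
    and "SX i Q = (\<Sum>k\<le>d. wt i k * (cx Q k * t Q ^ k))" for i Q
  have eq: "t Q ^ 3 * poly (wronskian (p Q)) (t Q) / (ny Q * nx Q)
    = SZ 0 Q * (SY 1 Q / ny Q * (SX 2 Q / nx Q) - SY 2 Q / ny Q * (SX 1 Q / nx Q))
    - SZ 1 Q * (SY 0 Q / ny Q * (SX 2 Q / nx Q) - SY 2 Q / ny Q * (SX 0 Q / nx Q))
    + SZ 2 Q * (SY 0 Q / ny Q * (SX 1 Q / nx Q) - SY 1 Q / ny Q * (SX 0 Q / nx Q))" for Q
    unfolding p_def wronskian_mk det3_def jet_def vector_3 SZ_def[symmetric] SY_def[symmetric] SX_def[symmetric]
    by (simp add: add_divide_distrib diff_divide_distrib algebra_simps)
  show ?thesis unfolding eq SZ_def SY_def SX_def by (intro tendsto_intros Z Y X) simp_all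
qed

lemma root_between:
  assumes "\<forall>\<^sub>F Q in at_top. t1 Q < t2 Q \<and> 0 < t1 Q * t2 Q \<and> 0 < n1 Q * n2 Q"
    and "((\<lambda>Q. t1 Q ^ 3 * poly (wronskian (p Q)) (t1 Q) / n1 Q) \<longlongrightarrow> l1) at_top"
    and "((\<lambda>Q. t2 Q ^ 3 * poly (wronskian (p Q)) (t2 Q) / n2 Q) \<longlongrightarrow> l2) at_top" and "l1 * l2 < 0"
  shows "\<forall>\<^sub>F Q in at_top. \<exists>x. t1 Q < x \<and> x < t2 Q \<and> poly (wronskian (p Q)) x = 0"
proof -
  have "\<forall>\<^sub>F Q in at_top. t1 Q ^ 3 * poly (wronskian (p Q)) (t1 Q) / n1 Q * (t2 Q ^ 3 * poly (wronskian (p Q)) (t2 Q) / n2 Q) < 0"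
    by (rule order_tendstoD(2)[OF tendsto_mult[OF assms(2,3)] assms(4)])
  with assms(1) show ?thesis
  proof eventually_elim
    case (elim Q)
    have "0 < (t1 Q * t2 Q) ^ 3 / (n1 Q * n2 Q)" using elim by simp
    moreover have "(t1 Q * t2 Q) ^ 3 / (n1 Q * n2 Q) * (poly (wronskian (p Q)) (t1 Q) * poly (wronskian (p Q)) (t2 Q)) < 0"
      using elim(2) by (simp add: power_mult_distrib mult_ac)
    ultimately have "poly (wronskian (p Q)) (t1 Q) * poly (wronskian (p Q)) (t2 Q) < 0"
      by (simp only: mult_less_0_iff) linarith
    from poly_IVT[OF _ this] show ?case using elim(1) by blast
  qed
qed

text \<open>At the radii \<open>R Q m\<close> the components behave like 1, a multiple of t^m and
  t^d, whose Wronskian is explicit. On the negative axis t^m contributes the alternating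
  sign.\<close>

lemma mid_limit:
  assumes m: "m \<in> {1..d - 1}"
  shows "((\<lambda>Q. (- R Q m) ^ 3 * poly (wronskian (p Q)) (- R Q m) / (Q ^ m\<^sup>2 * (- R Q m) ^ d)) \<longlongrightarrow>
    (-1) ^ m * (real m * real d * (real d - real m))) at_top"
proof -
  have "((\<lambda>Q. (- R Q m) ^ 3 * poly (wronskian (p Q)) (- R Q m) / (Q ^ m\<^sup>2 * (- R Q m) ^ d)) \<longlongrightarrow>
    wt 0 0 * (wt 1 m * (-1) ^ m * wt 2 d - wt 2 m * (-1) ^ m * wt 1 d) - wt 1 0 * (wt 0 m * (-1) ^ m * wt 2 d - wt 2 m * (-1) ^ m * wt 0 d)
    + wt 2 0 * (wt 0 m * (-1) ^ m * wt 1 d - wt 1 m * (-1) ^ m * wt 0 d)) at_top"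
  proof (rule det_limit)
    fix i :: nat
    have "((\<lambda>Q. - (De Q * R Q m)) \<longlongrightarrow> - 0) at_top" by (intro tendsto_minus De_R_limits) (use m in auto)
    hence "((\<lambda>Q. of_real (De Q) * (- R Q m)) \<longlongrightarrow> 0) at_top" by simp
    from tendsto_z[OF this, of "wt i"] show "((\<lambda>Q. \<Sum>k\<le>d. wt i k * (cz Q k * (- R Q m) ^ k)) \<longlongrightarrow> wt i 0) at_top"
      by (simp only: z_sum_0) simp
    from tendsto_y[OF filterlim_ident tendsto_const[of "-1 :: real"] m, of "wt i"]
    show "((\<lambda>Q. (\<Sum>k\<le>d. wt i k * (cy Q k * (- R Q m) ^ k)) / Q ^ m\<^sup>2) \<longlongrightarrow> wt i m * (-1) ^ m) at_top" by simp
    have "((\<lambda>Q. - (De Q / R Q m)) \<longlongrightarrow> - 0) at_top" by (intro tendsto_minus De_R_limits)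
    hence "((\<lambda>Q. of_real (De Q) / (- R Q m)) \<longlongrightarrow> 0) at_top" by simp
    moreover have "\<forall>\<^sub>F Q in at_top. - R Q m \<noteq> 0"
      using eventually_gt_at_top[of "0::real"] by eventually_elim (simp add: R_def)
    ultimately show "((\<lambda>Q. (\<Sum>k\<le>d. wt i k * (cx Q k * (- R Q m) ^ k)) / (- R Q m) ^ d) \<longlongrightarrow> wt i d) at_top"
      using tendsto_x[of "\<lambda>Q. Q" "\<lambda>Q. - R Q m" at_top "wt i"] by simp
  qed
  thus ?thesis by (simp add: wt_def algebra_simps)
qed

text \<open>At the scale \<open>De Q\<close> the first two components are asymptotically 1 and a
  multiple of t, so the Wronskian reduces to the second derivative of the third, a rescaled
  template.\<close>

lemma near_limit:
  assumes "0 < \<sigma>"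
  shows "((\<lambda>Q. (De Q * \<sigma>) ^ 3 * poly (wronskian (p Q)) (De Q * \<sigma>) / (ee Q 1 * De Q * De Q ^ d)) \<longlongrightarrow>
    \<sigma> * (\<Sum>k\<le>d. real k * (real k - 1) * a k * \<sigma> ^ k)) at_top"
proof -
  define X where "X i = (\<Sum>k\<le>d. wt i k * (a k * \<sigma> ^ k))" for i
  have "((\<lambda>Q. (De Q * \<sigma>) ^ 3 * poly (wronskian (p Q)) (De Q * \<sigma>) / (ee Q 1 * De Q * De Q ^ d)) \<longlongrightarrow>
    wt 0 0 * (wt 1 1 * \<sigma> * X 2 - wt 2 1 * \<sigma> * X 1) - wt 1 0 * (wt 0 1 * \<sigma> * X 2 - wt 2 1 * \<sigma> * X 0)
    + wt 2 0 * (wt 0 1 * \<sigma> * X 1 - wt 1 1 * \<sigma> * X 0)) at_top"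
  proof (rule det_limit)
    fix i :: nat
    have "((\<lambda>Q. De Q * (De Q * \<sigma>)) \<longlongrightarrow> 0 * (0 * \<sigma>)) at_top" by (intro tendsto_intros De_R_limits)
    hence "((\<lambda>Q. of_real (De Q) * (De Q * \<sigma>)) \<longlongrightarrow> 0) at_top" by simp
    from tendsto_z[OF this, of "wt i"] show "((\<lambda>Q. \<Sum>k\<le>d. wt i k * (cz Q k * (De Q * \<sigma>) ^ k)) \<longlongrightarrow> wt i 0) at_top"
      by (simp only: z_sum_0) simp
    show "((\<lambda>Q. (\<Sum>k\<le>d. wt i k * (cy Q k * (De Q * \<sigma>) ^ k)) / (ee Q 1 * De Q)) \<longlongrightarrow> wt i 1 * \<sigma>) at_top"
      by (rule tendsto_y_near(1)[OF assms])
    show "((\<lambda>Q. (\<Sum>k\<le>d. wt i k * (cx Q k * (De Q * \<sigma>) ^ k)) / De Q ^ d) \<longlongrightarrow> X i) at_top"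
    proof (rule Lim_transform_eventually)
      show "((\<lambda>Q::real. X i) \<longlongrightarrow> X i) at_top" by (rule tendsto_const)
      show "\<forall>\<^sub>F Q in at_top. X i = (\<Sum>k\<le>d. wt i k * (cx Q k * (De Q * \<sigma>) ^ k)) / De Q ^ d"
        using eventually_gt_at_top[of "0::real"]
      proof eventually_elim
        case (elim Q)
        show ?case unfolding X_def sum_divide_distrib
        proof (intro sum.cong refl)
          fix k assume "k \<in> {..d}"
          hence "De Q ^ d = De Q ^ (d - k) * De Q ^ k" by (simp flip: power_add)
          thus "wt i k * (a k * \<sigma> ^ k) = wt i k * (cx Q k * (De Q * \<sigma>) ^ k) / De Q ^ d"
            using De_pos[OF elim] by (simp add: cx_def power_mult_distrib)
        qed
      qed
    qed
  qed
  thus ?thesis by (simp add: wt_def X_def mult.assoc)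
qed

text \<open>The counterpart of \<open>near_limit\<close> under t -> 1/t, where the first component
  carries the template. The second limit is kept for comparing the components at the roots of the
  first one.\<close>

lemma far_limit:
  assumes "0 < \<sigma>"
  defines "t \<equiv> \<lambda>Q. 1 / (De Q * \<sigma>)"
  shows "((\<lambda>Q. t Q ^ 3 * poly (wronskian (p Q)) (t Q) / (ee Q (d - 1) * t Q ^ (d - 1) * t Q ^ d)) \<longlongrightarrow>
    (\<Sum>k\<le>d. real k * (real k - 1) * a k * \<sigma> ^ k) / \<sigma> ^ d) at_top"
    and "((\<lambda>Q. (\<Sum>k\<le>d. 1 * (cx Q k * t Q ^ k)) / t Q ^ d) \<longlongrightarrow> 1) at_top"
proof -
  define Z where "Z i = (\<Sum>k\<le>d. wt i k * (a (d - k) * (1 / \<sigma>) ^ k))" for i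
  have pos: "\<forall>\<^sub>F Q in at_top. 0 < De Q" using eventually_gt_at_top[of "0::real"] by eventually_elim (rule De_pos)
  have x: "((\<lambda>Q. (\<Sum>k\<le>d. w k * (cx Q k * t Q ^ k)) / t Q ^ d) \<longlongrightarrow> w d) at_top" for w
  proof -
    have "((\<lambda>Q. De Q * (De Q * \<sigma>)) \<longlongrightarrow> 0 * (0 * \<sigma>)) at_top" by (intro tendsto_intros De_R_limits)
    hence "((\<lambda>Q. of_real (De Q) / t Q) \<longlongrightarrow> 0) at_top" by (simp add: t_def)
    moreover have "\<forall>\<^sub>F Q in at_top. t Q \<noteq> 0" using pos by eventually_elim (use assms(1) in \<open>simp add: t_def\<close>)
    ultimately show ?thesis using tendsto_x[of "\<lambda>Q. Q" t at_top w] by simp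
  qed
  show "((\<lambda>Q. (\<Sum>k\<le>d. 1 * (cx Q k * t Q ^ k)) / t Q ^ d) \<longlongrightarrow> 1) at_top" by (rule x)
  have "((\<lambda>Q. t Q ^ 3 * poly (wronskian (p Q)) (t Q) / (ee Q (d - 1) * t Q ^ (d - 1) * t Q ^ d)) \<longlongrightarrow>
    Z 0 * (wt 1 (d - 1) * wt 2 d - wt 2 (d - 1) * wt 1 d) - Z 1 * (wt 0 (d - 1) * wt 2 d - wt 2 (d - 1) * wt 0 d)
    + Z 2 * (wt 0 (d - 1) * wt 1 d - wt 1 (d - 1) * wt 0 d)) at_top"
  proof (rule det_limit)
    fix i :: nat
    have "\<forall>\<^sub>F Q in at_top. 1 / \<sigma> = of_real (De Q) * t Q" using pos by eventually_elim (simp add: t_def)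
    hence "((\<lambda>Q. of_real (De Q) * t Q) \<longlongrightarrow> 1 / \<sigma>) at_top" by (rule Lim_transform_eventually[OF tendsto_const])
    from tendsto_z[OF this, of "wt i"] show "((\<lambda>Q. \<Sum>k\<le>d. wt i k * (cz Q k * t Q ^ k)) \<longlongrightarrow> Z i) at_top"
      by (simp add: Z_def)
    show "((\<lambda>Q. (\<Sum>k\<le>d. wt i k * (cy Q k * t Q ^ k)) / (ee Q (d - 1) * t Q ^ (d - 1))) \<longlongrightarrow> wt i (d - 1)) at_top"
      unfolding t_def by (rule tendsto_y_near(2)[OF assms(1)])
    show "((\<lambda>Q. (\<Sum>k\<le>d. wt i k * (cx Q k * t Q ^ k)) / t Q ^ d) \<longlongrightarrow> wt i d) at_top" by (rule x)
  qed
  \<comment> \<open>The combination is d (d - 1) Z0 - 2 (d - 1) Z1 + Z2. It weights the coefficient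
    of index \<open>k\<close> by (d - k) (d - k - 1), the second derivative of the reversed
    polynomial.\<close>
  also have "Z 0 * (wt 1 (d - 1) * wt 2 d - wt 2 (d - 1) * wt 1 d) - Z 1 * (wt 0 (d - 1) * wt 2 d - wt 2 (d - 1) * wt 0 d)
    + Z 2 * (wt 0 (d - 1) * wt 1 d - wt 1 (d - 1) * wt 0 d)
    = (\<Sum>k\<le>d. (real d - real k) * (real d - real k - 1) * (a (d - k) * (1 / \<sigma>) ^ k))"
  proof -
    define D where "D = real d"
    have rd: "real (d - 1) = D - 1" "real d = D" using d by (simp_all add: D_def)
    have "Z 0 * (wt 1 (d - 1) * wt 2 d - wt 2 (d - 1) * wt 1 d) - Z 1 * (wt 0 (d - 1) * wt 2 d - wt 2 (d - 1) * wt 0 d)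
      + Z 2 * (wt 0 (d - 1) * wt 1 d - wt 1 (d - 1) * wt 0 d) = D * (D - 1) * Z 0 - 2 * (D - 1) * Z 1 + Z 2"
      by (simp add: wt_def rd algebra_simps del: One_nat_def)
    also have "\<dots> = (\<Sum>k\<le>d. D * (D - 1) * (wt 0 k * (a (d - k) * (1 / \<sigma>) ^ k)) - 2 * (D - 1) * (wt 1 k * (a (d - k) * (1 / \<sigma>) ^ k))
      + wt 2 k * (a (d - k) * (1 / \<sigma>) ^ k))"
      by (simp only: Z_def sum_distrib_left sum.distrib sum_subtractf)
    also have "\<dots> = (\<Sum>k\<le>d. (D - real k) * (D - real k - 1) * (a (d - k) * (1 / \<sigma>) ^ k))"
      by (intro sum.cong refl) (simp add: wt_def algebra_simps)
    finally show ?thesis by (simp only: rd)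
  qed
  also have "\<dots> = (\<Sum>k\<le>d. real k * (real k - 1) * a k * \<sigma> ^ k) / \<sigma> ^ d"
  proof -
    have "(\<Sum>k\<le>d. (real d - real k) * (real d - real k - 1) * (a (d - k) * (1 / \<sigma>) ^ k))
      = (\<Sum>k\<le>d. real k * (real k - 1) * (a k * (1 / \<sigma>) ^ (d - k)))"
      by (rule sum.reindex_bij_witness[of _ "\<lambda>k. d - k" "\<lambda>k. d - k"]) (auto simp: of_nat_diff)
    also have "\<dots> = (\<Sum>k\<le>d. real k * (real k - 1) * a k * \<sigma> ^ k) / \<sigma> ^ d"
      unfolding sum_divide_distrib
    proof (intro sum.cong refl)
      fix k assume "k \<in> {..d}"
      hence "\<sigma> ^ d = \<sigma> ^ (d - k) * \<sigma> ^ k" by (simp flip: power_add)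
      thus "real k * (real k - 1) * (a k * (1 / \<sigma>) ^ (d - k)) = real k * (real k - 1) * a k * \<sigma> ^ k / \<sigma> ^ d"
        using assms(1) by (simp add: power_divide)
    qed
    finally show ?thesis .
  qed
  finally show "((\<lambda>Q. t Q ^ 3 * poly (wronskian (p Q)) (t Q) / (ee Q (d - 1) * t Q ^ (d - 1) * t Q ^ d)) \<longlongrightarrow>
    (\<Sum>k\<le>d. real k * (real k - 1) * a k * \<sigma> ^ k) / \<sigma> ^ d) at_top" .
qed

lemma s_less: "s m < s (Suc m)"
  using s(1) by (simp add: strict_mono_Suc_iff)

text \<open>Three groups of \<open>d - 2\<close> sign changes: on the negative axis from the middle
  component, and on the positive axis near 0 and far out from the two copies of the
  template.\<close>

lemma flexes_exist:
  "\<forall>\<^sub>F Q in at_top. \<exists>Fl. finite Fl \<and> card Fl = 3 * (d - 2) \<and> (\<forall>x\<in>Fl. poly (wronskian (p Q)) x = 0)"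
proof -
  have mid: "\<forall>\<^sub>F Q in at_top. \<forall>m\<in>{1..<d - 1}. \<exists>x. - R Q (d - m) < x \<and> x < - R Q (d - Suc m) \<and> poly (wronskian (p Q)) x = 0"
  proof (intro eventually_ball_finite ballI)
    fix m assume m: "m \<in> {1..<d - 1}"
    let ?m = "d - m" and ?m' = "d - Suc m"
    have mm: "?m \<in> {1..d - 1}" "?m' \<in> {1..d - 1}" "?m = Suc ?m'" using m by auto
    show "\<forall>\<^sub>F Q in at_top. \<exists>x. - R Q ?m < x \<and> x < - R Q ?m' \<and> poly (wronskian (p Q)) x = 0"
    proof (rule root_between[OF _ mid_limit[OF mm(1)] mid_limit[OF mm(2)]])
      show "\<forall>\<^sub>F Q in at_top. - R Q ?m < - R Q ?m' \<and> 0 < - R Q ?m * - R Q ?m' \<and>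
          0 < Q ^ ?m\<^sup>2 * (- R Q ?m) ^ d * (Q ^ ?m'\<^sup>2 * (- R Q ?m') ^ d)"
        using eventually_gt_at_top[of "1::real"]
      proof eventually_elim
        case (elim Q)
        have "(- R Q ?m) ^ d * (- R Q ?m') ^ d = (R Q ?m * R Q ?m') ^ d" by (simp flip: power_mult_distrib)
        moreover have "0 < R Q ?m" "0 < R Q ?m'" using elim by (simp_all add: R_pos)
        ultimately have "0 < (- R Q ?m) ^ d * (- R Q ?m') ^ d" by simp
        moreover have "0 < Q ^ ?m\<^sup>2 * Q ^ ?m'\<^sup>2" using elim by simp
        ultimately have "0 < (Q ^ ?m\<^sup>2 * Q ^ ?m'\<^sup>2) * ((- R Q ?m) ^ d * (- R Q ?m') ^ d)" by (rule mult_pos_pos[rotated])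
        thus ?case using \<open>0 < R Q ?m\<close> \<open>0 < R Q ?m'\<close> R_less[OF elim, of ?m' ?m] mm(3) by (simp add: mult_ac)
      qed
      have e1: "((-1) ^ ?m * (-1) ^ ?m' :: real) = -1" unfolding mm(3) by (simp flip: power_mult_distrib)
      have "0 < real ?m * real d * (real d - real ?m) * (real ?m' * real d * (real d - real ?m'))"
        using mm d by (intro mult_pos_pos) auto
      moreover have "(-1) ^ ?m * (real ?m * real d * (real d - real ?m)) * ((-1) ^ ?m' * (real ?m' * real d * (real d - real ?m')))
        = ((-1) ^ ?m * (-1) ^ ?m') * (real ?m * real d * (real d - real ?m) * (real ?m' * real d * (real d - real ?m')))"
        by (simp only: mult_ac)
      ultimately show "(-1) ^ ?m * (real ?m * real d * (real d - real ?m)) * ((-1) ^ ?m' * (real ?m' * real d * (real d - real ?m'))) < 0"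
        by (simp only: e1 mult_minus1 neg_less_0_iff_less)
    qed
  qed simp
  have near: "\<forall>\<^sub>F Q in at_top. \<forall>m\<in>{2..<d}. \<exists>x. De Q * s m < x \<and> x < De Q * s (Suc m) \<and> poly (wronskian (p Q)) x = 0"
  proof (intro eventually_ball_finite ballI)
    fix m assume m: "m \<in> {2..<d}"
    show "\<forall>\<^sub>F Q in at_top. \<exists>x. De Q * s m < x \<and> x < De Q * s (Suc m) \<and> poly (wronskian (p Q)) x = 0"
    proof (rule root_between[OF _ near_limit[OF s(2)] near_limit[OF s(2)]])
      show "\<forall>\<^sub>F Q in at_top. De Q * s m < De Q * s (Suc m) \<and> 0 < De Q * s m * (De Q * s (Suc m)) \<and>
        0 < ee Q 1 * De Q * De Q ^ d * (ee Q 1 * De Q * De Q ^ d)"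
        using eventually_gt_at_top[of "0::real"]
        by eventually_elim (use De_pos s s_less in \<open>simp add: ee_def\<close>)
      have "0 < s m * s (Suc m)" using s(2) by simp
      from mult_pos_neg[OF this alt2[OF m]]
      show "s m * (\<Sum>k\<le>d. real k * (real k - 1) * a k * s m ^ k) * (s (Suc m) * (\<Sum>k\<le>d. real k * (real k - 1) * a k * s (Suc m) ^ k)) < 0"
        by (simp only: mult_ac)
    qed
  qed simp
  have far: "\<forall>\<^sub>F Q in at_top. \<forall>m\<in>{2..<d}. \<exists>x. 1 / (De Q * s (Suc m)) < x \<and> x < 1 / (De Q * s m) \<and> poly (wronskian (p Q)) x = 0"
  proof (intro eventually_ball_finite ballI)
    fix m assume m: "m \<in> {2..<d}"
    show "\<forall>\<^sub>F Q in at_top. \<exists>x. 1 / (De Q * s (Suc m)) < x \<and> x < 1 / (De Q * s m) \<and> poly (wronskian (p Q)) x = 0"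
    proof (rule root_between[OF _ far_limit(1)[OF s(2)] far_limit(1)[OF s(2)]])
      show "\<forall>\<^sub>F Q in at_top. 1 / (De Q * s (Suc m)) < 1 / (De Q * s m) \<and> 0 < 1 / (De Q * s (Suc m)) * (1 / (De Q * s m)) \<and>
        0 < ee Q (d - 1) * (1 / (De Q * s (Suc m))) ^ (d - 1) * (1 / (De Q * s (Suc m))) ^ d *
          (ee Q (d - 1) * (1 / (De Q * s m)) ^ (d - 1) * (1 / (De Q * s m)) ^ d)"
        using eventually_gt_at_top[of "0::real"]
      proof eventually_elim
        case (elim Q)
        have "0 < De Q * s m" "0 < De Q * s (Suc m)" "De Q * s m < De Q * s (Suc m)" using De_pos[OF elim] s s_less by simp_all
        moreover have "0 < ee Q (d - 1)" using elim by (simp add: ee_def)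
        ultimately show ?case by (simp add: frac_less2)
      qed
      have "0 < 1 / (s m ^ d * s (Suc m) ^ d)" using s(2) by simp
      from mult_pos_neg[OF this alt2[OF m]]
      show "(\<Sum>k\<le>d. real k * (real k - 1) * a k * s (Suc m) ^ k) / s (Suc m) ^ d * ((\<Sum>k\<le>d. real k * (real k - 1) * a k * s m ^ k) / s m ^ d) < 0"
        by (simp add: mult_ac)
    qed
  qed simp
  have "((\<lambda>Q. De Q * s d) \<longlongrightarrow> 0 * s d) at_top" by (intro tendsto_intros De_R_limits)
  hence "\<forall>\<^sub>F Q in at_top. De Q * s d < 1" by (intro order_tendstoD(2)[of _ 0]) simp_all
  with mid near far eventually_gt_at_top[of "1::real"] show ?thesis
  proof eventually_elim
    case (elim Q)
    have De: "0 < De Q" using elim by (simp add: De_pos)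
    have "\<exists>F. finite F \<and> card F = (d - 1) - 1 \<and> F \<subseteq> {- R Q (d - 1)<..<- R Q (d - (d - 1))} \<and>
        (\<forall>x\<in>F. poly (wronskian (p Q)) x = 0) \<and> - R Q (d - 1) \<le> - R Q (d - (d - 1))"
      using elim(1) d R_less[OF elim(4)] by (intro roots_in_chain) auto
    then obtain F1 where F1: "finite F1" "card F1 = d - 2" "F1 \<subseteq> {- R Q (d - 1)<..<- R Q 1}" "\<forall>x\<in>F1. poly (wronskian (p Q)) x = 0"
      using d by (auto simp: numeral_2_eq_2)
    have "\<exists>F. finite F \<and> card F = d - 2 \<and> F \<subseteq> {De Q * s 2<..<De Q * s d} \<and> (\<forall>x\<in>F. poly (wronskian (p Q)) x = 0) \<and> De Q * s 2 \<le> De Q * s d"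
      using elim(2) d De s_less by (intro roots_in_chain) auto
    then obtain F2 where F2: "finite F2" "card F2 = d - 2" "F2 \<subseteq> {De Q * s 2<..<De Q * s d}" "\<forall>x\<in>F2. poly (wronskian (p Q)) x = 0"
      by blast
    \<comment> \<open>Inversion reverses the order of the radii; the index is reversed as well to
      obtain an increasing chain.\<close>
    define u where "u m = 1 / (De Q * s (d + 2 - m))" for m
    have ex: "u m < u (Suc m) \<and> (\<exists>x. u m < x \<and> x < u (Suc m) \<and> poly (wronskian (p Q)) x = 0)" if "m \<in> {2..<d}" for m
    proof -
      have m: "d + 1 - m \<in> {2..<d}" "Suc (d + 1 - m) = d + 2 - m" "d + 2 - Suc m = d + 1 - m" using that by auto
      from bspec[OF elim(3) m(1)] show ?thesis unfolding u_def m(2,3) by fastforce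
    qed
    have "\<exists>F. finite F \<and> card F = d - 2 \<and> F \<subseteq> {u 2<..<u d} \<and> (\<forall>x\<in>F. poly (wronskian (p Q)) x = 0) \<and> u 2 \<le> u d"
      using ex d by (intro roots_in_chain) auto
    then obtain F3 where F3: "finite F3" "card F3 = d - 2" "F3 \<subseteq> {u 2<..<u d}" "\<forall>x\<in>F3. poly (wronskian (p Q)) x = 0" by blast
    \<comment> \<open>The numbers 0 and 1 separate the three groups.\<close>
    have "1 < u 2" using elim(5) De s(2)[of d] by (simp add: u_def)
    hence r: "x < 0" if "x \<in> F1" for x using F1(3) that R_pos[of Q 1] elim(4) by auto
    have r2: "0 < x \<and> x < 1" if "x \<in> F2" for x
    proof -
      have "De Q * s 2 < x" "x < De Q * s d" using F2(3) that by auto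
      thus ?thesis using De s(2)[of 2] elim(5) mult_pos_pos[of "De Q" "s 2"] by linarith
    qed
    have r3: "1 < x" if "x \<in> F3" for x using F3(3) that \<open>1 < u 2\<close> by auto
    have "F1 \<inter> F2 = {}" "(F1 \<union> F2) \<inter> F3 = {}" using r r2 r3 by fastforce+
    hence "card (F1 \<union> F2 \<union> F3) = 3 * (d - 2)" using F1 F2 F3 by (simp add: card_Un_disjoint)
    thus ?case using F1 F2 F3 by (intro exI[of _ "F1 \<union> F2 \<union> F3"]) auto
  qed
qed

lemma degrees:
  assumes "0 < Q"
  shows "degree (p Q $ 1) = d - 2" "degree (p Q $ 2) = d - 1" "degree (p Q $ 3) = d"
proof -
  have deg: "degree (mk d c) = n" if "c n \<noteq> 0" "n \<le> d" "\<And>k. n < k \<Longrightarrow> k \<le> d \<Longrightarrow> c k = 0" for c n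
  proof (rule antisym)
    show "degree (mk d c) \<le> n" using that by (intro degree_le) (auto simp: coeff_mk)
    show "n \<le> degree (mk d c)" using that by (intro le_degree) (simp add: coeff_mk)
  qed
  have De: "De Q \<noteq> 0" using De_pos[OF assms] by simp
  show "degree (p Q $ 1) = d - 2" unfolding p_nth
  proof (rule deg)
    have "d - (d - 2) = 2" using d by simp
    thus "cz Q (d - 2) \<noteq> 0" using a De by (simp add: cz_def)
    show "d - 2 \<le> d" by simp
    fix k assume "d - 2 < k" "k \<le> d"
    hence "d - k = 0 \<or> d - k = 1" using d by linarith
    hence "a (d - k) = 0" using a(1,2) by metis
    thus "cz Q k = 0" by (simp add: cz_def)
  qed
  show "degree (p Q $ 2) = d - 1" unfolding p_nth
    by (rule deg) (use d assms in \<open>auto simp: cy_def ee_def\<close>)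
  show "degree (p Q $ 3) = d" unfolding p_nth
    by (rule deg) (use a in \<open>simp_all add: cx_def\<close>)
qed

text \<open>The roots are \<open>1 / (De Q * \<sigma>)\<close> for the positive roots
  \<open>\<sigma>\<close> of the template. The second component has no negative coefficient and does
  not vanish there, and the quotient of the other two components, suitably scaled, tends to
  \<open>1 / \<sigma>\<close>, which is injective.\<close>

lemma lines_exist:
  "\<forall>\<^sub>F Q in at_top. \<exists>A. finite A \<and> card A = d - 2 \<and> (\<forall>x\<in>A. poly (p Q $ 1) x = 0 \<and> poly (p Q $ 2) x \<noteq> 0) \<and>
     inj_on (\<lambda>x. poly (p Q $ 3) x / poly (p Q $ 2) x) A"
proof -
  have "\<exists>F. finite F \<and> card F = d - 2 \<and> F \<subseteq> {s 2<..<s d} \<and> (\<forall>x\<in>F. (\<Sum>k\<le>d. a k * x ^ k) = 0) \<and> s 2 \<le> s d"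
  proof (rule roots_in_chain)
    show "2 \<le> d" using d by simp
    show "s m < s (Suc m)" for m by (rule s_less)
    show "\<exists>x. s m < x \<and> x < s (Suc m) \<and> (\<Sum>k\<le>d. a k * x ^ k) = 0" if "m \<in> {2..<d}" for m
    proof -
      have "poly (mk d a) (s m) * poly (mk d a) (s (Suc m)) < 0" using alt[OF that] by (simp only: poly_mk mult_1_left)
      from poly_IVT[OF s_less this] show ?thesis by (simp only: poly_mk mult_1_left)
    qed
  qed
  then obtain F where F: "finite F" "card F = d - 2" "F \<subseteq> {s 2<..<s d}" "\<forall>x\<in>F. (\<Sum>k\<le>d. a k * x ^ k) = 0" by blast
  have pos: "0 < \<sigma>" if "\<sigma> \<in> F" for \<sigma>
  proof -
    have "s 2 < \<sigma>" using F(3) that by auto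
    thus ?thesis using s(2)[of 2] by linarith
  qed
  define t where "t Q \<sigma> = 1 / (De Q * \<sigma>)" for Q \<sigma>
  define rho where "rho Q x = poly (p Q $ 3) x / poly (p Q $ 2) x" for Q x
  have lim: "((\<lambda>Q. rho Q (t Q \<sigma>) * (ee Q (d - 1) * De Q)) \<longlongrightarrow> 1 / \<sigma>) at_top" if "0 < \<sigma>" for \<sigma>
  proof (rule Lim_transform_eventually)
    let ?l = "\<lambda>Q. (\<Sum>k\<le>d. 1 * (cx Q k * t Q \<sigma> ^ k)) / t Q \<sigma> ^ d /
        ((\<Sum>k\<le>d. 1 * (cy Q k * t Q \<sigma> ^ k)) / (ee Q (d - 1) * t Q \<sigma> ^ (d - 1))) * (1 / \<sigma>)"
    have "(?l \<longlongrightarrow> 1 / 1 * (1 / \<sigma>)) at_top"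
      unfolding t_def
      by (rule tendsto_mult[OF tendsto_divide[OF far_limit(2)[OF that] tendsto_y_near(2)[OF that, of "\<lambda>_. 1"] one_neq_zero] tendsto_const])
    thus "(?l \<longlongrightarrow> 1 / \<sigma>) at_top" by (simp only: div_by_1 mult_1_left)
    have gen: "x / (u * t') / (y / (e * u)) * (1 / \<sigma>) = x / y * (e * (1 / (t' * \<sigma>)))" if "u \<noteq> 0" for x y u t' e :: real
      using that by (simp add: mult_ac)
    show "\<forall>\<^sub>F Q in at_top. ?l Q = rho Q (t Q \<sigma>) * (ee Q (d - 1) * De Q)"
      using eventually_gt_at_top[of "0::real"]
    proof eventually_elim
      case (elim Q)
      have t0: "t Q \<sigma> \<noteq> 0" "1 / (t Q \<sigma> * \<sigma>) = De Q" using De_pos[OF elim] that by (simp_all add: t_def)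
      have td: "t Q \<sigma> ^ d = t Q \<sigma> ^ (d - 1) * t Q \<sigma>" using d by (intro power_minus_mult[symmetric]) simp
      have u: "t Q \<sigma> ^ (d - 1) \<noteq> 0" using t0 by simp
      show ?case unfolding rho_def p_nth poly_mk td gen[OF u] t0(2) ..
    qed
  qed
  have "\<forall>\<^sub>F Q in at_top. \<forall>\<sigma>\<in>F. \<forall>\<tau>\<in>F. \<sigma> \<noteq> \<tau> \<longrightarrow> rho Q (t Q \<sigma>) \<noteq> rho Q (t Q \<tau>)"
  proof (intro eventually_ball_finite F(1) ballI)
    fix \<sigma> \<tau> assume m: "\<sigma> \<in> F" "\<tau> \<in> F"
    show "\<forall>\<^sub>F Q in at_top. \<sigma> \<noteq> \<tau> \<longrightarrow> rho Q (t Q \<sigma>) \<noteq> rho Q (t Q \<tau>)"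
    proof (cases "\<sigma> = \<tau>")
      case False
      hence ne: "1 / \<sigma> - 1 / \<tau> \<noteq> 0" using pos[OF m(1)] pos[OF m(2)] by (simp add: frac_eq_eq)
      have "((\<lambda>Q. rho Q (t Q \<sigma>) * (ee Q (d - 1) * De Q) - rho Q (t Q \<tau>) * (ee Q (d - 1) * De Q)) \<longlongrightarrow> 1 / \<sigma> - 1 / \<tau>) at_top"
        by (intro tendsto_diff lim pos m)
      from tendsto_imp_eventually_ne[OF this ne] show ?thesis by eventually_elim auto
    qed simp
  qed
  with eventually_gt_at_top[of "0::real"] show ?thesis
  proof eventually_elim
    case (elim Q)
    have De: "0 < De Q" by (rule De_pos[OF elim(1)])
    have inj: "inj_on (t Q) F" by (rule inj_onI) (use De in \<open>simp add: t_def\<close>)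
    have tpos: "0 < t Q \<sigma>" if "\<sigma> \<in> F" for \<sigma> using De pos[OF that] by (simp add: t_def)
    have z: "poly (p Q $ 1) (t Q \<sigma>) = 0" if "\<sigma> \<in> F" for \<sigma>
    proof -
      have "poly (p Q $ 1) (t Q \<sigma>) = (\<Sum>k\<le>d. a (d - k) * (1 / \<sigma>) ^ k)" unfolding p_nth poly_mk
        by (intro sum.cong refl) (use De pos[OF that] in \<open>simp add: cz_def t_def power_divide power_mult_distrib\<close>)
      also have "\<dots> = (\<Sum>k\<le>d. a k * (1 / \<sigma>) ^ (d - k))"
        by (rule sum.reindex_bij_witness[of _ "\<lambda>k. d - k" "\<lambda>k. d - k"]) auto
      also have "\<dots> = (\<Sum>k\<le>d. a k * \<sigma> ^ k) / \<sigma> ^ d" unfolding sum_divide_distrib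
      proof (intro sum.cong refl)
        fix k assume "k \<in> {..d}"
        hence "\<sigma> ^ d = \<sigma> ^ (d - k) * \<sigma> ^ k" by (simp flip: power_add)
        thus "a k * (1 / \<sigma>) ^ (d - k) = a k * \<sigma> ^ k / \<sigma> ^ d" using pos[OF that] by (simp add: power_divide)
      qed
      finally show ?thesis using F(4) that by simp
    qed
    have y: "0 < poly (p Q $ 2) x" if "0 < x" for x unfolding p_nth poly_mk
      by (rule sum_pos2[of _ 1]) (use that elim(1) d in \<open>auto simp: cy_def ee_def\<close>)
    show ?case
    proof (intro exI[of _ "t Q ` F"] conjI ballI)
      show "finite (t Q ` F)" "card (t Q ` F) = d - 2" using F inj by (simp_all add: card_image)
      fix x assume "x \<in> t Q ` F"
      then obtain \<sigma> where \<sigma>: "\<sigma> \<in> F" "x = t Q \<sigma>" by blast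
      show "poly (p Q $ 1) x = 0" unfolding \<sigma>(2) by (rule z[OF \<sigma>(1)])
      show "poly (p Q $ 2) x \<noteq> 0" unfolding \<sigma>(2) using y[OF tpos[OF \<sigma>(1)]] by simp
    next
      show "inj_on (\<lambda>x. poly (p Q $ 3) x / poly (p Q $ 2) x) (t Q ` F)"
        unfolding rho_def[symmetric]
      proof (rule inj_onI)
        fix x y assume "x \<in> t Q ` F" "y \<in> t Q ` F" and e: "rho Q x = rho Q y"
        then obtain \<sigma> \<tau> where "\<sigma> \<in> F" "x = t Q \<sigma>" "\<tau> \<in> F" "y = t Q \<tau>" by blast
        with bspec[OF bspec[OF elim(2), of \<sigma>], of \<tau>] e show "x = y" by (cases "\<sigma> = \<tau>") simp_all
      qed
    qed
  qed
qed

section \<open>Solitary points near rays\<close>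

text \<open>For all radii between \<open>R Q l\<close> and \<open>R Q m\<close> the outer components
  are asymptotically 1 and t^d. Radius and angle are functions on an arbitrary filter, so that the
  joint limits required on the sides of a box are instances.\<close>

lemma ray_limits:
  fixes Q r \<theta> :: "'b \<Rightarrow> real"
  assumes Q: "filterlim Q at_top H" and \<theta>: "(\<theta> \<longlongrightarrow> \<theta>\<^sub>0) H"
    and r: "\<forall>\<^sub>F h in H. R (Q h) l \<le> r h \<and> r h \<le> R (Q h) m" and m: "m \<le> d"
  shows "((\<lambda>h. poly (cpoly (p (Q h) $ 1)) (of_real (r h) * cis (\<theta> h))) \<longlongrightarrow> 1) H"
    and "((\<lambda>h. poly (cpoly (p (Q h) $ 3)) (of_real (r h) * cis (\<theta> h)) / of_real (r h ^ d)) \<longlongrightarrow> cis (real d * \<theta>\<^sub>0)) H"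
proof -
  let ?t = "\<lambda>h. of_real (r h) * cis (\<theta> h)"
  have Q1: "\<forall>\<^sub>F h in H. 0 < Q h" using Q by (simp add: filterlim_at_top_dense)
  have pos: "\<forall>\<^sub>F h in H. 0 < r h" using Q1 r
  proof eventually_elim
    case (elim h)
    thus ?case using R_pos[of "Q h" l] by linarith
  qed
  have small: "((\<lambda>h. of_real (De (Q h)) / ?t h) \<longlongrightarrow> 0) H"
  proof (rule Lim_null_comparison)
    show "\<forall>\<^sub>F h in H. norm (of_real (De (Q h)) / ?t h) \<le> De (Q h) / R (Q h) l" using Q1 r pos
    proof eventually_elim
      case (elim h)
      have "norm (of_real (De (Q h)) / ?t h) = De (Q h) / r h"
        using De_pos[OF elim(1)] elim(3) by (simp add: norm_divide norm_mult)
      also have "\<dots> \<le> De (Q h) / R (Q h) l"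
        using De_pos[OF elim(1)] R_pos[OF elim(1), of l] elim by (intro divide_left_mono) auto
      finally show ?case .
    qed
    show "((\<lambda>h. De (Q h) / R (Q h) l) \<longlongrightarrow> 0) H" by (rule filterlim_compose[OF De_R_limits(1) Q])
  qed
  have large: "((\<lambda>h. of_real (De (Q h)) * ?t h) \<longlongrightarrow> 0) H"
  proof (rule Lim_null_comparison)
    show "\<forall>\<^sub>F h in H. norm (of_real (De (Q h)) * ?t h) \<le> De (Q h) * R (Q h) m" using Q1 r pos
      by eventually_elim (use De_pos in \<open>simp add: norm_mult less_imp_le\<close>)
    show "((\<lambda>h. De (Q h) * R (Q h) m) \<longlongrightarrow> 0) H" by (rule filterlim_compose[OF De_R_limits(2)[OF m] Q])
  qed
  show "((\<lambda>h. poly (cpoly (p (Q h) $ 1)) (?t h)) \<longlongrightarrow> 1) H"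
    using tendsto_z[OF large, of "\<lambda>_. 1"] unfolding z_sum_0 by (simp only: p_nth poly_cpoly_mk mult_1_left)
  have "\<forall>\<^sub>F h in H. ?t h \<noteq> 0" using pos by eventually_elim simp
  from tendsto_x[OF small this, of "\<lambda>_. 1"]
  have x: "((\<lambda>h. poly (cpoly (p (Q h) $ 3)) (?t h) / ?t h ^ d) \<longlongrightarrow> 1) H"
    by (simp only: p_nth poly_cpoly_mk mult_1_left)
  have "((\<lambda>h. cis (\<theta> h)) \<longlongrightarrow> cis \<theta>\<^sub>0) H" using \<theta> by (intro tendsto_cis)
  have dm: "cis \<theta>\<^sub>0 ^ d = cis (real d * \<theta>\<^sub>0)" by (rule Complex.DeMoivre)
  from tendsto_mult[OF x tendsto_power[OF \<open>((\<lambda>h. cis (\<theta> h)) \<longlongrightarrow> cis \<theta>\<^sub>0) H\<close>, of d]]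
  have "((\<lambda>h. poly (cpoly (p (Q h) $ 3)) (?t h) / ?t h ^ d * cis (\<theta> h) ^ d) \<longlongrightarrow> cis (real d * \<theta>\<^sub>0)) H"
    by (simp only: mult_1_left dm)
  thus "((\<lambda>h. poly (cpoly (p (Q h) $ 3)) (?t h) / of_real (r h ^ d)) \<longlongrightarrow> cis (real d * \<theta>\<^sub>0)) H"
  proof (rule Lim_transform_eventually)
    show "\<forall>\<^sub>F h in H. poly (cpoly (p (Q h) $ 3)) (?t h) / ?t h ^ d * cis (\<theta> h) ^ d = poly (cpoly (p (Q h) $ 3)) (?t h) / of_real (r h ^ d)"
      by (rule always_eventually) (simp add: power_mult_distrib)
  qed
qed

definition solitary_at :: "real \<Rightarrow> nat \<Rightarrow> nat \<Rightarrow> real \<Rightarrow> real \<Rightarrow> bool" where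
  "solitary_at Q j i r \<theta> \<longleftrightarrow> R Q (lo d j i) < r \<and> r < R Q (hi d j i) \<and> \<bar>\<theta> - real j * pi / real d\<bar> < pi / (real d)\<^sup>2 \<and>
     (\<forall>k\<in>{2, 3}. Im (poly (cpoly (p Q $ k)) (of_real r * cis \<theta>) * cnj (poly (cpoly (p Q $ 1)) (of_real r * cis \<theta>))) = 0)"

text \<open>The unknowns are the angle and the position \<open>v\<close> of the radius between the
  radii of index \<open>lo\<close> and \<open>hi\<close>. The imaginary part of the third coordinate
  follows sin (d \<theta>), which changes sign at j \<pi> / d. That of the second follows the sines
  of index \<open>lo\<close> and \<open>hi\<close> at the two ends, opposite in sign on the whole
  window; between the ends only its continuity enters.\<close>

lemma solitary_exists:
  assumes ij: "1 \<le> i" "i < j" "j < d"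
  shows "\<forall>\<^sub>F Q in at_top. \<exists>r \<theta>. solitary_at Q j i r \<theta>"
proof -
  define l h \<delta> \<theta>j where "l = lo d j i" and "h = hi d j i" and "\<delta> = pi / (real d)\<^sup>2" and "\<theta>j = real j * pi / real d"
  have lh: "l \<in> {1..d - 1}" "h \<in> {1..d - 1}" "l < h" "h \<le> d" using lo_hi(1-3)[OF ij] d unfolding l_def h_def by auto
  have \<delta>: "0 < \<delta>" using d by (simp add: \<delta>_def)
  \<comment> \<open>Limits are taken over full neighbourhoods of \<open>v\<close>, which leave the
    unit interval at its ends; clamping keeps the radius in range there.\<close>
  define clamp where "clamp v = max 0 (min 1 v)" for v :: real
  define r where "r Q v = R Q l + clamp v * (R Q h - R Q l)" for Q v
  \<comment> \<open>Interpolates between the normalising factors at the two ends and stays positive,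
    so it does not change the zeros.\<close>
  define N where "N Q v = (1 - v) * Q ^ l\<^sup>2 + v * Q ^ h\<^sup>2" for Q v :: real
  define t where "t Q \<theta> v = of_real (r Q v) * cis \<theta>" for Q v \<theta>
  define g1 where "g1 Q \<theta> v = Im (poly (cpoly (p Q $ 3)) (t Q \<theta> v) / of_real (r Q v ^ d) * cnj (poly (cpoly (p Q $ 1)) (t Q \<theta> v)))" for Q \<theta> v
  define g2 where "g2 Q \<theta> v = Im (poly (cpoly (p Q $ 2)) (t Q \<theta> v) / of_real (N Q v) * cnj (poly (cpoly (p Q $ 1)) (t Q \<theta> v)))" for Q \<theta> v
  have rb: "R Q l \<le> r Q v" "r Q v \<le> R Q h" if "1 < Q" for Q v
  proof -
    have c: "0 \<le> clamp v" "clamp v \<le> 1" by (auto simp: clamp_def)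
    have D: "0 \<le> R Q h - R Q l" using R_less[OF that lh(3)] by simp
    show "R Q l \<le> r Q v" unfolding r_def using mult_nonneg_nonneg[OF c(1) D] by linarith
    show "r Q v \<le> R Q h" unfolding r_def using mult_left_le_one_le[OF D c] by linarith
  qed
  have rpos: "0 < r Q v" if "1 < Q" for Q v using rb(1)[OF that, of v] R_pos[of Q l] that by linarith
  have Npos: "0 < N Q v" if "1 < Q" "0 \<le> v" "v \<le> 1" for Q v
  proof (cases "v = 0")
    case False
    have "0 \<le> (1 - v) * Q ^ l\<^sup>2" "0 < v * Q ^ h\<^sup>2" using that False by auto
    thus ?thesis unfolding N_def by linarith
  qed (use that in \<open>simp add: N_def\<close>)
  have fst_top: "filterlim fst at_top (at_top \<times>\<^sub>F nhds (x :: real) :: (real \<times> real) filter)" for x by (rule filterlim_fst)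
  have ev1: "\<forall>\<^sub>F q in at_top \<times>\<^sub>F nhds (x :: real). 1 < (fst q :: real)" for x
    using fst_top[of x] by (simp add: filterlim_at_top_dense)
  have rbe: "\<forall>\<^sub>F q in at_top \<times>\<^sub>F nhds (x :: real). R (fst q) l \<le> r (fst q) (f q) \<and> r (fst q) (f q) \<le> R (fst q) h" for x f
    using ev1[of x] by eventually_elim (use rb in blast)
  have G1: "((\<lambda>(Q, v). g1 Q \<theta> v) \<longlongrightarrow> sin (real d * \<theta>)) (at_top \<times>\<^sub>F nhds v\<^sub>0)" for \<theta> v\<^sub>0
  proof -
    note rl = ray_limits[OF fst_top[of v\<^sub>0] tendsto_const[of \<theta>] rbe[of snd v\<^sub>0] lh(4)]
    from tendsto_Im[OF tendsto_mult[OF rl(2) tendsto_cnj[OF rl(1)]]]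
    show ?thesis by (simp add: g1_def t_def case_prod_unfold)
  qed
  have G2: "((\<lambda>(Q, \<theta>). g2 Q \<theta> v) \<longlongrightarrow> sin (real m * \<theta>\<^sub>0)) (at_top \<times>\<^sub>F nhds \<theta>\<^sub>0)"
    if "v = 0 \<and> m = l \<or> v = 1 \<and> m = h" for v m \<theta>\<^sub>0
  proof -
    have m: "m \<in> {1..d - 1}" using that lh by auto
    have rR: "r Q v = R Q m" "N Q v = Q ^ m\<^sup>2" for Q using that by (auto simp: r_def N_def clamp_def)
    have \<theta>: "(snd \<longlongrightarrow> \<theta>\<^sub>0) (at_top \<times>\<^sub>F nhds \<theta>\<^sub>0 :: (real \<times> real) filter)" by (rule filterlim_snd)
    hence c: "((\<lambda>q. cis (snd q)) \<longlongrightarrow> cis \<theta>\<^sub>0) (at_top \<times>\<^sub>F nhds \<theta>\<^sub>0 :: (real \<times> real) filter)" by (rule tendsto_cis)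
    note rl = ray_limits(1)[OF fst_top[of \<theta>\<^sub>0] \<theta> rbe[of "\<lambda>_. v" \<theta>\<^sub>0] lh(4)]
    have y: "((\<lambda>q. poly (cpoly (p (fst q) $ 2)) (of_real (r (fst q) v) * cis (snd q)) / of_real (N (fst q) v)) \<longlongrightarrow> cis (real m * \<theta>\<^sub>0))
        (at_top \<times>\<^sub>F nhds \<theta>\<^sub>0)"
      using tendsto_y[OF fst_top[of \<theta>\<^sub>0] c m, of "\<lambda>_. 1"] by (simp only: p_nth poly_cpoly_mk mult_1_left Complex.DeMoivre rR)
    from tendsto_Im[OF tendsto_mult[OF y tendsto_cnj[OF rl]]]
    show ?thesis by (simp add: g2_def t_def case_prod_unfold)
  qed
  have "\<forall>\<^sub>F Q in at_top. \<exists>\<theta>\<in>{\<theta>j - \<delta><..<\<theta>j + \<delta>}. \<exists>v\<in>{0<..<1}. g1 Q \<theta> v = 0 \<and> g2 Q \<theta> v = 0"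
  proof (rule eventually_zero_in_box[where \<sigma> = "(-1) ^ j" and \<tau> = "(-1) ^ i"
        and la = "\<lambda>_. sin (real d * (\<theta>j - \<delta>))" and ra = "\<lambda>_. sin (real d * (\<theta>j + \<delta>))"
        and lb = "\<lambda>\<theta>. sin (real l * \<theta>)" and rb = "\<lambda>\<theta>. sin (real h * \<theta>)"])
    let ?B = "cbox (\<theta>j - \<delta>, 0) (\<theta>j + \<delta>, 1) :: (real \<times> real) set"
    show "\<theta>j - \<delta> < \<theta>j + \<delta>" "(0::real) < 1" using \<delta> by simp_all
    have ct: "continuous_on ?B (\<lambda>q. t Q (fst q) (snd q))" and cr: "continuous_on ?B (\<lambda>q. r Q (snd q))" for Q
      unfolding t_def r_def clamp_def by (intro continuous_intros)+
    have cN: "continuous_on ?B (\<lambda>q. N Q (snd q))" for Q unfolding N_def by (intro continuous_intros)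
    show "\<forall>\<^sub>F Q in at_top. continuous_on ?B (\<lambda>(x, y). g1 Q x y)" using eventually_gt_at_top[of "1::real"]
    proof eventually_elim
      case (elim Q)
      show ?case unfolding g1_def case_prod_unfold
        by (intro continuous_intros continuous_on_poly ct cr) (use rpos[OF elim] in \<open>simp add: less_imp_neq[symmetric]\<close>)
    qed
    show "\<forall>\<^sub>F Q in at_top. continuous_on ?B (\<lambda>(x, y). g2 Q x y)" using eventually_gt_at_top[of "1::real"]
    proof eventually_elim
      case (elim Q)
      have "N Q (snd q) \<noteq> 0" if "q \<in> ?B" for q
        using that Npos[OF elim, of "snd q"] by (cases q) (auto simp: cbox_Pair_eq)
      thus ?case unfolding g2_def case_prod_unfold
        by (intro continuous_intros continuous_on_poly ct cN) simp
    qed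
    have sq: "(-1) ^ j * (-1) ^ j = (1 :: real)" by (simp flip: power_mult_distrib)
    have sd: "0 < sin (pi / real d)" using d by (intro sin_gt_zero) (auto simp: field_simps)
    have ang: "real d * (\<theta>j - \<delta>) = real j * pi - pi / real d" "real d * (\<theta>j + \<delta>) = real j * pi + pi / real d"
      using d by (simp_all add: \<theta>j_def \<delta>_def field_simps power2_eq_square)
    have "(-1) ^ j * sin (real d * (\<theta>j - \<delta>)) = - (((-1) ^ j * (-1) ^ j) * sin (pi / real d))"
      "(-1) ^ j * sin (real d * (\<theta>j + \<delta>)) = ((-1) ^ j * (-1) ^ j) * sin (pi / real d)"
      unfolding ang sin_diff sin_add sin_npi cos_npi by simp_all
    hence "(-1) ^ j * sin (real d * (\<theta>j - \<delta>)) < 0" "0 < (-1) ^ j * sin (real d * (\<theta>j + \<delta>))"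
      unfolding sq using sd by linarith+
    thus "((\<lambda>(Q, y). g1 Q (\<theta>j - \<delta>) y) \<longlongrightarrow> sin (real d * (\<theta>j - \<delta>))) (at_top \<times>\<^sub>F nhds y) \<and>
      ((\<lambda>(Q, y). g1 Q (\<theta>j + \<delta>) y) \<longlongrightarrow> sin (real d * (\<theta>j + \<delta>))) (at_top \<times>\<^sub>F nhds y) \<and>
      (-1) ^ j * sin (real d * (\<theta>j - \<delta>)) < 0 \<and> 0 < (-1) ^ j * sin (real d * (\<theta>j + \<delta>))" for y
      using G1 by blast
    show "((\<lambda>(Q, x). g2 Q x 0) \<longlongrightarrow> sin (real l * x)) (at_top \<times>\<^sub>F nhds x) \<and>
      ((\<lambda>(Q, x). g2 Q x 1) \<longlongrightarrow> sin (real h * x)) (at_top \<times>\<^sub>F nhds x) \<and>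
      (-1) ^ i * sin (real l * x) < 0 \<and> 0 < (-1) ^ i * sin (real h * x)" if "x \<in> {\<theta>j - \<delta>..\<theta>j + \<delta>}" for x
    proof -
      have "\<bar>x - real j * pi / real d\<bar> \<le> pi / (real d)\<^sup>2" using that by (auto simp: \<theta>j_def \<delta>_def abs_le_iff)
      from sin_signs[OF ij this] show ?thesis unfolding l_def[symmetric] h_def[symmetric] using G2[of 0 l x] G2[of 1 h x] by simp
    qed
  qed
  with eventually_gt_at_top[of "1::real"] show ?thesis
  proof eventually_elim
    case (elim Q)
    from elim(2) obtain \<theta> v where "\<theta> \<in> {\<theta>j - \<delta><..<\<theta>j + \<delta>}" "v \<in> {0<..<1}" and g: "g1 Q \<theta> v = 0" "g2 Q \<theta> v = 0"
      by (elim bexE conjE)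
    hence v: "\<theta>j - \<delta> < \<theta>" "\<theta> < \<theta>j + \<delta>" "0 < v" "v < 1" "g1 Q \<theta> v = 0" "g2 Q \<theta> v = 0" by simp_all
    have D: "0 < R Q h - R Q l" using R_less[OF elim(1) lh(3)] by simp
    have rv: "r Q v = R Q l + v * (R Q h - R Q l)" using v by (simp add: r_def clamp_def)
    define w where "w = v * (R Q h - R Q l)"
    have "0 < w" "w < 1 * (R Q h - R Q l)"
      unfolding w_def by (rule mult_pos_pos[OF v(3) D], rule mult_strict_right_mono[OF v(4) D])
    hence "R Q l < r Q v \<and> r Q v < R Q h" unfolding rv w_def[symmetric] by simp
    moreover have "\<bar>\<theta> - real j * pi / real d\<bar> < pi / (real d)\<^sup>2" using v by (auto simp: \<theta>j_def \<delta>_def abs_less_iff)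
    moreover have Im0: "Im (x * w) = 0" if "Im (x / of_real c * w) = 0" "c \<noteq> 0" for x w c
    proof -
      have "Im (x / of_real c * w) = Im (x * w) / c" by (simp flip: Im_divide_of_real)
      thus ?thesis using that by simp
    qed
    have "r Q v ^ d \<noteq> 0" "N Q v \<noteq> 0" using rpos[OF elim(1), of v] Npos[OF elim(1), of v] v by simp_all
    from Im0[OF v(5)[unfolded g1_def] this(1)] Im0[OF v(6)[unfolded g2_def] this(2)]
    have "\<forall>k\<in>{2, 3}. Im (poly (cpoly (p Q $ k)) (of_real (r Q v) * cis \<theta>) * cnj (poly (cpoly (p Q $ 1)) (of_real (r Q v) * cis \<theta>))) = 0"
      by (simp add: t_def)
    ultimately show ?case unfolding solitary_at_def l_def h_def by blast
  qed
qed

text \<open>The windows of half-width \<pi> / d^2 around the multiples of \<pi> / d are disjoint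
  since 2 / d < 1, and for equal \<open>j\<close> the ranges of radii are separated by
  \<open>lo_hi_order\<close>.\<close>

lemma solitary_at_unique:
  assumes "1 < Q" "solitary_at Q j i r \<theta>" "solitary_at Q j' i' r \<theta>"
    and ij: "1 \<le> i" "i < j" "j < d" "1 \<le> i'" "i' < j'" "j' < d"
  shows "j = j'" "i = i'"
proof -
  have le: "j \<le> j'" if "\<bar>\<theta> - real j * pi / real d\<bar> < pi / (real d)\<^sup>2" "\<bar>\<theta> - real j' * pi / real d\<bar> < pi / (real d)\<^sup>2" for j j'
  proof (rule ccontr)
    assume "\<not> j \<le> j'"
    hence "real j' + 1 \<le> real j" by linarith
    hence "(real j' + 1) * (pi / real d) \<le> real j * (pi / real d)" by (rule mult_right_mono) simp
    hence "real j' * (pi / real d) + pi / real d \<le> real j * (pi / real d)" by (simp only: distrib_right mult_1_left)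
    moreover have "2 * (pi / (real d)\<^sup>2) < pi / real d"
    proof -
      have "2 / real d * (pi / real d) < 1 * (pi / real d)" using d by (intro mult_strict_right_mono) auto
      thus ?thesis by (simp add: power2_eq_square)
    qed
    moreover have "\<bar>\<theta> - real j * (pi / real d)\<bar> < pi / (real d)\<^sup>2" "\<bar>\<theta> - real j' * (pi / real d)\<bar> < pi / (real d)\<^sup>2"
      using that by simp_all
    ultimately show False unfolding abs_less_iff by linarith
  qed
  show j: "j = j'" using le assms(2,3) unfolding solitary_at_def by (intro antisym) blast+
  have le: "\<not> i < i'" if "R Q (lo d j i') < r" "r < R Q (hi d j i)" "1 \<le> i" "i' < j" for i i'
  proof
    assume "i < i'"
    from R_le[OF assms(1) lo_hi_order[OF this that(3,4) ij(3)]] that(1,2) show False by linarith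
  qed
  have b: "R Q (lo d j i) < r" "r < R Q (hi d j i)" "R Q (lo d j i') < r" "r < R Q (hi d j i')"
    using assms(2,3) unfolding solitary_at_def j by blast+
  have "i' < j" using ij(5) j by simp
  have "\<not> i < i'" "\<not> i' < i"
    by (rule le[OF b(3,2) ij(1) \<open>i' < j\<close>], rule le[OF b(1,4) ij(4,2)])
  thus "i = i'" by simp
qed

lemma solitary_curve:
  "\<exists>\<phi>. maximally_inflected d \<phi> \<and> has_exactly (flexes \<phi>) (3 * (d - 2)) \<and>
     has_exactly (solitary_points \<phi>) ((d - 1) choose 2) \<and> real_nodes \<phi> = {} \<and> complex_nodes \<phi> = {}"
proof -
  \<comment> \<open>Both indices are shifted by \<open>Suc\<close>, so that they run over 1 \<le> i
    < j < d, which are (d - 1 choose 2) pairs.\<close>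
  define I where "I = (SIGMA j:{..<d - 1}. {..<j})"
  have fin: "finite I" by (simp add: I_def)
  have Ij: "1 \<le> Suc (snd q)" "Suc (snd q) < Suc (fst q)" "Suc (fst q) < d" if "q \<in> I" for q using that by (auto simp: I_def)
  have "\<forall>\<^sub>F Q in at_top. \<forall>q\<in>I. \<exists>r \<theta>. solitary_at Q (Suc (fst q)) (Suc (snd q)) r \<theta>"
    by (intro eventually_ball_finite fin ballI solitary_exists Ij)
  with eventually_gt_at_top[of "1::real"] flexes_exist lines_exist
  have "\<forall>\<^sub>F Q in at_top. 1 < Q \<and> (\<exists>Fl. finite Fl \<and> card Fl = 3 * (d - 2) \<and> (\<forall>x\<in>Fl. poly (wronskian (p Q)) x = 0)) \<and>
    (\<exists>A. finite A \<and> card A = d - 2 \<and> (\<forall>x\<in>A. poly (p Q $ 1) x = 0 \<and> poly (p Q $ 2) x \<noteq> 0) \<and>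
     inj_on (\<lambda>x. poly (p Q $ 3) x / poly (p Q $ 2) x) A) \<and> (\<forall>q\<in>I. \<exists>r \<theta>. solitary_at Q (Suc (fst q)) (Suc (snd q)) r \<theta>)"
    by eventually_elim (intro conjI)
  from eventually_happens'[OF trivial_limit_at_top_linorder this]
  obtain Q Fl A where Q: "1 < Q" and Fl: "finite Fl" "card Fl = 3 * (d - 2)" and Fl': "\<forall>x\<in>Fl. poly (wronskian (p Q)) x = 0"
    and A: "finite A" "card A = d - 2" and A': "\<forall>x\<in>A. poly (p Q $ 1) x = 0 \<and> poly (p Q $ 2) x \<noteq> 0"
    and A_inj: "inj_on (\<lambda>x. poly (p Q $ 3) x / poly (p Q $ 2) x) A"
    and S: "\<forall>q\<in>I. \<exists>r \<theta>. solitary_at Q (Suc (fst q)) (Suc (snd q)) r \<theta>"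
    by (elim exE conjE) (rule that)
  note Fl = Fl bspec[OF Fl'] and A = A bspec[OF A', THEN conjunct1] bspec[OF A', THEN conjunct2] A_inj
  define r where "r q = (SOME r. \<exists>\<theta>. solitary_at Q (Suc (fst q)) (Suc (snd q)) r \<theta>)" for q
  define \<theta> where "\<theta> q = (SOME \<theta>. solitary_at Q (Suc (fst q)) (Suc (snd q)) (r q) \<theta>)" for q
  have r\<theta>: "solitary_at Q (Suc (fst q)) (Suc (snd q)) (r q) (\<theta> q)" if "q \<in> I" for q
    unfolding \<theta>_def by (rule someI_ex, unfold r_def, rule someI_ex, rule bspec[OF S that])
  define t where "t q = complex_of_real (r q) * cis (\<theta> q)" for q
  have Q0: "0 < Q" using Q by simp
  have \<theta>: "0 < \<theta> q" "\<theta> q < pi" and r: "0 < r q" if "q \<in> I" for q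
  proof -
    note S = r\<theta>[OF that, unfolded solitary_at_def]
    show "0 < r q" using S R_pos[OF Q0, of "lo d (Suc (fst q)) (Suc (snd q))"] by linarith
    have j: "1 \<le> real (Suc (fst q))" "real (Suc (fst q)) \<le> real d - 1" using Ij[OF that] by linarith+
    have "1 / real d * (pi / real d) < 1 * (pi / real d)" using d by (intro mult_strict_right_mono) auto
    hence e: "pi / (real d)\<^sup>2 < pi / real d" by (simp add: power2_eq_square)
    have "1 * (pi / real d) \<le> real (Suc (fst q)) * (pi / real d)" by (rule mult_right_mono[OF j(1)]) simp
    moreover have "real (Suc (fst q)) * (pi / real d) \<le> (real d - 1) * (pi / real d)" by (rule mult_right_mono[OF j(2)]) simp
    moreover have "(real d - 1) * (pi / real d) = pi - pi / real d" using d by (simp add: field_simps)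
    moreover have "\<bar>\<theta> q - real (Suc (fst q)) * (pi / real d)\<bar> < pi / (real d)\<^sup>2" using S by simp
    ultimately show "0 < \<theta> q" "\<theta> q < pi" using e unfolding abs_less_iff by linarith+
  qed
  have inj: "inj_on t I"
  proof (rule inj_onI)
    fix q q' assume q: "q \<in> I" "q' \<in> I" and eq: "t q = t q'"
    have "norm (t q) = norm (t q')" using eq by simp
    hence rr: "r q = r q'" using r[OF q(1)] r[OF q(2)] by (simp add: t_def norm_mult)
    hence "cis (\<theta> q) = cis (\<theta> q')" using eq r[OF q(2)] by (simp add: t_def)
    \<comment> \<open>The modulus gives the radius, and the cosine determines the angle because it
      lies between 0 and \<pi>.\<close>
    hence "cos (\<theta> q) = cos (\<theta> q')" by (metis cis.simps(1))
    hence \<theta>\<theta>: "\<theta> q = \<theta> q'" using \<theta>[OF q(1)] \<theta>[OF q(2)] by - (rule cos_inj_pi, simp_all add: less_imp_le)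
    from solitary_at_unique[OF Q r\<theta>[OF q(1)] r\<theta>[OF q(2), folded rr \<theta>\<theta>] Ij[OF q(1)] Ij[OF q(2)]]
    show "q = q'" by (simp add: prod_eq_iff)
  qed
  have card_t: "card (t ` I) = (d - 1) choose 2"
    by (rule trans[OF card_image[OF inj]]) (simp only: I_def card_pairs)
  have Im_t: "0 < Im (t q)" if "q \<in> I" for q
    using r[OF that] sin_gt_zero[OF \<theta>[OF that]] by (simp add: t_def)
  \<comment> \<open>The \<open>d - 2\<close> real roots in \<open>A\<close> exhaust the degree of
    the first component, so it has none in the upper half-plane.\<close>
  have nz: "poly (cpoly (p Q $ 1)) x \<noteq> 0" if "0 < Im x" for x
  proof
    assume x: "poly (cpoly (p Q $ 1)) x = 0"
    let ?z = "cpoly (p Q $ 1)"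
    have deg: "degree ?z = d - 2" by (simp add: degree_map_poly degrees[OF Q0])
    hence z0: "?z \<noteq> 0" using d by auto
    have "insert x (complex_of_real ` A) \<subseteq> {x. poly ?z x = 0}" using x A(3) by (auto simp: poly_cpoly_of_real)
    from card_mono[OF poly_roots_finite[OF z0] this]
    have "card (insert x (complex_of_real ` A)) \<le> d - 2" using card_poly_roots_bound[OF z0] deg by linarith
    moreover have "x \<notin> complex_of_real ` A" using that by auto
    moreover have "card (complex_of_real ` A) = d - 2" using A(2) by (simp add: card_image inj_on_def)
    ultimately show False using A(1) by simp
  qed
  have "\<exists>\<phi>. maximally_inflected d \<phi> \<and> has_exactly (cusps \<phi>) (card ({} :: real set)) \<and> has_exactly (flexes \<phi>) (card Fl) \<and>
    has_exactly (real_nodes \<phi>) (card ({} :: (real \<times> real) set)) \<and> has_exactly (solitary_points \<phi>) (card (t ` I)) \<and> complex_nodes \<phi> = {}"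
  proof (rule curve_from_real_data[OF _ degrees[OF Q0] A Fl(1,3)])
    show "3 \<le> d" using d by simp
    show "card Fl + 2 * card ({} :: real set) = 3 * (d - 2)" using Fl(2) by simp
    show "card ({} :: (real \<times> real) set) + card (t ` I) + card ({} :: real set) = (d - 1) choose 2"
      using card_t by simp
    show "finite (t ` I)" using fin by simp
    fix x assume "x \<in> t ` I"
    then obtain q where q: "q \<in> I" "x = t q" by blast
    show "0 < Im x" "poly (cpoly (p Q $ 1)) x \<noteq> 0" using Im_t[OF q(1)] nz q(2) by simp_all
    have S: "\<forall>k\<in>{2, 3}. Im (poly (cpoly (p Q $ k)) x * cnj (poly (cpoly (p Q $ 1)) x)) = 0"
      using r\<theta>[OF q(1)] unfolding solitary_at_def q(2) t_def by blast
    show "Im (poly (cpoly (p Q $ 2)) x * cnj (poly (cpoly (p Q $ 1)) x)) = 0" using S by simp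
    show "Im (poly (cpoly (p Q $ 3)) x * cnj (poly (cpoly (p Q $ 1)) x)) = 0" using S by simp
  qed simp_all
  thus ?thesis using Fl(2) card_t by (auto simp: has_exactly_def)
qed

end

theorem theorem4p1:
  fixes d :: nat
  assumes "d \<ge> 3"
  shows "(\<forall>\<kappa>. 0 \<le> \<kappa> \<and> \<kappa> \<le> d - 2 \<longrightarrow>
            (\<exists>\<phi>. maximally_inflected d \<phi> \<and>
                 has_exactly (cusps \<phi>) \<kappa> \<and>
                 has_exactly (flexes \<phi>) (3 * (d - 2) - 2 * \<kappa>) \<and>
                 has_exactly (real_nodes \<phi>) ((d - 2) choose 2) \<and>
                 has_exactly (solitary_points \<phi>) (d - 2 - \<kappa>))) \<and>
         (\<exists>\<phi>. maximally_inflected d \<phi> \<and>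
              has_exactly (flexes \<phi>) (3 * (d - 2)) \<and>
              has_exactly (solitary_points \<phi>) ((d - 1) choose 2) \<and>
              real_nodes \<phi> = {} \<and>
              complex_nodes \<phi> = {})"
proof (intro conjI allI impI)
  fix \<kappa> assume "0 \<le> \<kappa> \<and> \<kappa> \<le> d - 2"
  moreover have "1 \<le> d - 2" "d - 2 + 2 = d" using assms by simp_all
  ultimately show "\<exists>\<phi>. maximally_inflected d \<phi> \<and> has_exactly (cusps \<phi>) \<kappa> \<and> has_exactly (flexes \<phi>) (3 * (d - 2) - 2 * \<kappa>) \<and>
      has_exactly (real_nodes \<phi>) ((d - 2) choose 2) \<and> has_exactly (solitary_points \<phi>) (d - 2 - \<kappa>)"
    using tangent_curve_exists[of "d - 2" \<kappa>] by simp
next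
  have d: "2 < d" using assms by simp
  from alternating_template[OF d] obtain a s where "solitary_config d a s"
    using d unfolding solitary_config_def by blast
  then interpret solitary_config d a s .
  show "\<exists>\<phi>. maximally_inflected d \<phi> \<and> has_exactly (flexes \<phi>) (3 * (d - 2)) \<and>
      has_exactly (solitary_points \<phi>) ((d - 1) choose 2) \<and> real_nodes \<phi> = {} \<and> complex_nodes \<phi> = {}"
    by (rule solitary_curve)
qed

end
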